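(* The prop $\tilde{\mathcal S}$ (finitely presented in the category of CW-complexes by the generating cells, attaching maps and relations given in the context) is an $E_\infty$-prop; that is, the operad $U(\tilde{\mathcal S})=\{\tilde{\mathcal S}(1,m)\}_{m\ge 0}$ is an $E_\infty$-operad.
   Context: Work in the symmetric monoidal category $(\mathrm{CW},\times,\mathbf 1)$ of CW-complexes and CW-maps (cellular maps), $\mathbf 1$ being a single $0$-cell; $\mathrm I=[0,1]$ with its usual CW-structure. Operads. An operad $\mathcal O$ is $\Sigma$-free if $\Sigma_m$ acts freely on $\mathcal O(m)$ for every $m$. A $\Sigma$-free resolution of an operad $\mathcal O$ is an operad morphism from a $\Sigma$-free operad to $\mathcal O$ that is a homotopy equivalence in each arity. The terminal operad has $\mathbf 1$ in every arity $m\ge 0$. An operad $\mathcal O$ is an $E_\infty$-operad if it is a $\Sigma$-free resolution of the terminal operad and $\mathcal O(0)=\mathbf 1$. Props. A prop $\mathcal P$ is a strict symmetric monoidal category enriched in CW generated by a single object $p$. Put $\mathcal P(n,m)=\mathrm{Hom}(p^{\odot n},p^{\odot m})$ ($n$ inputs, $m$ outputs), with commuting right $\Sigma_n$- and left $\Sigma_m$-actions, horizontal compositions $\odot$ (monoidal product), vertical compositions $\circ$, and units $\mathrm{id}_n\in\mathcal P(n,n)$. The operad $U(\mathcal P)$ is $\{\mathcal P(1,m)\}_{m\ge0}$ with the operad structure induced from $\mathcal P$. A prop $\mathcal P$ is an $E_\infty$-prop if $U(\mathcal P)$ is an $E_\infty$-operad. Presentations. The free prop $F(\mathcal B)$ on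 a $\Sigma$-bimodule $\mathcal B$ consists of isomorphism classes of finite directed graphs without directed loops, with labeled ($1,\dots,n$) incoming external half-edges and labeled ($1,\dots,m$) outgoing external half-edges, with labeled incoming and outgoing half-edges at each vertex, each vertex $v$ being decorated by an element of $\mathcal B(|in(v)|,|out(v)|)$, modulo compatibility of decorations with relabeling. A presentation consists of: generating $d$-cells (copies of $\mathrm I^d$, each in a given biarity, freely extended by the actions of the symmetric groups); attaching maps from the boundaries of generating $d$-cells to the free prop on the generating $(d-1)$-cells; and relations. The presented prop is obtained from the free prop on the generating $0$-cells by successively attaching the generating cells via pushouts of props (the pushout of the free prop on the $d$-cells along the free prop on their boundaries), and finally taking the quotient by the smallest identification containing the relations and closed under the symmetric group actions and horizontal and vertical compositions. The prop $\tilde{\mathcal S}$ has generating cells: a $0$-cell $\varepsilon\in\tilde{\mathcal S}(1,0)$; a $0$-cell $\Delta\in\tilde{\mathcal S}(1,2)$; a $1$-cell $\{\mu_s\}_{s\in\mathrm I}$ in $\tilde{\mathcal S}(2,1)$; a $1$-cell $\{h_s\}_{s\in \mathrm I}$ in $\tilde{\mathcal S}(1,1)$. Attaching maps: $\mu_0=\mathrm{id}\odot\varepsilon$, $\mu_1=\varepsilon\odot\mathrm{id}$, $h_0=\mathrm{id}$, $h_1=(\varepsilon\odot\mathrm{id})\circ\Delta$. Relations (for all $s\in\mathrm I$): $(\varepsilon\odot\varepsilon)\circ\Delta=\varepsilon$, $\ \varepsilon\circ\mu_s=\varepsilon\odot\varepsilon$, $\ \varepsilon\circ h_s=\varepsilon$.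 *)

theory Defs
  imports "HOL-Analysis.Analysis" "HOL-Combinatorics.Permutations"
begin

section \<open>CW-complexes\<close>

text \<open>Characteristic maps are defined on cubes instead of balls.\<close>

definition cube :: "nat \<Rightarrow> (nat \<Rightarrow> real) topology" where
  "cube d = product_topology (\<lambda>_. top_of_set {0..1}) {..<d}"

definition open_cube :: "nat \<Rightarrow> (nat \<Rightarrow> real) set" where
  "open_cube d = (\<Pi>\<^sub>E i\<in>{..<d}. {0<..<1})"

definition cube_boundary :: "nat \<Rightarrow> (nat \<Rightarrow> real) set" where
  "cube_boundary d = topspace (cube d) - open_cube d"

record 'a cw =
  cw_top :: "'a topology"
  skel :: "nat \<Rightarrow> 'a set"

definition open_cell :: "nat \<times> ((nat \<Rightarrow> real) \<Rightarrow> 'a) \<Rightarrow> 'a set" where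
  "open_cell c = snd c ` open_cube (fst c)"

text \<open>Whitehead's definition.  A cell is its dimension together with a characteristic map.  The
  skeleta, but not the characteristic maps, are part of the structure.\<close>

definition CW_complex :: "'a cw \<Rightarrow> bool" where
  "CW_complex X \<longleftrightarrow> Hausdorff_space (cw_top X) \<and>
     (\<exists>cells :: (nat \<times> ((nat \<Rightarrow> real) \<Rightarrow> 'a)) set.
        (\<forall>(d, \<phi>) \<in> cells. continuous_map (cube d) (cw_top X) \<phi> \<and> inj_on \<phi> (open_cube d) \<and>
           (\<exists>F \<subseteq> cells. finite F \<and> (\<forall>c \<in> F. fst c < d) \<and>
              \<phi> ` cube_boundary d \<subseteq> (\<Union>c \<in> F. open_cell c))) \<and>
        (\<forall>c \<in> cells. \<forall>c' \<in> cells. c \<noteq> c' \<longrightarrow> disjnt (open_cell c) (open_cell c')) \<and>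
        topspace (cw_top X) = (\<Union>c \<in> cells. open_cell c) \<and>
        (\<forall>n. skel X n = (\<Union>c \<in> {c \<in> cells. fst c \<le> n}. open_cell c)) \<and>
        (\<forall>S \<subseteq> topspace (cw_top X).
           (\<forall>(d, \<phi>) \<in> cells. closedin (cube d) {x \<in> topspace (cube d). \<phi> x \<in> S})
             \<longrightarrow> closedin (cw_top X) S))"

definition cellular_map :: "'a cw \<Rightarrow> 'b cw \<Rightarrow> ('a \<Rightarrow> 'b) \<Rightarrow> bool" where
  "cellular_map X Y f \<longleftrightarrow>
     continuous_map (cw_top X) (cw_top Y) f \<and> (\<forall>n. f ` skel X n \<subseteq> skel Y n)"

text \<open>The product of CW-complexes carries the weak topology of its product cells, which is the
  compactly generated refinement of the product topology.\<close>

definition cw_prod :: "'a cw \<Rightarrow> 'b cw \<Rightarrow> ('a \<times> 'b) cw" where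
  "cw_prod X Y = \<lparr>cw_top = kification (prod_topology (cw_top X) (cw_top Y)),
                  skel = (\<lambda>n. \<Union>i\<le>n. skel X i \<times> skel Y (n - i))\<rparr>"

definition cw_unit :: "unit cw" where
  "cw_unit = \<lparr>cw_top = discrete_topology {()}, skel = (\<lambda>_. {()})\<rparr>"

definition homotopy_equivalence_map :: "'a topology \<Rightarrow> 'b topology \<Rightarrow> ('a \<Rightarrow> 'b) \<Rightarrow> bool" where
  "homotopy_equivalence_map X Y f \<longleftrightarrow> continuous_map X Y f \<and>
     (\<exists>g. continuous_map Y X g \<and>
          homotopic_with (\<lambda>_. True) X X (g \<circ> f) id \<and>
          homotopic_with (\<lambda>_. True) Y Y (f \<circ> g) id)"

text \<open>The finest topology on \<open>S\<close> making all the maps \<open>f i\<close> from \<open>T i\<close> to \<open>S\<close> continuous.\<close>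

definition final_topology :: "'a set \<Rightarrow> 'i set \<Rightarrow> ('i \<Rightarrow> 'b topology) \<Rightarrow> ('i \<Rightarrow> 'b \<Rightarrow> 'a) \<Rightarrow> 'a topology"
  where "final_topology S I T f = topology (\<lambda>U. U \<subseteq> S \<and>
           (\<forall>i\<in>I. openin (T i) {x \<in> topspace (T i). f i x \<in> U}))"

lemma openin_final_topology:
  "openin (final_topology S I T f) U \<longleftrightarrow>
     U \<subseteq> S \<and> (\<forall>i\<in>I. openin (T i) {x \<in> topspace (T i). f i x \<in> U})"
proof -
  have "istopology (\<lambda>U. U \<subseteq> S \<and> (\<forall>i\<in>I. openin (T i) {x \<in> topspace (T i). f i x \<in> U}))"
    unfolding istopology_def
  proof (intro conjI allI impI ballI)
    fix U V i
    assume U: "U \<subseteq> S \<and> (\<forall>i\<in>I. openin (T i) {x \<in> topspace (T i). f i x \<in> U})"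
      and V: "V \<subseteq> S \<and> (\<forall>i\<in>I. openin (T i) {x \<in> topspace (T i). f i x \<in> V})" and i: "i \<in> I"
    have eq: "{x \<in> topspace (T i). f i x \<in> U \<inter> V} =
          {x \<in> topspace (T i). f i x \<in> U} \<inter> {x \<in> topspace (T i). f i x \<in> V}" by auto
    show "openin (T i) {x \<in> topspace (T i). f i x \<in> U \<inter> V}"
      unfolding eq using U V i by (intro openin_Int) blast+
  next
    fix \<K> i
    assume K: "\<forall>K\<in>\<K>. K \<subseteq> S \<and> (\<forall>i\<in>I. openin (T i) {x \<in> topspace (T i). f i x \<in> K})"
      and i: "i \<in> I"
    have "{x \<in> topspace (T i). f i x \<in> \<Union>\<K>} = (\<Union>K\<in>\<K>. {x \<in> topspace (T i). f i x \<in> K})" by auto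
    then show "openin (T i) {x \<in> topspace (T i). f i x \<in> \<Union>\<K>}"
      using K i by auto
  qed auto
  then show ?thesis
    unfolding final_topology_def by (simp add: topology_inverse')
qed


section \<open>Operads\<close>

text \<open>Operads are given by the partial compositions \<open>x \<circ>\<^sub>i y\<close> with \<open>i < m\<close>, written
  \<open>ocomp A m k i x y\<close> for \<open>x\<close> in arity \<open>m\<close> and \<open>y\<close> in arity \<open>k\<close>.  The symmetric groups act from
  the left, since the operad of a prop below acts on outputs; a left action is turned into a
  right one by inversion.\<close>

record 'a operad =
  osp :: "nat \<Rightarrow> 'a cw"
  ounit :: 'a
  oact :: "nat \<Rightarrow> (nat \<Rightarrow> nat) \<Rightarrow> 'a \<Rightarrow> 'a"
  ocomp :: "nat \<Rightarrow> nat \<Rightarrow> nat \<Rightarrow> 'a \<Rightarrow> 'a \<Rightarrow> 'a"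

text \<open>The permutation \<open>\<sigma> \<circ>\<^sub>i \<tau>\<close>: the \<open>i\<close>-th of the points permuted by \<open>\<sigma>\<close> is replaced by a block of
  \<open>k\<close> points permuted by \<open>\<tau>\<close>.\<close>

definition perm_subst :: "nat \<Rightarrow> nat \<Rightarrow> nat \<Rightarrow> (nat \<Rightarrow> nat) \<Rightarrow> (nat \<Rightarrow> nat) \<Rightarrow> nat \<Rightarrow> nat" where
  "perm_subst m k i \<sigma> \<tau> j =
     (if m + k - 1 \<le> j then j
      else if i \<le> j \<and> j < i + k then \<sigma> i + \<tau> (j - i)
      else let b = (if j < i then j else j + 1 - k)
           in if \<sigma> b < \<sigma> i then \<sigma> b else \<sigma> b + k - 1)"

definition cw_operad :: "'a operad \<Rightarrow> bool" where
  "cw_operad A \<longleftrightarrow>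
     (\<forall>m. CW_complex (osp A m)) \<and>
     ounit A \<in> skel (osp A 1) 0 \<and>
     (\<forall>m \<sigma>. \<sigma> permutes {..<m} \<longrightarrow> cellular_map (osp A m) (osp A m) (oact A m \<sigma>)) \<and>
     (\<forall>m k i. i < m \<longrightarrow> cellular_map (cw_prod (osp A m) (osp A k)) (osp A (m + k - 1))
                            (\<lambda>(x, y). ocomp A m k i x y)) \<and>
     (\<forall>m. \<forall>x \<in> topspace (cw_top (osp A m)). oact A m id x = x \<and>
        (\<forall>\<sigma> \<tau>. \<sigma> permutes {..<m} \<and> \<tau> permutes {..<m} \<longrightarrow>
                 oact A m \<sigma> (oact A m \<tau> x) = oact A m (\<sigma> \<circ> \<tau>) x)) \<and>
     (\<forall>m. \<forall>x \<in> topspace (cw_top (osp A m)). ocomp A 1 m 0 (ounit A) x = x \<and>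
        (\<forall>i<m. ocomp A m 1 i x (ounit A) = x)) \<and>
     (\<forall>m k l. \<forall>x \<in> topspace (cw_top (osp A m)). \<forall>y \<in> topspace (cw_top (osp A k)).
        \<forall>z \<in> topspace (cw_top (osp A l)).
        (\<forall>i<m. \<forall>j<k. ocomp A (m + k - 1) l (i + j) (ocomp A m k i x y) z =
                      ocomp A m (k + l - 1) i x (ocomp A k l j y z)) \<and>
        (\<forall>i'<m. \<forall>i<i'. ocomp A (m + k - 1) l (i' + k - 1) (ocomp A m k i x y) z =
                        ocomp A (m + l - 1) k i (ocomp A m l i' x z) y)) \<and>
     (\<forall>m k. \<forall>x \<in> topspace (cw_top (osp A m)). \<forall>y \<in> topspace (cw_top (osp A k)).
        \<forall>\<sigma> \<tau>. \<sigma> permutes {..<m} \<and> \<tau> permutes {..<k} \<longrightarrow>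
        (\<forall>i<m. ocomp A m k (\<sigma> i) (oact A m \<sigma> x) (oact A k \<tau> y) =
                oact A (m + k - 1) (perm_subst m k i \<sigma> \<tau>) (ocomp A m k i x y)))"

definition operad_morphism :: "'a operad \<Rightarrow> 'b operad \<Rightarrow> (nat \<Rightarrow> 'a \<Rightarrow> 'b) \<Rightarrow> bool" where
  "operad_morphism A Q f \<longleftrightarrow>
     (\<forall>m. cellular_map (osp A m) (osp Q m) (f m)) \<and>
     f 1 (ounit A) = ounit Q \<and>
     (\<forall>m \<sigma>. \<forall>x \<in> topspace (cw_top (osp A m)). \<sigma> permutes {..<m} \<longrightarrow>
        f m (oact A m \<sigma> x) = oact Q m \<sigma> (f m x)) \<and>
     (\<forall>m k. \<forall>x \<in> topspace (cw_top (osp A m)). \<forall>y \<in> topspace (cw_top (osp A k)).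
        \<forall>i<m. f (m + k - 1) (ocomp A m k i x y) = ocomp Q m k i (f m x) (f k y))"

definition terminal_operad :: "unit operad" where
  "terminal_operad =
     \<lparr>osp = (\<lambda>_. cw_unit), ounit = (), oact = (\<lambda>_ _ _. ()), ocomp = (\<lambda>_ _ _ _ _. ())\<rparr>"

definition sigma_free :: "'a operad \<Rightarrow> bool" where
  "sigma_free A \<longleftrightarrow>
     (\<forall>m \<sigma>. \<forall>x \<in> topspace (cw_top (osp A m)). \<sigma> permutes {..<m} \<and> oact A m \<sigma> x = x \<longrightarrow> \<sigma> = id)"

definition sigma_free_resolution :: "'a operad \<Rightarrow> 'b operad \<Rightarrow> (nat \<Rightarrow> 'a \<Rightarrow> 'b) \<Rightarrow> bool" where
  "sigma_free_resolution A Q f \<longleftrightarrow>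
     cw_operad A \<and> cw_operad Q \<and> sigma_free A \<and> operad_morphism A Q f \<and>
     (\<forall>m. homotopy_equivalence_map (cw_top (osp A m)) (cw_top (osp Q m)) (f m))"

definition E_infinity_operad :: "'a operad \<Rightarrow> bool" where
  "E_infinity_operad A \<longleftrightarrow>
     (\<exists>f. sigma_free_resolution A terminal_operad f) \<and>
     (\<exists>a. topspace (cw_top (osp A 0)) = {a})"


section \<open>Props\<close>

text \<open>\<open>phom P n m\<close> has \<open>n\<close> inputs and \<open>m\<close> outputs.  As is usual for categories, distinct hom-spaces
  are required to be disjoint, so that the compositions need no arity arguments;
  \<open>pver P g f\<close> is \<open>g \<circ> f\<close> and \<open>phor P f g\<close> is \<open>f \<odot> g\<close>.  The morphism \<open>pperm P n \<sigma>\<close> is the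
  symmetry \<open>p\<^sup>\<odot>\<^sup>n \<rightarrow> p\<^sup>\<odot>\<^sup>n\<close> moving strand \<open>i\<close> to strand \<open>\<sigma> i\<close>; the identity is \<open>pperm P n id\<close>.
  The left and right actions of the symmetric groups are vertical compositions with
  these symmetries.\<close>

record 'a prop_data =
  phom :: "nat \<Rightarrow> nat \<Rightarrow> 'a cw"
  phor :: "'a \<Rightarrow> 'a \<Rightarrow> 'a"
  pver :: "'a \<Rightarrow> 'a \<Rightarrow> 'a"
  pperm :: "nat \<Rightarrow> (nat \<Rightarrow> nat) \<Rightarrow> 'a"

abbreviation pset :: "'a prop_data \<Rightarrow> nat \<Rightarrow> nat \<Rightarrow> 'a set" where
  "pset P n m \<equiv> topspace (cw_top (phom P n m))"

abbreviation pid :: "'a prop_data \<Rightarrow> nat \<Rightarrow> 'a" where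
  "pid P n \<equiv> pperm P n id"

definition perm_sum :: "nat \<Rightarrow> (nat \<Rightarrow> nat) \<Rightarrow> (nat \<Rightarrow> nat) \<Rightarrow> nat \<Rightarrow> nat" where
  "perm_sum n \<sigma> \<tau> i = (if i < n then \<sigma> i else n + \<tau> (i - n))"

definition block_swap :: "nat \<Rightarrow> nat \<Rightarrow> nat \<Rightarrow> nat" where
  "block_swap n m i = (if i < n then i + m else if i < n + m then i - n else i)"

definition cw_prop :: "'a prop_data \<Rightarrow> bool" where
  "cw_prop P \<longleftrightarrow>
     (\<forall>n m. CW_complex (phom P n m)) \<and>
     (\<forall>n m n' m'. (n, m) \<noteq> (n', m') \<longrightarrow> disjnt (pset P n m) (pset P n' m')) \<and>
     (\<forall>n m l. cellular_map (cw_prod (phom P m l) (phom P n m)) (phom P n l) (\<lambda>(g, f). pver P g f)) \<and>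
     (\<forall>n m n' m'. cellular_map (cw_prod (phom P n m) (phom P n' m')) (phom P (n + n') (m + m'))
                     (\<lambda>(f, g). phor P f g)) \<and>
     (\<forall>n \<sigma>. \<sigma> permutes {..<n} \<longrightarrow> pperm P n \<sigma> \<in> skel (phom P n n) 0) \<and>
     (\<forall>n m l k. \<forall>f \<in> pset P n m. \<forall>g \<in> pset P m l. \<forall>h \<in> pset P l k.
        pver P h (pver P g f) = pver P (pver P h g) f) \<and>
     (\<forall>n m. \<forall>f \<in> pset P n m. pver P (pid P m) f = f \<and> pver P f (pid P n) = f) \<and>
     (\<forall>n m n' m' n'' m''. \<forall>f \<in> pset P n m. \<forall>g \<in> pset P n' m'. \<forall>h \<in> pset P n'' m''.
        phor P (phor P f g) h = phor P f (phor P g h)) \<and>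
     (\<forall>n m. \<forall>f \<in> pset P n m. phor P (pid P 0) f = f \<and> phor P f (pid P 0) = f) \<and>
     (\<forall>n m l n' m' l'. \<forall>f \<in> pset P n m. \<forall>g \<in> pset P m l. \<forall>f' \<in> pset P n' m'. \<forall>g' \<in> pset P m' l'.
        pver P (phor P g g') (phor P f f') = phor P (pver P g f) (pver P g' f')) \<and>
     (\<forall>n \<sigma> \<tau>. \<sigma> permutes {..<n} \<and> \<tau> permutes {..<n} \<longrightarrow>
        pver P (pperm P n \<sigma>) (pperm P n \<tau>) = pperm P n (\<sigma> \<circ> \<tau>)) \<and>
     (\<forall>n m \<sigma> \<tau>. \<sigma> permutes {..<n} \<and> \<tau> permutes {..<m} \<longrightarrow>
        phor P (pperm P n \<sigma>) (pperm P m \<tau>) = pperm P (n + m) (perm_sum n \<sigma> \<tau>)) \<and>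
     (\<forall>n m n' m'. \<forall>f \<in> pset P n m. \<forall>g \<in> pset P n' m'.
        pver P (pperm P (m + m') (block_swap m m')) (phor P f g) =
        pver P (phor P g f) (pperm P (n + n') (block_swap n n')))"

definition operad_of_prop :: "'a prop_data \<Rightarrow> 'a operad" where
  "operad_of_prop P =
     \<lparr>osp = (\<lambda>m. phom P 1 m),
      ounit = pid P 1,
      oact = (\<lambda>m \<sigma> x. pver P (pperm P m \<sigma>) x),
      ocomp = (\<lambda>m k i x y. pver P (phor P (phor P (pid P i) y) (pid P (m - 1 - i))) x)\<rparr>"

definition E_infinity_prop :: "'a prop_data \<Rightarrow> bool" where
  "E_infinity_prop P \<longleftrightarrow> cw_prop P \<and> E_infinity_operad (operad_of_prop P)"


section \<open>Free props\<close>

record 'b bimodule =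
  bsp :: "nat \<Rightarrow> nat \<Rightarrow> 'b cw"
  lact :: "(nat \<Rightarrow> nat) \<Rightarrow> 'b \<Rightarrow> 'b"
  ract :: "'b \<Rightarrow> (nat \<Rightarrow> nat) \<Rightarrow> 'b"

text \<open>Half-edges are \<open>Ext i\<close>, the \<open>i\<close>-th external one, and \<open>Vert v i\<close>, the \<open>i\<close>-th one at the vertex
  \<open>v\<close>.  A graph on the vertices \<open>0, \<dots>, g_size - 1\<close> is given by matching the half-edges where an edge
  starts (external inputs of the graph and outputs of vertices) with those where it ends (external
  outputs of the graph and inputs of vertices).\<close>

datatype half_edge = Ext nat | Vert nat nat

record graph =
  g_in :: nat
  g_out :: nat
  g_size :: nat
  v_in :: "nat \<Rightarrow> nat"
  v_out :: "nat \<Rightarrow> nat"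
  wire :: "half_edge \<Rightarrow> half_edge"

definition sources :: "graph \<Rightarrow> half_edge set" where
  "sources G = {Ext i |i. i < g_in G} \<union> {Vert v j |v j. v < g_size G \<and> j < v_out G v}"

definition targets :: "graph \<Rightarrow> half_edge set" where
  "targets G = {Ext j |j. j < g_out G} \<union> {Vert v i |v i. v < g_size G \<and> i < v_in G v}"

definition valid_graph :: "graph \<Rightarrow> bool" where
  "valid_graph G \<longleftrightarrow> bij_betw (wire G) (sources G) (targets G) \<and>
     acyclic {(v, w). \<exists>i j. Vert v j \<in> sources G \<and> wire G (Vert v j) = Vert w i}"

type_synonym 'b dgraph = "graph \<times> (nat \<Rightarrow> 'b)"

definition dgraphs :: "'b bimodule \<Rightarrow> nat \<Rightarrow> nat \<Rightarrow> 'b dgraph set" where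
  "dgraphs B n m = {(G, d). valid_graph G \<and> g_in G = n \<and> g_out G = m \<and>
     (\<forall>v<g_size G. d v \<in> topspace (cw_top (bsp B (v_in G v) (v_out G v))))}"

fun map_half_edge :: "(nat \<Rightarrow> nat) \<Rightarrow> (nat \<Rightarrow> nat \<Rightarrow> nat) \<Rightarrow> half_edge \<Rightarrow> half_edge" where
  "map_half_edge \<pi> f (Ext i) = Ext i"
| "map_half_edge \<pi> f (Vert v i) = Vert (\<pi> v) (f v i)"

text \<open>Isomorphism of decorated graphs, including the relabeling of the half-edges at each vertex:
  input \<open>i\<close> and output \<open>j\<close> of \<open>v\<close> become input \<open>\<sigma> v i\<close> and output \<open>\<tau> v j\<close> of \<open>\<pi> v\<close>.\<close>

definition dgraph_iso :: "'b bimodule \<Rightarrow> 'b dgraph \<Rightarrow> 'b dgraph \<Rightarrow> bool" where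
  "dgraph_iso B X Y \<longleftrightarrow> (case X of (G, d) \<Rightarrow> case Y of (H, e) \<Rightarrow>
     g_in H = g_in G \<and> g_out H = g_out G \<and>
     (\<exists>\<pi> \<sigma> \<tau>. bij_betw \<pi> {..<g_size G} {..<g_size H} \<and>
        (\<forall>v<g_size G. v_in H (\<pi> v) = v_in G v \<and> v_out H (\<pi> v) = v_out G v \<and>
           \<sigma> v permutes {..<v_in G v} \<and> \<tau> v permutes {..<v_out G v} \<and>
           e (\<pi> v) = lact B (\<tau> v) (ract B (d v) (inv (\<sigma> v)))) \<and>
        (\<forall>p \<in> sources G.
           wire H (map_half_edge \<pi> \<tau> p) = map_half_edge \<pi> \<sigma> (wire G p))))"

definition dgraph_class :: "'b bimodule \<Rightarrow> 'b dgraph \<Rightarrow> 'b dgraph set" where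
  "dgraph_class B X = {Y. dgraph_iso B X Y}"

fun shift :: "nat \<Rightarrow> nat \<Rightarrow> half_edge \<Rightarrow> half_edge" where
  "shift k b (Ext i) = Ext (b + i)"
| "shift k b (Vert v i) = Vert (k + v) i"

definition append_fun :: "nat \<Rightarrow> (nat \<Rightarrow> 'b) \<Rightarrow> (nat \<Rightarrow> 'b) \<Rightarrow> nat \<Rightarrow> 'b" where
  "append_fun k d e v = (if v < k then d v else e (v - k))"

definition graph_hor :: "graph \<Rightarrow> graph \<Rightarrow> graph" where
  "graph_hor G H =
     \<lparr>g_in = g_in G + g_in H, g_out = g_out G + g_out H, g_size = g_size G + g_size H,
      v_in = append_fun (g_size G) (v_in G) (v_in H),
      v_out = append_fun (g_size G) (v_out G) (v_out H),
      wire = (\<lambda>p. case p of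
          Ext i \<Rightarrow> if i < g_in G then wire G (Ext i)
                  else shift (g_size G) (g_out G) (wire H (Ext (i - g_in G)))
        | Vert v j \<Rightarrow> if v < g_size G then wire G (Vert v j)
                     else shift (g_size G) (g_out G) (wire H (Vert (v - g_size G) j)))\<rparr>"

text \<open>\<open>graph_ver H G\<close> is \<open>H \<circ> G\<close>: the outputs of \<open>G\<close> are joined to the inputs of \<open>H\<close>.\<close>

definition graph_ver :: "graph \<Rightarrow> graph \<Rightarrow> graph" where
  "graph_ver H G =
     (let join = (\<lambda>q. case q of Ext j \<Rightarrow> shift (g_size G) 0 (wire H (Ext j)) | Vert v i \<Rightarrow> Vert v i)
      in \<lparr>g_in = g_in G, g_out = g_out H, g_size = g_size G + g_size H,
          v_in = append_fun (g_size G) (v_in G) (v_in H),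
          v_out = append_fun (g_size G) (v_out G) (v_out H),
          wire = (\<lambda>p. case p of
              Ext i \<Rightarrow> join (wire G (Ext i))
            | Vert v j \<Rightarrow> if v < g_size G then join (wire G (Vert v j))
                         else shift (g_size G) 0 (wire H (Vert (v - g_size G) j)))\<rparr>)"

definition dgraph_hor :: "'b dgraph \<Rightarrow> 'b dgraph \<Rightarrow> 'b dgraph" where
  "dgraph_hor X Y = (graph_hor (fst X) (fst Y), append_fun (g_size (fst X)) (snd X) (snd Y))"

definition dgraph_ver :: "'b dgraph \<Rightarrow> 'b dgraph \<Rightarrow> 'b dgraph" where
  "dgraph_ver Y X = (graph_ver (fst Y) (fst X), append_fun (g_size (fst X)) (snd X) (snd Y))"

definition perm_graph :: "nat \<Rightarrow> (nat \<Rightarrow> nat) \<Rightarrow> 'b dgraph" where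
  "perm_graph n \<sigma> =
     (\<lparr>g_in = n, g_out = n, g_size = 0, v_in = (\<lambda>_. 0), v_out = (\<lambda>_. 0),
       wire = (\<lambda>p. case p of Ext i \<Rightarrow> Ext (\<sigma> i) | Vert v j \<Rightarrow> Vert v j)\<rparr>, \<lambda>_. undefined)"

definition corolla :: "nat \<Rightarrow> nat \<Rightarrow> 'b \<Rightarrow> 'b dgraph" where
  "corolla n m b =
     (\<lparr>g_in = n, g_out = m, g_size = 1, v_in = (\<lambda>_. n), v_out = (\<lambda>_. m),
       wire = (\<lambda>p. case p of Ext i \<Rightarrow> Vert 0 i | Vert v j \<Rightarrow> Ext j)\<rparr>, \<lambda>_. b)"

text \<open>The space of decorations of a fixed graph is a product of CW-complexes, and the free prop
  has the quotient topology of the disjoint union of these products over all graphs.\<close>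

definition free_prop :: "'b bimodule \<Rightarrow> 'b dgraph set prop_data" where
  "free_prop B =
     \<lparr>phom = (\<lambda>n m.
        \<lparr>cw_top = final_topology (dgraph_class B ` dgraphs B n m)
            {G. valid_graph G \<and> g_in G = n \<and> g_out G = m}
            (\<lambda>G. kification (product_topology (\<lambda>v. cw_top (bsp B (v_in G v) (v_out G v))) {..<g_size G}))
            (\<lambda>G d. dgraph_class B (G, d)),
         skel = (\<lambda>k. dgraph_class B ` {(G, d) \<in> dgraphs B n m.
            \<exists>\<kappa>. (\<forall>v<g_size G. d v \<in> skel (bsp B (v_in G v) (v_out G v)) (\<kappa> v)) \<and>
                (\<Sum>v<g_size G. \<kappa> v) \<le> k})\<rparr>),
      phor = (\<lambda>X Y. {Z. \<exists>x\<in>X. \<exists>y\<in>Y. dgraph_iso B (dgraph_hor x y) Z}),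
      pver = (\<lambda>Y X. {Z. \<exists>x\<in>X. \<exists>y\<in>Y. dgraph_iso B (dgraph_ver y x) Z}),
      pperm = (\<lambda>n \<sigma>. dgraph_class B (perm_graph n \<sigma>))\<rparr>"


section \<open>Quotient props and presentations\<close>

text \<open>The smallest identification containing \<open>R\<close> and closed under both compositions; closure under
  the symmetric groups is the case of a vertical composition with \<open>pperm\<close>.\<close>

inductive prop_cong :: "'a prop_data \<Rightarrow> ('a \<times> 'a) set \<Rightarrow> 'a \<Rightarrow> 'a \<Rightarrow> bool"
  for P :: "'a prop_data" and R :: "('a \<times> 'a) set" where
  base: "\<lbrakk>(x, y) \<in> R; x \<in> pset P n m; y \<in> pset P n m\<rbrakk> \<Longrightarrow> prop_cong P R x y"
| refl: "x \<in> pset P n m \<Longrightarrow> prop_cong P R x x"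
| sym: "prop_cong P R x y \<Longrightarrow> prop_cong P R y x"
| trans: "\<lbrakk>prop_cong P R x y; prop_cong P R y z\<rbrakk> \<Longrightarrow> prop_cong P R x z"
| hor: "\<lbrakk>prop_cong P R x y; prop_cong P R x' y'\<rbrakk> \<Longrightarrow> prop_cong P R (phor P x x') (phor P y y')"
| ver: "\<lbrakk>prop_cong P R x y; prop_cong P R x' y'; x \<in> pset P n m; x' \<in> pset P m l\<rbrakk>
        \<Longrightarrow> prop_cong P R (pver P x' x) (pver P y' y)"

definition quot_class :: "'a prop_data \<Rightarrow> ('a \<times> 'a) set \<Rightarrow> 'a \<Rightarrow> 'a set" where
  "quot_class P R x = {y. prop_cong P R x y}"

definition prop_quot :: "'a prop_data \<Rightarrow> ('a \<times> 'a) set \<Rightarrow> 'a set prop_data" where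
  "prop_quot P R =
     \<lparr>phom = (\<lambda>n m.
        \<lparr>cw_top = final_topology (quot_class P R ` pset P n m) {()}
                    (\<lambda>_. cw_top (phom P n m)) (\<lambda>_. quot_class P R),
         skel = (\<lambda>k. quot_class P R ` skel (phom P n m) k)\<rparr>),
      phor = (\<lambda>X Y. {z. \<exists>x\<in>X. \<exists>y\<in>Y. prop_cong P R (phor P x y) z}),
      pver = (\<lambda>Y X. {z. \<exists>x\<in>X. \<exists>y\<in>Y. prop_cong P R (pver P y x) z}),
      pperm = (\<lambda>n \<sigma>. quot_class P R (pperm P n \<sigma>))\<rparr>"

record 'c cell_family =
  gens :: "'c set"
  gdim :: "'c \<Rightarrow> nat"
  garity_in :: "'c \<Rightarrow> nat"
  garity_out :: "'c \<Rightarrow> nat"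

type_synonym 'c cell_point = "(nat \<Rightarrow> nat) \<times> 'c \<times> (nat \<Rightarrow> real) \<times> (nat \<Rightarrow> nat)"

text \<open>The free bimodule on a family of cubes: \<open>(\<tau>, c, x, \<sigma>)\<close> is \<open>\<tau> \<cdot> x \<cdot> \<sigma>\<close> for the point \<open>x\<close> of the
  cell \<open>c\<close>.  The \<open>k\<close>-skeleton of a cube consists of its faces of dimension at most \<open>k\<close>.\<close>

definition cell_points :: "'c cell_family \<Rightarrow> nat \<Rightarrow> nat \<Rightarrow> 'c cell_point set" where
  "cell_points C n m = {(\<tau>, c, x, \<sigma>). c \<in> gens C \<and> garity_in C c = n \<and> garity_out C c = m \<and>
     x \<in> topspace (cube (gdim C c)) \<and> \<tau> permutes {..<m} \<and> \<sigma> permutes {..<n}}"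

definition cell_bimodule :: "'c cell_family \<Rightarrow> 'c cell_point bimodule" where
  "cell_bimodule C =
     \<lparr>bsp = (\<lambda>n m.
        \<lparr>cw_top = final_topology (cell_points C n m)
            {(\<tau>, c, \<sigma>). c \<in> gens C \<and> garity_in C c = n \<and> garity_out C c = m \<and>
                         \<tau> permutes {..<m} \<and> \<sigma> permutes {..<n}}
            (\<lambda>(\<tau>, c, \<sigma>). cube (gdim C c)) (\<lambda>(\<tau>, c, \<sigma>) x. (\<tau>, c, x, \<sigma>)),
         skel = (\<lambda>k. {(\<tau>, c, x, \<sigma>) \<in> cell_points C n m.
                       card {i. i < gdim C c \<and> x i \<notin> {0, 1}} \<le> k})\<rparr>),
      lact = (\<lambda>\<tau>' (\<tau>, c, x, \<sigma>). (\<tau>' \<circ> \<tau>, c, x, \<sigma>)),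
      ract = (\<lambda>(\<tau>, c, x, \<sigma>) \<sigma>'. (\<tau>, c, x, \<sigma> \<circ> \<sigma>'))\<rparr>"

definition free_on_cells :: "'c cell_family \<Rightarrow> 'c cell_point dgraph set prop_data" where
  "free_on_cells C = free_prop (cell_bimodule C)"

definition cell_elt :: "'c cell_family \<Rightarrow> 'c \<Rightarrow> (nat \<Rightarrow> real) \<Rightarrow> 'c cell_point dgraph set" where
  "cell_elt C c x =
     dgraph_class (cell_bimodule C) (corolla (garity_in C c) (garity_out C c) (id, c, x, id))"

text \<open>Attaching all generating cells.  Here \<open>att c x\<close>, for \<open>x\<close> in the boundary of the cell \<open>c\<close>, is an
  element of the free prop on the cells of smaller dimension, which is contained in
  the free prop on all cells.  A pushout of props \<open>A \<leftarrow> D \<rightarrow> B\<close> is the coproduct of \<open>A\<close> and \<open>B\<close> with the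
  two images of \<open>D\<close> identified.  Coproducts of free props are free on the disjoint union of
  the generators, so attaching the cells in order of dimension, starting from the free prop
  on the \<open>0\<close>-cells, gives the free prop on all cells with each boundary point identified with its
  image under the attaching map; identifying the images of the generators of
  the free prop on the boundaries is enough because the identification is closed under
  the compositions.\<close>

definition attached_prop ::
  "'c cell_family \<Rightarrow> ('c \<Rightarrow> (nat \<Rightarrow> real) \<Rightarrow> 'c cell_point dgraph set) \<Rightarrow>
   'c cell_point dgraph set set prop_data" where
  "attached_prop C att = prop_quot (free_on_cells C)
     {(cell_elt C c x, att c x) |c x. c \<in> gens C \<and> x \<in> cube_boundary (gdim C c)}"

definition attached_elt ::
  "'c cell_family \<Rightarrow> ('c \<Rightarrow> (nat \<Rightarrow> real) \<Rightarrow> 'c cell_point dgraph set) \<Rightarrow>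
   'c \<Rightarrow> (nat \<Rightarrow> real) \<Rightarrow> 'c cell_point dgraph set set" where
  "attached_elt C att c x = quot_class (free_on_cells C)
     {(cell_elt C c x, att c x) |c x. c \<in> gens C \<and> x \<in> cube_boundary (gdim C c)} (cell_elt C c x)"


section \<open>The prop S\<close>

datatype S_cell = Eps | Delta | Mu | Htp

fun S_dim :: "S_cell \<Rightarrow> nat" where
  "S_dim Eps = 0" | "S_dim Delta = 0" | "S_dim Mu = 1" | "S_dim Htp = 1"

fun S_in :: "S_cell \<Rightarrow> nat" where
  "S_in Eps = 1" | "S_in Delta = 1" | "S_in Mu = 2" | "S_in Htp = 1"

fun S_out :: "S_cell \<Rightarrow> nat" where
  "S_out Eps = 0" | "S_out Delta = 2" | "S_out Mu = 1" | "S_out Htp = 1"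

definition S_cells :: "S_cell cell_family" where
  "S_cells = \<lparr>gens = UNIV, gdim = S_dim, garity_in = S_in, garity_out = S_out\<rparr>"

definition pt0 :: "nat \<Rightarrow> real" where
  "pt0 = (\<lambda>i\<in>{..<0}. 0)"

definition pt1 :: "real \<Rightarrow> nat \<Rightarrow> real" where
  "pt1 s = (\<lambda>i\<in>{..<1}. s)"

text \<open>The value at \<open>Eps\<close> and \<open>Delta\<close> is irrelevant, as their boundaries are empty.\<close>

definition S_att :: "S_cell \<Rightarrow> (nat \<Rightarrow> real) \<Rightarrow> S_cell cell_point dgraph set" where
  "S_att c x =
     (let F = free_on_cells S_cells; \<epsilon> = cell_elt S_cells Eps pt0; \<Delta> = cell_elt S_cells Delta pt0 in
      case c of
        Mu \<Rightarrow> if x 0 = 0 then phor F (pid F 1) \<epsilon> else phor F \<epsilon> (pid F 1)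
      | Htp \<Rightarrow> if x 0 = 0 then pid F 1 else pver F (phor F \<epsilon> (pid F 1)) \<Delta>
      | _ \<Rightarrow> undefined)"

definition S_attached :: "S_cell cell_point dgraph set set prop_data" where
  "S_attached = attached_prop S_cells S_att"

definition S_elt :: "S_cell \<Rightarrow> (nat \<Rightarrow> real) \<Rightarrow> S_cell cell_point dgraph set set" where
  "S_elt = attached_elt S_cells S_att"

definition S_relations ::
  "(S_cell cell_point dgraph set set \<times> S_cell cell_point dgraph set set) set" where
  "S_relations =
     (let P = S_attached; \<epsilon> = S_elt Eps pt0; \<Delta> = S_elt Delta pt0;
          \<mu> = (\<lambda>s. S_elt Mu (pt1 s)); h = (\<lambda>s. S_elt Htp (pt1 s))
      in {(pver P (phor P \<epsilon> \<epsilon>) \<Delta>, \<epsilon>)} \<union>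
         {(pver P \<epsilon> (\<mu> s), phor P \<epsilon> \<epsilon>) |s. s \<in> {0..1}} \<union>
         {(pver P \<epsilon> (h s), \<epsilon>) |s. s \<in> {0..1}})"

definition S_prop :: "S_cell cell_point dgraph set set set prop_data" where
  "S_prop = prop_quot S_attached S_relations"

end

theory Submission
  imports Defs
begin

text \<open>Label every edge of a graph by the term describing its history from the inputs.  A graph is
  determined up to isomorphism by the terms of its outputs and the set of terms of the edges
  ending in \<open>\<epsilon>\<close>.  After the attaching identities have been used to remove \<open>\<mu>\<^sub>s\<close> and \<open>h\<^sub>s\<close> for
  \<open>s \<in> {0, 1}\<close>, the relations amount to forgetting the edges ending in \<open>\<epsilon>\<close>: a vertex all of whose
  outputs end in \<open>\<epsilon>\<close> may be removed, and a graph without such vertices is recovered from the terms of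
  its outputs.  So two graphs are identified in the prop iff their outputs have equal
  normalized terms, and the prop axioms become identities between terms under substitution.

  The normal forms of a fixed shape are parametrized by an open cube, the parameters of the \<open>\<mu>\<^sub>s\<close> and
  \<open>h\<^sub>s\<close>; on a facet of the closed cube the graph reduces to one with fewer parameters.  This is
  a cell structure in which every facet factors through a cube of smaller dimension, from which the
  Hausdorff property and Whitehead's conditions follow.

  The symmetric group acts freely since distinct outputs have distinct terms.  The space of
  operations with one input is contractible by the homotopies \<open>x \<simeq> x \<circ> (\<epsilon> \<odot> id) \<circ> \<Delta>\<close>, given by \<open>h\<close>,
  and \<open>x \<circ> (\<epsilon> \<odot> id) \<circ> \<Delta> \<simeq> c \<circ> (id \<odot> \<epsilon>) \<circ> \<Delta>\<close>, which applies \<open>\<mu>\<^sub>s\<close> to the outputs of \<open>(c \<odot> x) \<circ> \<Delta>\<close> in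
  pairs.\<close>

section \<open>Cubical cell structures\<close>

text \<open>The prop is an iterated quotient by generated congruences, so neither its points nor its
  topology are directly accessible. Soundness of the normalized terms is cheap, because they are
  compatible with both compositions. Completeness needs every graph to be driven to a reduced one;
  since a balanced finite set of vertices (\<open>lin\<close>) already determines a graph, the
  reduction manipulates sets of terms and leaves wirings alone.

  The reduction must also be uniform in the parameters. The relation \<open>peq\<close> demands
  equality under all parameter changes that fix 0 and 1, including those that push an inner
  parameter to 0 or 1. Only this turns a statement about single graphs into the factorization of
  whole families through one cell (\<open>factor_cell\<close>), which yields the facet maps, the
  bound on dimensions and the comparison of the quotient topology with the weak topology of the
  cells.

  Quotients do not inherit the Hausdorff property. Points are separated by real functions built cell
  by cell with Tietze's theorem.\<close>

lemma topspace_final_topology: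
  assumes "\<And>i x. \<lbrakk>i \<in> I; x \<in> topspace (T i)\<rbrakk> \<Longrightarrow> f i x \<in> S"
  shows "topspace (final_topology S I T f) = S"
proof -
  have "{x \<in> topspace (T i). f i x \<in> S} = topspace (T i)" if "i \<in> I" for i
    using assms that by blast
  then have "openin (final_topology S I T f) S"
    unfolding openin_final_topology by auto
  then show ?thesis
    using openin_final_topology[of S I T f] by (metis openin_subset openin_topspace subset_antisym)
qed

lemma topspace_cube: "topspace (cube d) = (\<Pi>\<^sub>E i\<in>{..<d}. {0..1})"
  by (simp add: cube_def)

lemma compact_space_cube: "compact_space (cube d)"
  unfolding cube_def compact_space_product_topology
  by (simp add: compact_space_subtopology)

lemma Hausdorff_space_cube: "Hausdorff_space (cube d)"
  unfolding cube_def Hausdorff_space_product_topology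
  by (simp add: Hausdorff_space_subtopology)

lemma continuous_map_cube_proj:
  "k < d \<Longrightarrow> continuous_map (cube d) euclideanreal (\<lambda>x. x k)"
  unfolding cube_def
  using continuous_map_product_projection[of k "{..<d}" "\<lambda>_. top_of_set {0..1::real}"]
  by (auto simp: continuous_map_in_subtopology)

lemma continuous_map_into_cube:
  assumes "\<And>k. k < d \<Longrightarrow> continuous_map X euclideanreal (\<lambda>x. f x k)"
    and "\<And>x k. \<lbrakk>x \<in> topspace X; k < d\<rbrakk> \<Longrightarrow> f x k \<in> {0..1}"
    and "\<And>x. x \<in> topspace X \<Longrightarrow> f x \<in> extensional {..<d}"
  shows "continuous_map X (cube d) f"
  unfolding cube_def
  by (rule iffD2[OF continuous_map_componentwise])
    (use assms in \<open>auto simp: continuous_map_in_subtopology\<close>)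

lemma open_cube_subset: "open_cube d \<subseteq> topspace (cube d)"
  by (fastforce simp: open_cube_def topspace_cube PiE_def Pi_def)

lemma cube_boundary_iff:
  "x \<in> cube_boundary d \<longleftrightarrow> x \<in> topspace (cube d) \<and> (\<exists>k<d. x k = 0 \<or> x k = 1)"
proof -
  have "x \<in> open_cube d \<longleftrightarrow> (\<forall>k<d. x k \<noteq> 0 \<and> x k \<noteq> 1)" if "x \<in> topspace (cube d)"
    using that by (fastforce simp: open_cube_def topspace_cube PiE_def Pi_def)
  then show ?thesis by (auto simp: cube_boundary_def)
qed

lemma cube_boundaryI: "\<lbrakk>x \<in> topspace (cube d); x \<notin> open_cube d\<rbrakk> \<Longrightarrow> x \<in> cube_boundary d"
  by (simp add: cube_boundary_def)

definition closed_facet :: "nat \<Rightarrow> nat \<times> real \<Rightarrow> (nat \<Rightarrow> real) set" where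
  "closed_facet d = (\<lambda>(k, e). {x \<in> topspace (cube d). x k = e})"

lemma cube_boundary_facets: "cube_boundary d = (\<Union>p\<in>{..<d} \<times> {0,1}. closed_facet d p)"
  by (force simp: cube_boundary_iff closed_facet_def set_eq_iff)

lemma closedin_facet: "p \<in> {..<d} \<times> {0,1} \<Longrightarrow> closedin (cube d) (closed_facet d p)"
  using closedin_continuous_map_preimage[OF continuous_map_cube_proj[of "fst p" d], of "{snd p}"]
  by (auto simp: closed_facet_def case_prod_beta)

lemma closedin_cube_boundary: "closedin (cube d) (cube_boundary d)"
  unfolding cube_boundary_facets by (intro closedin_Union) (auto intro: closedin_facet)

text \<open>The condition \<open>facet\<close> is stronger than Whitehead's: on a facet the cell is
  another cell precomposed with a continuous map into a smaller cube. Closure finiteness becomes an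
  induction on the dimension, and continuity on a boundary reduces to continuity on smaller cubes.
  The map \<open>g\<close> is defined on the whole cube, which avoids subspaces.\<close>

locale cube_complex =
  fixes S :: "'a set" and I :: "'i set" and dm :: "'i \<Rightarrow> nat" and \<Phi> :: "'i \<Rightarrow> (nat \<Rightarrow> real) \<Rightarrow> 'a"
    and T :: "'a topology"
  assumes openin_T: "openin T U \<longleftrightarrow> U \<subseteq> S \<and> (\<forall>i\<in>I. openin (cube (dm i)) {x \<in> topspace (cube (dm i)). \<Phi> i x \<in> U})"
    and cover: "S = (\<Union>i\<in>I. \<Phi> i ` open_cube (dm i))"
    and maps: "\<lbrakk>i \<in> I; x \<in> topspace (cube (dm i))\<rbrakk> \<Longrightarrow> \<Phi> i x \<in> S"
    and inj: "i \<in> I \<Longrightarrow> inj_on (\<Phi> i) (open_cube (dm i))"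
    and disj: "\<lbrakk>i \<in> I; j \<in> I; u \<in> open_cube (dm i); v \<in> open_cube (dm j); \<Phi> i u = \<Phi> j v\<rbrakk> \<Longrightarrow> i = j"
    and facet: "\<lbrakk>i \<in> I; k < dm i; e \<in> {0,1}\<rbrakk> \<Longrightarrow>
       \<exists>j\<in>I. \<exists>g. dm j < dm i \<and> continuous_map (cube (dm i)) (cube (dm j)) g \<and>
         (\<forall>x\<in>topspace (cube (dm i)). x k = e \<longrightarrow> \<Phi> i x = \<Phi> j (g x))"
begin

lemma topspace_T: "topspace T = S"
proof -
  have "{x \<in> topspace (cube (dm i)). \<Phi> i x \<in> S} = topspace (cube (dm i))" if "i \<in> I" for i
    using maps that by blast
  then have "openin T S"
    unfolding openin_T by auto
  then show ?thesis by (metis openin_T openin_subset openin_topspace subset_antisym)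
qed

lemma closedin_T:
  "closedin T C \<longleftrightarrow> C \<subseteq> S \<and> (\<forall>i\<in>I. closedin (cube (dm i)) {x \<in> topspace (cube (dm i)). \<Phi> i x \<in> C})"
proof -
  have "openin (cube (dm i)) {x \<in> topspace (cube (dm i)). \<Phi> i x \<in> S - C} \<longleftrightarrow>
     closedin (cube (dm i)) {x \<in> topspace (cube (dm i)). \<Phi> i x \<in> C}" if "i \<in> I" for i
  proof -
    have "{x \<in> topspace (cube (dm i)). \<Phi> i x \<in> S - C} =
      topspace (cube (dm i)) - {x \<in> topspace (cube (dm i)). \<Phi> i x \<in> C}"
      using maps that by auto
    then show ?thesis by (auto simp: closedin_def)
  qed
  then show ?thesis by (auto simp: closedin_def[of T] topspace_T openin_T)
qed

lemma continuous_cell: "i \<in> I \<Longrightarrow> continuous_map (cube (dm i)) T (\<Phi> i)"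
  by (auto simp: continuous_map_def topspace_T openin_T maps)

lemma continuous_from:
  assumes "\<And>i. i \<in> I \<Longrightarrow> continuous_map (cube (dm i)) Z (f \<circ> \<Phi> i)"
  shows "continuous_map T Z f"
  unfolding continuous_map_def
proof (intro conjI allI impI funcsetI)
  fix x assume "x \<in> topspace T"
  then obtain i u where "i \<in> I" "u \<in> open_cube (dm i)" "x = \<Phi> i u"
    using cover topspace_T by auto
  then show "f x \<in> topspace Z"
    using assms[of i] open_cube_subset[of "dm i"] by (auto simp: continuous_map_def)
next
  fix U assume U: "openin Z U"
  show "openin T {x \<in> topspace T. f x \<in> U}"
    unfolding openin_T
  proof (intro conjI ballI)
    fix i assume i: "i \<in> I"
    have "{x \<in> topspace (cube (dm i)). \<Phi> i x \<in> {x \<in> topspace T. f x \<in> U}} =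
        {x \<in> topspace (cube (dm i)). (f \<circ> \<Phi> i) x \<in> U}"
      using maps i by (auto simp: topspace_T)
    then show "openin (cube (dm i)) {x \<in> topspace (cube (dm i)). \<Phi> i x \<in> {x \<in> topspace T. f x \<in> U}}"
      using assms[OF i] U by (simp add: continuous_map_def)
  qed (auto simp: topspace_T)
qed

lemma facetE:
  assumes "i \<in> I" "p \<in> {..<dm i} \<times> {0,1}"
  obtains j g where "j \<in> I" "dm j < dm i" "continuous_map (cube (dm i)) (cube (dm j)) g"
    "\<forall>x\<in>topspace (cube (dm i)). x (fst p) = snd p \<longrightarrow> \<Phi> i x = \<Phi> j (g x)"
proof -
  have "fst p < dm i" "snd p \<in> {0,1}" using assms(2) by (auto simp: mem_Times_iff)
  from facet[OF assms(1) this] show ?thesis using that by blast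
qed

text \<open>A facet is mapped into the image of a smaller cube, so induction on the dimension
  applies. Two sets appear because the induction needs the whole closed cell covered, its own
  interior included, while the CW condition asks for cells of smaller dimension over the
  boundary.\<close>

lemma cell_image_finite:
  assumes "i \<in> I"
  shows "\<exists>F\<subseteq>I. finite F \<and> (\<forall>j\<in>F. dm j \<le> dm i) \<and>
           \<Phi> i ` topspace (cube (dm i)) \<subseteq> (\<Union>j\<in>F. \<Phi> j ` open_cube (dm j)) \<and>
           (\<exists>F'\<subseteq>F. (\<forall>j\<in>F'. dm j < dm i) \<and> \<Phi> i ` cube_boundary (dm i) \<subseteq> (\<Union>j\<in>F'. \<Phi> j ` open_cube (dm j)))"
  using assms
proof (induction "dm i" arbitrary: i rule: less_induct)
  case less
  let ?N = "{..<dm i} \<times> {0,1::real}"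
  have "\<exists>G\<subseteq>I. finite G \<and> (\<forall>j\<in>G. dm j < dm i) \<and> \<Phi> i ` closed_facet (dm i) p \<subseteq> (\<Union>j\<in>G. \<Phi> j ` open_cube (dm j))"
    if p: "p \<in> ?N" for p
  proof -
    obtain j g where j: "j \<in> I" "dm j < dm i" "continuous_map (cube (dm i)) (cube (dm j)) g"
      "\<forall>x\<in>topspace (cube (dm i)). x (fst p) = snd p \<longrightarrow> \<Phi> i x = \<Phi> j (g x)"
      using facetE[OF less.prems p] by blast
    obtain F where F: "F \<subseteq> I" "finite F" "\<forall>l\<in>F. dm l \<le> dm j"
      "\<Phi> j ` topspace (cube (dm j)) \<subseteq> (\<Union>j\<in>F. \<Phi> j ` open_cube (dm j))"
      using less.hyps[OF j(2) j(1)] by blast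
    have "\<Phi> i ` closed_facet (dm i) p \<subseteq> \<Phi> j ` topspace (cube (dm j))"
      using j by (force simp: closed_facet_def continuous_map_def)
    then show ?thesis using F j(2) by (intro exI[of _ F]) force
  qed
  then obtain G where G: "\<And>p. p \<in> ?N \<Longrightarrow> G p \<subseteq> I \<and> finite (G p) \<and> (\<forall>j\<in>G p. dm j < dm i) \<and>
      \<Phi> i ` closed_facet (dm i) p \<subseteq> (\<Union>j\<in>G p. \<Phi> j ` open_cube (dm j))"
    by metis
  define F' where "F' = (\<Union>p\<in>?N. G p)"
  have F': "F' \<subseteq> I" "finite F'" "\<forall>j\<in>F'. dm j < dm i"
    using G unfolding F'_def by (blast, simp, blast)
  have b: "\<Phi> i ` cube_boundary (dm i) \<subseteq> (\<Union>j\<in>F'. \<Phi> j ` open_cube (dm j))"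
  proof
    fix z assume "z \<in> \<Phi> i ` cube_boundary (dm i)"
    then obtain p where "p \<in> ?N" "z \<in> \<Phi> i ` closed_facet (dm i) p"
      unfolding cube_boundary_facets by blast
    then show "z \<in> (\<Union>j\<in>F'. \<Phi> j ` open_cube (dm j))"
      using G[of p] unfolding F'_def by blast
  qed
  have "topspace (cube (dm i)) \<subseteq> open_cube (dm i) \<union> cube_boundary (dm i)"
    by (auto simp: cube_boundary_def)
  then have "\<Phi> i ` topspace (cube (dm i)) \<subseteq> (\<Union>j\<in>insert i F'. \<Phi> j ` open_cube (dm j))"
    using b by blast
  then show ?case
    using F' b less.prems by (intro exI[of _ "insert i F'"]) (auto intro!: exI[of _ F'])
qed

lemma boundary_point:
  assumes "i \<in> I" "x \<in> cube_boundary (dm i)"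
  obtains j u where "j \<in> I" "dm j < dm i" "u \<in> open_cube (dm j)" "\<Phi> i x = \<Phi> j u"
proof -
  obtain F F' where "F \<subseteq> I" "F' \<subseteq> F" "\<forall>j\<in>F'. dm j < dm i"
      "\<Phi> i ` cube_boundary (dm i) \<subseteq> (\<Union>j\<in>F'. \<Phi> j ` open_cube (dm j))"
    using cell_image_finite[OF assms(1)] by blast
  then show ?thesis using assms that by blast
qed

section \<open>Extension of real functions over the skeleta\<close>

definition good :: "('a \<Rightarrow> real) \<Rightarrow> nat \<Rightarrow> bool" where
  "good f N \<longleftrightarrow> (\<forall>i\<in>I. dm i \<le> N \<longrightarrow> continuous_map (cube (dm i)) euclideanreal (f \<circ> \<Phi> i))"

text \<open>On the boundary of a cube of dimension \<open>Suc N\<close> the composite with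
  \<open>f\<close> is continuous by the facet maps and pasting along the closed facets. Tietze's
  theorem in the compact Hausdorff cube extends it inwards, independently for each cell since the
  open cells are disjoint.\<close>

lemma good_extend:
  assumes "good f N"
  shows "\<exists>f'. good f' (Suc N) \<and> (\<forall>i\<in>I. \<forall>u\<in>open_cube (dm i). dm i \<le> N \<longrightarrow> f' (\<Phi> i u) = f (\<Phi> i u))"
proof -
  have "\<exists>h. continuous_map (cube (dm i)) euclideanreal h \<and> (\<forall>x\<in>cube_boundary (dm i). h x = f (\<Phi> i x))"
    if i: "i \<in> I" "dm i = Suc N" for i
  proof -
    let ?B = "subtopology (cube (dm i)) (cube_boundary (dm i))"
    have "continuous_map ?B euclideanreal (f \<circ> \<Phi> i)"
    proof (rule pasting_lemma_closed[where I = "{..<dm i} \<times> {0,1}" and T = "closed_facet (dm i)"])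
      fix p assume p: "p \<in> {..<dm i} \<times> {0,1::real}"
      have sub: "closed_facet (dm i) p \<subseteq> cube_boundary (dm i)"
        using p cube_boundary_facets by blast
      show "closedin ?B (closed_facet (dm i) p)"
        using closedin_facet[OF p] sub closedin_subset_topspace by blast
      obtain j g where j: "j \<in> I" "dm j < dm i" "continuous_map (cube (dm i)) (cube (dm j)) g"
        "\<forall>x\<in>topspace (cube (dm i)). x (fst p) = snd p \<longrightarrow> \<Phi> i x = \<Phi> j (g x)"
        using facetE[OF i(1) p] by blast
      have "continuous_map (cube (dm i)) euclideanreal ((f \<circ> \<Phi> j) \<circ> g)"
        using assms j i(2) by (intro continuous_map_compose[OF j(3)]) (auto simp: good_def)
      then have "continuous_map (subtopology (cube (dm i)) (closed_facet (dm i) p)) euclideanreal ((f \<circ> \<Phi> j) \<circ> g)"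
        using continuous_map_from_subtopology by blast
      then have "continuous_map (subtopology (cube (dm i)) (closed_facet (dm i) p)) euclideanreal (f \<circ> \<Phi> i)"
        by (rule continuous_map_eq) (use j(4) in \<open>auto simp: closed_facet_def case_prod_beta\<close>)
      then show "continuous_map (subtopology ?B (closed_facet (dm i) p)) euclideanreal (f \<circ> \<Phi> i)"
        using sub by (simp add: subtopology_subtopology inf.absorb2)
    qed (use cube_boundary_facets[of "dm i"] in auto)
    moreover have "normal_space (cube (dm i))"
      by (simp add: compact_Hausdorff_or_regular_imp_normal_space compact_space_cube Hausdorff_space_cube)
    ultimately show ?thesis
      using closedin_cube_boundary unfolding normal_space_iff_Tietze by (metis comp_apply)
  qed
  then obtain h where h: "\<And>i. \<lbrakk>i \<in> I; dm i = Suc N\<rbrakk> \<Longrightarrow>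
     continuous_map (cube (dm i)) euclideanreal (h i) \<and> (\<forall>x\<in>cube_boundary (dm i). h i x = f (\<Phi> i x))"
    by metis
  \<comment> \<open>The description is unique: disjointness of the open cells and injectivity on
    each leave a single pair \<open>i\<close>, \<open>u\<close> for a given point
    \<open>z\<close>.\<close>
  define f' where "f' z = (if \<exists>i u. i \<in> I \<and> dm i = Suc N \<and> u \<in> open_cube (dm i) \<and> z = \<Phi> i u
     then (THE r. \<exists>i u. i \<in> I \<and> dm i = Suc N \<and> u \<in> open_cube (dm i) \<and> z = \<Phi> i u \<and> r = h i u) else f z)" for z
  have new: "f' (\<Phi> i u) = h i u" if "i \<in> I" "dm i = Suc N" "u \<in> open_cube (dm i)" for i u
  proof -
    have "(THE r. \<exists>i' u'. i' \<in> I \<and> dm i' = Suc N \<and> u' \<in> open_cube (dm i') \<and> \<Phi> i u = \<Phi> i' u' \<and> r = h i' u') = h i u"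
    proof (rule the_equality)
      fix r assume "\<exists>i' u'. i' \<in> I \<and> dm i' = Suc N \<and> u' \<in> open_cube (dm i') \<and> \<Phi> i u = \<Phi> i' u' \<and> r = h i' u'"
      then obtain i' u' where *: "i' \<in> I" "u' \<in> open_cube (dm i')" "\<Phi> i u = \<Phi> i' u'" "r = h i' u'" by blast
      then have "i' = i" using disj[of i i' u u'] that by auto
      then have "u' = u" using * inj[of i] that by (auto simp: inj_on_def)
      then show "r = h i u" using * \<open>i' = i\<close> by simp
    qed (use that in blast)
    moreover have "\<exists>i' u'. i' \<in> I \<and> dm i' = Suc N \<and> u' \<in> open_cube (dm i') \<and> \<Phi> i u = \<Phi> i' u'"
      using that by blast
    ultimately show ?thesis unfolding f'_def by simp
  qed
  have old: "f' (\<Phi> i u) = f (\<Phi> i u)" if "i \<in> I" "dm i \<le> N" "u \<in> open_cube (dm i)" for i u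
  proof -
    have "\<not> (\<exists>i' u'. i' \<in> I \<and> dm i' = Suc N \<and> u' \<in> open_cube (dm i') \<and> \<Phi> i u = \<Phi> i' u')"
    proof clarify
      fix i' u' assume "i' \<in> I" "dm i' = Suc N" "u' \<in> open_cube (dm i')" "\<Phi> i u = \<Phi> i' u'"
      then show False using disj[of i i' u u'] that by auto
    qed
    then show ?thesis unfolding f'_def by (rule if_not_P)
  qed
  have old': "f' (\<Phi> i x) = f (\<Phi> i x)" if "i \<in> I" "dm i \<le> N" "x \<in> topspace (cube (dm i))" for i x
  proof (cases "x \<in> open_cube (dm i)")
    case False
    note bd = boundary_point[OF that(1) cube_boundaryI[OF that(3) False]]
    obtain j u where "j \<in> I" "dm j < dm i" "u \<in> open_cube (dm j)" "\<Phi> i x = \<Phi> j u"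
      by (rule bd)
    then show ?thesis using old[of j u] that by simp
  qed (use old that in blast)
  have "continuous_map (cube (dm i)) euclideanreal (f' \<circ> \<Phi> i)" if "i \<in> I" "dm i \<le> Suc N" for i
  proof (cases "dm i = Suc N")
    case True
    have eq: "h i x = f' (\<Phi> i x)" if x: "x \<in> topspace (cube (dm i))" for x
    proof (cases "x \<in> open_cube (dm i)")
      case False
      then have x: "x \<in> cube_boundary (dm i)" using x by (auto simp: cube_boundary_def)
      obtain j u where "j \<in> I" "dm j < dm i" "u \<in> open_cube (dm j)" "\<Phi> i x = \<Phi> j u"
        by (rule boundary_point[OF \<open>i \<in> I\<close> x])
      then have "f' (\<Phi> i x) = f (\<Phi> i x)" using old[of j u] True by simp
      then show ?thesis using h[of i] True x \<open>i \<in> I\<close> by simp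
    qed (use new \<open>i \<in> I\<close> True in simp)
    have "continuous_map (cube (dm i)) euclideanreal (h i)" using h[OF \<open>i \<in> I\<close> True] by blast
    then show ?thesis by (rule continuous_map_eq) (simp add: eq)
  next
    case False
    then have le: "dm i \<le> N" using that by simp
    then have "continuous_map (cube (dm i)) euclideanreal (f \<circ> \<Phi> i)"
      using assms that by (simp add: good_def)
    then show ?thesis by (rule continuous_map_eq) (simp add: old'[OF that(1) le])
  qed
  then show ?thesis using old unfolding good_def by blast
qed

text \<open>Successive extensions no longer change on skeleta already treated. A point of an open
  cell of dimension \<open>dm i\<close> is given its value at stage \<open>dm i\<close>, which is
  late enough because \<open>dm i \<le> b + dm i\<close>.\<close>

lemma good_limit:
  assumes "good f b"
  shows "\<exists>F. continuous_map T euclideanreal F \<and> (\<forall>i\<in>I. \<forall>u\<in>open_cube (dm i). dm i \<le> b \<longrightarrow> F (\<Phi> i u) = f (\<Phi> i u))"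
proof -
  have "\<exists>g. \<forall>n. (good (g n) (b + n) \<and> (n = 0 \<longrightarrow> g n = f)) \<and>
       (\<forall>i\<in>I. \<forall>u\<in>open_cube (dm i). dm i \<le> b + n \<longrightarrow> g (Suc n) (\<Phi> i u) = g n (\<Phi> i u))"
  proof (rule dependent_nat_choice)
    fix x n assume "good x (b + n) \<and> (n = 0 \<longrightarrow> x = f)"
    then show "\<exists>y. (good y (b + Suc n) \<and> (Suc n = 0 \<longrightarrow> y = f)) \<and>
         (\<forall>i\<in>I. \<forall>u\<in>open_cube (dm i). dm i \<le> b + n \<longrightarrow> y (\<Phi> i u) = x (\<Phi> i u))"
      using good_extend[of x "b + n"] by simp
  qed (use assms in auto)
  then obtain g where g: "\<And>n. good (g n) (b + n)" "g 0 = f"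
     "\<And>n i u. \<lbrakk>i \<in> I; u \<in> open_cube (dm i); dm i \<le> b + n\<rbrakk> \<Longrightarrow> g (Suc n) (\<Phi> i u) = g n (\<Phi> i u)"
    by metis
  have stable: "g (n + k) (\<Phi> i u) = g n (\<Phi> i u)" if "i \<in> I" "u \<in> open_cube (dm i)" "dm i \<le> b + n" for n k i u
    by (induction k) (use g(3)[of i u] that in auto)
  define F where "F z = (THE r. \<exists>i u. i \<in> I \<and> u \<in> open_cube (dm i) \<and> z = \<Phi> i u \<and> r = g (dm i) z)" for z
  have F: "F (\<Phi> i u) = g (dm i) (\<Phi> i u)" if "i \<in> I" "u \<in> open_cube (dm i)" for i u
    unfolding F_def by (rule the_equality) (use that disj in blast)+
  have Fn: "F (\<Phi> i x) = g n (\<Phi> i x)" if i: "i \<in> I" "x \<in> topspace (cube (dm i))" "dm i \<le> b + n" for i x n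
  proof -
    obtain j u where j: "j \<in> I" "dm j \<le> dm i" "u \<in> open_cube (dm j)" "\<Phi> i x = \<Phi> j u"
    proof (cases "x \<in> open_cube (dm i)")
      case False
      then have "x \<in> cube_boundary (dm i)" using i by (auto simp: cube_boundary_def)
      from boundary_point[OF i(1) this] show ?thesis using that less_imp_le by metis
    qed (use i that in blast)
    have "g (dm j) (\<Phi> j u) = g (n + dm j) (\<Phi> j u)" "g n (\<Phi> j u) = g (n + dm j) (\<Phi> j u)"
      using stable[of j u "dm j" n] stable[of j u n "dm j"] j i by (auto simp: add.commute)
    then show ?thesis using F j by simp
  qed
  have "continuous_map T euclideanreal F"
  proof (rule continuous_from)
    fix i assume i: "i \<in> I"
    have "continuous_map (cube (dm i)) euclideanreal (g (dm i) \<circ> \<Phi> i)"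
      using g(1)[of "dm i"] i by (auto simp: good_def)
    then show "continuous_map (cube (dm i)) euclideanreal (F \<circ> \<Phi> i)"
      by (rule continuous_map_eq) (use Fn[OF i, of _ "dm i"] in auto)
  qed
  moreover have "F (\<Phi> i u) = f (\<Phi> i u)" if "i \<in> I" "u \<in> open_cube (dm i)" "dm i \<le> b" for i u
    using Fn[of i u 0] g(2) that open_cube_subset[of "dm i"] by auto
  ultimately show ?thesis by blast
qed

text \<open>A bump function on the larger of the two cells, vanishing on its boundary and on all
  other cells of at most that dimension, is continuous on this skeleton and extends to the whole
  space. If both points lie in the same cell, the factor \<open>q\<close> makes it vanish at
  \<open>u\<close> but not at \<open>v\<close>.\<close>

lemma separate_points:
  assumes i: "i \<in> I" "u \<in> open_cube (dm i)" and j: "j \<in> I" "v \<in> open_cube (dm j)"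
    and le: "dm i \<le> dm j" and ne: "\<Phi> i u \<noteq> \<Phi> j v"
  shows "\<exists>F. continuous_map T euclideanreal F \<and> F (\<Phi> i u) \<noteq> F (\<Phi> j v)"
proof -
  define b where "b = dm j"
  define q where "q w = (if i = j then \<Sum>k<b. (w k - u k)\<^sup>2 else 1)" for w :: "nat \<Rightarrow> real"
  define \<beta> where "\<beta> w = (\<Prod>k<b. w k * (1 - w k)) * q w" for w
  have cont: "continuous_map (cube (dm j)) euclideanreal \<beta>"
    unfolding \<beta>_def q_def b_def
    by (cases "i = j") (auto intro!: continuous_intros continuous_map_cube_proj)
  have bd: "\<beta> w = 0" if "w \<in> cube_boundary (dm j)" for w
    using that by (auto simp: cube_boundary_iff \<beta>_def b_def)
  have pv: "(\<Prod>k<b. v k * (1 - v k)) \<noteq> 0"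
    using j(2) by (fastforce simp: open_cube_def b_def PiE_def Pi_def)
  have qv: "q v \<noteq> 0"
  proof (cases "i = j")
    case True
    then have "u \<noteq> v" using ne by auto
    moreover have "u \<in> extensional {..<b}" "v \<in> extensional {..<b}"
      using i(2) j(2) True by (auto simp: open_cube_def b_def PiE_def)
    ultimately obtain k where "k < b" "u k \<noteq> v k"
      by (metis extensionalityI lessThan_iff)
    then have "(\<Sum>k<b. (v k - u k)\<^sup>2) > 0"
      by (intro sum_pos2[of _ k]) auto
    then show ?thesis using True by (simp add: q_def)
  qed (simp add: q_def)
  define f where "f z = (if \<exists>w\<in>open_cube (dm j). z = \<Phi> j w then \<beta> (THE w. w \<in> open_cube (dm j) \<and> z = \<Phi> j w) else 0)" for z
  have fj: "f (\<Phi> j w) = \<beta> w" if "w \<in> open_cube (dm j)" for w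
  proof -
    have "(THE w'. w' \<in> open_cube (dm j) \<and> \<Phi> j w = \<Phi> j w') = w"
      by (rule the_equality) (use that inj[OF j(1)] in \<open>auto simp: inj_on_def\<close>)
    then show ?thesis using that by (auto simp: f_def)
  qed
  have f0: "f (\<Phi> l w) = 0" if "l \<in> I" "l \<noteq> j" "w \<in> open_cube (dm l)" for l w
    using that disj[of l j w] j(1) by (auto simp: f_def)
  have fl: "f (\<Phi> l w) = 0" if l: "l \<in> I" "dm l \<le> b" "w \<in> topspace (cube (dm l))" and "l \<noteq> j \<or> w \<in> cube_boundary (dm l)" for l w
  proof (cases "w \<in> open_cube (dm l)")
    case True
    then show ?thesis using f0 that by (auto simp: cube_boundary_def)
  next
    case False
    then have "w \<in> cube_boundary (dm l)" using l by (auto simp: cube_boundary_def)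
    from boundary_point[OF l(1) this]
    obtain m y where "m \<in> I" "dm m < dm l" "y \<in> open_cube (dm m)" "\<Phi> l w = \<Phi> m y" .
    moreover then have "m \<noteq> j" using l by (auto simp: b_def)
    ultimately show ?thesis using f0[of m y] by simp
  qed
  have "good f b"
    unfolding good_def
  proof (intro ballI impI)
    fix l assume l: "l \<in> I" "dm l \<le> b"
    show "continuous_map (cube (dm l)) euclideanreal (f \<circ> \<Phi> l)"
    proof (cases "l = j")
      case True
      have eq: "\<beta> x = f (\<Phi> j x)" if x: "x \<in> topspace (cube (dm j))" for x
      proof (cases "x \<in> open_cube (dm j)")
        case False
        then have "x \<in> cube_boundary (dm j)" using x by (rule cube_boundaryI[rotated])
        then show ?thesis using fl[of j x] bd[of x] j x by (simp add: b_def)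
      qed (simp add: fj)
      have "continuous_map (cube (dm j)) euclideanreal (f \<circ> \<Phi> j)"
        by (rule continuous_map_eq[OF cont]) (simp add: eq)
      then show ?thesis using True by simp
    next
      case False
      have "continuous_map (cube (dm l)) euclideanreal (\<lambda>_. 0)" by simp
      then show ?thesis by (rule continuous_map_eq) (simp add: fl l False)
    qed
  qed
  then obtain F where F: "continuous_map T euclideanreal F"
    "\<forall>i\<in>I. \<forall>u\<in>open_cube (dm i). dm i \<le> b \<longrightarrow> F (\<Phi> i u) = f (\<Phi> i u)"
    using good_limit by blast
  have "F (\<Phi> j v) \<noteq> 0" using F(2) j fj pv qv by (auto simp: b_def \<beta>_def)
  moreover have "F (\<Phi> i u) = 0"
  proof (cases "i = j")
    case True
    then show ?thesis using F(2) i fj[of u] by (auto simp: b_def \<beta>_def q_def)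
  next
    case False
    then show ?thesis using F(2) i le f0 by (auto simp: b_def)
  qed
  ultimately show ?thesis using F(1) by metis
qed

lemma Hausdorff_T: "Hausdorff_space T"
  unfolding Hausdorff_space_def
proof (intro allI impI, elim conjE)
  fix x y assume x: "x \<in> topspace T" and y: "y \<in> topspace T" and "x \<noteq> y"
  obtain i u where i: "i \<in> I" "u \<in> open_cube (dm i)" "x = \<Phi> i u" using x cover topspace_T by auto
  obtain j v where j: "j \<in> I" "v \<in> open_cube (dm j)" "y = \<Phi> j v" using y cover topspace_T by auto
  obtain F where F: "continuous_map T euclideanreal F" "F x \<noteq> F y"
  proof (cases "dm i \<le> dm j")
    case True
    then show ?thesis using separate_points[of i u j v] i j \<open>x \<noteq> y\<close> that by blast
  next
    case False
    then show ?thesis using separate_points[of j v i u] i j \<open>x \<noteq> y\<close> that by (metis nle_le)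
  qed
  obtain A B where AB: "open A" "open B" "F x \<in> A" "F y \<in> B" "A \<inter> B = {}"
    using hausdorff[OF F(2)] by blast
  show "\<exists>U V. openin T U \<and> openin T V \<and> x \<in> U \<and> y \<in> V \<and> disjnt U V"
    by (rule exI[of _ "{z \<in> topspace T. F z \<in> A}"], rule exI[of _ "{z \<in> topspace T. F z \<in> B}"])
      (use F AB x y in \<open>auto simp: disjnt_def intro!: openin_continuous_map_preimage\<close>)
qed

lemma CW: "CW_complex \<lparr>cw_top = T, skel = (\<lambda>n. \<Union>i\<in>{i\<in>I. dm i \<le> n}. \<Phi> i ` open_cube (dm i))\<rparr>"
proof -
  let ?C = "(\<lambda>i. (dm i, \<Phi> i)) ` I"
  have "\<exists>F\<subseteq>?C. finite F \<and> (\<forall>c\<in>F. fst c < dm i) \<and> \<Phi> i ` cube_boundary (dm i) \<subseteq> (\<Union>c\<in>F. open_cell c)"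
    if i: "i \<in> I" for i
  proof -
    obtain F F' where F: "F \<subseteq> I" "finite F" "F' \<subseteq> F" "\<forall>j\<in>F'. dm j < dm i"
      "\<Phi> i ` cube_boundary (dm i) \<subseteq> (\<Union>j\<in>F'. \<Phi> j ` open_cube (dm j))"
      using cell_image_finite[OF i] by blast
    then show ?thesis
      by (intro exI[of _ "(\<lambda>i. (dm i, \<Phi> i)) ` F'"])
        (auto simp: open_cell_def dest: finite_subset)
  qed
  then show ?thesis
    unfolding CW_complex_def
  proof (intro conjI exI[of _ ?C])
    show "\<forall>c\<in>?C. \<forall>c'\<in>?C. c \<noteq> c' \<longrightarrow> disjnt (open_cell c) (open_cell c')"
      using disj by (fastforce simp: disjnt_iff open_cell_def)
    show "\<forall>S\<subseteq>topspace (cw_top \<lparr>cw_top = T, skel = (\<lambda>n. \<Union>i\<in>{i\<in>I. dm i \<le> n}. \<Phi> i ` open_cube (dm i))\<rparr>).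
       (\<forall>(d, \<phi>)\<in>?C. closedin (cube d) {x \<in> topspace (cube d). \<phi> x \<in> S}) \<longrightarrow>
       closedin (cw_top \<lparr>cw_top = T, skel = (\<lambda>n. \<Union>i\<in>{i\<in>I. dm i \<le> n}. \<Phi> i ` open_cube (dm i))\<rparr>) S"
      by (auto simp: closedin_T topspace_T)
    show "\<forall>n. skel \<lparr>cw_top = T, skel = (\<lambda>n. \<Union>i\<in>{i\<in>I. dm i \<le> n}. \<Phi> i ` open_cube (dm i))\<rparr> n =
        (\<Union>c\<in>{c \<in> ?C. fst c \<le> n}. open_cell c)"
      by (force simp: open_cell_def)
  qed (auto simp: Hausdorff_T continuous_cell inj topspace_T cover open_cell_def)
qed

text \<open>Choose a point of \<open>K\<close> in every open cell that \<open>K\<close> meets. Each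
  set of chosen points meets every closed cell in a finite set and is therefore closed. So the
  chosen points form a compact discrete space, which is finite.\<close>

lemma finite_in_compact:
  assumes K: "compactin T K"
  shows "finite {i \<in> I. \<Phi> i ` open_cube (dm i) \<inter> K \<noteq> {}}"
proof -
  define J where "J = {i \<in> I. \<Phi> i ` open_cube (dm i) \<inter> K \<noteq> {}}"
  have JI: "J \<subseteq> I" by (auto simp: J_def)
  have KS: "K \<subseteq> S" using compactin_subset_topspace[OF K] by (simp add: topspace_T)
  have "\<forall>i\<in>J. \<exists>u. u \<in> open_cube (dm i) \<and> \<Phi> i u \<in> K"
    by (auto simp: J_def)
  from bchoice[OF this] obtain u where u: "\<And>i. i \<in> J \<Longrightarrow> u i \<in> open_cube (dm i) \<and> \<Phi> i (u i) \<in> K"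
    by blast
  define p where "p i = \<Phi> i (u i)" for i
  have inj: "inj_on p J" 
  proof (rule inj_onI)
    fix i j assume "i \<in> J" "j \<in> J" "p i = p j"
    then show "i = j" using u[of i] u[of j] disj[of i j "u i" "u j"] JI by (auto simp: p_def)
  qed
  have pK: "p ` J \<subseteq> K" using u by (auto simp: p_def)
  have clo: "closedin T Q" if Q: "Q \<subseteq> p ` J" for Q
    unfolding closedin_T
  proof (intro conjI ballI)
    show "Q \<subseteq> S" using Q pK KS by (meson order_trans)
    fix i assume i: "i \<in> I"
    obtain F where F: "F \<subseteq> I" "finite F"
      "\<Phi> i ` topspace (cube (dm i)) \<subseteq> (\<Union>j\<in>F. \<Phi> j ` open_cube (dm j))"
      using cell_image_finite[OF i] by blast
    have "Q \<inter> \<Phi> i ` topspace (cube (dm i)) \<subseteq> p ` F"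
    proof
      fix z assume z: "z \<in> Q \<inter> \<Phi> i ` topspace (cube (dm i))"
      then obtain j where j: "j \<in> J" "z = p j" using Q by blast
      obtain l w where l: "l \<in> F" "z = \<Phi> l w" "w \<in> open_cube (dm l)"
        using z F(3) by blast
      have "j = l" using u[OF j(1)] disj[of j l "u j" w] F(1) j l JI by (auto simp: p_def)
      then show "z \<in> p ` F" using j l by blast
    qed
    then have fin: "finite (Q \<inter> \<Phi> i ` topspace (cube (dm i)))" using F(2) finite_subset by blast
    have eq: "{x \<in> topspace (cube (dm i)). \<Phi> i x \<in> Q} =
       {x \<in> topspace (cube (dm i)). \<Phi> i x \<in> Q \<inter> \<Phi> i ` topspace (cube (dm i))}" by auto
    have "Q \<inter> \<Phi> i ` topspace (cube (dm i)) \<subseteq> topspace T" using maps[OF i] by (auto simp: topspace_T)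
    then have "closedin T (Q \<inter> \<Phi> i ` topspace (cube (dm i)))"
      using fin Hausdorff_T by (simp add: closedin_Hausdorff_finite)
    then show "closedin (cube (dm i)) {x \<in> topspace (cube (dm i)). \<Phi> i x \<in> Q}"
      unfolding eq by (rule closedin_continuous_map_preimage[OF continuous_cell[OF i]])
  qed
  have "compactin T (p ` J)" using closed_compactin[OF K pK] clo[OF order_refl] by blast
  moreover have "subtopology T (p ` J) = discrete_topology (p ` J)"
  proof (rule topology_eq[THEN iffD2], intro allI iffI)
    fix U assume "openin (discrete_topology (p ` J)) U"
    then have U: "U \<subseteq> p ` J" by simp
    then have "closedin T (p ` J - U)" using clo by blast
    then have "closedin (subtopology T (p ` J)) (p ` J - U)"
      by (meson Diff_subset closedin_subset_topspace)
    then show "openin (subtopology T (p ` J)) U"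
      using U \<open>compactin T (p ` J)\<close>
      by (metis closedin_def compactin_subset_topspace double_diff order_refl topspace_subtopology_subset)
  qed (use openin_subset in force)
  ultimately have "compact_space (discrete_topology (p ` J))"
    by (metis compactin_subspace)
  then have "finite (p ` J)" by (simp add: compact_space_discrete_topology)
  then show ?thesis using inj finite_imageD unfolding J_def by blast
qed

lemma compact_cover:
  assumes K: "compactin T K"
  obtains F where "F \<subseteq> I" "finite F" "K \<subseteq> (\<Union>i\<in>F. \<Phi> i ` topspace (cube (dm i)))"
proof
  show "K \<subseteq> (\<Union>i\<in>{i \<in> I. \<Phi> i ` open_cube (dm i) \<inter> K \<noteq> {}}. \<Phi> i ` topspace (cube (dm i)))"
  proof
    fix x assume "x \<in> K"
    then have "x \<in> S" using compactin_subset_topspace[OF K] by (auto simp: topspace_T)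
    then obtain i u where "i \<in> I" "u \<in> open_cube (dm i)" "x = \<Phi> i u"
      using cover by blast
    then show "x \<in> (\<Union>i\<in>{i \<in> I. \<Phi> i ` open_cube (dm i) \<inter> K \<noteq> {}}. \<Phi> i ` topspace (cube (dm i)))"
      using \<open>x \<in> K\<close> open_cube_subset[of "dm i"] by blast
  qed
qed (simp_all add: finite_in_compact[OF K])

text \<open>Closedness is tested on closed cells, and their images are compact.\<close>

lemma k_space_T: "k_space T"
  unfolding k_space
proof (intro allI impI, elim conjE)
  fix C assume C: "C \<subseteq> topspace T" "\<forall>K. compactin T K \<longrightarrow> closedin (subtopology T K) (K \<inter> C)"
  show "closedin T C"
    unfolding closedin_T
  proof (intro conjI ballI)
    fix i assume i: "i \<in> I"
    let ?K = "\<Phi> i ` topspace (cube (dm i))"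
    have K: "compactin T ?K"
      by (rule image_compactin[OF compact_space_cube[unfolded compact_space_def] continuous_cell[OF i]])
    then have clo: "closedin T (?K \<inter> C)"
      using closedin_closed_subtopology[OF compactin_imp_closedin[OF Hausdorff_T K]] C(2)[rule_format, OF K]
      by blast
    have eq: "{x \<in> topspace (cube (dm i)). \<Phi> i x \<in> C} = {x \<in> topspace (cube (dm i)). \<Phi> i x \<in> ?K \<inter> C}" by auto
    show "closedin (cube (dm i)) {x \<in> topspace (cube (dm i)). \<Phi> i x \<in> C}"
      unfolding eq by (rule closedin_continuous_map_preimage[OF continuous_cell[OF i] clo])
  qed (use C(1) topspace_T in blast)
qed

end

text \<open>A k-ification is tested on compact sets. A compact subset of the product projects to
  compact sets, each covered by finitely many closed cells; over a product of two cells the preimage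
  of a closed set is compact, and its image is closed in the Hausdorff product.\<close>

lemma continuous_map_from_kified_product:
  assumes X: "cube_complex S1 I1 dm1 \<Phi>1 T1" and Y: "cube_complex S2 I2 dm2 \<Phi>2 T2"
    and f: "\<And>i j. \<lbrakk>i \<in> I1; j \<in> I2\<rbrakk> \<Longrightarrow>
      continuous_map (prod_topology (cube (dm1 i)) (cube (dm2 j))) Z (\<lambda>(x, y). f (\<Phi>1 i x, \<Phi>2 j y))"
  shows "continuous_map (kification (prod_topology T1 T2)) Z f"
proof -
  interpret X: cube_complex S1 I1 dm1 \<Phi>1 T1 by (rule X)
  interpret Y: cube_complex S2 I2 dm2 \<Phi>2 T2 by (rule Y)
  let ?P = "prod_topology T1 T2"
  have H: "Hausdorff_space ?P"
    by (simp add: Hausdorff_space_prod_topology X.Hausdorff_T Y.Hausdorff_T)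
  show ?thesis
    unfolding continuous_map_closedin
  proof (intro conjI allI impI ballI funcsetI)
    fix p assume "p \<in> topspace (kification ?P)"
    then obtain i u j v where "i \<in> I1" "u \<in> open_cube (dm1 i)" "j \<in> I2" "v \<in> open_cube (dm2 j)" "p = (\<Phi>1 i u, \<Phi>2 j v)"
      using X.topspace_T Y.topspace_T X.cover Y.cover by auto
    moreover from this have "(u, v) \<in> topspace (prod_topology (cube (dm1 i)) (cube (dm2 j)))"
      using open_cube_subset by auto
    ultimately show "f p \<in> topspace Z"
      using f[of i j] by (force simp: continuous_map_def)
  next
    fix C assume C: "closedin Z C"
    let ?W = "{p \<in> topspace (kification ?P). f p \<in> C}"
    show "closedin (kification ?P) ?W"
      unfolding closedin_kification
    proof (intro conjI allI impI)
      fix K assume K: "compactin ?P K"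
      have K1: "compactin T1 (fst ` K)" and K2: "compactin T2 (snd ` K)"
        using image_compactin[OF K] continuous_map_fst continuous_map_snd by blast+
      obtain F1 where F1: "F1 \<subseteq> I1" "finite F1" "fst ` K \<subseteq> (\<Union>i\<in>F1. \<Phi>1 i ` topspace (cube (dm1 i)))"
        using X.compact_cover[OF K1] by blast
      obtain F2 where F2: "F2 \<subseteq> I2" "finite F2" "snd ` K \<subseteq> (\<Union>i\<in>F2. \<Phi>2 i ` topspace (cube (dm2 i)))"
        using Y.compact_cover[OF K2] by blast
      define A where "A i j = (\<lambda>(x, y). (\<Phi>1 i x, \<Phi>2 j y)) `
         {p \<in> topspace (prod_topology (cube (dm1 i)) (cube (dm2 j))). (\<lambda>(x, y). f (\<Phi>1 i x, \<Phi>2 j y)) p \<in> C}" for i j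
      have cA: "compactin ?P (A i j)" if ij: "i \<in> F1" "j \<in> F2" for i j
      proof -
        have c: "continuous_map (prod_topology (cube (dm1 i)) (cube (dm2 j))) ?P (\<lambda>(x, y). (\<Phi>1 i x, \<Phi>2 j y))"
          using ij F1 F2 X.continuous_cell[of i] Y.continuous_cell[of j]
          by (auto simp: case_prod_beta continuous_map_pairwise comp_def
              intro: continuous_map_compose[OF continuous_map_fst, unfolded comp_def]
                continuous_map_compose[OF continuous_map_snd, unfolded comp_def])
        have "closedin (prod_topology (cube (dm1 i)) (cube (dm2 j)))
           {p \<in> topspace (prod_topology (cube (dm1 i)) (cube (dm2 j))). (\<lambda>(x, y). f (\<Phi>1 i x, \<Phi>2 j y)) p \<in> C}"
          using f[of i j] C ij F1 F2 by (intro closedin_continuous_map_preimage) auto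
        moreover have "compact_space (prod_topology (cube (dm1 i)) (cube (dm2 j)))"
          by (simp add: compact_space_prod_topology compact_space_cube)
        ultimately show ?thesis
          unfolding A_def using image_compactin[OF _ c] closedin_compact_space by blast
      qed
      have "K \<inter> ?W = K \<inter> (\<Union>i\<in>F1. \<Union>j\<in>F2. A i j)" (is "_ = K \<inter> ?A")
      proof (intro set_eqI iffI)
        fix p assume p: "p \<in> K \<inter> ?W"
        then have "fst p \<in> fst ` K" "snd p \<in> snd ` K" by auto
        then obtain i x j y where "i \<in> F1" "x \<in> topspace (cube (dm1 i))" "fst p = \<Phi>1 i x"
          "j \<in> F2" "y \<in> topspace (cube (dm2 j))" "snd p = \<Phi>2 j y"
          using F1(3) F2(3) by blast
        moreover then have "p = (\<Phi>1 i x, \<Phi>2 j y)" by (simp add: prod_eq_iff)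
        ultimately have "p \<in> A i j" using p by (force simp: A_def)
        then show "p \<in> K \<inter> ?A" using p \<open>i \<in> F1\<close> \<open>j \<in> F2\<close> by blast
      next
        fix p assume "p \<in> K \<inter> ?A"
        then show "p \<in> K \<inter> ?W" using compactin_subset_topspace[OF K] by (auto simp: A_def)
      qed
      moreover have "compactin ?P (\<Union>j\<in>F2. A i j)" if "i \<in> F1" for i
        by (rule compactin_Union) (use cA F2(2) that in auto)
      then have "compactin ?P ?A"
        by (intro compactin_Union) (use F1(2) in auto)
      then have "closedin ?P ?A" using compactin_imp_closedin[OF H] by blast
      ultimately show "closedin (subtopology ?P K) (K \<inter> ?W)"
        by (metis closedin_subtopology_Int_closed)
    qed auto
  qed
qed

section \<open>Terms of a graph\<close>

text \<open>The possible histories of an edge: the input \<open>In i\<close>, the two outputs of \<open>\<Delta>\<close>, the output of \<open>\<mu>\<^sub>s\<close>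
  and the output of \<open>h\<^sub>s\<close>.\<close>

datatype 'p tm = In nat | Lt "'p tm" | Rt "'p tm" | Mt 'p "'p tm" "'p tm" | Ht 'p "'p tm"

fun sub :: "'p tm \<Rightarrow> 'p tm set" where
  "sub (In i) = {In i}"
| "sub (Lt t) = insert (Lt t) (sub t)"
| "sub (Rt t) = insert (Rt t) (sub t)"
| "sub (Mt s t u) = insert (Mt s t u) (sub t \<union> sub u)"
| "sub (Ht s t) = insert (Ht s t) (sub t)"

lemma sub_refl [simp]: "t \<in> sub t"
  by (cases t) auto

lemma sub_trans: "\<lbrakk>s \<in> sub t; t \<in> sub u\<rbrakk> \<Longrightarrow> s \<in> sub u"
  by (induction u) auto

text \<open>Joining the outputs of one graph to the inputs of another acts on histories by this
  substitution.\<close>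

fun bind :: "(nat \<Rightarrow> 'p tm) \<Rightarrow> 'p tm \<Rightarrow> 'p tm" where
  "bind \<rho> (In i) = \<rho> i"
| "bind \<rho> (Lt t) = Lt (bind \<rho> t)"
| "bind \<rho> (Rt t) = Rt (bind \<rho> t)"
| "bind \<rho> (Mt s t u) = Mt s (bind \<rho> t) (bind \<rho> u)"
| "bind \<rho> (Ht s t) = Ht s (bind \<rho> t)"

section \<open>Graphs decorated by the generating cells and their labellings\<close>

abbreviation "\<B> \<equiv> cell_bimodule S_cells"

type_synonym sgraph = "S_cell cell_point dgraph"

abbreviation cout :: "S_cell cell_point \<Rightarrow> nat \<Rightarrow> nat" where "cout p \<equiv> fst p"
abbreviation ccell :: "S_cell cell_point \<Rightarrow> S_cell" where "ccell p \<equiv> fst (snd p)"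
abbreviation cpt :: "S_cell cell_point \<Rightarrow> nat \<Rightarrow> real" where "cpt p \<equiv> fst (snd (snd p))"
abbreviation cin :: "S_cell cell_point \<Rightarrow> nat \<Rightarrow> nat" where "cin p \<equiv> snd (snd (snd p))"

lemma topspace_bsp: "topspace (cw_top (bsp \<B> n m)) = cell_points S_cells n m"
  unfolding cell_bimodule_def
  by (simp add: case_prod_beta, rule topspace_final_topology) (auto simp: cell_points_def)

lemma in_cell_points:
  "p \<in> cell_points S_cells n m \<longleftrightarrow> S_in (ccell p) = n \<and> S_out (ccell p) = m \<and>
     cpt p \<in> topspace (cube (S_dim (ccell p))) \<and> cout p permutes {..<m} \<and> cin p permutes {..<n}"
  by (cases p) (auto simp: cell_points_def S_cells_def)

text \<open>No edge starts at an \<open>Eps\<close> vertex, so its clause only fills in a value. The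
  output number \<open>j\<close> matters for \<open>Delta\<close> alone.\<close>

fun cell_val :: "S_cell \<Rightarrow> 'p \<Rightarrow> nat \<Rightarrow> (nat \<Rightarrow> 'p tm) \<Rightarrow> 'p tm" where
  "cell_val Eps s j t = t 0"
| "cell_val Delta s j t = (if j = 0 then Lt (t 0) else Rt (t 0))"
| "cell_val Mu s j t = Mt s (t 0) (t 1)"
| "cell_val Htp s j t = Ht s (t 0)"

lemma cell_val_cong: "(\<And>k. k < S_in c \<Longrightarrow> t k = t' k) \<Longrightarrow> cell_val c s j t = cell_val c s j t'"
  by (cases c) auto

lemma bind_cell_val: "bind \<rho> (cell_val c s j t) = cell_val c s j (\<lambda>k. bind \<rho> (t k))"
  by (cases c) auto

text \<open>A decoration stands for the point of a cell acted on from both sides. Hence input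
  \<open>k\<close> of the cell is the half-edge \<open>inv (cin (d v)) k\<close> of the vertex, and
  in \<open>src_val\<close> the half-edge \<open>j\<close> is output
  \<open>inv (cout (d v)) j\<close> of the cell.\<close>

definition ivals :: "(nat \<Rightarrow> S_cell cell_point) \<Rightarrow> (half_edge \<Rightarrow> real tm) \<Rightarrow> nat \<Rightarrow> nat \<Rightarrow> real tm" where
  "ivals d g v k = g (Vert v (inv (cin (d v)) k))"

fun src_val :: "(nat \<Rightarrow> S_cell cell_point) \<Rightarrow> (half_edge \<Rightarrow> real tm) \<Rightarrow> half_edge \<Rightarrow> real tm" where
  "src_val d g (Ext i) = In i"
| "src_val d g (Vert v j) = cell_val (ccell (d v)) (cpt (d v) 0) (inv (cout (d v)) j) (ivals d g v)"

text \<open>Edges are labelled with their history, starting from the inputs; an edge is addressed by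
  its end.\<close>

definition labelling :: "sgraph \<Rightarrow> (half_edge \<Rightarrow> real tm) \<Rightarrow> bool" where
  "labelling X g \<longleftrightarrow> (\<forall>p\<in>sources (fst X). g (wire (fst X) p) = src_val (snd X) g p)"

definition sdg :: "sgraph \<Rightarrow> bool" where
  "sdg X \<longleftrightarrow> X \<in> dgraphs \<B> (g_in (fst X)) (g_out (fst X))"

lemma dgraphs_iff: "X \<in> dgraphs \<B> n m \<longleftrightarrow> sdg X \<and> g_in (fst X) = n \<and> g_out (fst X) = m"
  by (cases X) (auto simp: sdg_def dgraphs_def)

text \<open>By \<open>labelling_unique\<close> the choice is visible only outside
  \<open>targets\<close>.\<close>

definition lab :: "sgraph \<Rightarrow> half_edge \<Rightarrow> real tm" where
  "lab X = (SOME g. labelling X g)"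

definition outs :: "sgraph \<Rightarrow> real tm list" where
  "outs X = map (\<lambda>j. lab X (Ext j)) [0..<g_out (fst X)]"

text \<open>A set loses nothing against a multiset, because distinct edges carry distinct terms
  (\<open>labelling_inj\<close>).\<close>

definition eps_set :: "(half_edge \<Rightarrow> real tm) \<Rightarrow> sgraph \<Rightarrow> real tm set" where
  "eps_set g X = {g (Vert v 0) |v. v < g_size (fst X) \<and> ccell (snd X v) = Eps}"

definition epss :: "sgraph \<Rightarrow> real tm set" where
  "epss X = eps_set (lab X) X"

lemma length_outs [simp]: "length (outs X) = g_out (fst X)"
  by (simp add: outs_def)

definition edges :: "graph \<Rightarrow> (nat \<times> nat) set" where
  "edges G = {(v, w). \<exists>i j. Vert v j \<in> sources G \<and> wire G (Vert v j) = Vert w i}"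

lemma sdg_iff: "sdg (G, d) \<longleftrightarrow> bij_betw (wire G) (sources G) (targets G) \<and> acyclic (edges G) \<and>
   (\<forall>v<g_size G. d v \<in> cell_points S_cells (v_in G v) (v_out G v))"
  by (simp add: sdg_def dgraphs_def valid_graph_def edges_def topspace_bsp)

lemma in_sources [simp]:
  "Ext i \<in> sources G \<longleftrightarrow> i < g_in G" "Vert v j \<in> sources G \<longleftrightarrow> v < g_size G \<and> j < v_out G v"
  by (auto simp: sources_def)

lemma in_targets [simp]:
  "Ext i \<in> targets G \<longleftrightarrow> i < g_out G" "Vert v j \<in> targets G \<longleftrightarrow> v < g_size G \<and> j < v_in G v"
  by (auto simp: targets_def)

lemma bij_betw_mem: "\<lbrakk>bij_betw f A B; x \<in> A\<rbrakk> \<Longrightarrow> f x \<in> B"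
  by (auto simp: bij_betw_def)

lemma bij_betw_ex: "\<lbrakk>bij_betw f A B; y \<in> B\<rbrakk> \<Longrightarrow> \<exists>x\<in>A. y = f x"
  by (auto simp: bij_betw_def)

lemma finite_edges:
  assumes "bij_betw (wire G) (sources G) (targets G)"
  shows "finite (edges G)"
proof -
  have "edges G \<subseteq> {..<g_size G} \<times> {..<g_size G}"
    unfolding edges_def using bij_betw_mem[OF assms] by fastforce
  then show ?thesis by (rule finite_subset) simp
qed

locale sdgraph =
  fixes X :: sgraph and G d
  assumes X: "sdg X" and G_def: "G = fst X" and d_def: "d = snd X"
begin

lemma bij: "bij_betw (wire G) (sources G) (targets G)"
  and acyclic: "acyclic (edges G)"
  and dec: "v < g_size G \<Longrightarrow> d v \<in> cell_points S_cells (v_in G v) (v_out G v)"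
  using X unfolding G_def d_def by (cases X; simp add: sdg_iff)+

lemma dec_simps:
  assumes "v < g_size G"
  shows "v_in G v = S_in (ccell (d v))" "v_out G v = S_out (ccell (d v))"
    "cpt (d v) \<in> topspace (cube (S_dim (ccell (d v))))"
    "cout (d v) permutes {..<S_out (ccell (d v))}" "cin (d v) permutes {..<S_in (ccell (d v))}"
  using dec[OF assms] by (auto simp: in_cell_points)

lemma inv_cin: "\<lbrakk>v < g_size G; k < S_in (ccell (d v))\<rbrakk> \<Longrightarrow> inv (cin (d v)) k < S_in (ccell (d v))"
  using permutes_in_image[OF permutes_inv[OF dec_simps(5)], of v k] by simp

lemma inv_cout: "\<lbrakk>v < g_size G; k < S_out (ccell (d v))\<rbrakk> \<Longrightarrow> inv (cout (d v)) k < S_out (ccell (d v))"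
  using permutes_in_image[OF permutes_inv[OF dec_simps(4)], of v k] by simp

lemma cin_lt: "\<lbrakk>v < g_size G; k < S_in (ccell (d v))\<rbrakk> \<Longrightarrow> cin (d v) k < S_in (ccell (d v))"
  using permutes_in_image[OF dec_simps(5), of v k] by simp

lemma cout_lt: "\<lbrakk>v < g_size G; k < S_out (ccell (d v))\<rbrakk> \<Longrightarrow> cout (d v) k < S_out (ccell (d v))"
  using permutes_in_image[OF dec_simps(4), of v k] by simp

lemma wf_edges: "wf (edges G)" "wf ((edges G)\<inverse>)"
  using finite_acyclic_wf[OF finite_edges[OF bij] acyclic]
    finite_acyclic_wf_converse[OF finite_edges[OF bij] acyclic] by auto

lemma edgesI: "\<lbrakk>v < g_size G; j < v_out G v; wire G (Vert v j) = Vert w i\<rbrakk> \<Longrightarrow> (v, w) \<in> edges G"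
  by (auto simp: edges_def)

lemma src_val_cong:
  assumes "p \<in> sources G" "\<And>v j i. \<lbrakk>p = Vert v j; i < v_in G v\<rbrakk> \<Longrightarrow> g (Vert v i) = g' (Vert v i)"
  shows "src_val d g p = src_val d g' p"
proof (cases p)
  case (Vert v j)
  then have v: "v < g_size G" using assms(1) by simp
  show ?thesis
    unfolding Vert src_val.simps
    by (rule cell_val_cong) (use assms(2)[OF Vert] inv_cin[OF v] dec_simps(1)[OF v] in \<open>auto simp: ivals_def\<close>)
qed simp

text \<open>Recursion along the acyclic edge relation: the label of an input of a vertex is computed
  from the inputs of the vertex where that edge starts. The auxiliary \<open>un\<close> reads a
  table of labels at vertex inputs as a function on half-edges.\<close>

lemma ex_labelling: "\<exists>g. labelling X g"
proof -
  define src where "src = inv_into (sources G) (wire G)"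
  have src: "src q \<in> sources G" "wire G (src q) = q" if "q \<in> targets G" for q
    using that bij unfolding src_def bij_betw_def by (auto intro: inv_into_into f_inv_into_f)
  have src': "src (wire G p) = p" if "p \<in> sources G" for p
    using that bij unfolding src_def bij_betw_def by auto
  define un where "un f h = (case h of Vert u i \<Rightarrow> f u i | Ext _ \<Rightarrow> undefined)"
    for f :: "nat \<Rightarrow> nat \<Rightarrow> real tm" and h
  define H where "H f v = (\<lambda>i. src_val d (un f) (src (Vert v i)))" for f v
  define f where "f = wfrec (edges G) H"
  have f: "f v i = src_val d (un f) (src (Vert v i))" if v: "v < g_size G" "i < v_in G v" for v i
  proof -
    have "f v = H (cut f (edges G) v) v"
      unfolding f_def by (rule wfrec[OF wf_edges(1)])
    then have "f v i = src_val d (un (cut f (edges G) v)) (src (Vert v i))" by (simp add: H_def)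
    also have "\<dots> = src_val d (un f) (src (Vert v i))"
    proof (rule src_val_cong)
      have t: "Vert v i \<in> targets G" using v by simp
      show "src (Vert v i) \<in> sources G" using src(1)[OF t] .
      fix u j i' assume *: "src (Vert v i) = Vert u j"
      then have "(u, v) \<in> edges G" using src[OF t] by (auto simp: edges_def)
      then show "un (cut f (edges G) v) (Vert u i') = un f (Vert u i')" by (simp add: un_def cut_apply)
    qed
    finally show ?thesis .
  qed
  \<comment> \<open>The recursion covers the inputs of vertices only. One further evaluation labels
    the external outputs as well.\<close>
  define g where "g h = src_val d (un f) (src h)" for h
  have "labelling X g"
    unfolding labelling_def G_def[symmetric] d_def[symmetric]
  proof
    fix p assume p: "p \<in> sources G"
    have "g (wire G p) = src_val d (un f) p" by (simp add: g_def src'[OF p])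
    also have "\<dots> = src_val d g p"
    proof (rule src_val_cong[OF p])
      fix v j i assume "p = Vert v j" "i < v_in G v"
      then show "un f (Vert v i) = g (Vert v i)" using p f by (simp add: un_def g_def)
    qed
    finally show "g (wire G p) = src_val d g p" .
  qed
  then show ?thesis by blast
qed

lemma labellingD: "\<lbrakk>labelling X g; p \<in> sources G\<rbrakk> \<Longrightarrow> g (wire G p) = src_val d g p"
  by (simp add: labelling_def G_def d_def)

lemma labelling_unique:
  assumes g: "labelling X g" and g': "labelling X g'" and q: "q \<in> targets G"
  shows "g q = g' q"
proof -
  have vert: "\<forall>i. v < g_size G \<and> i < v_in G v \<longrightarrow> g (Vert v i) = g' (Vert v i)" for v
  proof (induction v rule: wf_induct_rule[OF wf_edges(1)])
    case (1 v)
    show ?case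
    proof (intro allI impI)
      fix i assume "v < g_size G \<and> i < v_in G v"
      then obtain p where p: "p \<in> sources G" "Vert v i = wire G p"
        using bij_betw_ex[OF bij, of "Vert v i"] by auto
      have "src_val d g p = src_val d g' p"
      proof (rule src_val_cong[OF p(1)])
        fix u j i' assume u: "p = Vert u j" "i' < v_in G u"
        then have "(u, v) \<in> edges G" using p edgesI[of u j v i] by simp
        then show "g (Vert u i') = g' (Vert u i')" using 1 u p(1) by simp
      qed
      then show "g (Vert v i) = g' (Vert v i)" using labellingD[OF g p(1)] labellingD[OF g' p(1)] p(2) by simp
    qed
  qed
  obtain p where p: "p \<in> sources G" "q = wire G p"
    using bij_betw_ex[OF bij q] by auto
  have "src_val d g p = src_val d g' p"
    by (rule src_val_cong[OF p(1)]) (use vert p(1) in auto)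
  then show ?thesis using labellingD[OF g p(1)] labellingD[OF g' p(1)] p(2) by simp
qed

lemma labelling_lab: "labelling X (lab X)"
  unfolding lab_def using ex_labelling by (rule someI_ex)

lemma outs_eq: "labelling X g \<Longrightarrow> outs X = map (\<lambda>j. g (Ext j)) [0..<g_out G]"
  unfolding outs_def G_def[symmetric]
  by (rule map_cong) (auto intro: labelling_unique[OF labelling_lab])

lemma eps_target: "\<lbrakk>v < g_size G; ccell (d v) = Eps\<rbrakk> \<Longrightarrow> Vert v 0 \<in> targets G"
  using dec_simps(1)[of v] by simp

lemma epss_eq:
  assumes "labelling X g"
  shows "epss X = eps_set g X"
proof -
  have "lab X (Vert v 0) = g (Vert v 0)" if "v < g_size G" "ccell (d v) = Eps" for v
    using labelling_unique[OF labelling_lab assms eps_target[OF that]] .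
  then show ?thesis unfolding epss_def eps_set_def G_def d_def
    by (metis (no_types, lifting))
qed

end

lemma sdgraphI: "sdg X \<Longrightarrow> sdgraph X (fst X) (snd X)"
  by (simp add: sdgraph_def)

lemma cell_val_ne_In: "c \<noteq> Eps \<Longrightarrow> cell_val c s j t \<noteq> In i"
  by (cases c) auto

lemma cell_val_inject:
  assumes "cell_val c s j t = cell_val c' s' j' t'" "c \<noteq> Eps" "c' \<noteq> Eps"
    "j < S_out c" "j' < S_out c'"
  shows "c = c' \<and> j = j' \<and> (S_dim c = 1 \<longrightarrow> s = s') \<and> (\<forall>k<S_in c. t k = t' k)"
  using assms by (cases c; cases c') (auto split: if_splits simp: less_Suc_eq numeral_2_eq_2)

lemma size_cell_val: "\<lbrakk>c \<noteq> Eps; k < S_in c\<rbrakk> \<Longrightarrow> size (t k) < size (cell_val c s j t)"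
  by (cases c) (auto simp: less_Suc_eq numeral_2_eq_2)

lemma sub_cell_val: "\<lbrakk>c \<noteq> Eps; k < S_in c\<rbrakk> \<Longrightarrow> t k \<in> sub (cell_val c s j t)"
  by (cases c) (auto simp: less_Suc_eq numeral_2_eq_2)

lemma sub_cell_val_subset:
  "c \<noteq> Eps \<Longrightarrow> sub (cell_val c s i t) \<subseteq> insert (cell_val c s i t) (\<Union>k<S_in c. sub (t k))"
  by (cases c) (auto simp: lessThan_Suc numeral_2_eq_2)

lemma S_in_pos: "0 < S_in c"
  by (cases c) auto

lemma S_out_pos: "c \<noteq> Eps \<Longrightarrow> 0 < S_out c"
  by (cases c) auto

context sdgraph
begin

lemma source_not_Eps: "Vert v j \<in> sources G \<Longrightarrow> ccell (d v) \<noteq> Eps"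
  using dec_simps(2)[of v] by auto

lemma ivals_target: "\<lbrakk>v < g_size G; k < S_in (ccell (d v))\<rbrakk> \<Longrightarrow> Vert v (inv (cin (d v)) k) \<in> targets G"
  using inv_cin dec_simps(1) by simp

text \<open>Equal terms come from sources of the same kind with equal arguments. Every cell has an
  input, and the labels there are smaller terms, so by induction the first inputs of the two
  vertices coincide, hence so do the vertices. The constructors \<open>Lt\<close> and
  \<open>Rt\<close> then separate the outputs of a \<Delta>.\<close>

lemma labelling_inj:
  assumes g: "labelling X g" and "q \<in> targets G" "q' \<in> targets G" "g q = g q'"
  shows "q = q'"
  using assms(2-)
proof (induction "size (g q)" arbitrary: q q' rule: less_induct)
  case less
  obtain p where p: "p \<in> sources G" "q = wire G p" using bij_betw_ex[OF bij less.prems(1)] by auto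
  obtain p' where p': "p' \<in> sources G" "q' = wire G p'" using bij_betw_ex[OF bij less.prems(2)] by auto
  have e: "src_val d g p = src_val d g p'"
    using less.prems(3) labellingD[OF g p(1)] labellingD[OF g p'(1)] p p' by simp
  have "p = p'"
  proof (cases p)
    case (Ext i)
    show ?thesis
    proof (cases p')
      case V: (Vert v' j')
      have "ccell (d v') \<noteq> Eps" using source_not_Eps p'(1) V by blast
      then show ?thesis using e cell_val_ne_In Ext V by (metis src_val.simps)
    qed (use e Ext in auto)
  next
    case V: (Vert v j)
    have nE: "ccell (d v) \<noteq> Eps" using source_not_Eps p(1) V by blast
    show ?thesis
    proof (cases p')
      case (Ext i)
      then show ?thesis using e cell_val_ne_In[OF nE] V by (metis src_val.simps)
    next
      case V': (Vert v' j')
      have nE': "ccell (d v') \<noteq> Eps" using source_not_Eps p'(1) V' by blast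
      have v: "v < g_size G" "j < S_out (ccell (d v))" and v': "v' < g_size G" "j' < S_out (ccell (d v'))"
        using p(1) p'(1) V V' dec_simps(2) by auto
      have *: "ccell (d v) = ccell (d v')" "inv (cout (d v)) j = inv (cout (d v')) j'"
        "\<forall>k<S_in (ccell (d v)). ivals d g v k = ivals d g v' k"
        using cell_val_inject[OF e[unfolded V V' src_val.simps] nE nE' inv_cout[OF v] inv_cout[OF v']] by auto
      have "g (Vert v (inv (cin (d v)) 0)) = g (Vert v' (inv (cin (d v')) 0))"
        using *(3) S_in_pos by (simp add: ivals_def)
      moreover have "size (g (Vert v (inv (cin (d v)) 0))) < size (g q)"
        using labellingD[OF g p(1)] p(2) V size_cell_val[OF nE S_in_pos, of "ivals d g v"]
        by (simp add: ivals_def)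
      ultimately have "Vert v (inv (cin (d v)) 0) = Vert v' (inv (cin (d v')) 0)"
        using less.hyps ivals_target[OF v(1) S_in_pos] ivals_target[OF v'(1) S_in_pos] by blast
      then have "v = v'" by simp
      moreover have "j = j'"
        using *(2) \<open>v = v'\<close> permutes_inverses(1)[OF dec_simps(4)[OF v(1)]] by metis
      ultimately show ?thesis using V V' by simp
    qed
  qed
  then show ?case using p p' by simp
qed

text \<open>Going downstream from any edge one reaches an external output or an \<open>Eps\<close>
  vertex, by finiteness and acyclicity, and terms only grow on the way; so the first term is a
  subterm of the last. Conversely the arguments of a label are labels again.\<close>

lemma labels:
  assumes g: "labelling X g"
  shows "g ` targets G = \<Union> (sub ` (set (outs X) \<union> epss X))" (is "_ = ?U")
proof
  have V: "\<forall>i. v < g_size G \<and> i < v_in G v \<longrightarrow> g (Vert v i) \<in> ?U" for v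
  proof (induction v rule: wf_induct_rule[OF wf_edges(2)])
    case (1 v)
    show ?case
    proof (intro allI impI)
      fix i assume i: "v < g_size G \<and> i < v_in G v"
      show "g (Vert v i) \<in> ?U"
      proof (cases "ccell (d v) = Eps")
        case True
        then have "i = 0" using i dec_simps(1)[of v] by simp
        then have "g (Vert v i) \<in> epss X"
          using True i by (auto simp: epss_eq[OF g] eps_set_def G_def d_def)
        then show ?thesis by (meson UN_I UnI2 sub_refl)
      next
        case False
        have p: "Vert v 0 \<in> sources G" using i dec_simps(2)[of v] S_out_pos[OF False] by simp
        have i': "cin (d v) i < S_in (ccell (d v))" using cin_lt i dec_simps(1)[of v] by simp
        have "ivals d g v (cin (d v) i) = g (Vert v i)"
          unfolding ivals_def using permutes_inverses(2)[OF dec_simps(5)] i by metis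
        then have s: "g (Vert v i) \<in> sub (g (wire G (Vert v 0)))"
          unfolding labellingD[OF g p] using sub_cell_val[OF False i', of "ivals d g v"] by simp
        have "g (wire G (Vert v 0)) \<in> ?U"
        proof (cases "wire G (Vert v 0)")
          case (Ext j)
          then have "j < g_out G" using bij_betw_mem[OF bij p] by simp
          then have "g (Ext j) \<in> set (outs X)" by (simp add: outs_eq[OF g])
          then show ?thesis unfolding Ext by (meson UN_I UnI1 sub_refl)
        next
          case W: (Vert w k)
          then have "(v, w) \<in> edges G" using p by (auto simp: edges_def)
          then show ?thesis using 1[of w] bij_betw_mem[OF bij p] W by simp
        qed
        then show ?thesis using sub_trans[OF s] by blast
      qed
    qed
  qed
  show "g ` targets G \<subseteq> ?U"
  proof (rule image_subsetI)
    fix q assume q: "q \<in> targets G"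
    show "g q \<in> ?U"
    proof (cases q)
      case (Ext j)
      then have "g q \<in> set (outs X)" using q by (simp add: outs_eq[OF g])
      then show ?thesis by (meson UN_I UnI1 sub_refl)
    qed (use V q in simp)
  qed
  have closed: "sub (g q) \<subseteq> g ` targets G" if "q \<in> targets G" for q
    using that
  proof (induction "size (g q)" arbitrary: q rule: less_induct)
    case less
    obtain p where p: "p \<in> sources G" "q = wire G p" using bij_betw_ex[OF bij less.prems] by auto
    have gq: "g q = src_val d g p" using labellingD[OF g p(1)] p by simp
    show ?case
    proof (cases p)
      case (Ext i)
      then have "sub (g q) = {g q}" using gq by simp
      then show ?thesis using less.prems by auto
    next
      case V: (Vert v j)
      have nE: "ccell (d v) \<noteq> Eps" using source_not_Eps p(1) V by blast
      have v: "v < g_size G" using p(1) V by simp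
      have args: "sub (ivals d g v k) \<subseteq> g ` targets G" if k: "k < S_in (ccell (d v))" for k
        unfolding ivals_def
      proof (rule less.hyps[OF _ ivals_target[OF v k]])
        show "size (g (Vert v (inv (cin (d v)) k))) < size (g q)"
          using size_cell_val[OF nE k, of "ivals d g v"] gq V by (simp add: ivals_def)
      qed
      have "sub (g q) \<subseteq> insert (g q) (\<Union>k<S_in (ccell (d v)). sub (ivals d g v k))"
        unfolding gq V src_val.simps by (rule sub_cell_val_subset[OF nE])
      also have "\<dots> \<subseteq> insert (g q) (g ` targets G)"
        using args by blast
      finally have "sub (g q) \<subseteq> insert (g q) (g ` targets G)" .
      then show ?thesis using less.prems by auto
    qed
  qed
  have "set (outs X) \<union> epss X \<subseteq> g ` targets G"
  proof
    fix w assume "w \<in> set (outs X) \<union> epss X"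
    then consider j where "j < g_out G" "w = g (Ext j)"
      | v where "v < g_size G" "ccell (d v) = Eps" "w = g (Vert v 0)"
      by (auto simp: outs_eq[OF g] epss_eq[OF g] eps_set_def G_def d_def)
    then show "w \<in> g ` targets G"
      by cases (use eps_target in \<open>auto intro!: imageI\<close>)
  qed
  then show "?U \<subseteq> g ` targets G" using closed by blast
qed

end

section \<open>Terms as a complete isomorphism invariant of graphs\<close>

definition same_terms :: "sgraph \<Rightarrow> sgraph \<Rightarrow> bool" where
  "same_terms X Y \<longleftrightarrow> g_in (fst X) = g_in (fst Y) \<and> outs X = outs Y \<and> epss X = epss Y"

lemma same_terms_refl: "same_terms X X"
  and same_terms_sym: "same_terms X Y \<Longrightarrow> same_terms Y X"
  and same_terms_trans: "same_terms X Y \<Longrightarrow> same_terms Y Z \<Longrightarrow> same_terms X Z"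
  by (auto simp: same_terms_def)

lemma same_terms_out: "same_terms X Y \<Longrightarrow> g_out (fst X) = g_out (fst Y)"
  unfolding same_terms_def by (metis length_outs)

lemma cube_point_eqI:
  assumes "x \<in> topspace (cube k)" "y \<in> topspace (cube k)" "k \<le> 1" "k = 1 \<Longrightarrow> x 0 = y 0"
  shows "x = y"
proof
  fix i
  show "x i = y i"
  proof (cases "i < k")
    case True
    then have "k = 1" "i = 0" using assms(3) by auto
    then show ?thesis using assms by simp
  next
    case False
    then show ?thesis using assms(1,2) by (simp add: topspace_cube PiE_def extensional_def)
  qed
qed

lemma S_dim_le: "S_dim c \<le> 1"
  by (cases c) auto

lemma permutes_one: "\<sigma> permutes {..<1} \<Longrightarrow> \<sigma> (0::nat) = 0"
  using permutes_in_image[of \<sigma> "{..<1}" 0] by simp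

text \<open>Isomorphic graphs can only identify vertices related in this way. The relation will turn
  out to be a bijection.\<close>

definition matches :: "sgraph \<Rightarrow> nat \<Rightarrow> sgraph \<Rightarrow> nat \<Rightarrow> bool" where
  "matches X v Y w \<longleftrightarrow> ccell (snd X v) = ccell (snd Y w) \<and> cpt (snd X v) = cpt (snd Y w) \<and>
     (\<forall>k<S_in (ccell (snd X v)). ivals (snd X) (lab X) v k = ivals (snd Y) (lab Y) w k)"

lemma matches_sym: "matches X v Y w \<Longrightarrow> matches Y w X v"
  by (auto simp: matches_def)

lemma matches_unique:
  assumes Y: "sdg Y" and "matches X v Y w" "matches X v Y w'" "w < g_size (fst Y)" "w' < g_size (fst Y)"
  shows "w = w'"
proof -
  interpret Y: sdgraph Y "fst Y" "snd Y" using Y by (rule sdgraphI)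
  have "ivals (snd Y) (lab Y) w 0 = ivals (snd Y) (lab Y) w' 0"
    using assms S_in_pos[of "ccell (snd X v)"] by (auto simp: matches_def)
  moreover have "Vert w (inv (cin (snd Y w)) 0) \<in> targets (fst Y)" "Vert w' (inv (cin (snd Y w')) 0) \<in> targets (fst Y)"
    using Y.ivals_target[OF _ S_in_pos] assms by auto
  ultimately have "Vert w (inv (cin (snd Y w)) 0) = Vert w' (inv (cin (snd Y w')) 0)"
    by (intro Y.labelling_inj[OF Y.labelling_lab]) (auto simp: ivals_def)
  then show ?thesis by simp
qed

text \<open>An \<open>Eps\<close> vertex is found through \<open>epss\<close>. Any other vertex has
  an output whose label also occurs in \<open>Y\<close> by \<open>labels\<close>, and a label
  determines the cell, parameter and arguments of the vertex that emits it.\<close>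

lemma matches_ex:
  assumes X: "sdg X" and Y: "sdg Y" and same: "same_terms X Y" and v: "v < g_size (fst X)"
  shows "\<exists>w<g_size (fst Y). matches X v Y w"
proof -
  interpret X: sdgraph X "fst X" "snd X" using X by (rule sdgraphI)
  interpret Y: sdgraph Y "fst Y" "snd Y" using Y by (rule sdgraphI)
  let ?g = "lab X" and ?h = "lab Y" and ?d = "snd X" and ?e = "snd Y"
  show ?thesis
  proof (cases "ccell (?d v) = Eps")
    case True
    then have "?g (Vert v 0) \<in> epss Y"
      using v same by (auto simp: epss_def eps_set_def same_terms_def)
    then obtain w where w: "w < g_size (fst Y)" "ccell (?e w) = Eps" "?g (Vert v 0) = ?h (Vert w 0)"
      by (auto simp: epss_def eps_set_def)
    have "cin (?d v) permutes {..<1}" "cin (?e w) permutes {..<1}"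
      using X.dec_simps(5)[OF v] Y.dec_simps(5)[OF w(1)] True w(2) by auto
    then have "inv (cin (?d v)) 0 = 0" "inv (cin (?e w)) 0 = 0"
      by (auto intro!: permutes_one[OF permutes_inv])
    moreover have "cpt (?d v) \<in> topspace (cube 0)" "cpt (?e w) \<in> topspace (cube 0)"
      using X.dec_simps(3)[OF v] Y.dec_simps(3)[OF w(1)] unfolding True w(2) by simp_all
    then have "cpt (?d v) = cpt (?e w)" by (rule cube_point_eqI) simp_all
    ultimately have "matches X v Y w"
      using w True by (auto simp: matches_def ivals_def)
    then show ?thesis using w(1) by blast
  next
    case False
    define j where "j = cout (?d v) 0"
    have j: "j < S_out (ccell (?d v))" unfolding j_def by (rule X.cout_lt[OF v S_out_pos[OF False]])
    have p: "Vert v j \<in> sources (fst X)" using v j X.dec_simps(2)[OF v] by simp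
    have "?g (wire (fst X) (Vert v j)) \<in> ?g ` targets (fst X)"
      using bij_betw_mem[OF X.bij p] by blast
    then have "?g (wire (fst X) (Vert v j)) \<in> ?h ` targets (fst Y)"
      using X.labels[OF X.labelling_lab] Y.labels[OF Y.labelling_lab] same by (simp add: same_terms_def)
    then obtain p' where p': "p' \<in> sources (fst Y)" "?g (wire (fst X) (Vert v j)) = ?h (wire (fst Y) p')"
      using bij_betw_ex[OF Y.bij] by blast
    have e: "src_val ?d ?g (Vert v j) = src_val ?e ?h p'"
      using p' X.labellingD[OF X.labelling_lab p] Y.labellingD[OF Y.labelling_lab p'(1)] by simp
    show ?thesis
    proof (cases p')
      case (Ext i)
      then show ?thesis using e cell_val_ne_In[OF False] by (metis src_val.simps)
    next
      case V: (Vert w j')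
      have w: "w < g_size (fst Y)" "j' < S_out (ccell (?e w))" using p'(1) V Y.dec_simps(2) by auto
      have nE: "ccell (?e w) \<noteq> Eps" using Y.source_not_Eps p'(1) V by blast
      have *: "ccell (?d v) = ccell (?e w)" "S_dim (ccell (?d v)) = 1 \<longrightarrow> cpt (?d v) 0 = cpt (?e w) 0"
        "\<forall>k<S_in (ccell (?d v)). ivals ?d ?g v k = ivals ?e ?h w k"
        using cell_val_inject[OF e[unfolded V src_val.simps] False nE X.inv_cout[OF v j] Y.inv_cout[OF w]] by auto
      have "cpt (?d v) = cpt (?e w)"
        using X.dec_simps(3)[OF v] Y.dec_simps(3)[OF w(1), folded *(1)] S_dim_le *(2)[rule_format]
        by (rule cube_point_eqI)
      then show ?thesis using * w(1) by (auto simp: matches_def)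
    qed
  qed
qed

lemma lact_B [simp]: "lact \<B> \<tau> p = (\<tau> \<circ> cout p, ccell p, cpt p, cin p)"
  and ract_B [simp]: "ract \<B> p \<sigma> = (cout p, ccell p, cpt p, cin p \<circ> \<sigma>)"
  by (cases p; simp add: cell_bimodule_def)+

text \<open>Matching vertices give \<open>\<pi>\<close>, and the decorations force the relabelings
  \<open>\<sigma>\<close> and \<open>\<tau>\<close>. The wirings then agree without being inspected:
  both sides of the required equation are targets of \<open>Y\<close> with the same label, and
  labels are injective.\<close>

lemma iso_if_same_terms:
  assumes X: "sdg X" and Y: "sdg Y" and same: "same_terms X Y"
  shows "dgraph_iso \<B> X Y"
proof -
  interpret X: sdgraph X "fst X" "snd X" using X by (rule sdgraphI)
  interpret Y: sdgraph Y "fst Y" "snd Y" using Y by (rule sdgraphI)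
  let ?g = "lab X" and ?h = "lab Y" and ?d = "snd X" and ?e = "snd Y" and ?G = "fst X" and ?H = "fst Y"
  note Xl = X.labelling_lab and Yl = Y.labelling_lab
  have "\<forall>v\<in>{..<g_size ?G}. \<exists>w. w < g_size ?H \<and> matches X v Y w" using matches_ex[OF X Y same] by auto
  from bchoice[OF this] obtain \<pi> where
    \<pi>: "\<And>v. v < g_size ?G \<Longrightarrow> \<pi> v < g_size ?H" "\<And>v. v < g_size ?G \<Longrightarrow> matches X v Y (\<pi> v)"
    by auto
  have bij: "bij_betw \<pi> {..<g_size ?G} {..<g_size ?H}"
    unfolding bij_betw_def
  proof
    show "inj_on \<pi> {..<g_size ?G}"
    proof (rule inj_onI)
      fix v w assume vw: "v \<in> {..<g_size ?G}" "w \<in> {..<g_size ?G}" "\<pi> v = \<pi> w"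
      then show "v = w"
        using matches_unique[OF X, of Y "\<pi> v" v w] \<pi>[of v] \<pi>[of w] matches_sym by auto
    qed
    show "\<pi> ` {..<g_size ?G} = {..<g_size ?H}"
    proof
      show "{..<g_size ?H} \<subseteq> \<pi> ` {..<g_size ?G}"
      proof
        fix w assume w: "w \<in> {..<g_size ?H}"
        then obtain v where v: "v < g_size ?G" "matches Y w X v"
          using matches_ex[OF Y X same_terms_sym[OF same]] by auto
        then have "\<pi> v = w"
          using matches_unique[OF Y, of X v "\<pi> v" w] \<pi>[of v] matches_sym w by auto
        then show "w \<in> \<pi> ` {..<g_size ?G}" using v by auto
      qed
    qed (use \<pi> in auto)
  qed
  have cell: "ccell (?e (\<pi> v)) = ccell (?d v)" "cpt (?e (\<pi> v)) = cpt (?d v)"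
    and iv: "\<And>k. k < S_in (ccell (?d v)) \<Longrightarrow> ivals ?d ?g v k = ivals ?e ?h (\<pi> v) k"
    if "v < g_size ?G" for v
    using \<pi>(2)[OF that] by (auto simp: matches_def)
  define \<sigma> where "\<sigma> v = inv (cin (?e (\<pi> v))) \<circ> cin (?d v)" for v
  define \<tau> where "\<tau> v = cout (?e (\<pi> v)) \<circ> inv (cout (?d v))" for v
  have perm: "\<sigma> v permutes {..<v_in ?G v}" "\<tau> v permutes {..<v_out ?G v}"
    and dec: "?e (\<pi> v) = lact \<B> (\<tau> v) (ract \<B> (?d v) (inv (\<sigma> v)))"
    and ar: "v_in ?H (\<pi> v) = v_in ?G v" "v_out ?H (\<pi> v) = v_out ?G v"
    if v: "v < g_size ?G" for v
  proof -
    note dX = X.dec_simps[OF v] and dY = Y.dec_simps[OF \<pi>(1)[OF v], unfolded cell[OF v]]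
    show "v_in ?H (\<pi> v) = v_in ?G v" "v_out ?H (\<pi> v) = v_out ?G v" using dX dY by simp_all
    show "\<sigma> v permutes {..<v_in ?G v}" "\<tau> v permutes {..<v_out ?G v}"
      unfolding \<sigma>_def \<tau>_def dX(1,2) by (intro permutes_compose permutes_inv dX dY)+
    have "inv (\<sigma> v) = inv (cin (?d v)) \<circ> cin (?e (\<pi> v))"
      unfolding \<sigma>_def using permutes_bij[OF dX(5)] permutes_bij[OF dY(5)]
      by (simp add: o_inv_distrib bij_imp_bij_inv inv_inv_eq)
    then have "cin (?d v) \<circ> inv (\<sigma> v) = cin (?e (\<pi> v))"
      using permutes_inv_o(1)[OF dX(5)] by (simp add: o_assoc)
    moreover have "\<tau> v \<circ> cout (?d v) = cout (?e (\<pi> v))"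
      unfolding \<tau>_def using permutes_inv_o(2)[OF dX(4)] by (simp add: o_assoc[symmetric])
    ultimately show "?e (\<pi> v) = lact \<B> (\<tau> v) (ract \<B> (?d v) (inv (\<sigma> v)))"
      by (simp add: cell[OF v, symmetric] prod_eq_iff)
  qed
  have src: "map_half_edge \<pi> \<tau> p \<in> sources ?H" "?h (wire ?H (map_half_edge \<pi> \<tau> p)) = ?g (wire ?G p)"
    if p: "p \<in> sources ?G" for p
  proof -
    show s: "map_half_edge \<pi> \<tau> p \<in> sources ?H"
    proof (cases p)
      case (Vert v j)
      then have v: "v < g_size ?G" "j < v_out ?G v" using p by auto
      then have "\<tau> v j < v_out ?G v" using permutes_in_image[OF perm(2)[OF v(1)], of j] by simp
      then show ?thesis using Vert v \<pi>(1) ar(2) by simp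
    qed (use p same in \<open>simp add: same_terms_def\<close>)
    have "src_val ?e ?h (map_half_edge \<pi> \<tau> p) = src_val ?d ?g p"
    proof (cases p)
      case (Vert v j)
      then have v: "v < g_size ?G" "j < v_out ?G v" using p by auto
      have "inv (cout (?e (\<pi> v))) (\<tau> v j) = inv (cout (?d v)) j"
        unfolding \<tau>_def using permutes_inverses(2)[OF Y.dec_simps(4)[OF \<pi>(1)[OF v(1)]]] by simp
      then show ?thesis
        using Vert cell[OF v(1)] iv[OF v(1)] by (auto intro!: cell_val_cong)
    qed simp
    then show "?h (wire ?H (map_half_edge \<pi> \<tau> p)) = ?g (wire ?G p)"
      using X.labellingD[OF Xl p] Y.labellingD[OF Yl s] by simp
  qed
  have tgt: "map_half_edge \<pi> \<sigma> q \<in> targets ?H" "?h (map_half_edge \<pi> \<sigma> q) = ?g q"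
    if q: "q \<in> targets ?G" for q
  proof -
    have "map_half_edge \<pi> \<sigma> q \<in> targets ?H \<and> ?h (map_half_edge \<pi> \<sigma> q) = ?g q"
    proof (cases q)
      case (Ext j)
      have "outs X ! j = outs Y ! j" using same by (simp add: same_terms_def)
      then show ?thesis
        using Ext q same_terms_out[OF same] by (simp add: outs_def)
    next
      case (Vert v i)
      then have v: "v < g_size ?G" "i < S_in (ccell (?d v))" using q X.dec_simps(1) by auto
      then have "\<sigma> v i < v_in ?G v" using permutes_in_image[OF perm(1)[OF v(1)], of i] X.dec_simps(1) by simp
      moreover have "ivals ?e ?h (\<pi> v) (cin (?d v) i) = ivals ?d ?g v (cin (?d v) i)"
        using iv[OF v(1) X.cin_lt[OF v]] by simp
      then have "?h (Vert (\<pi> v) (\<sigma> v i)) = ?g (Vert v i)"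
        using permutes_inverses(2)[OF X.dec_simps(5)[OF v(1)]] by (simp add: ivals_def \<sigma>_def)
      ultimately show ?thesis using Vert v \<pi>(1) ar(1) by simp
    qed
    then show "map_half_edge \<pi> \<sigma> q \<in> targets ?H" "?h (map_half_edge \<pi> \<sigma> q) = ?g q" by auto
  qed
  have "wire ?H (map_half_edge \<pi> \<tau> p) = map_half_edge \<pi> \<sigma> (wire ?G p)" if p: "p \<in> sources ?G" for p
  proof (rule Y.labelling_inj[OF Yl])
    show "wire ?H (map_half_edge \<pi> \<tau> p) \<in> targets ?H"
      by (rule bij_betw_mem[OF Y.bij src(1)[OF p]])
    show "map_half_edge \<pi> \<sigma> (wire ?G p) \<in> targets ?H"
      by (rule tgt(1)[OF bij_betw_mem[OF X.bij p]])
    show "?h (wire ?H (map_half_edge \<pi> \<tau> p)) = ?h (map_half_edge \<pi> \<sigma> (wire ?G p))"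
      using src(2)[OF p] tgt(2)[OF bij_betw_mem[OF X.bij p]] by simp
  qed
  then show ?thesis
    unfolding dgraph_iso_def case_prod_beta
    using same same_terms_out[OF same] bij perm dec ar
    by (intro conjI exI[of _ \<pi>] exI[of _ \<sigma>] exI[of _ \<tau>]) (auto simp: same_terms_def simp del: lact_B ract_B)
qed

lemma bij_betw_map_half_edge_sources:
  assumes \<pi>: "bij_betw \<pi> {..<g_size G} {..<g_size H}" and "g_in H = g_in G"
    and \<tau>: "\<And>v. v < g_size G \<Longrightarrow> v_out H (\<pi> v) = v_out G v \<and> \<tau> v permutes {..<v_out G v}"
  shows "bij_betw (map_half_edge \<pi> \<tau>) (sources G) (sources H)"
proof (rule bij_betw_imageI)
  show "inj_on (map_half_edge \<pi> \<tau>) (sources G)"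
  proof (rule inj_onI)
    fix p q assume pq: "p \<in> sources G" "q \<in> sources G" "map_half_edge \<pi> \<tau> p = map_half_edge \<pi> \<tau> q"
    show "p = q"
    proof (cases p; cases q)
      fix v j w k assume *: "p = Vert v j" "q = Vert w k"
      then have "v = w" using pq bij_betw_imp_inj_on[OF \<pi>] by (auto simp: inj_on_def)
      then show "p = q" using * pq \<tau>[of v] permutes_inj[of "\<tau> v"] by (auto simp: inj_eq)
    qed (use pq in auto)
  qed
  show "map_half_edge \<pi> \<tau> ` sources G = sources H"
  proof (intro set_eqI iffI)
    fix q assume "q \<in> map_half_edge \<pi> \<tau> ` sources G"
    then obtain p where p: "p \<in> sources G" "q = map_half_edge \<pi> \<tau> p" by blast
    show "q \<in> sources H"
    proof (cases p)
      case (Vert v j)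
      then have v: "v < g_size G" "j < v_out G v" using p by auto
      then have "\<tau> v j < v_out G v" "\<pi> v < g_size H"
        using permutes_in_image[of "\<tau> v" "{..<v_out G v}" j] \<tau>[of v] bij_betw_mem[OF \<pi>, of v] by auto
      then show ?thesis using p Vert v \<tau> by simp
    qed (use p assms in auto)
  next
    fix q assume q: "q \<in> sources H"
    show "q \<in> map_half_edge \<pi> \<tau> ` sources G"
    proof (cases q)
      case (Ext i)
      then show ?thesis using q assms by (intro image_eqI[of _ _ "Ext i"]) auto
    next
      case (Vert w k)
      then obtain v where v: "v < g_size G" "w = \<pi> v" using q bij_betw_ex[OF \<pi>, of w] by auto
      have k: "inv (\<tau> v) k < v_out G v"
        using q Vert v \<tau>[of v] permutes_in_image[OF permutes_inv, of "\<tau> v" "{..<v_out G v}" k] by auto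
      show ?thesis
        by (rule image_eqI[of _ _ "Vert v (inv (\<tau> v) k)"])
          (use k v Vert \<tau>[of v] permutes_inverses(1)[of "\<tau> v" "{..<v_out G v}" k] in auto)
    qed
  qed
qed

lemma bij_betw_map_half_edge_targets:
  assumes "bij_betw \<pi> {..<g_size G} {..<g_size H}" and "g_out H = g_out G"
    and "\<And>v. v < g_size G \<Longrightarrow> v_in H (\<pi> v) = v_in G v \<and> \<sigma> v permutes {..<v_in G v}"
  shows "bij_betw (map_half_edge \<pi> \<sigma>) (targets G) (targets H)"
proof -
  \<comment> \<open>Exchanging inputs and outputs turns targets into sources, so the preceding lemma
    applies.\<close>
  define op where "op K = \<lparr>g_in = g_out K, g_out = g_in K, g_size = g_size K, v_in = v_out K,
     v_out = v_in K, wire = wire K\<rparr>" for K :: graph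
  have "sources (op K) = targets K" for K by (auto simp: sources_def targets_def op_def)
  moreover have "bij_betw (map_half_edge \<pi> \<sigma>) (sources (op G)) (sources (op H))"
    by (rule bij_betw_map_half_edge_sources) (use assms in \<open>auto simp: op_def\<close>)
  ultimately show ?thesis by simp
qed

text \<open>The labelling of \<open>Y\<close> pulls back along the isomorphism to a labelling of
  \<open>X\<close>, and labellings are unique on targets. That \<open>Y\<close> is well formed has
  to be proved too, since \<open>dgraph_iso\<close> does not presuppose it.\<close>

lemma iso_imp_same_terms:
  assumes X: "sdg X" and iso: "dgraph_iso \<B> X Y"
  shows "sdg Y \<and> same_terms X Y"
proof -
  interpret X: sdgraph X "fst X" "snd X" using X by (rule sdgraphI)
  let ?d = "snd X" and ?e = "snd Y" and ?G = "fst X" and ?H = "fst Y"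
  obtain \<pi> \<sigma> \<tau> where io: "g_in ?H = g_in ?G" "g_out ?H = g_out ?G"
    and \<pi>: "bij_betw \<pi> {..<g_size ?G} {..<g_size ?H}"
    and v: "\<And>v. v < g_size ?G \<Longrightarrow> v_in ?H (\<pi> v) = v_in ?G v \<and> v_out ?H (\<pi> v) = v_out ?G v \<and>
       \<sigma> v permutes {..<v_in ?G v} \<and> \<tau> v permutes {..<v_out ?G v} \<and>
       ?e (\<pi> v) = lact \<B> (\<tau> v) (ract \<B> (?d v) (inv (\<sigma> v)))"
    and w: "\<And>p. p \<in> sources ?G \<Longrightarrow> wire ?H (map_half_edge \<pi> \<tau> p) = map_half_edge \<pi> \<sigma> (wire ?G p)"
    using iso unfolding dgraph_iso_def case_prod_beta by blast
  let ?S = "map_half_edge \<pi> \<tau>" and ?T = "map_half_edge \<pi> \<sigma>"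
  have S: "bij_betw ?S (sources ?G) (sources ?H)"
    by (rule bij_betw_map_half_edge_sources) (use \<pi> io v in auto)
  have T: "bij_betw ?T (targets ?G) (targets ?H)"
    by (rule bij_betw_map_half_edge_targets) (use \<pi> io v in auto)
  have bij: "bij_betw (wire ?H) (sources ?H) (targets ?H)"
  proof -
    have "bij_betw (?T \<circ> wire ?G) (sources ?G) (targets ?H)"
      using X.bij T by (rule bij_betw_trans)
    then have "bij_betw (wire ?H \<circ> ?S) (sources ?G) (targets ?H)"
      by (rule iffD1[OF bij_betw_cong, rotated]) (simp add: w)
    then show ?thesis using bij_betw_comp_iff[OF S] by blast
  qed
  have edge: "\<exists>v' w'. (v', w') \<in> edges ?G \<and> v = \<pi> v' \<and> w = \<pi> w'" if vw: "(v, w) \<in> edges ?H" for v w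
  proof -
    obtain j i where ji: "Vert v j \<in> sources ?H" "wire ?H (Vert v j) = Vert w i"
      using vw by (auto simp: edges_def)
    obtain p where p: "p \<in> sources ?G" "Vert v j = ?S p" using bij_betw_ex[OF S ji(1)] by blast
    then obtain v' j' where v': "p = Vert v' j'" "v = \<pi> v'" by (cases p) auto
    have "?T (wire ?G p) = Vert w i" using w[OF p(1)] p ji by simp
    then obtain w' i' where "wire ?G p = Vert w' i'" "w = \<pi> w'" by (cases "wire ?G p") auto
    then show ?thesis using v' p by (auto simp: edges_def)
  qed
  have ac: "acyclic (edges ?H)"
  proof (rule acyclicI, rule allI)
    fix x
    define \<rho> where "\<rho> = inv_into {..<g_size ?G} \<pi>"
    have \<rho>: "\<rho> (\<pi> v) = v" if "v < g_size ?G" for v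
      using that bij_betw_imp_inj_on[OF \<pi>] by (simp add: \<rho>_def)
    have step: "(\<rho> v, \<rho> w) \<in> edges ?G" if vw: "(v, w) \<in> edges ?H" for v w
    proof -
      obtain v' w' where *: "(v', w') \<in> edges ?G" "v = \<pi> v'" "w = \<pi> w'" using edge[OF vw] by blast
      then obtain j i where "Vert v' j \<in> sources ?G" "wire ?G (Vert v' j) = Vert w' i"
        by (auto simp: edges_def)
      then have "v' < g_size ?G" "w' < g_size ?G" using bij_betw_mem[OF X.bij] by fastforce+
      then show ?thesis using * \<rho> by simp
    qed
    have "(\<rho> x, \<rho> y) \<in> (edges ?G)\<^sup>+" if "(x, y) \<in> (edges ?H)\<^sup>+" for y
      using that by (induction rule: trancl_induct) (use step in \<open>auto intro: trancl_into_trancl\<close>)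
    then show "(x, x) \<notin> (edges ?H)\<^sup>+" using X.acyclic by (auto simp: acyclic_def)
  qed
  have dec: "?e w \<in> cell_points S_cells (v_in ?H w) (v_out ?H w)" if w: "w < g_size ?H" for w
  proof -
    obtain u where u: "u < g_size ?G" "w = \<pi> u" using bij_betw_ex[OF \<pi>, of w] w by auto
    show ?thesis
      using v[OF u(1)] u X.dec_simps[OF u(1)]
      by (auto simp: in_cell_points intro!: permutes_compose permutes_inv)
  qed
  have Y: "sdg Y" using bij ac dec by (cases Y) (simp add: sdg_iff)
  interpret Y: sdgraph Y "fst Y" "snd Y" using Y by (rule sdgraphI)
  let ?h = "lab Y"
  define g where "g = ?h \<circ> ?T"
  have g: "labelling X g"
    unfolding labelling_def
  proof
    fix p assume p: "p \<in> sources ?G"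
    have "g (wire ?G p) = ?h (wire ?H (?S p))" using w[OF p] by (simp add: g_def)
    also have "\<dots> = src_val ?e ?h (?S p)"
      by (rule Y.labellingD[OF Y.labelling_lab bij_betw_mem[OF S p]])
    also have "\<dots> = src_val ?d g p"
    proof (cases p)
      case (Vert u j)
      then have u: "u < g_size ?G" using p by simp
      have c: "cout (?e (\<pi> u)) = \<tau> u \<circ> cout (?d u)" "cin (?e (\<pi> u)) = cin (?d u) \<circ> inv (\<sigma> u)"
        "ccell (?e (\<pi> u)) = ccell (?d u)" "cpt (?e (\<pi> u)) = cpt (?d u)"
        using v[OF u] by simp_all
      have b: "bij (\<tau> u)" "bij (\<sigma> u)" "bij (cout (?d u))" "bij (cin (?d u))"
        using v[OF u] X.dec_simps(4,5)[OF u] permutes_bij by blast+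
      have "inv (cout (?e (\<pi> u))) (\<tau> u j) = inv (cout (?d u)) j"
        unfolding c using b by (simp add: o_inv_distrib bij_is_inj inv_f_f)
      moreover have "inv (cin (?e (\<pi> u))) = \<sigma> u \<circ> inv (cin (?d u))"
        unfolding c using b by (simp add: o_inv_distrib bij_imp_bij_inv inv_inv_eq)
      then have "ivals ?e ?h (\<pi> u) = ivals ?d g u"
        by (simp add: ivals_def g_def fun_eq_iff)
      ultimately show ?thesis using Vert c by simp
    qed simp
    finally show "g (wire ?G p) = src_val ?d g p" .
  qed
  have "outs X = outs Y"
    using X.outs_eq[OF g] io by (simp add: outs_def g_def)
  moreover have "epss X = epss Y"
  proof -
    have 1: "g (Vert u 0) = ?h (Vert (\<pi> u) 0)" if u: "u < g_size ?G" "ccell (?d u) = Eps" for u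
    proof -
      have "\<sigma> u permutes {..<1}" using v[OF u(1)] X.dec_simps(1)[OF u(1)] u(2) by simp
      then have "\<sigma> u 0 = 0" by (rule permutes_one)
      then show ?thesis by (simp add: g_def)
    qed
    have 2: "ccell (?e (\<pi> u)) = ccell (?d u)" "\<pi> u < g_size ?H" if "u < g_size ?G" for u
      using v[OF that] bij_betw_mem[OF \<pi>, of u] that by simp_all
    have "eps_set g X = eps_set ?h Y"
    proof (intro set_eqI iffI)
      fix t assume "t \<in> eps_set g X"
      then obtain u where "u < g_size ?G" "ccell (?d u) = Eps" "t = g (Vert u 0)"
        by (auto simp: eps_set_def)
      then show "t \<in> eps_set ?h Y"
        unfolding eps_set_def mem_Collect_eq using 1 2 by (intro exI[of _ "\<pi> u"]) simp
    next
      fix t assume "t \<in> eps_set ?h Y"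
      then obtain w where w: "w < g_size ?H" "ccell (?e w) = Eps" "t = ?h (Vert w 0)"
        by (auto simp: eps_set_def)
      obtain u where "u < g_size ?G" "w = \<pi> u" using bij_betw_ex[OF \<pi>, of w] w(1) by auto
      then show "t \<in> eps_set g X"
        unfolding eps_set_def mem_Collect_eq using 1 2 w by (intro exI[of _ u]) simp
    qed
    then show ?thesis by (simp only: X.epss_eq[OF g] epss_def[of Y])
  qed
  ultimately show ?thesis using Y io by (simp add: same_terms_def)
qed

lemma dgraph_class_eq: "sdg X \<Longrightarrow> dgraph_class \<B> X = {Y. sdg Y \<and> same_terms X Y}"
  unfolding dgraph_class_def using iso_if_same_terms iso_imp_same_terms by blast

lemma dgraph_class_eq_iff:
  "\<lbrakk>sdg X; sdg Y\<rbrakk> \<Longrightarrow> dgraph_class \<B> X = dgraph_class \<B> Y \<longleftrightarrow> same_terms X Y"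
  unfolding dgraph_class_eq set_eq_iff mem_Collect_eq
  by (meson same_terms_refl same_terms_sym same_terms_trans)

section \<open>Terms of composite graphs\<close>

text \<open>Edges between the blocks lead only from the lower to the upper one, so a cycle would
  have to stay inside a single block.\<close>

lemma acyclic_blocks:
  fixes k :: nat
  assumes E1: "acyclic E1" and E2: "acyclic E2"
    and E: "\<And>v w. (v, w) \<in> E \<Longrightarrow> (v < k \<and> w < k \<and> (v, w) \<in> E1) \<or>
       (k \<le> v \<and> k \<le> w \<and> (v - k, w - k) \<in> E2) \<or> (v < k \<and> k \<le> w)"
  shows "acyclic E"
proof (rule acyclicI, rule allI)
  fix x
  have "(x < k \<and> y < k \<and> (x, y) \<in> E1\<^sup>+) \<or>
       (k \<le> x \<and> k \<le> y \<and> (x - k, y - k) \<in> E2\<^sup>+) \<or> (x < k \<and> k \<le> y)" if "(x, y) \<in> E\<^sup>+" for y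
    using that
  proof (induction rule: trancl_induct)
    case (base y)
    then show ?case using E[of x y] by auto
  next
    case (step y z)
    show ?case using E[OF step.hyps(2)] step.IH by (auto intro: trancl_into_trancl)
  qed
  from this[of x] show "(x, x) \<notin> E\<^sup>+" using E1 E2 by (auto simp: acyclic_def)
qed

lemma shift_inj: "shift k b p = shift k b q \<longleftrightarrow> p = q"
  by (cases p; cases q) auto

lemma src_val_append1:
  assumes "v < k" "\<And>i. g (Vert v i) = g1 (Vert v i)"
  shows "src_val (append_fun k d e) g (Vert v j) = src_val d g1 (Vert v j)"
proof -
  have "ivals (append_fun k d e) g v = ivals d g1 v"
    using assms by (simp add: ivals_def append_fun_def fun_eq_iff)
  then show ?thesis using assms(1) by (simp add: append_fun_def)
qed

lemma src_val_append2:
  assumes "\<And>i. g (Vert (k + v) i) = bind \<rho> (g2 (Vert v i))"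
  shows "src_val (append_fun k d e) g (Vert (k + v) j) = bind \<rho> (src_val e g2 (Vert v j))"
proof -
  have "ivals (append_fun k d e) g (k + v) = (\<lambda>i. bind \<rho> (ivals e g2 v i))"
    using assms by (simp add: ivals_def append_fun_def fun_eq_iff)
  then show ?thesis by (simp add: append_fun_def bind_cell_val)
qed

lemma eps_set_append:
  assumes "g_size (fst Z) = g_size (fst X) + g_size (fst Y)"
    and "snd Z = append_fun (g_size (fst X)) (snd X) (snd Y)"
    and 1: "\<And>v i. v < g_size (fst X) \<Longrightarrow> g (Vert v i) = g1 (Vert v i)"
    and 2: "\<And>v i. g (Vert (g_size (fst X) + v) i) = b (g2 (Vert v i))"
  shows "eps_set g Z = eps_set g1 X \<union> b ` eps_set g2 Y"
proof (intro set_eqI iffI)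
  let ?k = "g_size (fst X)"
  fix t
  assume "t \<in> eps_set g Z"
  then obtain v where v: "v < ?k + g_size (fst Y)" "ccell (snd Z v) = Eps" "t = g (Vert v 0)"
    using assms(1) by (auto simp: eps_set_def)
  show "t \<in> eps_set g1 X \<union> b ` eps_set g2 Y"
  proof (cases "v < ?k")
    case True
    then show ?thesis using v assms(2) 1 by (auto simp: eps_set_def append_fun_def)
  next
    case False
    then obtain u where "v = ?k + u" using le_Suc_ex not_less by blast
    then show ?thesis using v assms(2) 2 by (auto simp: eps_set_def append_fun_def)
  qed
next
  let ?k = "g_size (fst X)"
  fix t
  assume "t \<in> eps_set g1 X \<union> b ` eps_set g2 Y"
  then consider v where "v < ?k" "ccell (snd X v) = Eps" "t = g1 (Vert v 0)"
    | v where "v < g_size (fst Y)" "ccell (snd Y v) = Eps" "t = b (g2 (Vert v 0))"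
    by (auto simp: eps_set_def)
  then show "t \<in> eps_set g Z"
  proof cases
    case (1 v)
    then show ?thesis
      unfolding eps_set_def mem_Collect_eq using assms(1,2) assms(3)[of v]
      by (intro exI[of _ v]) (simp add: append_fun_def)
  next
    case (2 v)
    then show ?thesis
      unfolding eps_set_def mem_Collect_eq using assms(1,2) assms(4)[of v]
      by (intro exI[of _ "?k + v"]) (simp add: append_fun_def)
  qed
qed

lemma append_dec:
  assumes "\<And>v. v < k \<Longrightarrow> d v \<in> cell_points C (a v) (b v)" "\<And>v. v < l \<Longrightarrow> e v \<in> cell_points C (a' v) (b' v)"
    and "v < k + l"
  shows "append_fun k d e v \<in> cell_points C (append_fun k a a' v) (append_fun k b b' v)"
  using assms by (auto simp: append_fun_def)

lemma Vert_ge_cases: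
  fixes v k :: nat
  obtains "v < k" | u where "v = k + u"
  using le_Suc_ex[of k v] by (cases "v < k") auto

subsection \<open>Vertical composition\<close>

lemma graph_ver_simps [simp]:
  "g_in (graph_ver H G) = g_in G" "g_out (graph_ver H G) = g_out H"
  "g_size (graph_ver H G) = g_size G + g_size H"
  "v_in (graph_ver H G) = append_fun (g_size G) (v_in G) (v_in H)"
  "v_out (graph_ver H G) = append_fun (g_size G) (v_out G) (v_out H)"
  by (simp_all add: graph_ver_def Let_def)

locale two_sdg =
  fixes X Y :: sgraph and G H d e
  assumes X: "sdg X" and Y: "sdg Y"
    and G_def: "G = fst X" and H_def: "H = fst Y" and d_def: "d = snd X" and e_def: "e = snd Y"
begin

sublocale X: sdgraph X G d using X G_def d_def by unfold_locales
sublocale Y: sdgraph Y H e using Y H_def e_def by unfold_locales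

end

locale ver_sdg = two_sdg +
  assumes join: "g_out G = g_in H"
begin

definition "Z = dgraph_ver Y X"

lemma Z: "fst Z = graph_ver H G" "snd Z = append_fun (g_size G) d e"
  by (simp_all add: Z_def dgraph_ver_def G_def H_def d_def e_def)

text \<open>Injectivity, acyclicity and the labelling of a vertical composite are checked along
  these kinds of edges: those ending inside the lower graph, those crossing the joint, and those
  starting in the upper graph.\<close>

lemma source_cases:
  assumes "p \<in> sources (graph_ver H G)"
  obtains (vert) v i where "p \<in> sources G" "wire G p = Vert v i" "wire (graph_ver H G) p = Vert v i"
      "Vert v i \<in> targets G"
  | (ext) j where "p \<in> sources G" "wire G p = Ext j" "Ext j \<in> sources H"
      "wire (graph_ver H G) p = shift (g_size G) 0 (wire H (Ext j))"
  | (upper) v j where "Vert v j \<in> sources H" "p = Vert (g_size G + v) j"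
      "wire (graph_ver H G) p = shift (g_size G) 0 (wire H (Vert v j))"
proof (cases "p \<in> sources G")
  case True
  have t: "wire G p \<in> targets G" using bij_betw_mem[OF X.bij True] .
  have w: "wire (graph_ver H G) p = (case wire G p of Ext j \<Rightarrow> shift (g_size G) 0 (wire H (Ext j)) | Vert v i \<Rightarrow> Vert v i)"
    using True by (cases p) (auto simp: graph_ver_def Let_def)
  show ?thesis
  proof (cases "wire G p")
    case (Ext j)
    then show ?thesis using ext[of j] w t True join by simp
  next
    case (Vert v i)
    then show ?thesis using vert[of v i] w t True by simp
  qed
next
  case False
  then obtain v j where p: "p = Vert v j" using assms by (cases p) auto
  show ?thesis
  proof (cases v "g_size G" rule: Vert_ge_cases)
    case 1
    then show ?thesis using False assms p by (auto simp: append_fun_def)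
  next
    case (2 u)
    then show ?thesis using upper[of u j] assms p by (auto simp: append_fun_def graph_ver_def Let_def)
  qed
qed

lemma shift_target: "q \<in> targets H \<Longrightarrow> shift (g_size G) 0 q \<in> targets (graph_ver H G)"
  by (cases q) (auto simp: append_fun_def)

lemma bij_ver: "bij_betw (wire (graph_ver H G)) (sources (graph_ver H G)) (targets (graph_ver H G))"
proof (rule bij_betw_imageI)
  let ?V = "graph_ver H G" and ?s = "shift (g_size G) 0"
  have ne: "Vert v i \<noteq> ?s q" if "Vert v i \<in> targets G" for v i q
    using that by (cases q) auto
  show "inj_on (wire ?V) (sources ?V)"
  proof (rule inj_onI)
    fix p p' assume pp: "p \<in> sources ?V" "p' \<in> sources ?V" "wire ?V p = wire ?V p'"
    have GI: "\<And>p p'. \<lbrakk>p \<in> sources G; p' \<in> sources G; wire G p = wire G p'\<rbrakk> \<Longrightarrow> p = p'"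
      and HI: "\<And>p p'. \<lbrakk>p \<in> sources H; p' \<in> sources H; wire H p = wire H p'\<rbrakk> \<Longrightarrow> p = p'"
      using X.bij Y.bij by (auto simp: bij_betw_def inj_on_def)
    show "p = p'"
      using pp(1)
    proof (cases rule: source_cases)
      case (vert v i)
      note 1 = this
      show ?thesis using pp(2)
      proof (cases rule: source_cases)
        case (vert v' i')
        then show ?thesis using 1 pp(3) GI by simp
      next
        case (ext j')
        then show ?thesis using 1 pp(3) ne by metis
      next
        case (upper v' j')
        then show ?thesis using 1 pp(3) ne by metis
      qed
    next
      case (ext j)
      note 1 = this
      show ?thesis using pp(2)
      proof (cases rule: source_cases)
        case (vert v' i')
        then show ?thesis using 1 pp(3) ne by metis
      next
        case (ext j')
        then have "Ext j = Ext j'" using HI 1 pp(3) by (metis shift_inj)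
        then show ?thesis using GI 1 ext by simp
      next
        case (upper v' j')
        then have "Ext j = Vert v' j'" using HI 1 pp(3) by (metis shift_inj)
        then show ?thesis by simp
      qed
    next
      case (upper v j)
      note 1 = this
      show ?thesis using pp(2)
      proof (cases rule: source_cases)
        case (vert v' i')
        then show ?thesis using 1 pp(3) ne by metis
      next
        case (ext j')
        then have "Vert v j = Ext j'" using HI 1 pp(3) by (metis shift_inj)
        then show ?thesis by simp
      next
        case (upper v' j')
        then have "Vert v j = Vert v' j'" using HI 1 pp(3) by (metis shift_inj)
        then show ?thesis using 1 upper by simp
      qed
    qed
  qed
  show "wire ?V ` sources ?V = targets ?V"
  proof (intro set_eqI iffI)
    fix q assume "q \<in> wire ?V ` sources ?V"
    then obtain p where p: "p \<in> sources ?V" "q = wire ?V p" by blast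
    from p(1) show "q \<in> targets ?V"
    proof (cases rule: source_cases)
      case (vert v i)
      then show ?thesis using p by (auto simp: append_fun_def)
    next
      case (ext j)
      then show ?thesis using p shift_target bij_betw_mem[OF Y.bij] by simp
    next
      case (upper v j)
      then show ?thesis using p shift_target bij_betw_mem[OF Y.bij] by simp
    qed
  next
    fix q assume q: "q \<in> targets ?V"
    have sub: "sources G \<subseteq> sources ?V"
      by (auto simp: sources_def append_fun_def)
    have lower: "q' \<in> wire ?V ` sources ?V" if q': "q' \<in> targets G" "q' = Vert v i" for q' v i
    proof -
      obtain p where p: "p \<in> sources G" "q' = wire G p" using bij_betw_ex[OF X.bij q'(1)] by blast
      then have "wire G p = Vert v i" using q'(2) by simp
      then have "wire ?V p = q'" using q'(2) p(1) by (cases p) (auto simp: graph_ver_def Let_def)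
      then show ?thesis using p(1) sub by blast
    qed
    have up: "?s q' \<in> wire ?V ` sources ?V" if q': "q' \<in> targets H" for q'
    proof -
      obtain p where p: "p \<in> sources H" "q' = wire H p" using bij_betw_ex[OF Y.bij q'] by blast
      show ?thesis
      proof (cases p)
        case (Ext j)
        then obtain r where r: "r \<in> sources G" "wire G r = Ext j"
          using bij_betw_ex[OF X.bij, of "Ext j"] p join by auto
        then have "wire ?V r = ?s q'" using p Ext by (cases r) (auto simp: graph_ver_def Let_def)
        then show ?thesis using r(1) sub by (metis image_eqI subsetD)
      next
        case (Vert v j)
        then have "wire ?V (Vert (g_size G + v) j) = ?s q'" using p by (simp add: graph_ver_def Let_def)
        moreover have "Vert (g_size G + v) j \<in> sources ?V" using p Vert by (simp add: append_fun_def)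
        ultimately show ?thesis by (metis image_eqI)
      qed
    qed
    show "q \<in> wire ?V ` sources ?V"
    proof (cases q)
      case (Ext j)
      then show ?thesis using up[of "Ext j"] q by simp
    next
      case (Vert v i)
      show ?thesis
      proof (cases v "g_size G" rule: Vert_ge_cases)
        case 1
        then show ?thesis using lower[of q v i] q Vert by (simp add: append_fun_def)
      next
        case (2 u)
        then show ?thesis using up[of "Vert u i"] q Vert by (simp add: append_fun_def)
      qed
    qed
  qed
qed

lemma acyclic_ver: "acyclic (edges (graph_ver H G))"
proof (rule acyclic_blocks[OF X.acyclic Y.acyclic, where k = "g_size G"])
  fix v w assume "(v, w) \<in> edges (graph_ver H G)"
  then obtain j i where ji: "Vert v j \<in> sources (graph_ver H G)" "wire (graph_ver H G) (Vert v j) = Vert w i"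
    by (auto simp: edges_def)
  have sh: "g_size G \<le> w \<and> q = Vert (w - g_size G) i" if "shift (g_size G) 0 q = Vert w i" for q
    using that by (cases q) auto
  from ji(1) show "(v < g_size G \<and> w < g_size G \<and> (v, w) \<in> edges G) \<or>
       (g_size G \<le> v \<and> g_size G \<le> w \<and> (v - g_size G, w - g_size G) \<in> edges H) \<or> (v < g_size G \<and> g_size G \<le> w)"
  proof (cases rule: source_cases)
    case (vert v' i')
    then show ?thesis using ji by (auto simp: edges_def)
  next
    case (ext j')
    then show ?thesis using ji sh by auto
  next
    case (upper v' j')
    then show ?thesis using ji sh[of "wire H (Vert v' j')"] by (auto simp: edges_def)
  qed
qed

lemma sdg_ver: "sdg Z"
proof -
  have "append_fun (g_size G) d e v \<in> cell_points S_cells (append_fun (g_size G) (v_in G) (v_in H) v)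
     (append_fun (g_size G) (v_out G) (v_out H) v)" if "v < g_size G + g_size H" for v
    by (rule append_dec[OF X.dec Y.dec that])
  moreover have "Z = (graph_ver H G, append_fun (g_size G) d e)" using Z by (simp add: prod_eq_iff)
  ultimately show ?thesis
    using bij_ver acyclic_ver by (simp add: sdg_iff)
qed

definition "\<rho> i = outs X ! i"

definition "g q = (case q of Ext j \<Rightarrow> bind \<rho> (lab Y (Ext j))
  | Vert v i \<Rightarrow> if v < g_size G then lab X (Vert v i) else bind \<rho> (lab Y (Vert (v - g_size G) i)))"

lemma g_shift: "g (shift (g_size G) 0 q) = bind \<rho> (lab Y q)"
  by (cases q) (auto simp: g_def)

lemma labelling_ver: "labelling Z g"
  unfolding labelling_def Z
proof
  fix p assume "p \<in> sources (graph_ver H G)"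
  then show "g (wire (graph_ver H G) p) = src_val (append_fun (g_size G) d e) g p"
  proof (cases rule: source_cases)
    case (upper v j)
    have "g (wire (graph_ver H G) p) = bind \<rho> (src_val e (lab Y) (Vert v j))"
      using upper Y.labellingD[OF Y.labelling_lab upper(1)] by (simp only: g_shift)
    also have "\<dots> = src_val (append_fun (g_size G) d e) g (Vert (g_size G + v) j)"
      by (rule src_val_append2[symmetric]) (simp add: g_def)
    finally show ?thesis using upper by simp
  next
    case (vert v i)
    have "g (Vert v i) = lab X (wire G p)" using vert by (simp add: g_def)
    also have "\<dots> = src_val d (lab X) p" by (rule X.labellingD[OF X.labelling_lab vert(1)])
    also have "\<dots> = src_val (append_fun (g_size G) d e) g p"
    proof (cases p)
      case (Vert u k)
      show ?thesis unfolding Vert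
        by (rule src_val_append1[symmetric]) (use vert(1) Vert in \<open>auto simp: g_def\<close>)
    qed simp
    finally show ?thesis using vert by simp
  next
    case (ext j)
    have "g (wire (graph_ver H G) p) = bind \<rho> (src_val e (lab Y) (Ext j))"
      using ext Y.labellingD[OF Y.labelling_lab ext(3)] by (simp only: g_shift)
    also have "\<dots> = lab X (wire G p)"
      using ext join by (simp add: \<rho>_def outs_def G_def)
    also have "\<dots> = src_val d (lab X) p" by (rule X.labellingD[OF X.labelling_lab ext(1)])
    also have "\<dots> = src_val (append_fun (g_size G) d e) g p"
    proof (cases p)
      case (Vert u k)
      show ?thesis unfolding Vert
        by (rule src_val_append1[symmetric]) (use ext(1) Vert in \<open>auto simp: g_def\<close>)
    qed simp
    finally show ?thesis .
  qed
qed

lemma terms_ver: "outs Z = map (bind \<rho>) (outs Y)" "epss Z = epss X \<union> bind \<rho> ` epss Y"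
proof -
  interpret Z: sdgraph Z "fst Z" "snd Z" using sdg_ver by (rule sdgraphI)
  show "outs Z = map (bind \<rho>) (outs Y)"
    using Z.outs_eq[OF labelling_ver] by (simp add: Z outs_def H_def g_def)
  show "epss Z = epss X \<union> bind \<rho> ` epss Y"
    unfolding Z.epss_eq[OF labelling_ver] unfolding epss_def
    by (rule eps_set_append) (auto simp: Z G_def[symmetric] H_def[symmetric] d_def[symmetric] e_def[symmetric] g_def)
qed

end

lemma dgraph_ver:
  assumes "X \<in> dgraphs \<B> n m" "Y \<in> dgraphs \<B> m l"
  shows "dgraph_ver Y X \<in> dgraphs \<B> n l"
    "outs (dgraph_ver Y X) = map (bind (\<lambda>i. outs X ! i)) (outs Y)"
    "epss (dgraph_ver Y X) = epss X \<union> bind (\<lambda>i. outs X ! i) ` epss Y"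
proof -
  interpret ver_sdg X Y "fst X" "fst Y" "snd X" "snd Y"
    using assms by unfold_locales (auto simp: dgraphs_iff)
  have r: "\<rho> = (\<lambda>i. outs X ! i)" by (simp add: fun_eq_iff \<rho>_def)
  show "dgraph_ver Y X \<in> dgraphs \<B> n l"
    using sdg_ver assms unfolding dgraphs_iff Z_def by (simp add: dgraph_ver_def)
  show "outs (dgraph_ver Y X) = map (bind (\<lambda>i. outs X ! i)) (outs Y)"
    "epss (dgraph_ver Y X) = epss X \<union> bind (\<lambda>i. outs X ! i) ` epss Y"
    using terms_ver unfolding Z_def r by simp_all
qed

subsection \<open>Horizontal composition\<close>

lemma graph_hor_simps [simp]:
  "g_in (graph_hor G H) = g_in G + g_in H" "g_out (graph_hor G H) = g_out G + g_out H"
  "g_size (graph_hor G H) = g_size G + g_size H"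
  "v_in (graph_hor G H) = append_fun (g_size G) (v_in G) (v_in H)"
  "v_out (graph_hor G H) = append_fun (g_size G) (v_out G) (v_out H)"
  by (simp_all add: graph_hor_def)

context two_sdg
begin

definition "Zh = dgraph_hor X Y"

lemma Zh: "fst Zh = graph_hor G H" "snd Zh = append_fun (g_size G) d e"
  by (simp_all add: Zh_def dgraph_hor_def G_def H_def d_def e_def)

lemma sources_hor: "sources (graph_hor G H) = sources G \<union> shift (g_size G) (g_in G) ` sources H"
proof (intro set_eqI iffI)
  fix p assume p: "p \<in> sources (graph_hor G H)"
  show "p \<in> sources G \<union> shift (g_size G) (g_in G) ` sources H"
  proof (cases p)
    case (Ext i)
    show ?thesis
    proof (cases i "g_in G" rule: Vert_ge_cases)
      case (2 u)
      then show ?thesis using p Ext by (intro UnI2 image_eqI[of _ _ "Ext u"]) auto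
    qed (use Ext in auto)
  next
    case (Vert v j)
    show ?thesis
    proof (cases v "g_size G" rule: Vert_ge_cases)
      case (2 u)
      then show ?thesis using p Vert by (intro UnI2 image_eqI[of _ _ "Vert u j"]) (auto simp: append_fun_def)
    qed (use p Vert in \<open>auto simp: append_fun_def\<close>)
  qed
qed (auto simp: sources_def append_fun_def)

lemma targets_hor: "targets (graph_hor G H) = targets G \<union> shift (g_size G) (g_out G) ` targets H"
proof (intro set_eqI iffI)
  fix p assume p: "p \<in> targets (graph_hor G H)"
  show "p \<in> targets G \<union> shift (g_size G) (g_out G) ` targets H"
  proof (cases p)
    case (Ext i)
    show ?thesis
    proof (cases i "g_out G" rule: Vert_ge_cases)
      case (2 u)
      then show ?thesis using p Ext by (intro UnI2 image_eqI[of _ _ "Ext u"]) auto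
    qed (use Ext in auto)
  next
    case (Vert v j)
    show ?thesis
    proof (cases v "g_size G" rule: Vert_ge_cases)
      case (2 u)
      then show ?thesis using p Vert by (intro UnI2 image_eqI[of _ _ "Vert u j"]) (auto simp: append_fun_def)
    qed (use p Vert in \<open>auto simp: append_fun_def\<close>)
  qed
qed (auto simp: targets_def append_fun_def)

lemma wire_hor1: "p \<in> sources G \<Longrightarrow> wire (graph_hor G H) p = wire G p"
  by (cases p) (auto simp: graph_hor_def)

lemma wire_hor2: "wire (graph_hor G H) (shift (g_size G) (g_in G) p) = shift (g_size G) (g_out G) (wire H p)"
  by (cases p) (auto simp: graph_hor_def)

lemma bij_hor: "bij_betw (wire (graph_hor G H)) (sources (graph_hor G H)) (targets (graph_hor G H))"
  unfolding sources_hor targets_hor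
proof (rule bij_betw_combine)
  show "bij_betw (wire (graph_hor G H)) (sources G) (targets G)"
    using X.bij by (rule iffD1[OF bij_betw_cong, rotated]) (simp add: wire_hor1)
  have s: "bij_betw (shift (g_size G) b) A (shift (g_size G) b ` A)" for b A
    by (rule bij_betw_imageI) (auto simp: inj_on_def shift_inj)
  have "bij_betw (shift (g_size G) (g_out G) \<circ> wire H) (sources H) (shift (g_size G) (g_out G) ` targets H)"
    using Y.bij s by (rule bij_betw_trans)
  then have "bij_betw (wire (graph_hor G H) \<circ> shift (g_size G) (g_in G)) (sources H) (shift (g_size G) (g_out G) ` targets H)"
    by (simp add: comp_def wire_hor2)
  then show "bij_betw (wire (graph_hor G H)) (shift (g_size G) (g_in G) ` sources H) (shift (g_size G) (g_out G) ` targets H)"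
    using bij_betw_comp_iff[OF s] by blast
  have "shift (g_size G) (g_out G) q \<notin> targets G" for q by (cases q) auto
  then show "targets G \<inter> shift (g_size G) (g_out G) ` targets H = {}" by auto
qed

lemma acyclic_hor: "acyclic (edges (graph_hor G H))"
proof (rule acyclic_blocks[OF X.acyclic Y.acyclic, where k = "g_size G"])
  fix v w assume "(v, w) \<in> edges (graph_hor G H)"
  then obtain j i where ji: "Vert v j \<in> sources (graph_hor G H)" "wire (graph_hor G H) (Vert v j) = Vert w i"
    by (auto simp: edges_def)
  have sh: "g_size G \<le> w \<and> q = Vert (w - g_size G) i" if "shift (g_size G) b q = Vert w i" for q b w i
    using that by (cases q) auto
  from ji(1) consider "Vert v j \<in> sources G"
    | p where "p \<in> sources H" "Vert v j = shift (g_size G) (g_in G) p"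
    unfolding sources_hor by blast
  then show "(v < g_size G \<and> w < g_size G \<and> (v, w) \<in> edges G) \<or>
       (g_size G \<le> v \<and> g_size G \<le> w \<and> (v - g_size G, w - g_size G) \<in> edges H) \<or> (v < g_size G \<and> g_size G \<le> w)"
  proof cases
    case 1
    then have "wire G (Vert v j) = Vert w i" using ji wire_hor1 by simp
    then show ?thesis using 1 bij_betw_mem[OF X.bij 1] by (auto simp: edges_def)
  next
    case (2 p)
    have p: "g_size G \<le> v" "p = Vert (v - g_size G) j" using sh[of _ p v j] 2(2) by (metis)+
    have "shift (g_size G) (g_out G) (wire H p) = Vert w i" using ji 2 wire_hor2 by simp
    then have "g_size G \<le> w" "wire H p = Vert (w - g_size G) i" using sh by blast+
    then show ?thesis using p 2(1) by (auto simp: edges_def)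
  qed
qed

lemma sdg_hor: "sdg Zh"
proof -
  have "append_fun (g_size G) d e v \<in> cell_points S_cells (append_fun (g_size G) (v_in G) (v_in H) v)
     (append_fun (g_size G) (v_out G) (v_out H) v)" if "v < g_size G + g_size H" for v
    by (rule append_dec[OF X.dec Y.dec that])
  moreover have "Zh = (graph_hor G H, append_fun (g_size G) d e)" using Zh by (simp add: prod_eq_iff)
  ultimately show ?thesis
    using bij_hor acyclic_hor by (simp add: sdg_iff)
qed

definition "\<rho>h i = (In (g_in G + i) :: real tm)"

definition "gh q = (case q of Ext j \<Rightarrow> if j < g_out G then lab X (Ext j) else bind \<rho>h (lab Y (Ext (j - g_out G)))
  | Vert v i \<Rightarrow> if v < g_size G then lab X (Vert v i) else bind \<rho>h (lab Y (Vert (v - g_size G) i)))"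

lemma gh1: "q \<in> targets G \<Longrightarrow> gh q = lab X q"
  by (cases q) (auto simp: gh_def)

lemma gh2: "gh (shift (g_size G) (g_out G) q) = bind \<rho>h (lab Y q)"
  by (cases q) (auto simp: gh_def)

lemma labelling_hor: "labelling Zh gh"
  unfolding labelling_def Zh
proof
  fix p assume "p \<in> sources (graph_hor G H)"
  then consider "p \<in> sources G" | r where "r \<in> sources H" "p = shift (g_size G) (g_in G) r"
    unfolding sources_hor by blast
  then show "gh (wire (graph_hor G H) p) = src_val (append_fun (g_size G) d e) gh p"
  proof cases
    case 1
    have "gh (wire (graph_hor G H) p) = lab X (wire G p)"
      using 1 gh1 bij_betw_mem[OF X.bij 1] by (simp add: wire_hor1)
    also have "\<dots> = src_val d (lab X) p" by (rule X.labellingD[OF X.labelling_lab 1])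
    also have "\<dots> = src_val (append_fun (g_size G) d e) gh p"
    proof (cases p)
      case (Vert u k)
      show ?thesis unfolding Vert
        by (rule src_val_append1[symmetric]) (use 1 Vert in \<open>auto simp: gh_def\<close>)
    qed simp
    finally show ?thesis .
  next
    case (2 r)
    have "gh (wire (graph_hor G H) p) = bind \<rho>h (src_val e (lab Y) r)"
      unfolding 2(2) wire_hor2 gh2 using Y.labellingD[OF Y.labelling_lab 2(1)] by simp
    also have "\<dots> = src_val (append_fun (g_size G) d e) gh p"
    proof (cases r)
      case (Ext i)
      then show ?thesis using 2 by (simp add: \<rho>h_def)
    next
      case (Vert v j)
      have "src_val (append_fun (g_size G) d e) gh (Vert (g_size G + v) j) = bind \<rho>h (src_val e (lab Y) (Vert v j))"
        by (rule src_val_append2) (simp add: gh_def)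
      then show ?thesis using 2 Vert by simp
    qed
    finally show ?thesis .
  qed
qed

lemma terms_hor: "outs Zh = outs X @ map (bind \<rho>h) (outs Y)" "epss Zh = epss X \<union> bind \<rho>h ` epss Y"
proof -
  interpret Z: sdgraph Zh "fst Zh" "snd Zh" using sdg_hor by (rule sdgraphI)
  show "outs Zh = outs X @ map (bind \<rho>h) (outs Y)"
    unfolding Z.outs_eq[OF labelling_hor]
    by (rule nth_equalityI) (auto simp: Zh outs_def G_def[symmetric] H_def[symmetric] gh_def nth_append)
  show "epss Zh = epss X \<union> bind \<rho>h ` epss Y"
    unfolding Z.epss_eq[OF labelling_hor] unfolding epss_def
    by (rule eps_set_append) (auto simp: Zh G_def[symmetric] H_def[symmetric] d_def[symmetric] e_def[symmetric] gh_def)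
qed

end

lemma dgraph_hor:
  assumes "X \<in> dgraphs \<B> n m" "Y \<in> dgraphs \<B> n' m'"
  shows "dgraph_hor X Y \<in> dgraphs \<B> (n + n') (m + m')"
    "outs (dgraph_hor X Y) = outs X @ map (bind (\<lambda>i. In (n + i))) (outs Y)"
    "epss (dgraph_hor X Y) = epss X \<union> bind (\<lambda>i. In (n + i)) ` epss Y"
proof -
  interpret two_sdg X Y "fst X" "fst Y" "snd X" "snd Y"
    using assms by unfold_locales (auto simp: dgraphs_iff)
  have r: "\<rho>h = (\<lambda>i. In (n + i))" using assms by (simp add: fun_eq_iff \<rho>h_def dgraphs_iff)
  show "dgraph_hor X Y \<in> dgraphs \<B> (n + n') (m + m')"
    using sdg_hor assms unfolding dgraphs_iff Zh_def by (simp add: dgraph_hor_def)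
  show "outs (dgraph_hor X Y) = outs X @ map (bind (\<lambda>i. In (n + i))) (outs Y)"
    "epss (dgraph_hor X Y) = epss X \<union> bind (\<lambda>i. In (n + i)) ` epss Y"
    using terms_hor unfolding Zh_def r by simp_all
qed

subsection \<open>Permutations and generators\<close>

lemma dgraph_perm:
  assumes \<sigma>: "\<sigma> permutes {..<n}"
  shows "perm_graph n \<sigma> \<in> dgraphs \<B> n n"
    "outs (perm_graph n \<sigma>) = map (\<lambda>j. In (inv \<sigma> j)) [0..<n]" "epss (perm_graph n \<sigma>) = {}"
proof -
  let ?P = "perm_graph n \<sigma> :: sgraph"
  have s: "sources (fst ?P) = Ext ` {..<n}" "targets (fst ?P) = Ext ` {..<n}"
    by (auto simp: sources_def targets_def perm_graph_def)
  have w: "wire (fst ?P) (Ext i) = Ext (\<sigma> i)" for i by (simp add: perm_graph_def)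
  have "wire (fst ?P) ` sources (fst ?P) = targets (fst ?P)"
  proof -
    have "wire (fst ?P) ` Ext ` {..<n} = Ext ` \<sigma> ` {..<n}" by (simp add: image_image w)
    then show ?thesis unfolding s permutes_image[OF \<sigma>] .
  qed
  moreover have "inj_on (wire (fst ?P)) (sources (fst ?P))"
    unfolding s by (rule inj_onI) (use permutes_inj[OF \<sigma>] in \<open>auto simp: w inj_eq\<close>)
  moreover have "edges (fst ?P) = {}" by (auto simp: edges_def s)
  ultimately have P: "sdg ?P"
    using sdg_iff[of "fst ?P" "snd ?P"] by (simp add: bij_betw_def acyclic_def) (simp add: perm_graph_def)
  then show "?P \<in> dgraphs \<B> n n" by (simp add: dgraphs_iff) (simp add: perm_graph_def)
  interpret sdgraph ?P "fst ?P" "snd ?P" using P by (rule sdgraphI)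
  have g: "labelling ?P (\<lambda>q. case q of Ext j \<Rightarrow> In (inv \<sigma> j) | Vert v i \<Rightarrow> undefined)"
    unfolding labelling_def s using permutes_inverses(2)[OF \<sigma>] by (auto simp: w)
  show "outs ?P = map (\<lambda>j. In (inv \<sigma> j)) [0..<n]"
    unfolding outs_eq[OF g] by (simp add: perm_graph_def)
  show "epss ?P = {}" unfolding epss_eq[OF g] by (simp add: eps_set_def perm_graph_def)
qed

definition gen :: "S_cell \<Rightarrow> (nat \<Rightarrow> real) \<Rightarrow> sgraph" where
  "gen c x = corolla (S_in c) (S_out c) (id, c, x, id)"

lemma dgraph_gen:
  assumes x: "x \<in> topspace (cube (S_dim c))"
  shows "gen c x \<in> dgraphs \<B> (S_in c) (S_out c)"
    "outs (gen c x) = map (\<lambda>j. cell_val c (x 0) j In) [0..<S_out c]"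
    "epss (gen c x) = (if c = Eps then {In 0} else {})"
proof -
  let ?P = "gen c x"
  have s: "sources (fst ?P) = Ext ` {..<S_in c} \<union> Vert 0 ` {..<S_out c}"
    "targets (fst ?P) = Vert 0 ` {..<S_in c} \<union> Ext ` {..<S_out c}"
    by (auto simp: sources_def targets_def gen_def corolla_def)
  have w: "wire (fst ?P) (Ext i) = Vert 0 i" "wire (fst ?P) (Vert v i) = Ext i" for i v
    by (simp_all add: gen_def corolla_def)
  have "wire (fst ?P) ` sources (fst ?P) = targets (fst ?P)"
    unfolding s by (auto simp: w image_Un image_image)
  moreover have "inj_on (wire (fst ?P)) (sources (fst ?P))"
    unfolding s by (auto simp: inj_on_def w)
  moreover have "edges (fst ?P) = {}" by (auto simp: edges_def w)
  moreover have "snd ?P v \<in> cell_points S_cells (v_in (fst ?P) v) (v_out (fst ?P) v)" for v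
    using x by (simp add: in_cell_points gen_def corolla_def permutes_id)
  ultimately have P: "sdg ?P"
    using sdg_iff[of "fst ?P" "snd ?P"] by (simp add: bij_betw_def acyclic_def)
  then show "?P \<in> dgraphs \<B> (S_in c) (S_out c)" by (simp add: dgraphs_iff) (simp add: gen_def corolla_def)
  interpret sdgraph ?P "fst ?P" "snd ?P" using P by (rule sdgraphI)
  have sn: "snd ?P v = (id, c, x, id)" for v by (simp add: gen_def corolla_def)
  define g where "g q = (case q of Ext j \<Rightarrow> cell_val c (x 0) j In | Vert v i \<Rightarrow> In i)" for q
  have iv: "ivals (snd ?P) g v = In" for v by (simp add: ivals_def sn g_def fun_eq_iff)
  have g: "labelling ?P g"
    unfolding labelling_def s by (auto simp: w iv sn g_def[of "Ext _"] g_def[of "Vert _ _"])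
  show "outs ?P = map (\<lambda>j. cell_val c (x 0) j In) [0..<S_out c]"
    unfolding outs_eq[OF g] by (simp add: g_def) (simp add: gen_def corolla_def)
  show "epss ?P = (if c = Eps then {In 0} else {})"
    unfolding epss_eq[OF g] by (auto simp: eps_set_def g_def sn) (auto simp: gen_def corolla_def)
qed

subsection \<open>Change of parameters\<close>

lemma cube_coord: "\<lbrakk>x \<in> topspace (cube k); i < k\<rbrakk> \<Longrightarrow> x i \<in> {0..1}"
  unfolding topspace_cube by (drule PiE_mem[of _ _ _ i]) auto

text \<open>Points of cubes are extensional functions, so the new point is rebuilt with
  \<open>pt1\<close> and is not a pointwise composite.\<close>

definition inst_pt :: "(real \<Rightarrow> real) \<Rightarrow> S_cell cell_point \<Rightarrow> S_cell cell_point" where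
  "inst_pt \<theta> p = (cout p, ccell p, (if S_dim (ccell p) = 1 then pt1 (\<theta> (cpt p 0)) else cpt p), cin p)"

definition inst :: "(real \<Rightarrow> real) \<Rightarrow> sgraph \<Rightarrow> sgraph" where
  "inst \<theta> X = (fst X, \<lambda>v. inst_pt \<theta> (snd X v))"

lemma pt1_in_cube: "pt1 s \<in> topspace (cube 1) \<longleftrightarrow> s \<in> {0..1}"
  by (auto simp: pt1_def topspace_cube)

lemma pt1_0 [simp]: "pt1 s 0 = s"
  by (simp add: pt1_def)

lemma pt0_in_cube: "pt0 \<in> topspace (cube 0)"
  by (simp add: pt0_def topspace_cube fun_eq_iff)

lemma map_tm_cell_val: "map_tm \<theta> (cell_val c s j t) = cell_val c (\<theta> s) j (\<lambda>k. map_tm \<theta> (t k))"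
  by (cases c) auto

lemma cell_val_dim0: "S_dim c \<noteq> 1 \<Longrightarrow> cell_val c s j t = cell_val c s' j t"
  by (cases c) auto

lemma inst:
  assumes X: "X \<in> dgraphs \<B> n m" and \<theta>: "\<And>s. s \<in> {0..1} \<Longrightarrow> \<theta> s \<in> {0..1}"
  shows "inst \<theta> X \<in> dgraphs \<B> n m" "outs (inst \<theta> X) = map (map_tm \<theta>) (outs X)"
    "epss (inst \<theta> X) = map_tm \<theta> ` epss X"
    "labelling (inst \<theta> X) (\<lambda>q. map_tm \<theta> (lab X q))"
proof -
  have sX: "sdg X" using X by (simp add: dgraphs_iff)
  interpret X: sdgraph X "fst X" "snd X" using sX by (rule sdgraphI)
  have "inst_pt \<theta> (snd X v) \<in> cell_points S_cells (v_in (fst X) v) (v_out (fst X) v)" if "v < g_size (fst X)" for v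
  proof -
    have "cpt (inst_pt \<theta> (snd X v)) \<in> topspace (cube (S_dim (ccell (snd X v))))"
    proof (cases "S_dim (ccell (snd X v)) = 1")
      case True
      then have "cpt (snd X v) 0 \<in> {0..1}"
        using cube_coord[OF X.dec_simps(3)[OF that]] by simp
      then show ?thesis using \<theta> True by (simp add: inst_pt_def pt1_in_cube del: One_nat_def atLeastAtMost_iff)
    next
      case False
      then show ?thesis using X.dec_simps(3)[OF that] by (simp add: inst_pt_def)
    qed
    then show ?thesis
      using X.dec[OF that] unfolding in_cell_points by (simp add: inst_pt_def)
  qed
  then have P: "sdg (inst \<theta> X)"
    using X.bij X.acyclic by (simp add: inst_def sdg_iff)
  then show "inst \<theta> X \<in> dgraphs \<B> n m" using X by (simp add: dgraphs_iff inst_def)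
  interpret Y: sdgraph "inst \<theta> X" "fst X" "snd (inst \<theta> X)"
    using P by unfold_locales (simp_all add: inst_def)
  let ?g = "\<lambda>q. map_tm \<theta> (lab X q)"
  have "src_val (snd (inst \<theta> X)) ?g p = map_tm \<theta> (src_val (snd X) (lab X) p)" for p
  proof (cases p)
    case (Vert v j)
    have "ivals (snd (inst \<theta> X)) ?g v = (\<lambda>k. map_tm \<theta> (ivals (snd X) (lab X) v k))"
      by (simp add: fun_eq_iff ivals_def inst_def inst_pt_def)
    then show ?thesis
      using Vert cell_val_dim0[of "ccell (snd X v)" "cpt (snd X v) 0" _ _ "\<theta> (cpt (snd X v) 0)"]
      by (auto simp: map_tm_cell_val) (auto simp: inst_def inst_pt_def)
  qed simp
  then show g: "labelling (inst \<theta> X) ?g"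
    using X.labellingD[OF X.labelling_lab] by (auto simp: labelling_def inst_def)
  show "outs (inst \<theta> X) = map (map_tm \<theta>) (outs X)"
    using Y.outs_eq[OF g] by (simp add: outs_def)
  show "epss (inst \<theta> X) = map_tm \<theta> ` epss X"
    using Y.epss_eq[OF g] by (auto simp: epss_def eps_set_def inst_def inst_pt_def)
qed

lemma inst_pt_append: "(\<lambda>v. inst_pt \<theta> (append_fun k d e v)) = append_fun k (\<lambda>v. inst_pt \<theta> (d v)) (\<lambda>v. inst_pt \<theta> (e v))"
  by (auto simp: append_fun_def)

lemma inst_comp:
  "inst \<theta> (dgraph_hor X Y) = dgraph_hor (inst \<theta> X) (inst \<theta> Y)"
  "inst \<theta> (dgraph_ver Y X) = dgraph_ver (inst \<theta> Y) (inst \<theta> X)"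
  by (simp_all add: inst_def dgraph_hor_def dgraph_ver_def inst_pt_append)

section \<open>Quotients of props\<close>

declare One_nat_def [simp del]

text \<open>The part of the prop structure that passes to every quotient by a generated congruence.
  It is enough to compute compositions of classes on representatives.\<close>

locale good_prop =
  fixes P :: "'a prop_data"
  assumes arity: "\<lbrakk>x \<in> pset P n m; x \<in> pset P n' m'\<rbrakk> \<Longrightarrow> n = n' \<and> m = m'"
    and hor_in: "\<lbrakk>x \<in> pset P n m; y \<in> pset P n' m'\<rbrakk> \<Longrightarrow> phor P x y \<in> pset P (n + n') (m + m')"
    and ver_in: "\<lbrakk>x \<in> pset P n m; y \<in> pset P m l\<rbrakk> \<Longrightarrow> pver P y x \<in> pset P n l"
begin

lemma cong_arity: "prop_cong P R x y \<Longrightarrow> \<exists>n m. x \<in> pset P n m \<and> y \<in> pset P n m"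
proof (induction rule: prop_cong.induct)
  case (ver x y x' y' n m l)
  obtain a b where 1: "x \<in> pset P a b" "y \<in> pset P a b" using ver by blast
  obtain c e where 2: "x' \<in> pset P c e" "y' \<in> pset P c e" using ver by blast
  have "a = n" "b = m" "c = m" "e = l" using arity 1 2 ver.hyps by blast+
  then show ?case using 1 2 ver_in by blast
next
  case (trans x y z)
  then show ?case using arity by metis
qed (use hor_in in blast)+

lemma cong_in: "\<lbrakk>prop_cong P R x y; x \<in> pset P n m\<rbrakk> \<Longrightarrow> y \<in> pset P n m"
  using cong_arity arity by metis

lemma quot_class_eq_iff: "x \<in> pset P n m \<Longrightarrow> quot_class P R x = quot_class P R y \<longleftrightarrow> prop_cong P R x y"
  unfolding quot_class_def set_eq_iff mem_Collect_eq
  by (meson prop_cong.refl prop_cong.sym prop_cong.trans)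

lemma pset_quot: "pset (prop_quot P R) n m = quot_class P R ` pset P n m"
  unfolding prop_quot_def by (simp, rule topspace_final_topology) simp

lemma phor_quot:
  assumes "x \<in> pset P n m" "y \<in> pset P n' m'"
  shows "phor (prop_quot P R) (quot_class P R x) (quot_class P R y) = quot_class P R (phor P x y)"
proof (intro set_eqI iffI)
  fix z assume "z \<in> phor (prop_quot P R) (quot_class P R x) (quot_class P R y)"
  then show "z \<in> quot_class P R (phor P x y)"
    by (auto simp: prop_quot_def quot_class_def intro: prop_cong.trans prop_cong.hor)
next
  fix z assume "z \<in> quot_class P R (phor P x y)"
  then show "z \<in> phor (prop_quot P R) (quot_class P R x) (quot_class P R y)"
    using prop_cong.refl[OF assms(1)] prop_cong.refl[OF assms(2)]
    by (auto simp: prop_quot_def quot_class_def)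
qed

lemma pver_quot:
  assumes "x \<in> pset P n m" "y \<in> pset P m l"
  shows "pver (prop_quot P R) (quot_class P R y) (quot_class P R x) = quot_class P R (pver P y x)"
proof (intro set_eqI iffI)
  fix z assume "z \<in> pver (prop_quot P R) (quot_class P R y) (quot_class P R x)"
  then obtain y' x' where c: "prop_cong P R y y'" "prop_cong P R x x'" "prop_cong P R (pver P y' x') z"
    by (auto simp: prop_quot_def quot_class_def)
  show "z \<in> quot_class P R (pver P y x)"
    unfolding quot_class_def mem_Collect_eq
    by (rule prop_cong.trans[OF prop_cong.ver[OF c(2,1) assms] c(3)])
next
  fix z assume "z \<in> quot_class P R (pver P y x)"
  then show "z \<in> pver (prop_quot P R) (quot_class P R y) (quot_class P R x)"
    using prop_cong.refl[OF assms(1)] prop_cong.refl[OF assms(2)]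
    by (auto simp: prop_quot_def quot_class_def)
qed

lemma good_prop_quot: "good_prop (prop_quot P R)"
proof
  fix X n m n' m' assume "X \<in> pset (prop_quot P R) n m" "X \<in> pset (prop_quot P R) n' m'"
  then obtain x y where "x \<in> pset P n m" "y \<in> pset P n' m'" "quot_class P R x = quot_class P R y"
    unfolding pset_quot by auto
  then show "n = n' \<and> m = m'" using quot_class_eq_iff cong_in arity by blast
next
  fix X Y n m n' m' assume "X \<in> pset (prop_quot P R) n m" "Y \<in> pset (prop_quot P R) n' m'"
  then show "phor (prop_quot P R) X Y \<in> pset (prop_quot P R) (n + n') (m + m')"
    unfolding pset_quot using phor_quot hor_in by blast
next
  fix X Y n m l assume "X \<in> pset (prop_quot P R) n m" "Y \<in> pset (prop_quot P R) m l"
  then show "pver (prop_quot P R) Y X \<in> pset (prop_quot P R) n l"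
    unfolding pset_quot using pver_quot ver_in by blast
qed

text \<open>An invariant that carries both compositions to operations \<open>H\<close> and
  \<open>V\<close> on its values has a kernel closed under the congruence rules, so only the
  generating pairs need a check. It will be used with \<open>hcomp\<close> and
  \<open>vcomp\<close>.\<close>

lemma cong_invariant:
  assumes "prop_cong P R x y"
    and base: "\<And>x y n m. \<lbrakk>(x, y) \<in> R; x \<in> pset P n m; y \<in> pset P n m\<rbrakk> \<Longrightarrow> f x = f y"
    and hor: "\<And>x y n m n' m'. \<lbrakk>x \<in> pset P n m; y \<in> pset P n' m'\<rbrakk> \<Longrightarrow> f (phor P x y) = H (f x) (f y)"
    and ver: "\<And>x y n m l. \<lbrakk>x \<in> pset P n m; y \<in> pset P m l\<rbrakk> \<Longrightarrow> f (pver P y x) = V (f y) (f x)"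
  shows "f x = f y"
  using assms(1)
proof (induction rule: prop_cong.induct)
  case (hor x y x' y')
  then show ?case using cong_arity assms(3) by metis
next
  case (ver x y x' y' n m l)
  have "y \<in> pset P n m" "y' \<in> pset P m l" using ver cong_in by blast+
  then show ?case using ver assms(4) by metis
qed (use base in auto)

end

section \<open>Normal forms in the prop S\<close>

text \<open>The attaching maps read as rewriting rules: \<mu>_0 = id \<odot> \<epsilon> passes on
  its first input, \<mu>_1 = \<epsilon> \<odot> id its second, h_0 is the identity, and h_1 =
  (\<epsilon> \<odot> id) \<circ> \<Delta> keeps the right output of a \<Delta>.\<close>

fun norm :: "real tm \<Rightarrow> real tm" where
  "norm (In i) = In i"
| "norm (Lt t) = Lt (norm t)"
| "norm (Rt t) = Rt (norm t)"
| "norm (Mt s t u) = (if s = 0 then norm t else if s = 1 then norm u else Mt s (norm t) (norm u))"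
| "norm (Ht s t) = (if s = 0 then norm t else if s = 1 then Rt (norm t) else Ht s (norm t))"

lemma norm_bind: "norm (bind \<rho> t) = bind (\<lambda>i. norm (\<rho> i)) (norm t)"
  by (induction t) auto

lemma bind_cong: "(\<And>i. In i \<in> sub t \<Longrightarrow> \<rho> i = \<rho>' i) \<Longrightarrow> bind \<rho> t = bind \<rho>' t"
  by (induction t) auto

lemma In_norm: "In i \<in> sub (norm t) \<Longrightarrow> In i \<in> sub t"
  by (induction t) (auto split: if_splits)

lemma (in sdgraph) In_label:
  assumes "t \<in> set (outs X) \<union> epss X" "In i \<in> sub t"
  shows "i < g_in G"
proof -
  have "In i \<in> lab X ` targets G" using labels[OF labelling_lab] assms by blast
  then obtain p where p: "p \<in> sources G" "In i = lab X (wire G p)"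
    using bij_betw_ex[OF bij] by blast
  then have e: "In i = src_val d (lab X) p" using labellingD[OF labelling_lab p(1)] by simp
  show ?thesis
  proof (cases p)
    case (Ext k)
    then show ?thesis using e p by simp
  next
    case (Vert v j)
    have "ccell (d v) \<noteq> Eps" using source_not_Eps p(1) Vert by blast
    then show ?thesis using e cell_val_ne_In Vert by (metis src_val.simps(2))
  qed
qed

lemma In_outs: "\<lbrakk>X \<in> dgraphs \<B> n m; t \<in> set (outs X) \<union> epss X; In i \<in> sub t\<rbrakk> \<Longrightarrow> i < n"
  using sdgraph.In_label[OF sdgraphI, of X t i] by (simp add: dgraphs_iff)

text \<open>Leaving out \<open>epss\<close> is what builds in the relations. The number of inputs is
  kept because the output terms do not determine it.\<close>

definition ev :: "sgraph \<Rightarrow> nat \<times> real tm list" where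
  "ev X = (g_in (fst X), map norm (outs X))"

fun hcomp :: "nat \<times> real tm list \<Rightarrow> nat \<times> real tm list \<Rightarrow> nat \<times> real tm list" where
  "hcomp (n, a) (n', a') = (n + n', a @ map (bind (\<lambda>i. In (n + i))) a')"

fun vcomp :: "nat \<times> real tm list \<Rightarrow> nat \<times> real tm list \<Rightarrow> nat \<times> real tm list" where
  "vcomp (n', a') (n, a) = (n, map (bind (\<lambda>i. a ! i)) a')"

lemma ev_hor:
  assumes "X \<in> dgraphs \<B> n m" "Y \<in> dgraphs \<B> n' m'"
  shows "ev (dgraph_hor X Y) = hcomp (ev X) (ev Y)"
  using dgraph_hor[OF assms] assms by (simp add: ev_def dgraphs_iff norm_bind)

lemma ev_ver:
  assumes "X \<in> dgraphs \<B> n m" "Y \<in> dgraphs \<B> m l"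
  shows "ev (dgraph_ver Y X) = vcomp (ev Y) (ev X)"
proof -
  \<comment> \<open>Mapping and indexing commute only within the length of the list, which is
    guaranteed by the inputs that occur in \<open>t\<close>.\<close>
  have "bind (\<lambda>i. norm (outs X ! i)) (norm t) = bind (\<lambda>i. map norm (outs X) ! i) (norm t)"
    if "t \<in> set (outs Y)" for t
  proof (rule bind_cong)
    fix i assume "In i \<in> sub (norm t)"
    then have "i < length (outs X)" using In_outs[OF assms(2), of t i] In_norm that assms(1) by (simp add: dgraphs_iff)
    then show "norm (outs X ! i) = map norm (outs X) ! i" by simp
  qed
  then show ?thesis
    using dgraph_ver[OF assms] assms by (simp add: ev_def dgraphs_iff norm_bind)
qed

section \<open>The free prop and its two quotients computed on graphs\<close>

abbreviation "\<F> \<equiv> free_on_cells S_cells"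

definition "attach_rel = {(cell_elt S_cells c x, S_att c x) |c x. c \<in> gens S_cells \<and> x \<in> cube_boundary (gdim S_cells c)}"

lemma S_attached_eq: "S_attached = prop_quot \<F> attach_rel"
  by (simp add: S_attached_def attached_prop_def attach_rel_def)

lemma S_elt_eq: "S_elt c x = quot_class \<F> attach_rel (dgraph_class \<B> (gen c x))"
  by (simp add: S_elt_def attached_elt_def attach_rel_def cell_elt_def gen_def S_cells_def)

lemma cell_elt_eq: "cell_elt S_cells c x = dgraph_class \<B> (gen c x)"
  by (simp add: cell_elt_def gen_def S_cells_def)

lemma pset_free: "pset \<F> n m = dgraph_class \<B> ` dgraphs \<B> n m"
proof -
  have "topspace (final_topology (dgraph_class \<B> ` dgraphs \<B> n m)
      {G. valid_graph G \<and> g_in G = n \<and> g_out G = m}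
      (\<lambda>G. kification (product_topology (\<lambda>v. cw_top (bsp \<B> (v_in G v) (v_out G v))) {..<g_size G}))
      (\<lambda>G d. dgraph_class \<B> (G, d))) = dgraph_class \<B> ` dgraphs \<B> n m"
  proof (rule topspace_final_topology, rule imageI)
    fix G d
    assume "G \<in> {G. valid_graph G \<and> g_in G = n \<and> g_out G = m}"
      and d: "d \<in> topspace (kification (product_topology (\<lambda>v. cw_top (bsp \<B> (v_in G v) (v_out G v))) {..<g_size G}))"
    moreover from d have "d v \<in> topspace (cw_top (bsp \<B> (v_in G v) (v_out G v)))" if "v < g_size G" for v
      using that by (auto dest!: PiE_mem)
    ultimately show "(G, d) \<in> dgraphs \<B> n m" by (simp add: dgraphs_def)
  qed
  then show ?thesis by (simp add: free_on_cells_def free_prop_def)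
qed

lemma class_in_dgraphs: "\<lbrakk>X \<in> dgraphs \<B> n m; Y \<in> dgraph_class \<B> X\<rbrakk> \<Longrightarrow> Y \<in> dgraphs \<B> n m"
  unfolding dgraphs_iff using same_terms_out[of X Y] by (auto simp: dgraph_class_eq same_terms_def)

lemma dgraph_class_self: "X \<in> dgraphs \<B> n m \<Longrightarrow> X \<in> dgraph_class \<B> X"
  by (auto simp: dgraphs_iff dgraph_class_eq same_terms_refl)

lemma same_terms_hor:
  assumes "X \<in> dgraphs \<B> n m" "Y \<in> dgraphs \<B> n' m'" "X' \<in> dgraph_class \<B> X" "Y' \<in> dgraph_class \<B> Y"
  shows "same_terms (dgraph_hor X Y) (dgraph_hor X' Y')"
proof -
  have d: "X' \<in> dgraphs \<B> n m" "Y' \<in> dgraphs \<B> n' m'" using class_in_dgraphs assms by blast+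
  have "same_terms X X'" "same_terms Y Y'" using assms by (auto simp: dgraphs_iff dgraph_class_eq)
  then show ?thesis
    using dgraph_hor[OF assms(1,2)] dgraph_hor[OF d] by (simp add: same_terms_def dgraphs_iff)
qed

lemma same_terms_ver:
  assumes "X \<in> dgraphs \<B> n m" "Y \<in> dgraphs \<B> m l" "X' \<in> dgraph_class \<B> X" "Y' \<in> dgraph_class \<B> Y"
  shows "same_terms (dgraph_ver Y X) (dgraph_ver Y' X')"
proof -
  have d: "X' \<in> dgraphs \<B> n m" "Y' \<in> dgraphs \<B> m l" using class_in_dgraphs assms by blast+
  have "same_terms X X'" "same_terms Y Y'" using assms by (auto simp: dgraphs_iff dgraph_class_eq)
  then show ?thesis
    using dgraph_ver[OF assms(1,2)] dgraph_ver[OF d] by (simp add: same_terms_def dgraphs_iff)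
qed

lemma iso_class: "sdg X \<Longrightarrow> dgraph_iso \<B> X Z \<longleftrightarrow> sdg Z \<and> same_terms X Z"
  using iso_if_same_terms iso_imp_same_terms by blast

lemma phor_free:
  assumes "X \<in> dgraphs \<B> n m" "Y \<in> dgraphs \<B> n' m'"
  shows "phor \<F> (dgraph_class \<B> X) (dgraph_class \<B> Y) = dgraph_class \<B> (dgraph_hor X Y)"
proof -
  have s: "sdg (dgraph_hor X' Y')" if "X' \<in> dgraph_class \<B> X" "Y' \<in> dgraph_class \<B> Y" for X' Y'
    using dgraph_hor(1) class_in_dgraphs assms that unfolding dgraphs_iff by metis
  note self = dgraph_class_self[OF assms(1)] dgraph_class_self[OF assms(2)]
  have "phor \<F> (dgraph_class \<B> X) (dgraph_class \<B> Y) =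
      {Z. \<exists>x\<in>dgraph_class \<B> X. \<exists>y\<in>dgraph_class \<B> Y. dgraph_iso \<B> (dgraph_hor x y) Z}"
    by (simp add: free_on_cells_def free_prop_def)
  also have "\<dots> = dgraph_class \<B> (dgraph_hor X Y)"
  proof (intro set_eqI iffI)
    fix Z assume "Z \<in> {Z. \<exists>x\<in>dgraph_class \<B> X. \<exists>y\<in>dgraph_class \<B> Y. dgraph_iso \<B> (dgraph_hor x y) Z}"
    then obtain x y where xy: "x \<in> dgraph_class \<B> X" "y \<in> dgraph_class \<B> Y" "dgraph_iso \<B> (dgraph_hor x y) Z" by blast
    then have "sdg Z \<and> same_terms (dgraph_hor x y) Z" using s iso_class by blast
    then show "Z \<in> dgraph_class \<B> (dgraph_hor X Y)"
      using same_terms_trans[OF same_terms_hor[OF assms xy(1,2)]] dgraph_class_eq[OF s[OF self]] by blast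
  next
    fix Z assume "Z \<in> dgraph_class \<B> (dgraph_hor X Y)"
    then show "Z \<in> {Z. \<exists>x\<in>dgraph_class \<B> X. \<exists>y\<in>dgraph_class \<B> Y. dgraph_iso \<B> (dgraph_hor x y) Z}"
      using self by (auto simp: dgraph_class_def[of _ "dgraph_hor X Y"])
  qed
  finally show ?thesis .
qed

lemma pver_free:
  assumes "X \<in> dgraphs \<B> n m" "Y \<in> dgraphs \<B> m l"
  shows "pver \<F> (dgraph_class \<B> Y) (dgraph_class \<B> X) = dgraph_class \<B> (dgraph_ver Y X)"
proof -
  have s: "sdg (dgraph_ver Y' X')" if "X' \<in> dgraph_class \<B> X" "Y' \<in> dgraph_class \<B> Y" for X' Y'
    using dgraph_ver(1) class_in_dgraphs assms that unfolding dgraphs_iff by metis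
  note self = dgraph_class_self[OF assms(1)] dgraph_class_self[OF assms(2)]
  have "pver \<F> (dgraph_class \<B> Y) (dgraph_class \<B> X) =
      {Z. \<exists>x\<in>dgraph_class \<B> X. \<exists>y\<in>dgraph_class \<B> Y. dgraph_iso \<B> (dgraph_ver y x) Z}"
    by (simp add: free_on_cells_def free_prop_def)
  also have "\<dots> = dgraph_class \<B> (dgraph_ver Y X)"
  proof (intro set_eqI iffI)
    fix Z assume "Z \<in> {Z. \<exists>x\<in>dgraph_class \<B> X. \<exists>y\<in>dgraph_class \<B> Y. dgraph_iso \<B> (dgraph_ver y x) Z}"
    then obtain x y where xy: "x \<in> dgraph_class \<B> X" "y \<in> dgraph_class \<B> Y" "dgraph_iso \<B> (dgraph_ver y x) Z" by blast
    then have "sdg Z \<and> same_terms (dgraph_ver y x) Z" using s iso_class by blast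
    then show "Z \<in> dgraph_class \<B> (dgraph_ver Y X)"
      using same_terms_trans[OF same_terms_ver[OF assms xy(1,2)]] dgraph_class_eq[OF s[OF self]] by blast
  next
    fix Z assume "Z \<in> dgraph_class \<B> (dgraph_ver Y X)"
    then show "Z \<in> {Z. \<exists>x\<in>dgraph_class \<B> X. \<exists>y\<in>dgraph_class \<B> Y. dgraph_iso \<B> (dgraph_ver y x) Z}"
      using self by (auto simp: dgraph_class_def[of _ "dgraph_ver Y X"])
  qed
  finally show ?thesis .
qed

lemma pperm_free: "pperm \<F> n \<sigma> = dgraph_class \<B> (perm_graph n \<sigma>)"
  by (simp add: free_on_cells_def free_prop_def)

interpretation \<F>: good_prop \<F>
proof
  fix x n m n' m' assume "x \<in> pset \<F> n m" "x \<in> pset \<F> n' m'"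
  then obtain X Y where "x = dgraph_class \<B> X" "X \<in> dgraphs \<B> n m" "x = dgraph_class \<B> Y" "Y \<in> dgraphs \<B> n' m'"
    unfolding pset_free by blast
  then have "X \<in> dgraphs \<B> n m" "X \<in> dgraphs \<B> n' m'" using dgraph_class_self class_in_dgraphs by metis+
  then show "n = n' \<and> m = m'" by (auto simp: dgraphs_iff)
next
  fix x y n m n' m' assume "x \<in> pset \<F> n m" "y \<in> pset \<F> n' m'"
  then show "phor \<F> x y \<in> pset \<F> (n + n') (m + m')"
    unfolding pset_free using phor_free dgraph_hor(1) by blast
next
  fix x y n m l assume "x \<in> pset \<F> n m" "y \<in> pset \<F> m l"
  then show "pver \<F> y x \<in> pset \<F> n l"
    unfolding pset_free using pver_free dgraph_ver(1) by blast
qed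

interpretation \<A>: good_prop S_attached
  unfolding S_attached_eq by (rule \<F>.good_prop_quot)

interpretation \<S>: good_prop S_prop
  unfolding S_prop_def by (rule \<A>.good_prop_quot)

text \<open>The image of a graph before the relations are imposed; \<open>cl\<close> is its image in
  the final prop.\<close>

definition acl :: "sgraph \<Rightarrow> S_cell cell_point dgraph set set" where
  "acl X = quot_class \<F> attach_rel (dgraph_class \<B> X)"

definition cl :: "sgraph \<Rightarrow> S_cell cell_point dgraph set set set" where
  "cl X = quot_class S_attached S_relations (acl X)"

lemma pset_attached: "pset S_attached n m = acl ` dgraphs \<B> n m"
  unfolding S_attached_eq \<F>.pset_quot pset_free acl_def by (simp add: image_image)

lemma pset_S: "pset S_prop n m = cl ` dgraphs \<B> n m"
  unfolding S_prop_def \<A>.pset_quot pset_attached cl_def by (simp add: image_image)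

lemma class_in_free: "X \<in> dgraphs \<B> n m \<Longrightarrow> dgraph_class \<B> X \<in> pset \<F> n m"
  unfolding pset_free by (rule imageI)

lemma acl_in: "X \<in> dgraphs \<B> n m \<Longrightarrow> acl X \<in> pset S_attached n m"
  unfolding pset_attached by (rule imageI)

lemma cl_in: "X \<in> dgraphs \<B> n m \<Longrightarrow> cl X \<in> pset S_prop n m"
  unfolding pset_S by (rule imageI)

lemma acl_hor:
  "\<lbrakk>X \<in> dgraphs \<B> n m; Y \<in> dgraphs \<B> n' m'\<rbrakk> \<Longrightarrow> phor S_attached (acl X) (acl Y) = acl (dgraph_hor X Y)"
  unfolding acl_def S_attached_eq by (simp add: \<F>.phor_quot[OF class_in_free class_in_free] phor_free)

lemma acl_ver:
  "\<lbrakk>X \<in> dgraphs \<B> n m; Y \<in> dgraphs \<B> m l\<rbrakk> \<Longrightarrow> pver S_attached (acl Y) (acl X) = acl (dgraph_ver Y X)"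
  unfolding acl_def S_attached_eq by (simp add: \<F>.pver_quot[OF class_in_free class_in_free] pver_free)

lemma cl_hor:
  "\<lbrakk>X \<in> dgraphs \<B> n m; Y \<in> dgraphs \<B> n' m'\<rbrakk> \<Longrightarrow> phor S_prop (cl X) (cl Y) = cl (dgraph_hor X Y)"
  unfolding cl_def S_prop_def by (simp add: \<A>.phor_quot[OF acl_in acl_in] acl_hor)

lemma cl_ver:
  "\<lbrakk>X \<in> dgraphs \<B> n m; Y \<in> dgraphs \<B> m l\<rbrakk> \<Longrightarrow> pver S_prop (cl Y) (cl X) = cl (dgraph_ver Y X)"
  unfolding cl_def S_prop_def by (simp add: \<A>.pver_quot[OF acl_in acl_in] acl_ver)

lemma cl_perm: "pperm S_prop n \<sigma> = cl (perm_graph n \<sigma>)"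
  unfolding cl_def acl_def S_prop_def S_attached_eq by (simp add: prop_quot_def pperm_free)

lemma acl_cong: "\<lbrakk>X \<in> dgraphs \<B> n m; Y \<in> dgraphs \<B> n m; same_terms X Y\<rbrakk> \<Longrightarrow> acl X = acl Y"
  unfolding acl_def by (simp add: dgraphs_iff dgraph_class_eq_iff[of X Y, THEN iffD2])

lemma cl_cong: "\<lbrakk>X \<in> dgraphs \<B> n m; Y \<in> dgraphs \<B> n m; same_terms X Y\<rbrakk> \<Longrightarrow> cl X = cl Y"
  unfolding cl_def using acl_cong by metis

lemma acl_attach:
  assumes "x \<in> cube_boundary (S_dim c)" "S_att c x = dgraph_class \<B> Y" "Y \<in> dgraphs \<B> (S_in c) (S_out c)"
  shows "acl (gen c x) = acl Y"
proof -
  have x: "gen c x \<in> dgraphs \<B> (S_in c) (S_out c)"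
    using assms(1) by (intro dgraph_gen) (simp add: cube_boundary_iff)
  have "(dgraph_class \<B> (gen c x), dgraph_class \<B> Y) \<in> attach_rel"
    using assms(1,2) unfolding attach_rel_def cell_elt_eq by (auto simp: S_cells_def)
  then have "prop_cong \<F> attach_rel (dgraph_class \<B> (gen c x)) (dgraph_class \<B> Y)"
    by (rule prop_cong.base) (use class_in_free x assms(3) in blast)+
  then show ?thesis
    unfolding acl_def using \<F>.quot_class_eq_iff[OF class_in_free[OF x]] by blast
qed

abbreviation "gE \<equiv> gen Eps pt0"
abbreviation "gD \<equiv> gen Delta pt0"
abbreviation "gM s \<equiv> gen Mu (pt1 s)"
abbreviation "gH s \<equiv> gen Htp (pt1 s)"
abbreviation gI :: "nat \<Rightarrow> sgraph" where "gI n \<equiv> perm_graph n id"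

lemma gE: "gE \<in> dgraphs \<B> 1 0" "outs gE = []" "epss gE = {In 0}"
  using dgraph_gen[of pt0 Eps] pt0_in_cube by simp_all

lemma gD: "gD \<in> dgraphs \<B> 1 2" "outs gD = [Lt (In 0), Rt (In 0)]" "epss gD = {}"
  using dgraph_gen[of pt0 Delta] pt0_in_cube by (simp_all add: upt_conv_Cons)

lemma gM:
  assumes "s \<in> {0..1}"
  shows "gM s \<in> dgraphs \<B> 2 1" "outs (gM s) = [Mt s (In 0) (In 1)]" "epss (gM s) = {}"
  using dgraph_gen[of "pt1 s" Mu] pt1_in_cube assms by (simp_all add: upt_conv_Cons)

lemma gH:
  assumes "s \<in> {0..1}"
  shows "gH s \<in> dgraphs \<B> 1 1" "outs (gH s) = [Ht s (In 0)]" "epss (gH s) = {}"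
  using dgraph_gen[of "pt1 s" Htp] pt1_in_cube assms by (simp_all add: upt_conv_Cons)

lemma gI: "gI n \<in> dgraphs \<B> n n" "outs (gI n) = map In [0..<n]" "epss (gI n) = {}"
  using dgraph_perm[OF permutes_id, of n] by simp_all

lemma boundary_1: "s \<in> {0,1} \<Longrightarrow> pt1 s \<in> cube_boundary 1"
  using pt1_in_cube[of s] by (auto simp: cube_boundary_iff)

lemma att_Mu: "acl (gM 0) = acl (dgraph_hor (gI 1) gE)" "acl (gM 1) = acl (dgraph_hor gE (gI 1))"
proof -
  show "acl (gM 0) = acl (dgraph_hor (gI 1) gE)"
    by (rule acl_attach) (use boundary_1[of 0] dgraph_hor(1)[OF gI(1) gE(1), of 1] in
      \<open>auto simp: S_att_def Let_def cell_elt_eq pperm_free phor_free[OF gI(1) gE(1)]\<close>)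
  show "acl (gM 1) = acl (dgraph_hor gE (gI 1))"
    by (rule acl_attach) (use boundary_1[of 1] dgraph_hor(1)[OF gE(1) gI(1), of 1] in
      \<open>auto simp: S_att_def Let_def cell_elt_eq pperm_free phor_free[OF gE(1) gI(1)]\<close>)
qed

lemma dEI: "dgraph_hor gE (gI 1) \<in> dgraphs \<B> 2 1"
  using dgraph_hor(1)[OF gE(1) gI(1), of 1] by (simp add:)

lemma dEE: "dgraph_hor gE gE \<in> dgraphs \<B> 2 0"
  using dgraph_hor(1)[OF gE(1) gE(1)] by (simp add:)

lemma att_Htp: "acl (gH 0) = acl (gI 1)" "acl (gH 1) = acl (dgraph_ver (dgraph_hor gE (gI 1)) gD)"
proof -
  show "acl (gH 0) = acl (gI 1)"
    by (rule acl_attach) (use boundary_1[of 0] gI(1)[of 1] in \<open>auto simp: S_att_def Let_def pperm_free\<close>)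
  show "acl (gH 1) = acl (dgraph_ver (dgraph_hor gE (gI 1)) gD)"
    by (rule acl_attach) (use boundary_1[of 1] dgraph_ver(1)[OF gD(1) dEI] in
      \<open>auto simp: S_att_def Let_def cell_elt_eq pperm_free phor_free[OF gE(1) gI(1)] pver_free[OF gD(1) dEI]\<close>)
qed

lemma cl_rel:
  assumes "(acl X, acl Y) \<in> S_relations" "X \<in> dgraphs \<B> n m" "Y \<in> dgraphs \<B> n m"
  shows "cl X = cl Y"
  unfolding cl_def using \<A>.quot_class_eq_iff[OF acl_in[OF assms(2)]]
    prop_cong.base[OF assms(1) acl_in acl_in] assms(2,3) by blast

lemma S_relations_eq: "S_relations =
   {(acl (dgraph_ver (dgraph_hor gE gE) gD), acl gE)} \<union>
   {(acl (dgraph_ver gE (gM s)), acl (dgraph_hor gE gE)) |s. s \<in> {0..1}} \<union>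
   {(acl (dgraph_ver gE (gH s)), acl gE) |s. s \<in> {0..1}}"
proof -
  have e: "S_elt c x = acl (gen c x)" for c x by (simp add: S_elt_eq acl_def)
  have "pver S_attached (acl gE) (acl (gM s)) = acl (dgraph_ver gE (gM s))"
    "pver S_attached (acl gE) (acl (gH s)) = acl (dgraph_ver gE (gH s))" if "s \<in> {0..1}" for s
    using acl_ver[OF gM(1)[OF that] gE(1)] acl_ver[OF gH(1)[OF that] gE(1)] by auto
  then show ?thesis
    unfolding S_relations_def Let_def e acl_hor[OF gE(1) gE(1)] acl_ver[OF gD(1) dEE] by blast
qed

lemma cl_relations:
  "cl (dgraph_ver (dgraph_hor gE gE) gD) = cl gE"
  "s \<in> {0..1} \<Longrightarrow> cl (dgraph_ver gE (gM s)) = cl (dgraph_hor gE gE)"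
  "s \<in> {0..1} \<Longrightarrow> cl (dgraph_ver gE (gH s)) = cl gE"
  "cl (gM 0) = cl (dgraph_hor (gI 1) gE)" "cl (gM 1) = cl (dgraph_hor gE (gI 1))"
  "cl (gH 0) = cl (gI 1)" "cl (gH 1) = cl (dgraph_ver (dgraph_hor gE (gI 1)) gD)"
proof -
  show "cl (dgraph_ver (dgraph_hor gE gE) gD) = cl gE"
    by (rule cl_rel[OF _ dgraph_ver(1)[OF gD(1) dEE] gE(1)]) (simp add: S_relations_eq)
  show "cl (dgraph_ver gE (gM s)) = cl (dgraph_hor gE gE)" if "s \<in> {0..1}"
    by (rule cl_rel[OF _ dgraph_ver(1)[OF gM(1)[OF that] gE(1)] dEE]) (use that in \<open>auto simp: S_relations_eq\<close>)
  show "cl (dgraph_ver gE (gH s)) = cl gE" if "s \<in> {0..1}"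
    by (rule cl_rel[OF _ dgraph_ver(1)[OF gH(1)[OF that] gE(1)] gE(1)]) (use that in \<open>auto simp: S_relations_eq\<close>)
qed (simp_all add: cl_def att_Mu att_Htp)

subsection \<open>Soundness\<close>

lemma ev_class: "\<lbrakk>X \<in> dgraphs \<B> n m; Y \<in> dgraph_class \<B> X\<rbrakk> \<Longrightarrow> ev Y = ev X"
  by (auto simp: dgraphs_iff dgraph_class_eq same_terms_def ev_def)

definition evF :: "S_cell cell_point dgraph set \<Rightarrow> nat \<times> real tm list" where
  "evF C = ev (SOME X. X \<in> C)"

lemma evF: "X \<in> dgraphs \<B> n m \<Longrightarrow> evF (dgraph_class \<B> X) = ev X"
  unfolding evF_def using ev_class[OF _ someI[of "\<lambda>Y. Y \<in> dgraph_class \<B> X", OF dgraph_class_self]] by blast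

lemma ev_gens:
  "ev gE = (1, [])" "ev gD = (1, [Lt (In 0), Rt (In 0)])" "ev (gI n) = (n, map In [0..<n])"
  "s \<in> {0..1} \<Longrightarrow> ev (gM s) = (2, [norm (Mt s (In 0) (In 1))])"
  "s \<in> {0..1} \<Longrightarrow> ev (gH s) = (1, [norm (Ht s (In 0))])"
  using gE gD gI[of n] gM[of s] gH[of s] unfolding ev_def dgraphs_iff
  by (simp_all del: norm.simps(4,5))

lemma S_att_eq:
  "S_att Mu x = (if x 0 = 0 then dgraph_class \<B> (dgraph_hor (gI 1) gE) else dgraph_class \<B> (dgraph_hor gE (gI 1)))"
  "S_att Htp x = (if x 0 = 0 then dgraph_class \<B> (gI 1)
     else dgraph_class \<B> (dgraph_ver (dgraph_hor gE (gI 1)) gD))"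
  by (simp_all add: S_att_def Let_def cell_elt_eq pperm_free phor_free[OF gI(1) gE(1)]
      phor_free[OF gE(1) gI(1)] pver_free[OF gD(1) dEI])

text \<open>Cells have dimension at most 1, so a boundary point is an end of an interval, and there
  \<open>norm\<close> follows the attaching map.\<close>

lemma attach_sound:
  assumes "x \<in> cube_boundary (S_dim c)"
  shows "evF (dgraph_class \<B> (gen c x)) = evF (S_att c x)"
proof -
  have x: "x \<in> topspace (cube (S_dim c))" and b: "\<exists>k<S_dim c. x k = 0 \<or> x k = 1"
    using assms by (auto simp: cube_boundary_iff)
  then have dim: "S_dim c = 1" using S_dim_le[of c] by linarith
  then have x0: "x 0 = 0 \<or> x 0 = 1" using b by auto
  have x1: "x = pt1 (x 0)"
    by (rule cube_point_eqI[where k = 1]) (use x dim x0 pt1_in_cube[of "x 0"] in auto)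
  have g: "evF (dgraph_class \<B> (gen c x)) = ev (gen c (pt1 (x 0)))"
    using evF[OF dgraph_gen(1)[OF x]] x1 by simp
  have s: "x 0 \<in> {0..1}" using x0 by auto
  show ?thesis
  proof (cases c)
    case Mu
    show ?thesis
      unfolding g unfolding Mu ev_gens(4)[OF s] S_att_eq
      using x0 ev_hor[OF gI(1) gE(1), of 1] ev_hor[OF gE(1) gI(1), of 1]
        evF[OF dgraph_hor(1)[OF gI(1) gE(1)], of 1] evF[OF dgraph_hor(1)[OF gE(1) gI(1)], of 1]
      by (auto simp: ev_gens upt_conv_Cons)
  next
    case Htp
    show ?thesis
      unfolding g unfolding Htp ev_gens(5)[OF s] S_att_eq
      using x0 ev_hor[OF gE(1) gI(1), of 1] ev_ver[OF gD(1) dEI] evF[OF gI(1), of 1]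
        evF[OF dgraph_ver(1)[OF gD(1) dEI]]
      by (auto simp: ev_gens upt_conv_Cons)
  qed (use dim in auto)
qed

lemma cong_sound_free:
  assumes "prop_cong \<F> attach_rel x y"
  shows "evF x = evF y"
  using assms
proof (rule \<F>.cong_invariant)
  show "evF x = evF y" if "(x, y) \<in> attach_rel" for x y
    using that attach_sound by (auto simp: attach_rel_def cell_elt_eq) (auto simp: S_cells_def)
  show "evF (phor \<F> x y) = hcomp (evF x) (evF y)" if "x \<in> pset \<F> n m" "y \<in> pset \<F> n' m'" for x y n m n' m'
    using that unfolding pset_free
    by (auto simp: phor_free evF ev_hor evF[OF dgraph_hor(1)])
  show "evF (pver \<F> y x) = vcomp (evF y) (evF x)" if "x \<in> pset \<F> n m" "y \<in> pset \<F> m l" for x y n m l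
    using that unfolding pset_free
    by (auto simp: pver_free evF ev_ver evF[OF dgraph_ver(1)])
qed

definition evA :: "S_cell cell_point dgraph set set \<Rightarrow> nat \<times> real tm list" where
  "evA C = evF (SOME X. X \<in> C)"

lemma evA: "X \<in> dgraphs \<B> n m \<Longrightarrow> evA (acl X) = ev X"
proof -
  assume X: "X \<in> dgraphs \<B> n m"
  have "dgraph_class \<B> X \<in> acl X"
    unfolding acl_def quot_class_def using prop_cong.refl[OF class_in_free[OF X]] by blast
  then have "(SOME C. C \<in> acl X) \<in> acl X" by (rule someI)
  then have "evF (dgraph_class \<B> X) = evF (SOME C. C \<in> acl X)"
    unfolding acl_def quot_class_def by (auto dest: cong_sound_free)
  then show ?thesis using evF[OF X] by (simp add: evA_def)
qed

text \<open>Both sides of each defining relation have no outputs and the same number of inputs, so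
  \<open>ev\<close> cannot tell them apart.\<close>

lemma cong_sound:
  assumes "prop_cong S_attached S_relations x y"
  shows "evA x = evA y"
  using assms
proof (rule \<A>.cong_invariant)
  show "evA x = evA y" if "(x, y) \<in> S_relations" for x y
  proof -
    have "evA (acl (dgraph_ver (dgraph_hor gE gE) gD)) = evA (acl gE)"
      unfolding evA[OF dgraph_ver(1)[OF gD(1) dEE]] evA[OF gE(1)] ev_ver[OF gD(1) dEE] ev_hor[OF gE(1) gE(1)]
      by (simp add: ev_gens)
    moreover have "evA (acl (dgraph_ver gE (gM s))) = evA (acl (dgraph_hor gE gE))" if s: "s \<in> {0..1}" for s
      unfolding evA[OF dgraph_ver(1)[OF gM(1)[OF s] gE(1)]] evA[OF dEE] ev_ver[OF gM(1)[OF s] gE(1)]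
        ev_hor[OF gE(1) gE(1)] ev_gens(4)[OF s]
      by (simp add: ev_gens)
    moreover have "evA (acl (dgraph_ver gE (gH s))) = evA (acl gE)" if s: "s \<in> {0..1}" for s
      unfolding evA[OF dgraph_ver(1)[OF gH(1)[OF s] gE(1)]] evA[OF gE(1)] ev_ver[OF gH(1)[OF s] gE(1)] ev_gens(5)[OF s]
      by (simp add: ev_gens)
    ultimately show ?thesis using that unfolding S_relations_eq by blast
  qed
  show "evA (phor S_attached x y) = hcomp (evA x) (evA y)"
    if "x \<in> pset S_attached n m" "y \<in> pset S_attached n' m'" for x y n m n' m'
    using that unfolding pset_attached by (auto simp: acl_hor evA ev_hor evA[OF dgraph_hor(1)])
  show "evA (pver S_attached y x) = vcomp (evA y) (evA x)"
    if "x \<in> pset S_attached n m" "y \<in> pset S_attached m l" for x y n m l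
    using that unfolding pset_attached by (auto simp: acl_ver evA ev_ver evA[OF dgraph_ver(1)])
qed

lemma cl_sound:
  assumes "X \<in> dgraphs \<B> n m" "Y \<in> dgraphs \<B> n' m'" "cl X = cl Y"
  shows "ev X = ev Y"
  using assms \<A>.quot_class_eq_iff[OF acl_in[OF assms(1)]] cong_sound evA unfolding cl_def by metis

section \<open>Linear systems of terms\<close>

text \<open>A vertex other than an \<epsilon>, stripped of half-edge labels and of wiring: the terms
  on its inputs identify it within a graph. The ends in \<epsilon> are recorded separately.\<close>

datatype vt = VD "real tm" | VM real "real tm" "real tm" | VH real "real tm"

fun vouts :: "vt \<Rightarrow> real tm list" where
  "vouts (VD t) = [Lt t, Rt t]"
| "vouts (VM s a b) = [Mt s a b]"
| "vouts (VH s a) = [Ht s a]"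

fun vins :: "vt \<Rightarrow> real tm list" where
  "vins (VD t) = [t]"
| "vins (VM s a b) = [a, b]"
| "vins (VH s a) = [a]"

fun vpar :: "vt \<Rightarrow> real multiset" where
  "vpar (VD t) = {#}"
| "vpar (VM s a b) = {#s#}"
| "vpar (VH s a) = {#s#}"

text \<open>All outputs of a vertex have the same size, which exceeds the size of each input. This
  rank increases along edges and takes the place of acyclicity.\<close>

definition osz :: "vt \<Rightarrow> nat" where
  "osz v = size (hd (vouts v))"

lemma osz_out: "t \<in> set (vouts v) \<Longrightarrow> size t = osz v"
  by (cases v) (auto simp: osz_def)

lemma osz_in: "t \<in> set (vins v) \<Longrightarrow> size t < osz v"
  by (cases v) (auto simp: osz_def)

lemma vouts_disjoint: "\<lbrakk>t \<in> set (vouts v); t \<in> set (vouts w)\<rbrakk> \<Longrightarrow> v = w"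
  by (cases v; cases w) auto

lemma vins_sub: "\<lbrakk>t \<in> set (vins v); u \<in> set (vouts v)\<rbrakk> \<Longrightarrow> t \<in> sub u"
  by (cases v) auto

lemma vouts_not_In: "In i \<notin> set (vouts v)"
  by (cases v) auto

lemma vouts_hd: "hd (vouts v) \<in> set (vouts v)"
  by (cases v) auto

text \<open>The multiset of edges, with all edges leaving a vertex in \<open>V\<close> or an input on one side and all
  edges entering a vertex in \<open>V\<close> or one of the ends in \<open>D\<close> on the other.  The finite sets \<open>V\<close>
  with this property describe graphs with ends \<open>D\<close>; acyclicity is automatic.\<close>

definition edge_mset :: "nat \<Rightarrow> vt set \<Rightarrow> real tm multiset" where
  "edge_mset n V = mset (map In [0..<n]) + (\<Sum>v\<in>V. mset (vouts v))"

definition lin :: "nat \<Rightarrow> real tm multiset \<Rightarrow> vt set \<Rightarrow> bool" where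
  "lin n D V \<longleftrightarrow> finite V \<and> edge_mset n V = D + (\<Sum>v\<in>V. mset (vins v))"

lemma set_sum_mset: "finite V \<Longrightarrow> set_mset (\<Sum>v\<in>V. mset (f v)) = (\<Union>v\<in>V. set (f v))"
  by (induction V rule: finite_induct) auto

lemma in_edge_mset:
  "finite V \<Longrightarrow> t \<in># edge_mset n V \<longleftrightarrow> (\<exists>i<n. t = In i) \<or> (\<exists>v\<in>V. t \<in> set (vouts v))"
  by (auto simp: edge_mset_def set_sum_mset)

lemma lin_mem:
  assumes "lin n D V"
  shows "t \<in># edge_mset n V \<longleftrightarrow> t \<in># D \<or> (\<exists>v\<in>V. t \<in> set (vins v))"
  using assms by (auto simp: lin_def set_sum_mset)

lemma lin_finite: "lin n D V \<Longrightarrow> finite V"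
  by (simp add: lin_def)

lemma lin_vertex: "\<lbrakk>lin n D V; t \<in># edge_mset n V; t \<in> set (vouts v)\<rbrakk> \<Longrightarrow> v \<in> V"
  using in_edge_mset[OF lin_finite, of n D V t n] vouts_not_In vouts_disjoint by metis

text \<open>A term determines the vertex that emits it and its place among the outputs there, so no
  term is emitted twice.\<close>

lemma count_sum_vouts:
  assumes "finite V"
  shows "count (\<Sum>v\<in>V. mset (vouts v)) t \<le> 1"
proof (cases "\<exists>v\<in>V. t \<in> set (vouts v)")
  case True
  then obtain v where v: "v \<in> V" "t \<in> set (vouts v)" by blast
  have "t \<notin># (\<Sum>v\<in>V - {v}. mset (vouts v))"
  proof
    assume "t \<in># (\<Sum>v\<in>V - {v}. mset (vouts v))"
    then obtain w where "w \<in> V - {v}" "t \<in> set (vouts w)"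
      using set_sum_mset[of "V - {v}" vouts] assms by blast
    then show False using vouts_disjoint[OF v(2)] by blast
  qed
  then have "count (\<Sum>v\<in>V - {v}. mset (vouts v)) t = 0" by (simp only: not_in_iff)
  then have "count (\<Sum>v\<in>V. mset (vouts v)) t = count (mset (vouts v)) t"
    using sum.remove[OF assms v(1), of "\<lambda>v. mset (vouts v)"] by simp
  also have "\<dots> \<le> 1" by (cases v) auto
  finally show ?thesis .
next
  case False
  then have "t \<notin># (\<Sum>v\<in>V. mset (vouts v))" using set_sum_mset[OF assms, of vouts] by blast
  then show ?thesis by (simp add: not_in_iff)
qed

lemma count_edge_mset: "finite V \<Longrightarrow> count (edge_mset n V) t \<le> 1"
proof -
  assume V: "finite V"
  show ?thesis
  proof (cases t)
    case (In i)
    define xs where "xs = map (In :: nat \<Rightarrow> real tm) [0..<n]"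
    have "distinct xs" by (simp add: xs_def distinct_map inj_on_def)
    then have "count (mset xs) t \<le> 1" by (simp add: distinct_count_atmost_1)
    moreover have "t \<notin># (\<Sum>v\<in>V. mset (vouts v))" using In vouts_not_In V by (auto simp: set_sum_mset)
    ultimately show ?thesis by (simp add: edge_mset_def not_in_iff xs_def)
  qed (use count_sum_vouts[OF V, of t] in \<open>simp_all add: edge_mset_def count_image_mset vimage_def\<close>)
qed

lemma lin_count: "lin n D V \<Longrightarrow> count D t \<le> 1"
  using count_edge_mset[of V n t] by (simp add: lin_def)

lemma lin_D_not_ins:
  assumes "lin n D V" "t \<in># D" "v \<in> V"
  shows "t \<notin> set (vins v)"
proof
  assume "t \<in> set (vins v)"
  then have "t \<in># (\<Sum>v\<in>V. mset (vins v))" using assms by (auto simp: lin_def set_sum_mset)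
  then have "count (edge_mset n V) t \<ge> 2"
    using assms by (simp add: lin_def) (metis add_mono count_greater_eq_one_iff one_add_one)
  then show False using count_edge_mset[of V n t] assms by (simp add: lin_def)
qed

lemma lin_closed:
  assumes "lin n D V" "t \<in># edge_mset n V"
  shows "sub t \<subseteq> set_mset (edge_mset n V)"
  using assms(2)
proof (induction "size t" arbitrary: t rule: less_induct)
  case less
  have fin: "finite V" using assms by (simp add: lin_def)
  show ?case
  proof (cases "\<exists>i. t = In i")
    case False
    then obtain v where v: "v \<in> V" "t \<in> set (vouts v)" using less.prems in_edge_mset[OF fin] by blast
    have "sub u \<subseteq> set_mset (edge_mset n V)" if "u \<in> set (vins v)" for u
    proof (rule less.hyps)
      show "size u < size t" using osz_in[OF that] osz_out[OF v(2)] by simp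
      show "u \<in># edge_mset n V" using lin_mem[OF assms(1)] v(1) that by blast
    qed
    then show ?thesis using v(2) less.prems by (cases v) auto
  qed (use less.prems in auto)
qed

text \<open>Follow from \<open>v\<close> an output that is not an end outside \<open>A\<close>.
  Either it lies in \<open>A\<close>, or some vertex of larger \<open>osz\<close> consumes it; as
  \<open>V\<close> is finite the walk must reach \<open>A\<close>. Every term met on the way is a
  subterm of the last one.\<close>

lemma lin_alive:
  assumes V: "lin n D V"
    and alive: "\<And>v. \<lbrakk>v \<in> V; \<forall>t\<in>set (vouts v). t \<in># D \<and> t \<notin> A\<rbrakk> \<Longrightarrow> False"
    and "v \<in> V"
  shows "\<exists>t\<in>set (vouts v). t \<in> \<Union> (sub ` A)"
  using assms(3)
proof (induction "Max (osz ` V) - osz v" arbitrary: v rule: less_induct)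
  case less
  have fin: "finite (osz ` V)" using V by (simp add: lin_def)
  obtain t where t: "t \<in> set (vouts v)" "t \<notin># D \<or> t \<in> A" using alive[OF less.prems] by blast
  show ?case
  proof (cases "t \<in> A")
    case True
    then show ?thesis using t sub_refl by blast
  next
    case False
    have "t \<in># edge_mset n V" using in_edge_mset[OF lin_finite[OF V]] t(1) less.prems by blast
    then obtain w where w: "w \<in> V" "t \<in> set (vins w)" using lin_mem[OF V] False t by blast
    have "osz v < osz w" using osz_in[OF w(2)] osz_out[OF t(1)] by simp
    moreover have "osz w \<le> Max (osz ` V)" using fin w(1) by simp
    ultimately have "Max (osz ` V) - osz w < Max (osz ` V) - osz v" by linarith
    from less.hyps[OF this w(1)] obtain u where "u \<in> set (vouts w)" "u \<in> \<Union> (sub ` A)" by blast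
    then have "t \<in> \<Union> (sub ` A)" using vins_sub[OF w(2)] sub_trans by blast
    then show ?thesis using t(1) by blast
  qed
qed

text \<open>By \<open>lin_alive\<close> each vertex of \<open>V\<close> emits a subterm of some
  element of \<open>A\<close>. The edges of \<open>V'\<close> are closed under subterms, and an edge
  determines its emitting vertex, which is thus in \<open>V'\<close>.\<close>

lemma lin_subset:
  assumes V: "lin n D V" and V': "lin n' D' V'"
    and A: "A \<subseteq> set_mset (edge_mset n' V')"
    and alive: "\<And>v. \<lbrakk>v \<in> V; \<forall>t\<in>set (vouts v). t \<in># D \<and> t \<notin> A\<rbrakk> \<Longrightarrow> False"
  shows "V \<subseteq> V'"
proof
  fix v assume "v \<in> V"
  have "\<exists>t\<in>set (vouts v). t \<in> \<Union> (sub ` A)"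
    by (rule lin_alive[OF V alive \<open>v \<in> V\<close>])
  then obtain t where t: "t \<in> set (vouts v)" "t \<in> \<Union> (sub ` A)" ..
  then have "t \<in># edge_mset n' V'" using A lin_closed[OF V'] by blast
  then show "v \<in> V'" using lin_vertex[OF V' _ t(1)] by blast
qed

lemma lin_unique:
  assumes "lin n D V" "lin n D V'"
  shows "V = V'"
proof
  have 1: "set_mset D \<subseteq> set_mset (edge_mset n V')" using assms lin_mem by blast
  show "V \<subseteq> V'" by (rule lin_subset[OF assms 1]) (metis vouts_hd)
  have 2: "set_mset D \<subseteq> set_mset (edge_mset n V)" using assms lin_mem by blast
  show "V' \<subseteq> V" by (rule lin_subset[OF assms(2,1) 2]) (metis vouts_hd)
qed

text \<open>All conceivable vertices are quantified over, so that the condition speaks of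
  \<open>E\<close> alone. If \<open>E\<close> consists of edges of a system, only vertices of that
  system can violate it, because an edge determines its vertex.\<close>

definition reduced :: "real tm set \<Rightarrow> bool" where
  "reduced E \<longleftrightarrow> (\<forall>v. \<not> set (vouts v) \<subseteq> E)"

text \<open>Reducedness makes every vertex lie upstream of one of the outputs \<open>l\<close>. So
  \<open>l\<close> determines \<open>V\<close>, and the balance equation then determines
  \<open>E\<close>.\<close>

lemma lin_reduced_unique:
  assumes 1: "lin n (mset l + mset_set E) V" "reduced E" "finite E"
    and 2: "lin n (mset l + mset_set E') V'" "reduced E'" "finite E'"
  shows "E = E'"
proof -
  have *: "V \<subseteq> V'" if 1: "lin n (mset l + mset_set E) V" "reduced E" "finite E"
    and 2: "lin n (mset l + mset_set E') V'" for E E' V V'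
  proof (rule lin_subset[OF 1(1) 2, of "set l"])
    show "set l \<subseteq> set_mset (edge_mset n V')" using lin_mem[OF 2] by auto
    fix v assume v: "v \<in> V" "\<forall>t\<in>set (vouts v). t \<in># mset l + mset_set E \<and> t \<notin> set l"
    then have "set (vouts v) \<subseteq> E" using 1(3) by auto
    then show False using 1(2) by (simp add: reduced_def)
  qed
  have "V = V'" using *[OF 1 2(1)] *[OF 2 1(1)] by blast
  then have "mset l + mset_set E = mset l + mset_set E'"
    using 1(1) 2(1) by (simp add: lin_def)
  then show ?thesis using 1(3) 2(3) by (metis add_left_cancel finite_set_mset_mset_set)
qed

definition nondeg :: "vt set \<Rightarrow> bool" where
  "nondeg V \<longleftrightarrow> (\<forall>v\<in>V. set_mset (vpar v) \<subseteq> {0<..<1})"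

lemma lin_norm:
  assumes "lin n D V" "nondeg V" "t \<in># edge_mset n V"
  shows "norm t = t \<and> set_tm t \<subseteq> {0<..<1}"
  using assms(3)
proof (induction "size t" arbitrary: t rule: less_induct)
  case less
  have fin: "finite V" using assms by (simp add: lin_def)
  show ?case
  proof (cases "\<exists>i. t = In i")
    case False
    then obtain v where v: "v \<in> V" "t \<in> set (vouts v)" using less.prems in_edge_mset[OF fin] by blast
    have "norm u = u \<and> set_tm u \<subseteq> {0<..<1}" if "u \<in> set (vins v)" for u
    proof (rule less.hyps)
      show "size u < size t" using osz_in[OF that] osz_out[OF v(2)] by simp
      show "u \<in># edge_mset n V" using lin_mem[OF assms(1)] v(1) that by blast
    qed
    moreover have "set_mset (vpar v) \<subseteq> {0<..<1}" using assms(2) v(1) by (simp add: nondeg_def)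
    ultimately show ?thesis using v(2) by (cases v) auto
  qed auto
qed

text \<open>A vertex of maximal \<open>osz\<close> feeds no other vertex, so all its outputs are
  ends.\<close>

lemma lin_top:
  assumes "lin n D V" "V \<noteq> {}"
  obtains v where "v \<in> V" "mset (vouts v) \<subseteq># D"
proof -
  have fin: "finite V" using assms by (simp add: lin_def)
  have "Max (osz ` V) \<in> osz ` V" using fin assms(2) by simp
  then obtain v where v: "v \<in> V" "osz v = Max (osz ` V)" by auto
  have "count (mset (vouts v)) t \<le> count D t" for t
  proof (cases "t \<in> set (vouts v)")
    case True
    have "t \<notin># (\<Sum>v\<in>V. mset (vins v))"
    proof
      assume "t \<in># (\<Sum>v\<in>V. mset (vins v))"
      then obtain w where w: "w \<in> V" "t \<in> set (vins w)" using fin by (auto simp: set_sum_mset)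
      have "osz v < osz w" using osz_in[OF w(2)] osz_out[OF True] by simp
      moreover have "osz w \<le> Max (osz ` V)" using fin w(1) by simp
      ultimately show False using v(2) by simp
    qed
    then have "count D t = count (edge_mset n V) t" using assms(1) by (simp add: lin_def not_in_iff)
    also have "\<dots> \<ge> count (mset (vouts v)) t"
      using sum.remove[OF fin v(1), of "\<lambda>v. mset (vouts v)"] by (simp add: edge_mset_def)
    finally show ?thesis .
  next
    case False
    then have c: "count (mset (vouts v)) t = 0" by (simp only: count_mset_0_iff not_False_eq_True)
    show ?thesis by (simp only: c le0)
  qed
  then show ?thesis using that v(1) by (simp add: subseteq_mset_def)
qed

lemma lin_remove:
  assumes "lin n D V" "v \<in> V" "mset (vouts v) \<subseteq># D"
  shows "lin n (D - mset (vouts v) + mset (vins v)) (V - {v})"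
proof -
  have fin: "finite V" using assms by (simp add: lin_def)
  have "edge_mset n (V - {v}) + mset (vouts v) = edge_mset n V"
    using sum.remove[OF fin assms(2), of "\<lambda>v. mset (vouts v)"] by (simp add: edge_mset_def add_ac)
  also have "\<dots> = D + (mset (vins v) + (\<Sum>v\<in>V - {v}. mset (vins v)))"
    using assms(1) sum.remove[OF fin assms(2), of "\<lambda>v. mset (vins v)"] by (simp add: lin_def)
  also have "\<dots> = (D - mset (vouts v) + mset (vins v) + (\<Sum>v\<in>V - {v}. mset (vins v))) + mset (vouts v)"
    using assms(3) by (metis (no_types, lifting) add.assoc add.commute subset_mset.diff_add)
  finally show ?thesis using fin by (simp add: lin_def)
qed

text \<open>If \<open>v\<close> were already present, its inputs would be consumed by it and also be
  ends, which no edge can be.\<close>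

lemma lin_insert:
  assumes "lin n (mset (vins v) + D) V"
  shows "lin n (mset (vouts v) + D) (insert v V)" "v \<notin> V"
proof -
  have fin: "finite V" using assms by (simp add: lin_def)
  show v: "v \<notin> V"
  proof
    assume "v \<in> V"
    moreover have "hd (vins v) \<in> set (vins v)" by (cases v) auto
    ultimately show False using lin_D_not_ins[OF assms, of "hd (vins v)" v] by auto
  qed
  show "lin n (mset (vouts v) + D) (insert v V)"
    using assms fin v by (simp add: lin_def edge_mset_def add_ac)
qed

subsection \<open>The linear system of a graph\<close>

definition half_edges :: "nat \<Rightarrow> nat \<Rightarrow> (nat \<Rightarrow> nat) \<Rightarrow> half_edge set" where
  "half_edges a k b = {Ext i |i. i < a} \<union> {Vert v j |v j. v < k \<and> j < b v}"

lemma sum_half_edges: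
  fixes f :: "half_edge \<Rightarrow> 'a multiset"
  shows "sum f (half_edges a k b) = (\<Sum>i<a. f (Ext i)) + (\<Sum>v<k. \<Sum>j<b v. f (Vert v j))"
proof -
  have e: "half_edges a k b = Ext ` {..<a} \<union> (\<lambda>(v, j). Vert v j) ` (SIGMA v:{..<k}. {..<b v})"
    by (auto simp: half_edges_def)
  have "sum f (half_edges a k b) = sum f (Ext ` {..<a}) + sum f ((\<lambda>(v, j). Vert v j) ` (SIGMA v:{..<k}. {..<b v}))"
    unfolding e by (rule sum.union_disjoint) auto
  also have "sum f (Ext ` {..<a}) = (\<Sum>i<a. f (Ext i))"
    by (subst sum.reindex) (auto simp: inj_on_def)
  also have "sum f ((\<lambda>(v, j). Vert v j) ` (SIGMA v:{..<k}. {..<b v})) = (\<Sum>v<k. \<Sum>j<b v. f (Vert v j))"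
    by (subst sum.reindex) (auto simp: inj_on_def sum.Sigma case_prod_beta)
  finally show ?thesis .
qed

text \<open>The default branch means \<Delta>; it would also catch \<open>Eps\<close>, which
  \<open>vtxs\<close> excludes.\<close>

definition vtx :: "sgraph \<Rightarrow> nat \<Rightarrow> vt" where
  "vtx X v = (let t = ivals (snd X) (lab X) v; s = cpt (snd X v) 0 in
     case ccell (snd X v) of Mu \<Rightarrow> VM s (t 0) (t 1) | Htp \<Rightarrow> VH s (t 0) | _ \<Rightarrow> VD (t 0))"

definition vtxs :: "sgraph \<Rightarrow> vt set" where
  "vtxs X = vtx X ` {v. v < g_size (fst X) \<and> ccell (snd X v) \<noteq> Eps}"

definition pars :: "sgraph \<Rightarrow> real multiset" where
  "pars X = image_mset (\<lambda>v. cpt (snd X v) 0) (mset_set {v. v < g_size (fst X) \<and> S_dim (ccell (snd X v)) = 1})"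

lemma mset_vouts_vtx:
  assumes "ccell (snd X v) \<noteq> Eps"
  shows "mset (vouts (vtx X v)) = (\<Sum>j<S_out (ccell (snd X v)).
     {#cell_val (ccell (snd X v)) (cpt (snd X v) 0) j (ivals (snd X) (lab X) v)#})"
  using assms by (cases "ccell (snd X v)") (auto simp: vtx_def Let_def numeral_2_eq_2 lessThan_Suc One_nat_def)

lemma mset_vins_vtx:
  assumes "ccell (snd X v) \<noteq> Eps"
  shows "mset (vins (vtx X v)) = (\<Sum>k<S_in (ccell (snd X v)). {#ivals (snd X) (lab X) v k#})"
  using assms by (cases "ccell (snd X v)") (auto simp: vtx_def Let_def numeral_2_eq_2 lessThan_Suc One_nat_def)

text \<open>The wiring is a bijection from sources to targets that preserves labels, so summing the
  labels over both sides gives the balance equation. The permutations in the decorations merely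
  reorder the half-edges at a vertex, and injectivity of labels makes \<open>vtx X\<close> injective
  off the \<epsilon>'s.\<close>

lemma graph_lin:
  assumes X: "sdg X"
  shows "lin (g_in (fst X)) (mset (outs X) + mset_set (epss X)) (vtxs X)"
    "(\<Sum>v\<in>vtxs X. vpar v) = pars X" "finite (epss X)"
proof -
  interpret sdgraph X "fst X" "snd X" using X by (rule sdgraphI)
  let ?G = "fst X" and ?d = "snd X" and ?g = "lab X"
  define N where "N = {v. v < g_size ?G \<and> ccell (?d v) \<noteq> Eps}"
  define Z where "Z = {v. v < g_size ?G \<and> ccell (?d v) = Eps}"
  have fin: "finite N" "finite Z" by (simp_all add: N_def Z_def)
  have split: "(\<Sum>v<g_size ?G. f v) = (\<Sum>v\<in>N. f v) + (\<Sum>v\<in>Z. f v)" for f :: "nat \<Rightarrow> 'c multiset"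
  proof -
    have "{..<g_size ?G} = N \<union> Z" "N \<inter> Z = {}" by (auto simp: N_def Z_def)
    then show ?thesis using fin by (simp add: sum.union_disjoint)
  qed
  have inj: "inj_on (vtx X) N"
  proof (rule inj_onI)
    fix v w assume vw: "v \<in> N" "w \<in> N" "vtx X v = vtx X w"
    then have "ivals ?d ?g v 0 = ivals ?d ?g w 0"
      by (cases "ccell (?d v)"; cases "ccell (?d w)") (auto simp: vtx_def Let_def N_def)
    moreover have "v < g_size ?G" "w < g_size ?G" using vw by (auto simp: N_def)
    ultimately have "Vert v (inv (cin (?d v)) 0) = Vert w (inv (cin (?d w)) 0)"
      by (intro labelling_inj[OF labelling_lab] ivals_target S_in_pos) (auto simp: ivals_def)
    then show "v = w" by simp
  qed
  have V: "vtxs X = vtx X ` N" by (simp add: vtxs_def N_def)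
  have eps: "mset_set (epss X) = (\<Sum>v\<in>Z. {#?g (Vert v 0)#})"
  proof -
    have "epss X = (\<lambda>v. ?g (Vert v 0)) ` Z" by (auto simp: epss_def eps_set_def Z_def)
    moreover have "inj_on (\<lambda>v. ?g (Vert v 0)) Z"
    proof (rule inj_onI)
      fix v w assume "v \<in> Z" "w \<in> Z" "?g (Vert v 0) = ?g (Vert w 0)"
      then have "Vert v 0 = Vert w 0"
        by (intro labelling_inj[OF labelling_lab] eps_target) (auto simp: Z_def)
      then show "v = w" by simp
    qed
    ultimately show ?thesis
      by (simp add: sum.reindex comp_def flip: sum_multiset_singleton)
  qed
  show "finite (epss X)"
  proof -
    have "epss X = (\<lambda>v. ?g (Vert v 0)) ` Z" by (auto simp: epss_def eps_set_def Z_def)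
    then show ?thesis using fin by simp
  qed
  have s: "sources ?G = half_edges (g_in ?G) (g_size ?G) (v_out ?G)"
    and t: "targets ?G = half_edges (g_out ?G) (g_size ?G) (v_in ?G)"
    by (auto simp: sources_def targets_def half_edges_def)
  have out: "(\<Sum>j<v_out ?G v. {#src_val ?d ?g (Vert v j)#}) = (if v \<in> N then mset (vouts (vtx X v)) else {#})"
    if v: "v < g_size ?G" for v
  proof (cases "v \<in> N")
    case True
    let ?F = "\<lambda>j. {#cell_val (ccell (?d v)) (cpt (?d v) 0) j (ivals ?d ?g v)#}"
    have "sum ?F {..<S_out (ccell (?d v))} = sum (?F \<circ> inv (cout (?d v))) {..<S_out (ccell (?d v))}"
      by (rule sum.permute[OF permutes_inv[OF dec_simps(4)[OF v]]])
    then show ?thesis using True mset_vouts_vtx[of X v] by (simp add: N_def comp_def dec_simps(2)[OF v])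
  next
    case False
    then show ?thesis using v dec_simps(2)[OF v] by (simp add: N_def)
  qed
  have inn: "(\<Sum>i<v_in ?G v. {#?g (Vert v i)#}) = (if v \<in> N then mset (vins (vtx X v)) else {#?g (Vert v 0)#})"
    if v: "v < g_size ?G" for v
  proof (cases "v \<in> N")
    case True
    let ?F = "\<lambda>i. {#?g (Vert v i)#}"
    have "sum ?F {..<S_in (ccell (?d v))} = sum (?F \<circ> inv (cin (?d v))) {..<S_in (ccell (?d v))}"
      by (rule sum.permute[OF permutes_inv[OF dec_simps(5)[OF v]]])
    then show ?thesis using True mset_vins_vtx[of X v] by (simp add: N_def comp_def dec_simps(1)[OF v] ivals_def)
  next
    case False
    then show ?thesis using v dec_simps(1)[OF v] by (simp add: N_def One_nat_def)
  qed
  have "(\<Sum>p\<in>sources ?G. {#src_val ?d ?g p#}) = (\<Sum>q\<in>targets ?G. {#?g q#})"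
    using sum.reindex_bij_betw[OF bij, of "\<lambda>q. {#?g q#}"] labellingD[OF labelling_lab] by simp
  moreover have "(\<Sum>v<g_size ?G. \<Sum>j<v_out ?G v. {#src_val ?d ?g (Vert v j)#}) = (\<Sum>v\<in>N. mset (vouts (vtx X v)))"
  proof -
    have "(\<Sum>v<g_size ?G. \<Sum>j<v_out ?G v. {#src_val ?d ?g (Vert v j)#}) =
        (\<Sum>v<g_size ?G. if v \<in> N then mset (vouts (vtx X v)) else {#})"
      by (rule sum.cong[OF HOL.refl], rule out) simp
    also have "\<dots> = (\<Sum>v\<in>N. mset (vouts (vtx X v)))"
      unfolding split by (simp add: N_def Z_def)
    finally show ?thesis .
  qed
  moreover have "(\<Sum>v<g_size ?G. \<Sum>i<v_in ?G v. {#?g (Vert v i)#}) =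
      (\<Sum>v\<in>N. mset (vins (vtx X v))) + mset_set (epss X)"
  proof -
    have "(\<Sum>v<g_size ?G. \<Sum>i<v_in ?G v. {#?g (Vert v i)#}) =
        (\<Sum>v<g_size ?G. if v \<in> N then mset (vins (vtx X v)) else {#?g (Vert v 0)#})"
      by (rule sum.cong[OF HOL.refl], rule inn) simp
    also have "\<dots> = (\<Sum>v\<in>N. mset (vins (vtx X v))) + (\<Sum>v\<in>Z. {#?g (Vert v 0)#})"
      unfolding split by (simp add: N_def Z_def)
    finally show ?thesis by (simp only: eps)
  qed
  ultimately have "(\<Sum>i<g_in ?G. {#In i#}) + (\<Sum>v\<in>N. mset (vouts (vtx X v))) =
      (\<Sum>j<g_out ?G. {#?g (Ext j)#}) + ((\<Sum>v\<in>N. mset (vins (vtx X v))) + mset_set (epss X))"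
    unfolding s t sum_half_edges by (simp only: src_val.simps(1))
  moreover have re: "(\<Sum>v\<in>vtxs X. f v) = (\<Sum>v\<in>N. f (vtx X v))" for f :: "vt \<Rightarrow> 'c multiset"
    unfolding V using inj by (simp add: sum.reindex)
  moreover have m: "(\<Sum>i<k. {#f i#}) = mset (map f [0..<k])" for k and f :: "nat \<Rightarrow> real tm"
    by (induction k) auto
  ultimately show "lin (g_in ?G) (mset (outs X) + mset_set (epss X)) (vtxs X)"
    unfolding lin_def edge_mset_def re using fin V by (simp add: outs_def m add_ac)
  have "(\<Sum>v\<in>vtxs X. vpar v) = (\<Sum>v\<in>N. vpar (vtx X v))"
    unfolding V using inj by (simp add: sum.reindex)
  also have "\<dots> = (\<Sum>v\<in>N. if S_dim (ccell (?d v)) = 1 then {#cpt (?d v) 0#} else {#})"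
  proof (rule sum.cong)
    fix v assume "v \<in> N"
    then show "vpar (vtx X v) = (if S_dim (ccell (?d v)) = 1 then {#cpt (?d v) 0#} else {#})"
      by (cases "ccell (?d v)") (auto simp: vtx_def Let_def N_def)
  qed simp
  also have "\<dots> = (\<Sum>v\<in>{v. v < g_size ?G \<and> S_dim (ccell (?d v)) = 1}. {#cpt (?d v) 0#})"
  proof -
    have "{v. v < g_size ?G \<and> S_dim (ccell (?d v)) = 1} = N \<inter> {v. S_dim (ccell (?d v)) = 1}"
      by (auto simp: N_def)
    then show ?thesis using fin by (simp add: sum.inter_restrict)
  qed
  also have "\<dots> = pars X"
  proof -
    have "(\<Sum>v\<in>A. {#f v#}) = image_mset f (mset_set A)" if "finite A" for A :: "nat set" and f :: "nat \<Rightarrow> real"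
      using that by (induction rule: finite_induct) auto
    then show ?thesis by (simp add: pars_def)
  qed
  finally show "(\<Sum>v\<in>vtxs X. vpar v) = pars X" .
qed

lemma pars_in: "sdg X \<Longrightarrow> set_mset (pars X) \<subseteq> {0..1}"
proof -
  assume X: "sdg X"
  interpret sdgraph X "fst X" "snd X" using X by (rule sdgraphI)
  have "cpt (snd X v) 0 \<in> {0..1}" if "v < g_size (fst X)" "S_dim (ccell (snd X v)) = 1" for v
    using cube_coord[OF dec_simps(3)[OF that(1)], of 0] that(2) by simp
  then show ?thesis by (auto simp: pars_def)
qed

section \<open>Reduction of graphs\<close>

text \<open>\<open>Z\<close> acts on the first outputs of \<open>X\<close> and the last
  \<open>m\<close> pass through. Up to a permutation of outputs, every single step of the reduction
  is a composite of this form.\<close>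

definition ap :: "sgraph \<Rightarrow> nat \<Rightarrow> sgraph \<Rightarrow> sgraph" where
  "ap Z m X = dgraph_ver (dgraph_hor Z (gI m)) X"

lemma ap:
  assumes Z: "Z \<in> dgraphs \<B> a b" and X: "X \<in> dgraphs \<B> n (a + m)"
  shows "ap Z m X \<in> dgraphs \<B> n (b + m)"
    "outs (ap Z m X) = map (bind (\<lambda>i. outs X ! i)) (outs Z) @ drop a (outs X)"
    "epss (ap Z m X) = epss X \<union> bind (\<lambda>i. outs X ! i) ` epss Z"
proof -
  note h = dgraph_hor[OF Z gI(1), of m]
  note v = dgraph_ver[OF X h(1)]
  show "ap Z m X \<in> dgraphs \<B> n (b + m)" unfolding ap_def by (rule v(1))
  have l: "length (outs X) = a + m" using X by (simp add: dgraphs_iff)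
  have "map (\<lambda>i. outs X ! (a + i)) [0..<m] = drop a (outs X)"
    by (rule nth_equalityI) (use l in auto)
  then show "outs (ap Z m X) = map (bind (\<lambda>i. outs X ! i)) (outs Z) @ drop a (outs X)"
    unfolding ap_def v(2) h(2) gI(2) by (simp add: comp_def)
  show "epss (ap Z m X) = epss X \<union> bind (\<lambda>i. outs X ! i) ` epss Z"
    unfolding ap_def v(3) h(3) gI(3) by simp
qed

lemma ap_gE:
  assumes "X \<in> dgraphs \<B> n (1 + m)" "outs X = t # l"
  shows "ap gE m X \<in> dgraphs \<B> n m" "outs (ap gE m X) = l" "epss (ap gE m X) = insert t (epss X)"
  using ap[OF gE(1) assms(1)] assms(2) by (auto simp: gE One_nat_def)

definition perm_to :: "sgraph \<Rightarrow> real tm list \<Rightarrow> nat \<Rightarrow> (nat \<Rightarrow> nat) \<Rightarrow> bool" where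
  "perm_to X l m \<sigma> \<longleftrightarrow> \<sigma> permutes {..<m} \<and> outs (dgraph_ver (perm_graph m \<sigma>) X) = l"

lemma ver_perm:
  assumes X: "X \<in> dgraphs \<B> n m" and \<sigma>: "\<sigma> permutes {..<m}"
  shows "dgraph_ver (perm_graph m \<sigma>) X \<in> dgraphs \<B> n m"
    "outs (dgraph_ver (perm_graph m \<sigma>) X) = map (\<lambda>j. outs X ! inv \<sigma> j) [0..<m]"
    "epss (dgraph_ver (perm_graph m \<sigma>) X) = epss X"
  using dgraph_ver[OF X dgraph_perm(1)[OF \<sigma>]] by (simp_all add: dgraph_perm[OF \<sigma>] comp_def)

lemma ex_perm_to:
  assumes "X \<in> dgraphs \<B> n m" "mset l = mset (outs X)"
  shows "\<exists>\<sigma>. perm_to X l m \<sigma>"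
proof -
  obtain p where p: "p permutes {..<length (outs X)}" "permute_list p (outs X) = l"
    using mset_eq_permutation[OF assms(2)] by blast
  have m: "length (outs X) = m" using assms(1) by (simp add: dgraphs_iff)
  have "inv p permutes {..<m}" using permutes_inv[OF p(1)] m by simp
  moreover have "inv (inv p) = p" using permutes_bij[OF p(1)] by (rule inv_inv_eq)
  ultimately show ?thesis
    using ver_perm(2)[OF assms(1), of "inv p"] p(2) m by (auto simp: perm_to_def permute_list_def)
qed

text \<open>Fixing 0 and 1 keeps the attaching identities valid. Inner parameters may go anywhere,
  the ends included; this is how faces are reached. Arbitrary functions are allowed since only
  finitely many parameters of a graph are moved.\<close>

definition Theta :: "(real \<Rightarrow> real) set" where
  "Theta = {\<theta>. (\<forall>s\<in>{0..1}. \<theta> s \<in> {0..1}) \<and> \<theta> 0 = 0 \<and> \<theta> 1 = 1}"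

lemma inst_Theta:
  assumes "\<theta> \<in> Theta" "X \<in> dgraphs \<B> n m"
  shows "inst \<theta> X \<in> dgraphs \<B> n m" "outs (inst \<theta> X) = map (map_tm \<theta>) (outs X)"
    "epss (inst \<theta> X) = map_tm \<theta> ` epss X"
  using inst[OF assms(2), of \<theta>] assms(1) by (auto simp: Theta_def)

text \<open>Equality of \<open>cl\<close> alone would compare the graphs at one value of the
  parameters. The cell structure needs one reduction that serves the whole family.\<close>

definition peq :: "sgraph \<Rightarrow> sgraph \<Rightarrow> bool" where
  "peq X Y \<longleftrightarrow> (\<forall>\<theta>\<in>Theta. cl (inst \<theta> X) = cl (inst \<theta> Y))"

lemma peq_refl: "peq X X"
  and peq_sym: "peq X Y \<Longrightarrow> peq Y X"
  and peq_trans: "peq X Y \<Longrightarrow> peq Y Z \<Longrightarrow> peq X Z"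
  by (auto simp: peq_def)

lemma peq_same:
  assumes X: "X \<in> dgraphs \<B> n m" and Y: "Y \<in> dgraphs \<B> n m" and "outs X = outs Y" "epss X = epss Y"
  shows "peq X Y"
  unfolding peq_def
proof
  fix \<theta> assume t: "\<theta> \<in> Theta"
  have "same_terms (inst \<theta> X) (inst \<theta> Y)"
    using inst_Theta[OF t X] inst_Theta[OF t Y] assms by (simp add: same_terms_def dgraphs_iff)
  then show "cl (inst \<theta> X) = cl (inst \<theta> Y)"
    using cl_cong[OF inst_Theta(1)[OF t X] inst_Theta(1)[OF t Y]] by blast
qed

lemma peq_hor:
  assumes X: "X \<in> dgraphs \<B> n m" and Y: "Y \<in> dgraphs \<B> n' m'" and X': "X' \<in> dgraphs \<B> n m"
    and Y': "Y' \<in> dgraphs \<B> n' m'" and "peq X X'" "peq Y Y'"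
  shows "peq (dgraph_hor X Y) (dgraph_hor X' Y')"
  unfolding peq_def inst_comp
proof
  fix \<theta> assume t: "\<theta> \<in> Theta"
  note i = inst_Theta(1)[OF t]
  show "cl (dgraph_hor (inst \<theta> X) (inst \<theta> Y)) = cl (dgraph_hor (inst \<theta> X') (inst \<theta> Y'))"
    using assms(5,6) t cl_hor[OF i[OF X] i[OF Y]] cl_hor[OF i[OF X'] i[OF Y']] by (simp add: peq_def)
qed

lemma peq_ver:
  assumes X: "X \<in> dgraphs \<B> n m" and Y: "Y \<in> dgraphs \<B> m l" and X': "X' \<in> dgraphs \<B> n m"
    and Y': "Y' \<in> dgraphs \<B> m l" and "peq X X'" "peq Y Y'"
  shows "peq (dgraph_ver Y X) (dgraph_ver Y' X')"
  unfolding peq_def inst_comp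
proof
  fix \<theta> assume t: "\<theta> \<in> Theta"
  note i = inst_Theta(1)[OF t]
  show "cl (dgraph_ver (inst \<theta> Y) (inst \<theta> X)) = cl (dgraph_ver (inst \<theta> Y') (inst \<theta> X'))"
    using assms(5,6) t cl_ver[OF i[OF X] i[OF Y]] cl_ver[OF i[OF X'] i[OF Y']] by (simp add: peq_def)
qed

lemma peq_ap:
  assumes "Z \<in> dgraphs \<B> a b" "Z' \<in> dgraphs \<B> a b" "X \<in> dgraphs \<B> n (a + m)" "X' \<in> dgraphs \<B> n (a + m)"
    and "peq Z Z'" "peq X X'"
  shows "peq (ap Z m X) (ap Z' m X')"
proof -
  have "peq (dgraph_hor Z (gI m)) (dgraph_hor Z' (gI m))"
    by (rule peq_hor[OF assms(1) gI(1) assms(2) gI(1) assms(5) peq_refl])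
  then show ?thesis unfolding ap_def
    by (rule peq_ver[OF assms(3) dgraph_hor(1)[OF assms(1) gI(1)] assms(4) dgraph_hor(1)[OF assms(2) gI(1)] assms(6)])
qed

lemma inst_gen: "inst \<theta> (gen c x) = gen c (if S_dim c = 1 then pt1 (\<theta> (x 0)) else x)"
  by (simp add: inst_def gen_def corolla_def inst_pt_def)

lemma cl_inst_gI:
  assumes t: "\<theta> \<in> Theta"
  shows "cl (inst \<theta> (gI n)) = cl (gI n)"
  by (rule cl_cong[OF inst_Theta(1)[OF t gI(1)] gI(1)])
    (use inst_Theta[OF t gI(1), of n] gI[of n] in \<open>simp add: same_terms_def dgraphs_iff comp_def\<close>)

text \<open>A parameter change fixes the parameters 0 and 1 of the attaching identities, and the
  relations with a free parameter hold for every value of it; so all of them are stable.\<close>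

lemma peq_relations:
  "peq (dgraph_ver (dgraph_hor gE gE) gD) gE"
  "s \<in> {0..1} \<Longrightarrow> peq (dgraph_ver gE (gM s)) (dgraph_hor gE gE)"
  "s \<in> {0..1} \<Longrightarrow> peq (dgraph_ver gE (gH s)) gE"
  "peq (gM 0) (dgraph_hor (gI 1) gE)" "peq (gM 1) (dgraph_hor gE (gI 1))"
  "peq (gH 0) (gI 1)" "peq (gH 1) (dgraph_ver (dgraph_hor gE (gI 1)) gD)"
proof -
  note i = inst_Theta(1)
  show "peq (dgraph_ver (dgraph_hor gE gE) gD) gE"
    unfolding peq_def inst_comp by (simp add: inst_gen cl_relations)
  show "peq (dgraph_ver gE (gM s)) (dgraph_hor gE gE)" if "s \<in> {0..1}"
    unfolding peq_def inst_comp using that by (auto simp: inst_gen cl_relations Theta_def)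
  show "peq (dgraph_ver gE (gH s)) gE" if "s \<in> {0..1}"
    unfolding peq_def inst_comp using that by (auto simp: inst_gen cl_relations Theta_def)
  show "peq (gM 0) (dgraph_hor (gI 1) gE)"
    unfolding peq_def inst_comp
  proof
    fix \<theta> assume t: "\<theta> \<in> Theta"
    have "cl (dgraph_hor (inst \<theta> (gI 1)) gE) = cl (dgraph_hor (gI 1) gE)"
      using cl_hor[OF i[OF t gI(1)] gE(1), of 1] cl_hor[OF gI(1) gE(1), of 1] cl_inst_gI[OF t] by simp
    then show "cl (inst \<theta> (gM 0)) = cl (dgraph_hor (inst \<theta> (gI 1)) (inst \<theta> gE))"
      using t by (simp add: inst_gen cl_relations Theta_def)
  qed
  have EI: "cl (dgraph_hor gE (inst \<theta> (gI 1))) = cl (dgraph_hor gE (gI 1))" if t: "\<theta> \<in> Theta" for \<theta>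
    using cl_hor[OF gE(1) i[OF t gI(1)], of 1] cl_hor[OF gE(1) gI(1), of 1] cl_inst_gI[OF t] by simp
  then show "peq (gM 1) (dgraph_hor gE (gI 1))"
    unfolding peq_def inst_comp by (auto simp: inst_gen cl_relations Theta_def)
  show "peq (gH 0) (gI 1)"
    unfolding peq_def using cl_inst_gI by (auto simp: inst_gen cl_relations Theta_def)
  show "peq (gH 1) (dgraph_ver (dgraph_hor gE (gI 1)) gD)"
    unfolding peq_def inst_comp
  proof
    fix \<theta> assume t: "\<theta> \<in> Theta"
    have d: "dgraph_hor gE (inst \<theta> (gI 1)) \<in> dgraphs \<B> 2 1"
      using dgraph_hor(1)[OF gE(1) i[OF t gI(1)], of 1] by simp
    have "cl (dgraph_ver (dgraph_hor gE (inst \<theta> (gI 1))) gD) = cl (dgraph_ver (dgraph_hor gE (gI 1)) gD)"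
      using cl_ver[OF gD(1) d] cl_ver[OF gD(1) dEI] EI[OF t] by simp
    then show "cl (inst \<theta> (gH 1)) = cl (dgraph_ver (dgraph_hor (inst \<theta> gE) (inst \<theta> (gI 1))) (inst \<theta> gD))"
      using t by (simp add: inst_gen cl_relations Theta_def)
  qed
qed

subsection \<open>Realization of linear systems\<close>

fun gv :: "vt \<Rightarrow> sgraph" where
  "gv (VD t) = gD" | "gv (VM s a b) = gM s" | "gv (VH s a) = gH s"

lemma gv_in: "set_mset (vpar v) \<subseteq> {0..1} \<Longrightarrow> gv v \<in> dgraphs \<B> (length (vins v)) (length (vouts v))"
  using gD(1) gM(1) gH(1) by (cases v) (auto simp flip: One_nat_def numeral_2_eq_2)

lemma ap_gv:
  assumes p: "set_mset (vpar v) \<subseteq> {0..1}" and X: "X \<in> dgraphs \<B> n (length (vins v) + length r)"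
    and o: "outs X = vins v @ r"
  shows "ap (gv v) (length r) X \<in> dgraphs \<B> n (length (vouts v) + length r)"
    "outs (ap (gv v) (length r) X) = vouts v @ r" "epss (ap (gv v) (length r) X) = epss X"
proof -
  note a = ap[OF gv_in[OF p] X]
  show "ap (gv v) (length r) X \<in> dgraphs \<B> n (length (vouts v) + length r)" by (rule a(1))
  have t: "map (bind (\<lambda>i. outs X ! i)) (outs (gv v)) = vouts v" "epss (gv v) = {}"
    using o p gM[of "case v of VM s a b \<Rightarrow> s | _ \<Rightarrow> 0"] gH[of "case v of VH s a \<Rightarrow> s | _ \<Rightarrow> 0"] gD
    by (cases v; simp add: One_nat_def)+
  show "outs (ap (gv v) (length r) X) = vouts v @ r" unfolding a(2) t(1) by (simp add: o)
  show "epss (ap (gv v) (length r) X) = epss X" unfolding a(3) t(2) by simp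
qed

abbreviation unit_pars :: "vt set \<Rightarrow> bool" where
  "unit_pars V \<equiv> \<forall>v\<in>V. set_mset (vpar v) \<subseteq> {0..1}"

text \<open>Without vertices the ends are a permutation of the inputs. Otherwise remove a vertex of
  maximal \<open>osz\<close>, realize the rest with the inputs of that vertex in front, apply its
  generator and permute the outputs.\<close>

lemma realize_outs:
  assumes "lin n (mset l) V" "unit_pars V"
  shows "\<exists>X\<in>dgraphs \<B> n (length l). outs X = l \<and> epss X = {}"
  using assms
proof (induction "card V" arbitrary: V l)
  case 0
  then have "V = {}" by (auto simp: lin_def)
  then have m: "mset l = mset (outs (gI n))" using 0 by (simp add: lin_def edge_mset_def gI)
  then have "length l = n" using mset_eq_length[OF m] gI by simp
  obtain \<sigma> where s: "perm_to (gI n) l n \<sigma>" using ex_perm_to[OF gI(1) m] by blast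
  then show ?case
    using ver_perm[OF gI(1), of \<sigma> n] gI(3) \<open>length l = n\<close> by (auto simp: perm_to_def)
next
  case (Suc k)
  then have "V \<noteq> {}" by auto
  then obtain v where v: "v \<in> V" "mset (vouts v) \<subseteq># mset l" using lin_top[OF Suc.prems(1)] by blast
  obtain r where r: "mset r = mset l - mset (vouts v)" using ex_mset by blast
  have "lin n (mset (vins v @ r)) (V - {v})"
    using lin_remove[OF Suc.prems(1) v] by (simp add: r add.commute)
  moreover have "k = card (V - {v})" using Suc.hyps(2) v lin_finite[OF Suc.prems(1)] by simp
  ultimately obtain X where X: "X \<in> dgraphs \<B> n (length (vins v @ r))" "outs X = vins v @ r" "epss X = {}"
    using Suc.hyps(1)[of "V - {v}" "vins v @ r"] Suc.prems(2) by auto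
  have p: "set_mset (vpar v) \<subseteq> {0..1}" using Suc.prems(2) v(1) by blast
  note a = ap_gv[OF p X(1)[unfolded length_append] X(2)]
  have m: "mset l = mset (outs (ap (gv v) (length r) X))"
    unfolding a(2) using r v(2) by simp
  then have len: "length l = length (vouts v) + length r" using mset_eq_length[OF m] a(2) by simp
  obtain \<sigma> where "perm_to (ap (gv v) (length r) X) l (length l) \<sigma>"
    using ex_perm_to[OF a(1) m] len by auto
  then show ?case
    using ver_perm[OF a(1)[folded len], of \<sigma>] a(3) X(3) by (auto simp: perm_to_def)
qed

text \<open>Each end in \<epsilon> is first realized as an additional output and capped
  afterwards.\<close>

lemma realize:
  assumes "finite E" "lin n (mset l + mset_set E) V" "unit_pars V"
  shows "\<exists>X\<in>dgraphs \<B> n (length l). outs X = l \<and> epss X = E"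
  using assms
proof (induction E arbitrary: l rule: finite_induct)
  case empty
  then show ?case using realize_outs by simp
next
  case (insert e E)
  have "lin n (mset (e # l) + mset_set E) V" using insert by simp
  then obtain X where X: "X \<in> dgraphs \<B> n (length (e # l))" "outs X = e # l" "epss X = E"
    using insert by blast
  then have "X \<in> dgraphs \<B> n (1 + length l)" by (simp add: One_nat_def)
  from ap_gE[OF this X(2)] show ?case using X(3) by blast
qed

subsection \<open>Reduced graphs\<close>

text \<open>The set \<open>V\<close> is determined by \<open>X\<close> (\<open>graph_lin\<close>,
  \<open>lin_unique\<close>). Carrying it along shows how the vertices shrink, which bounds the
  inner parameters.\<close>

definition red_graph :: "nat \<Rightarrow> nat \<Rightarrow> sgraph \<Rightarrow> vt set \<Rightarrow> bool" where
  "red_graph n m X V \<longleftrightarrow> X \<in> dgraphs \<B> n m \<and> lin n (mset (outs X) + mset_set (epss X)) V \<and>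
     nondeg V \<and> reduced (epss X)"

lemma finite_epss: "X \<in> dgraphs \<B> n m \<Longrightarrow> finite (epss X)"
  using graph_lin(3) by (simp add: dgraphs_iff)

lemma red_finite_epss: "red_graph n m X V \<Longrightarrow> finite (epss X)"
  unfolding red_graph_def using finite_epss by blast

lemma nondeg_unit: "nondeg V \<Longrightarrow> unit_pars V"
  unfolding nondeg_def by fastforce

text \<open>The smaller graph is realized afresh from the linear system without \<open>v\<close>;
  nothing is cut out of \<open>X\<close>. It is reduced because its \<epsilon>-ends are among the
  old ones.\<close>

lemma red_remove:
  assumes X: "red_graph n m X V" and v: "v \<in> V"
    and eq: "mset (outs X) + mset_set (epss X) = mset (vouts v) + D"
    and new: "mset l + mset_set E = mset (vins v) + D" and E: "E \<subseteq> epss X"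
  shows "\<exists>Y. red_graph n (length l) Y (V - {v}) \<and> outs Y = l \<and> epss Y = E"
proof -
  have L: "lin n (mset (vouts v) + D) V" using X eq by (simp add: red_graph_def)
  have "lin n (mset l + mset_set E) (V - {v})"
    using lin_remove[OF L v] new by (simp add: add.commute)
  moreover have fin: "finite E" using finite_subset[OF E red_finite_epss[OF X]] .
  moreover have nd: "nondeg (V - {v})" using X by (auto simp: red_graph_def nondeg_def)
  ultimately obtain Y where "Y \<in> dgraphs \<B> n (length l)" "outs Y = l" "epss Y = E"
    using realize nondeg_unit by blast
  moreover have "reduced E" using X E by (auto simp: red_graph_def reduced_def)
  ultimately have "red_graph n (length l) Y (V - {v}) \<and> outs Y = l \<and> epss Y = E"
    using \<open>lin n (mset l + mset_set E) (V - {v})\<close> nd by (simp add: red_graph_def)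
  then show ?thesis by blast
qed

lemma red_vertex:
  assumes X: "red_graph n m X V" and "t \<in> set (outs X) \<union> epss X" "t \<in> set (vouts v)"
  shows "v \<in> V"
proof -
  have L: "lin n (mset (outs X) + mset_set (epss X)) V" using X by (simp add: red_graph_def)
  have "t \<in># mset (outs X) + mset_set (epss X)"
    using assms(2) red_finite_epss[OF X] by auto
  then show ?thesis using lin_vertex[OF L _ assms(3)] lin_mem[OF L] by blast
qed

lemma red_not_eps:
  assumes X: "red_graph n m X V" and "t \<in> set (outs X)"
  shows "t \<notin> epss X"
proof
  assume "t \<in> epss X"
  have L: "lin n (mset (outs X) + mset_set (epss X)) V" using X by (simp add: red_graph_def)
  have "count (mset (outs X)) t \<ge> 1" using assms(2) by (simp add: Suc_le_eq One_nat_def)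
  moreover have "count (mset_set (epss X)) t = 1"
    using \<open>t \<in> epss X\<close> red_finite_epss[OF X] by simp
  ultimately show False using lin_count[OF L, of t] by simp
qed

section \<open>Capping outputs of reduced graphs\<close>

lemma cap_simple:
  assumes X: "red_graph n (1 + m) X V" and o: "outs X = t # l" and r: "reduced (insert t (epss X))"
  shows "red_graph n m (ap gE m X) V"
proof -
  have d: "X \<in> dgraphs \<B> n (1 + m)" using X by (simp add: red_graph_def)
  have "mset_set (insert t (epss X)) = add_mset t (mset_set (epss X))"
    using finite_epss[OF d] red_not_eps[OF X, of t] o by simp
  then show ?thesis using ap_gE[OF d o] X r o by (simp add: red_graph_def)
qed

text \<open>A new \<epsilon>-end \<open>t\<close> may complete the outputs of one vertex
  \<open>v\<close>, necessarily the one emitting \<open>t\<close>. A relation then trades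
  \<open>v\<close> for caps on its inputs, which are smaller terms, so the induction is on the size
  of \<open>t\<close> and continues in the reduced graph \<open>X2\<close> without
  \<open>v\<close>.\<close>

lemma cap:
  assumes "red_graph n (1 + m) X V" "outs X = t # l"
  shows "\<exists>Y V'. red_graph n m Y V' \<and> V' \<subseteq> V \<and> outs Y = l \<and> peq (ap gE m X) Y"
  using assms
proof (induction "size t" arbitrary: t X V m l rule: less_induct)
  case less
  note X = less.prems(1) and o = less.prems(2)
  have d: "X \<in> dgraphs \<B> n (1 + m)" using X by (simp add: red_graph_def)
  have "length (outs X) = 1 + m" using d by (simp add: dgraphs_iff)
  then have len: "length l = m" by (simp add: o One_nat_def)
  have red: "reduced (epss X)" using X by (simp add: red_graph_def)
  note aX = ap_gE[OF d o]
  show ?case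
  proof (cases "reduced (insert t (epss X))")
    case True
    then show ?thesis using cap_simple[OF X o True] aX peq_refl by blast
  next
    case False
    then obtain v where v: "set (vouts v) \<subseteq> insert t (epss X)" by (auto simp: reduced_def)
    have tv: "t \<in> set (vouts v)" using v red by (auto simp: reduced_def)
    have vV: "v \<in> V" by (rule red_vertex[OF X _ tv]) (simp add: o)
    have pv: "set_mset (vpar v) \<subseteq> {0..1}" using X vV nondeg_unit by (auto simp: red_graph_def)
    show ?thesis
    proof (cases v)
      \<comment> \<open>By \<epsilon> \<circ> \<mu>_s = \<epsilon> \<odot> \<epsilon> both inputs
        are capped, one after the other. The second cap acts on \<open>Y1\<close>, the reduced
        result of the first.\<close>
      case (VM s a b)
      then have t: "t = Mt s a b" using tv by simp
      obtain X2 where X2: "red_graph n (length (a # b # l)) X2 (V - {v})" "outs X2 = a # b # l" "epss X2 = epss X"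
        using red_remove[OF X vV, of "mset l + mset_set (epss X)" "a # b # l" "epss X"] o VM t by auto
      have s: "s \<in> {0..1}" using pv VM by simp
      have d2: "X2 \<in> dgraphs \<B> n (2 + m)" "X2 \<in> dgraphs \<B> n (1 + (1 + m))"
        using X2(1) len by (auto simp: red_graph_def One_nat_def numeral_2_eq_2)
      note vg = dgraph_ver[OF gM(1)[OF s] gE(1)] and hg = dgraph_hor[OF gE(1) gE(1)]
      have e1: "epss (dgraph_ver gE (gM s)) = {Mt s (In 0) (In 1)}" "outs (dgraph_ver gE (gM s)) = []"
        using vg gM[OF s] gE by simp_all
      have e2: "epss (dgraph_hor gE gE) = {In 0, In 1}" "outs (dgraph_hor gE gE) = []"
        using hg gE by (simp_all add: insert_commute)
      note a1 = ap[OF vg(1) d2(1)] and a2 = ap[OF dEE d2(1)]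
      note b1 = ap_gE[OF d2(2) X2(2)]
      note b2 = ap_gE[OF b1(1,2)]
      have p1: "peq (ap gE m X) (ap (dgraph_ver gE (gM s)) m X2)"
        by (rule peq_same[OF aX(1)]) (use a1 aX e1 X2 t in \<open>auto simp: One_nat_def numeral_2_eq_2\<close>)
      have p2: "peq (ap (dgraph_ver gE (gM s)) m X2) (ap (dgraph_hor gE gE) m X2)"
        by (rule peq_ap[OF vg(1) dEE d2(1) d2(1) peq_relations(2)[OF s] peq_refl])
      have p3: "peq (ap (dgraph_hor gE gE) m X2) (ap gE m (ap gE (1 + m) X2))"
        by (rule peq_same[OF _ b2(1)]) (use a2 b1 b2 e2 X2 in \<open>auto simp: One_nat_def numeral_2_eq_2\<close>)
      obtain Y1 V1 where Y1: "red_graph n (1 + m) Y1 V1" "V1 \<subseteq> V - {v}" "outs Y1 = b # l" "peq (ap gE (1 + m) X2) Y1"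
        using less.hyps[of a "1 + m" X2 "V - {v}" "b # l"] X2 t len by (auto simp: One_nat_def)
      obtain Y2 V2 where Y2: "red_graph n m Y2 V2" "V2 \<subseteq> V1" "outs Y2 = l" "peq (ap gE m Y1) Y2"
        using less.hyps[of b m Y1 V1 l] Y1 t by auto
      have "Y1 \<in> dgraphs \<B> n (1 + m)" using Y1(1) by (simp add: red_graph_def)
      from peq_ap[OF gE(1) gE(1) b1(1) this peq_refl Y1(4)]
      have "peq (ap gE m X) Y2" using p1 p2 p3 Y2(4) peq_trans by blast
      then show ?thesis using Y1 Y2 by blast
    next
      \<comment> \<open>By \<epsilon> \<circ> h_s = \<epsilon> the cap moves to the input.\<close>
      case (VH s a)
      then have t: "t = Ht s a" using tv by simp
      obtain X2 where X2: "red_graph n (length (a # l)) X2 (V - {v})" "outs X2 = a # l" "epss X2 = epss X"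
        using red_remove[OF X vV, of "mset l + mset_set (epss X)" "a # l" "epss X"] o VH t by auto
      have s: "s \<in> {0..1}" using pv VH by simp
      have d2: "X2 \<in> dgraphs \<B> n (1 + m)" using X2(1) len by (auto simp: red_graph_def One_nat_def)
      note vg = dgraph_ver[OF gH(1)[OF s] gE(1)]
      have e1: "epss (dgraph_ver gE (gH s)) = {Ht s (In 0)}" "outs (dgraph_ver gE (gH s)) = []"
        using vg gH[OF s] gE by simp_all
      note a1 = ap[OF vg(1) d2]
      have p1: "peq (ap gE m X) (ap (dgraph_ver gE (gH s)) m X2)"
        by (rule peq_same[OF aX(1)]) (use a1 aX e1 X2 t in \<open>auto simp: One_nat_def\<close>)
      have p2: "peq (ap (dgraph_ver gE (gH s)) m X2) (ap gE m X2)"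
        by (rule peq_ap[OF vg(1) gE(1) d2 d2 peq_relations(3)[OF s] peq_refl])
      obtain Y V' where "red_graph n m Y V'" "V' \<subseteq> V - {v}" "outs Y = l" "peq (ap gE m X2) Y"
        using less.hyps[of a m X2 "V - {v}" l] X2 t len by (auto simp: One_nat_def)
      then show ?thesis using p1 p2 peq_trans by blast
    next
      \<comment> \<open>The sibling output \<open>u\<close> already ends in \<epsilon>. The relation
        (\<epsilon> \<odot> \<epsilon>) \<circ> \<Delta> = \<epsilon> removes this end together with
        \<open>t\<close>, leaving one cap on the input.\<close>
      case (VD a)
      define u where "u = (if t = Lt a then Rt a else Lt a)"
      have "t = Lt a \<or> t = Rt a" using tv VD by simp
      then have u: "{t, u} = {Lt a, Rt a}" "t \<noteq> u" "mset (vouts v) = {#t, u#}" "size a < size t"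
        by (auto simp: u_def VD)
      have "u \<in> set (vouts v)" using u(1) VD by auto
      then have uE: "u \<in> epss X" using v u(2) by auto
      have tE: "t \<notin> epss X" using red_not_eps[OF X] o by simp
      have "mset_set (epss X) = add_mset u (mset_set (epss X - {u}))"
        using uE finite_epss[OF d] by (simp add: mset_set.remove)
      then obtain X2 where X2: "red_graph n (length (a # l)) X2 (V - {v})" "outs X2 = a # l" "epss X2 = epss X - {u}"
        using red_remove[OF X vV, of "mset l + mset_set (epss X - {u})" "a # l" "epss X - {u}"] o VD u(3) by auto
      have d2: "X2 \<in> dgraphs \<B> n (1 + m)" using X2(1) len by (auto simp: red_graph_def One_nat_def)
      note vg = dgraph_ver[OF gD(1) dEE]
      have e1: "epss (dgraph_ver (dgraph_hor gE gE) gD) = {Lt (In 0), Rt (In 0)}"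
        "outs (dgraph_ver (dgraph_hor gE gE) gD) = []"
        using vg dgraph_hor[OF gE(1) gE(1)] gD gE by (simp_all add: One_nat_def insert_commute)
      note a1 = ap[OF vg(1) d2]
      have "bind (\<lambda>i. outs X2 ! i) ` epss (dgraph_ver (dgraph_hor gE gE) gD) = {t, u}"
        unfolding e1(1) u(1) by (simp add: X2(2))
      then have "epss (ap (dgraph_ver (dgraph_hor gE gE) gD) m X2) = epss X - {u} \<union> {t, u}"
        using a1(3) X2(3) by simp
      then have p1: "peq (ap gE m X) (ap (dgraph_ver (dgraph_hor gE gE) gD) m X2)"
        by (intro peq_same[OF aX(1)]) (use a1 aX e1 X2 uE in \<open>auto simp: One_nat_def\<close>)
      have p2: "peq (ap (dgraph_ver (dgraph_hor gE gE) gD) m X2) (ap gE m X2)"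
        by (rule peq_ap[OF vg(1) gE(1) d2 d2 peq_relations(1) peq_refl])
      obtain Y V' where "red_graph n m Y V'" "V' \<subseteq> V - {v}" "outs Y = l" "peq (ap gE m X2) Y"
        using less.hyps[of a m X2 "V - {v}" l] X2 len u(4) by (auto simp: One_nat_def)
      then show ?thesis using p1 p2 peq_trans by blast
    qed
  qed
qed

text \<open>\<open>Y\<close> is a reduced form of \<open>X\<close>, so its outputs may carry other
  terms. The caps are matched by position, which is why \<open>e\<close> constrains the outputs of
  \<open>X\<close> only.\<close>

lemma caps:
  assumes "red_graph n (length e + m) Y V" "X \<in> dgraphs \<B> n (length e + m)" "peq X Y" "outs X = e @ l"
    and "Z \<in> dgraphs \<B> n m" "outs Z = l" "epss Z = epss X \<union> set e"
  shows "\<exists>Y' V'. red_graph n m Y' V' \<and> V' \<subseteq> V \<and> peq Z Y'"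
  using assms(1-4,7)
proof (induction e arbitrary: X Y V)
  case Nil
  then have "peq Z X" by (intro peq_same[OF assms(5)]) (use assms(6) in auto)
  then show ?case using Nil peq_trans by (metis add_0 list.size(3) order_refl)
next
  case (Cons t e)
  have d: "X \<in> dgraphs \<B> n (1 + (length e + m))" "red_graph n (1 + (length e + m)) Y V"
    using Cons.prems by (simp_all add: One_nat_def)
  then have dY: "Y \<in> dgraphs \<B> n (1 + (length e + m))" by (simp add: red_graph_def)
  then obtain t' l' where o: "outs Y = t' # l'" by (cases "outs Y") (auto simp: dgraphs_iff dest: arg_cong[where f = length])
  note a = ap_gE[OF d(1), of t "e @ l"]
  obtain Y1 V1 where Y1: "red_graph n (length e + m) Y1 V1" "V1 \<subseteq> V" "peq (ap gE (length e + m) Y) Y1"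
    using cap[OF d(2) o] by blast
  have "peq (ap gE (length e + m) X) (ap gE (length e + m) Y)"
    by (rule peq_ap[OF gE(1) gE(1) d(1) dY peq_refl Cons.prems(3)])
  then have "peq (ap gE (length e + m) X) Y1" using Y1(3) peq_trans by blast
  then have "\<exists>Y' V'. red_graph n m Y' V' \<and> V' \<subseteq> V1 \<and> peq Z Y'"
    by (intro Cons.IH[OF Y1(1)]) (use a Cons.prems in auto)
  then show ?case using Y1(2) by blast
qed

text \<open>Its size will bound the dimension of the cell containing a given point, so the reduction
  must never enlarge it.\<close>

definition inner_pars :: "vt set \<Rightarrow> real multiset" where
  "inner_pars V = filter_mset (\<lambda>s. s \<noteq> 0 \<and> s \<noteq> 1) (\<Sum>v\<in>V. vpar v)"

lemma inner_pars_mono: "\<lbrakk>V' \<subseteq> V; finite V\<rbrakk> \<Longrightarrow> inner_pars V' \<subseteq># inner_pars V"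
  unfolding inner_pars_def by (intro multiset_filter_mono) (simp add: sum.subset_diff)

lemma inner_pars_insert:
  "\<lbrakk>v \<notin> V; finite V\<rbrakk> \<Longrightarrow> inner_pars (insert v V) = filter_mset (\<lambda>s. s \<noteq> 0 \<and> s \<noteq> 1) (vpar v) + inner_pars V"
  by (simp add: inner_pars_def)

lemma red_finite: "red_graph n m X V \<Longrightarrow> finite V"
  by (auto simp: red_graph_def lin_def)

lemma red_extend:
  assumes Y: "red_graph n (length (vins v) + k) Y V" and o: "outs Y = vins v @ r"
    and p: "set_mset (vpar v) \<subseteq> {0<..<1}"
  shows "red_graph n (length (vouts v) + k) (ap (gv v) k Y) (insert v V)" "v \<notin> V"
proof -
  have p': "set_mset (vpar v) \<subseteq> {0..1}" using p by fastforce
  have d: "Y \<in> dgraphs \<B> n (length (vins v) + k)" using Y by (simp add: red_graph_def)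
  then have k: "k = length r" using o by (simp add: dgraphs_iff) (metis add_left_cancel length_append length_outs)
  note a = ap_gv[OF p' d[unfolded k] o, folded k]
  have L: "lin n (mset (vins v) + (mset r + mset_set (epss Y))) V"
    using Y o by (simp add: red_graph_def add.assoc)
  show "v \<notin> V" by (rule lin_insert(2)[OF L])
  show "red_graph n (length (vouts v) + k) (ap (gv v) k Y) (insert v V)"
    using a lin_insert(1)[OF L] Y p by (simp add: red_graph_def nondeg_def add.assoc)
qed

lemma red_perm:
  assumes Y: "red_graph n m Y V" and \<sigma>: "\<sigma> permutes {..<m}"
  shows "red_graph n m (dgraph_ver (perm_graph m \<sigma>) Y) V"
proof -
  have d: "Y \<in> dgraphs \<B> n m" using Y by (simp add: red_graph_def)
  have m: "length (outs Y) = m" using d by (simp add: dgraphs_iff)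
  have "outs (dgraph_ver (perm_graph m \<sigma>) Y) = permute_list (inv \<sigma>) (outs Y)"
    unfolding ver_perm(2)[OF d \<sigma>] permute_list_def m ..
  then have "mset (outs (dgraph_ver (perm_graph m \<sigma>) Y)) = mset (outs Y)"
    using mset_permute_list[of "inv \<sigma>" "outs Y"] permutes_inv[OF \<sigma>] m by simp
  then show ?thesis using Y ver_perm(1,3)[OF d \<sigma>] by (simp add: red_graph_def)
qed

text \<open>A vertex with inner parameter, or a \<Delta>, is simply added: the set of
  \<epsilon>-ends is unchanged, so the graph stays reduced. For parameter 0 or 1 the attaching map
  replaces the vertex by something with at most one cap, which \<open>cap\<close> then
  removes.\<close>

lemma red_step:
  assumes Y: "red_graph n (length (vins v) + k) Y V" and p: "set_mset (vpar v) \<subseteq> {0..1}"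
  shows "\<exists>Y' V'. red_graph n (length (vouts v) + k) Y' V' \<and> peq (ap (gv v) k Y) Y' \<and>
     inner_pars V' \<subseteq># filter_mset (\<lambda>s. s \<noteq> 0 \<and> s \<noteq> 1) (vpar v) + inner_pars V"
proof -
  have d: "Y \<in> dgraphs \<B> n (length (vins v) + k)" using Y by (simp add: red_graph_def)
  then have len: "length (outs Y) = length (vins v) + k" by (simp add: dgraphs_iff)
  \<comment> \<open>The inputs recorded in \<open>v\<close> are terms of the unreduced graph.
    \<open>w\<close> is the same generator applied to the terms that \<open>Y\<close> really
    has.\<close>
  have nondeg: ?thesis if "vins w = take (length (vins v)) (outs Y)" "gv w = gv v" "vpar w = vpar v"
    "length (vouts w) = length (vouts v)" "set_mset (vpar v) \<subseteq> {0<..<1}" for w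
  proof -
    have l: "length (vins w) = length (vins v)" using that(1) len by simp
    have o: "outs Y = vins w @ drop (length (vins v)) (outs Y)" using that(1) by simp
    have "red_graph n (length (vouts v) + k) (ap (gv v) k Y) (insert w V)" "w \<notin> V"
      using red_extend[of n w k Y V, OF _ o] Y l that by simp_all
    then show ?thesis
      using inner_pars_insert[of w V] red_finite[OF Y] that(3) peq_refl
      by (metis subset_mset.order_refl)
  qed
  show ?thesis
  proof (cases v)
    case (VD t)
    obtain a r where o: "outs Y = a # r" using len VD by (cases "outs Y") auto
    show ?thesis by (rule nondeg[of "VD a"]) (simp_all add: VD o)
  next
    case (VM s t u)
    obtain a b r where o: "outs Y = a # b # r" using len VM by (cases "outs Y"; cases "tl (outs Y)") auto
    have r: "length r = k" using len VM o by simp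
    have d2: "Y \<in> dgraphs \<B> n (2 + k)" using d VM by (simp add: numeral_2_eq_2)
    have IE: "dgraph_hor (gI 1) gE \<in> dgraphs \<B> 2 1"
      using dgraph_hor(1)[OF gI(1) gE(1), of 1] by simp
    consider "s = 0" | "s = 1" | "s \<in> {0<..<1}" using p VM by fastforce
    then show ?thesis
    proof cases
      case 1
      \<comment> \<open>The map \<mu>_0 = id \<odot> \<epsilon> caps the second input, whereas
        \<open>cap\<close> acts on the first output; hence the transposition.\<close>
      obtain \<sigma> where \<sigma>: "perm_to Y (b # a # r) (2 + k) \<sigma>"
        using ex_perm_to[OF d2, of "b # a # r"] o by auto
      define Y' where "Y' = dgraph_ver (perm_graph (2 + k) \<sigma>) Y"
      have sp: "\<sigma> permutes {..<2 + k}" and oY': "outs Y' = b # a # r" using \<sigma> by (auto simp: perm_to_def Y'_def)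
      have "red_graph n (2 + k) Y V" using Y VM by (simp add: numeral_2_eq_2)
      then have Y': "red_graph n (2 + k) Y' V" unfolding Y'_def by (rule red_perm[OF _ sp])
      then have Y'2: "red_graph n (1 + (1 + k)) Y' V" by (simp add: One_nat_def)
      then have d': "Y' \<in> dgraphs \<B> n (1 + (1 + k))" by (simp add: red_graph_def)
      have eY': "epss Y' = epss Y" unfolding Y'_def by (rule ver_perm(3)[OF d2 sp])
      obtain Z W where Z: "red_graph n (1 + k) Z W" "W \<subseteq> V" "peq (ap gE (1 + k) Y') Z"
        using cap[OF Y'2 oY'] by blast
      have p1: "peq (ap (gM 0) k Y) (ap (dgraph_hor (gI 1) gE) k Y)"
        by (rule peq_ap[OF gM(1) IE d2 d2 peq_relations(4) peq_refl]) simp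
      have p2: "peq (ap (dgraph_hor (gI 1) gE) k Y) (ap gE (1 + k) Y')"
        by (rule peq_same[OF ap(1)[OF IE d2] ap_gE(1)[OF d' oY']])
          (use ap[OF IE d2] ap_gE[OF d' oY'] eY' o dgraph_hor[OF gI(1) gE(1), of 1] in
            \<open>simp_all add: gI gE upt_conv_Cons One_nat_def numeral_2_eq_2\<close>)
      have "peq (ap (gv v) k Y) Z" using peq_trans[OF p1 peq_trans[OF p2 Z(3)]] VM 1 by simp
      then show ?thesis using Z(1) VM 1 inner_pars_mono[OF Z(2) red_finite[OF Y]]
        by (intro exI[of _ Z] exI[of _ W]) (simp add: One_nat_def)
    next
      case 2
      have Y2: "red_graph n (1 + (1 + k)) Y V" using Y VM by (simp add: One_nat_def)
      then have d': "Y \<in> dgraphs \<B> n (1 + (1 + k))" by (simp add: red_graph_def)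
      obtain Z W where Z: "red_graph n (1 + k) Z W" "W \<subseteq> V" "peq (ap gE (1 + k) Y) Z"
        using cap[OF Y2 o] by blast
      have p1: "peq (ap (gM 1) k Y) (ap (dgraph_hor gE (gI 1)) k Y)"
        by (rule peq_ap[OF gM(1) dEI d2 d2 peq_relations(5) peq_refl]) simp
      have p2: "peq (ap (dgraph_hor gE (gI 1)) k Y) (ap gE (1 + k) Y)"
        by (rule peq_same[OF ap(1)[OF dEI d2] ap_gE(1)[OF d' o]])
          (use ap[OF dEI d2] ap_gE[OF d' o] o dgraph_hor[OF gE(1) gI(1), of 1] in
            \<open>simp_all add: gI gE upt_conv_Cons One_nat_def numeral_2_eq_2\<close>)
      have "peq (ap (gv v) k Y) Z" using peq_trans[OF p1 peq_trans[OF p2 Z(3)]] VM 2 by simp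
      then show ?thesis using Z(1) VM 2 inner_pars_mono[OF Z(2) red_finite[OF Y]]
        by (intro exI[of _ Z] exI[of _ W]) (simp add: One_nat_def)
    next
      case 3
      show ?thesis by (rule nondeg[of "VM s a b"]) (use VM o 3 in \<open>simp_all add: numeral_2_eq_2\<close>)
    qed
  next
    case (VH s t)
    obtain a r where o: "outs Y = a # r" using len VH by (cases "outs Y") auto
    have r: "length r = k" using len VH o by simp
    have d1: "Y \<in> dgraphs \<B> n (1 + k)" and Y1: "red_graph n (1 + k) Y V" using d Y VH by (simp_all add: One_nat_def)
    consider "s = 0" | "s = 1" | "s \<in> {0<..<1}" using p VH by fastforce
    then show ?thesis
    proof cases
      case 1
      have p1: "peq (ap (gH 0) k Y) (ap (gI 1) k Y)"
        by (rule peq_ap[OF gH(1) gI(1) d1 d1 peq_relations(6) peq_refl]) simp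
      have p2: "peq (ap (gI 1) k Y) Y"
        by (rule peq_same[OF ap(1)[OF gI(1) d1] d1])
          (use ap[OF gI(1) d1] o in \<open>simp_all add: gI upt_conv_Cons One_nat_def\<close>)
      have "peq (ap (gv v) k Y) Y" using peq_trans[OF p1 p2] VH 1 by simp
      then show ?thesis using Y1 VH 1
        by (intro exI[of _ Y] exI[of _ V]) (simp add: One_nat_def)
    next
      case 2
      \<comment> \<open>For h_1 = (\<epsilon> \<odot> id) \<circ> \<Delta> insert a \<Delta>, which
        has no parameter, and cap its left output.\<close>
      let ?D = "ap gD k Y"
      have g: "gv (VD a) = gD" by simp
      have D: "red_graph n (2 + k) ?D (insert (VD a) V)" "VD a \<notin> V"
        using red_extend[of n "VD a" k Y V r] Y1 o by (simp_all add: numeral_2_eq_2 One_nat_def)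
      then have D2: "red_graph n (1 + (1 + k)) ?D (insert (VD a) V)" by (simp add: One_nat_def)
      then have dD: "?D \<in> dgraphs \<B> n (1 + (1 + k))" by (simp add: red_graph_def)
      have oD: "outs ?D = Lt a # Rt a # r" "epss ?D = epss Y"
        using ap_gv[of "VD a" Y n r] d1 o r by (simp_all add: One_nat_def)
      note vg = dgraph_ver[OF gD(1) dEI]
      obtain Z W where Z: "red_graph n (1 + k) Z W" "W \<subseteq> insert (VD a) V" "peq (ap gE (1 + k) ?D) Z"
        using cap[OF D2 oD(1)] by blast
      have p1: "peq (ap (gH 1) k Y) (ap (dgraph_ver (dgraph_hor gE (gI 1)) gD) k Y)"
        by (rule peq_ap[OF gH(1) vg(1) d1 d1 peq_relations(7) peq_refl]) simp
      have p2: "peq (ap (dgraph_ver (dgraph_hor gE (gI 1)) gD) k Y) (ap gE (1 + k) ?D)"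
        by (rule peq_same[OF ap(1)[OF vg(1) d1] ap_gE(1)[OF dD oD(1)]])
          (use ap[OF vg(1) d1] ap_gE[OF dD oD(1)] o oD(2) vg dgraph_hor[OF gE(1) gI(1), of 1] in
            \<open>simp_all add: gI gE gD upt_conv_Cons One_nat_def\<close>)
      have "peq (ap (gv v) k Y) Z" using peq_trans[OF p1 peq_trans[OF p2 Z(3)]] VH 2 by simp
      moreover have "inner_pars W \<subseteq># inner_pars V"
        using inner_pars_mono[OF Z(2)] inner_pars_insert[OF D(2)] red_finite[OF Y] by simp
      ultimately show ?thesis using Z(1) VH 2
        by (intro exI[of _ Z] exI[of _ W]) (simp add: One_nat_def)
    next
      case 3
      show ?thesis by (rule nondeg[of "VH s a"]) (use VH o 3 in simp_all)
    qed
  qed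
qed

text \<open>Take off a top vertex \<open>v\<close>. What remains is realized as \<open>X0\<close>
  with all ends, those in \<epsilon> included, as ordinary outputs; reduce it by induction, put
  \<open>v\<close> back with \<open>red_step\<close>, and finally cap the outputs that are
  \<epsilon>-ends of \<open>X\<close>.\<close>

lemma reduce_lin:
  assumes "X \<in> dgraphs \<B> n m" "lin n (mset (outs X) + mset_set (epss X)) V" "unit_pars V"
  shows "\<exists>Y V'. red_graph n m Y V' \<and> peq X Y \<and> inner_pars V' \<subseteq># inner_pars V"
  using assms
proof (induction "card V" arbitrary: V X m)
  case 0
  then have V: "V = {}" by (auto simp: lin_def)
  have "reduced (epss X)"
    unfolding reduced_def
  proof (intro allI notI)
    fix v assume "set (vouts v) \<subseteq> epss X"
    then have "hd (vouts v) \<in> epss X" using vouts_hd by blast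
    then have "hd (vouts v) \<in># edge_mset n V"
      using lin_mem[OF 0(3)] finite_epss[OF 0(2)] by auto
    then show False using lin_vertex[OF 0(3) _ vouts_hd] V by blast
  qed
  then have "red_graph n m X V" using 0 V by (simp add: red_graph_def nondeg_def)
  then show ?case using peq_refl by blast
next
  case (Suc c)
  note d = Suc.prems(1) and L = Suc.prems(2)
  have "V \<noteq> {}" using Suc.hyps(2) by auto
  then obtain v where v: "v \<in> V" "mset (vouts v) \<subseteq># mset (outs X) + mset_set (epss X)" using lin_top[OF L] by blast
  obtain r where r: "mset r = mset (outs X) + mset_set (epss X) - mset (vouts v)" using ex_mset by blast
  have L0: "lin n (mset (vins v @ r)) (V - {v})"
    using lin_remove[OF L v] by (simp add: r add.commute)
  have p: "set_mset (vpar v) \<subseteq> {0..1}" "unit_pars (V - {v})" using Suc.prems(3) v(1) by blast+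
  obtain X0 where X0: "X0 \<in> dgraphs \<B> n (length (vins v) + length r)" "outs X0 = vins v @ r" "epss X0 = {}"
    using realize_outs[OF L0 p(2)] by auto
  have c: "c = card (V - {v})" using Suc.hyps(2) v lin_finite[OF L] by simp
  have "lin n (mset (outs X0) + mset_set (epss X0)) (V - {v})" using L0 X0 by simp
  from Suc.hyps(1)[OF c X0(1) this p(2)]
  obtain Y0 V0 where Y0: "red_graph n (length (vins v) + length r) Y0 V0" "peq X0 Y0"
      "inner_pars V0 \<subseteq># inner_pars (V - {v})" by blast
  obtain Y1 V1 where Y1: "red_graph n (length (vouts v) + length r) Y1 V1" "peq (ap (gv v) (length r) Y0) Y1"
      "inner_pars V1 \<subseteq># filter_mset (\<lambda>s. s \<noteq> 0 \<and> s \<noteq> 1) (vpar v) + inner_pars V0"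
    using red_step[OF Y0(1) p(1)] by blast
  let ?X1 = "ap (gv v) (length r) X0"
  note a = ap_gv[OF p(1) X0(1,2)]
  have "Y0 \<in> dgraphs \<B> n (length (vins v) + length r)" using Y0(1) by (simp add: red_graph_def)
  from peq_ap[OF gv_in[OF p(1)] gv_in[OF p(1)] X0(1) this peq_refl Y0(2)]
  have pe1: "peq ?X1 Y1" using Y1(2) peq_trans by blast
  obtain e where e: "set e = epss X" "distinct e" using finite_distinct_list[OF finite_epss[OF d]] by blast
  have me: "mset e = mset_set (epss X)" using e by (simp add: mset_set_set[symmetric])
  have meq: "mset (e @ outs X) = mset (outs ?X1)"
    unfolding a(2) using v(2) r me by (simp add: add.commute)
  have len: "length (vouts v) + length r = length e + m"
    using mset_eq_length[OF meq] a(2) d by (simp add: dgraphs_iff)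
  obtain \<sigma> where \<sigma>: "perm_to ?X1 (e @ outs X) (length e + m) \<sigma>"
    using ex_perm_to[OF a(1)[unfolded len] meq] by blast
  then have sp: "\<sigma> permutes {..<length e + m}" by (simp add: perm_to_def)
  let ?P = "perm_graph (length e + m) \<sigma>"
  have d1: "?X1 \<in> dgraphs \<B> n (length e + m)" using a(1) len by simp
  have Y1': "red_graph n (length e + m) Y1 V1" using Y1(1) len by simp
  then have dY1: "Y1 \<in> dgraphs \<B> n (length e + m)" by (simp add: red_graph_def)
  have pe2: "peq (dgraph_ver ?P ?X1) (dgraph_ver ?P Y1)"
    by (rule peq_ver[OF d1 dgraph_perm(1)[OF sp] dY1 dgraph_perm(1)[OF sp] pe1 peq_refl])
  have "\<exists>Y' V'. red_graph n m Y' V' \<and> V' \<subseteq> V1 \<and> peq X Y'"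
  proof (rule caps[OF red_perm[OF Y1' sp] ver_perm(1)[OF d1 sp] pe2 _ d])
    show "outs (dgraph_ver ?P ?X1) = e @ outs X" using \<sigma> by (simp add: perm_to_def)
    show "epss X = epss (dgraph_ver ?P ?X1) \<union> set e" using ver_perm(3)[OF d1 sp] a(3) X0(3) e by simp
  qed simp
  then obtain Y' V' where Y': "red_graph n m Y' V'" "V' \<subseteq> V1" "peq X Y'" by blast
  have "inner_pars V' \<subseteq># inner_pars V1" by (rule inner_pars_mono[OF Y'(2) red_finite[OF Y1(1)]])
  also have "\<dots> \<subseteq># filter_mset (\<lambda>s. s \<noteq> 0 \<and> s \<noteq> 1) (vpar v) + inner_pars (V - {v})"
    using Y1(3) Y0(3) by (meson subset_mset.add_left_mono subset_mset.order_trans)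
  also have "\<dots> = inner_pars V"
    using inner_pars_insert[of v "V - {v}"] lin_finite[OF L] v(1) by (simp add: insert_absorb)
  finally show ?case using Y' by blast
qed

lemma reduce:
  assumes X: "X \<in> dgraphs \<B> n m"
  obtains Y where "red_graph n m Y (vtxs Y)" "peq X Y"
    "pars Y \<subseteq># filter_mset (\<lambda>s. s \<noteq> 0 \<and> s \<noteq> 1) (pars X)"
proof -
  have sX: "sdg X" and n: "g_in (fst X) = n" using X by (simp_all add: dgraphs_iff)
  have "unit_pars (vtxs X)"
  proof
    fix v assume "v \<in> vtxs X"
    moreover have "finite (vtxs X)" using lin_finite[OF graph_lin(1)[OF sX]] .
    ultimately have "vpar v \<subseteq># pars X"
      unfolding graph_lin(2)[OF sX, symmetric] by (simp add: sum.remove)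
    then show "set_mset (vpar v) \<subseteq> {0..1}" using pars_in[OF sX] set_mset_mono by blast
  qed
  from reduce_lin[OF X graph_lin(1)[OF sX, unfolded n] this]
  obtain Y V' where Y: "red_graph n m Y V'" "peq X Y" "inner_pars V' \<subseteq># inner_pars (vtxs X)" by blast
  have sY: "sdg Y" "g_in (fst Y) = n" using Y(1) by (simp_all add: red_graph_def dgraphs_iff)
  have V': "V' = vtxs Y"
    using lin_unique[OF _ graph_lin(1)[OF sY(1), unfolded sY(2)]] Y(1) by (simp add: red_graph_def)
  have "s \<noteq> 0 \<and> s \<noteq> 1" if "s \<in># pars Y" for s
  proof -
    have fin: "finite (vtxs Y)" using red_finite[OF Y(1)] V' by simp
    have "set_mset (\<Sum>v\<in>V. vpar v) = (\<Union>v\<in>V. set_mset (vpar v))" if "finite V" for V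
      using that by (induction rule: finite_induct) auto
    then have "s \<in> (\<Union>v\<in>vtxs Y. set_mset (vpar v))" using that graph_lin(2)[OF sY(1)] fin by metis
    then show ?thesis using Y(1) unfolding V' red_graph_def nondeg_def by fastforce
  qed
  then have "inner_pars (vtxs Y) = pars Y"
    unfolding inner_pars_def graph_lin(2)[OF sY(1)] by (simp add: filter_mset_eq_conv)
  then show ?thesis using that[of Y] Y V' by (simp add: inner_pars_def graph_lin(2)[OF sX])
qed

subsection \<open>Completeness\<close>

lemma id_Theta: "id \<in> Theta"
  by (simp add: Theta_def)

lemma cl_inst_id:
  assumes "X \<in> dgraphs \<B> n m"
  shows "cl (inst id X) = cl X"
  by (rule cl_cong[OF inst_Theta(1)[OF id_Theta assms] assms])
    (use inst_Theta[OF id_Theta assms] assms in \<open>simp add: same_terms_def dgraphs_iff tm.map_id0\<close>)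

lemma peq_cl: "\<lbrakk>X \<in> dgraphs \<B> n m; Y \<in> dgraphs \<B> n' m'; peq X Y\<rbrakk> \<Longrightarrow> cl X = cl Y"
  using cl_inst_id id_Theta by (metis peq_def)

lemma red_ev:
  assumes "red_graph n m X V"
  shows "ev X = (n, outs X)" "t \<in> set (outs X) \<Longrightarrow> set_tm t \<subseteq> {0<..<1}"
proof -
  have L: "lin n (mset (outs X) + mset_set (epss X)) V" "nondeg V" using assms by (simp_all add: red_graph_def)
  have "norm t = t \<and> set_tm t \<subseteq> {0<..<1}" if "t \<in> set (outs X)" for t
    by (rule lin_norm[OF L]) (use that lin_mem[OF L(1)] in auto)
  then show "ev X = (n, outs X)" "t \<in> set (outs X) \<Longrightarrow> set_tm t \<subseteq> {0<..<1}"
    using assms by (auto simp: ev_def red_graph_def dgraphs_iff intro: map_idI)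
qed

lemma red_alive:
  assumes "red_graph n m X V" "v \<in> V"
  shows "\<exists>t\<in>set (vouts v). t \<in> \<Union> (sub ` set (outs X))"
proof (rule lin_alive[OF _ _ assms(2)])
  show L: "lin n (mset (outs X) + mset_set (epss X)) V" using assms(1) by (simp add: red_graph_def)
  fix v assume v: "v \<in> V" "\<forall>t\<in>set (vouts v). t \<in># mset (outs X) + mset_set (epss X) \<and> t \<notin> set (outs X)"
  then have "set (vouts v) \<subseteq> epss X" using red_finite_epss[OF assms(1)] by auto
  then show False using assms(1) by (simp add: red_graph_def reduced_def)
qed

lemma red_same_terms:
  assumes X: "red_graph n m X V" and Y: "red_graph n m Y V'" and "outs X = outs Y"
  shows "same_terms X Y"
proof -
  have "finite (epss X)" "finite (epss Y)" using red_finite_epss[OF X] red_finite_epss[OF Y] by auto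
  then have "epss X = epss Y"
    using lin_reduced_unique[of n "outs X" "epss X" V "epss Y" V'] X Y assms(3) by (simp add: red_graph_def)
  then show ?thesis using X Y assms(3) by (simp add: same_terms_def red_graph_def dgraphs_iff)
qed

text \<open>Both graphs are congruent to reduced ones. The output terms of those are already normal,
  so by soundness they agree, and reduced graphs with the same outputs have the same terms
  throughout.\<close>

lemma cl_complete:
  assumes X: "X \<in> dgraphs \<B> n m" and Y: "Y \<in> dgraphs \<B> n m" and e: "ev X = ev Y"
  shows "cl X = cl Y"
proof -
  obtain X' where X': "red_graph n m X' (vtxs X')" "peq X X'" using reduce[OF X] by blast
  obtain Y' where Y': "red_graph n m Y' (vtxs Y')" "peq Y Y'" using reduce[OF Y] by blast
  have d: "X' \<in> dgraphs \<B> n m" "Y' \<in> dgraphs \<B> n m" using X' Y' by (simp_all add: red_graph_def)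
  have c: "cl X = cl X'" "cl Y = cl Y'" using peq_cl X Y d X' Y' by blast+
  then have "ev X' = ev Y'" using cl_sound[OF X d(1)] cl_sound[OF Y d(2)] e by simp
  then have "outs X' = outs Y'" using red_ev(1)[OF X'(1)] red_ev(1)[OF Y'(1)] by simp
  then have "cl X' = cl Y'" using cl_cong[OF d red_same_terms[OF X'(1) Y'(1)]] by blast
  then show ?thesis using c by simp
qed

lemma cl_eq_iff:
  "\<lbrakk>X \<in> dgraphs \<B> n m; Y \<in> dgraphs \<B> n m\<rbrakk> \<Longrightarrow> cl X = cl Y \<longleftrightarrow> ev X = ev Y"
  using cl_complete cl_sound by blast

section \<open>Cells of the prop S\<close>

text \<open>Decorations are total functions, and different constructions fill the values beyond
  \<open>g_size\<close> differently.\<close>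

lemma same_terms_agree:
  assumes X: "sdg X" and "fst Y = fst X" "\<And>v. v < g_size (fst X) \<Longrightarrow> snd Y v = snd X v"
  shows "sdg Y \<and> same_terms X Y"
proof -
  interpret X: sdgraph X "fst X" "snd X" using X by (rule sdgraphI)
  have Y: "sdg Y"
    using X.bij X.acyclic X.dec assms(2,3) by (cases Y) (simp add: sdg_iff)
  interpret Y: sdgraph Y "fst X" "snd Y" using Y assms(2) by unfold_locales simp_all
  have "src_val (snd Y) (lab X) p = src_val (snd X) (lab X) p" if "p \<in> sources (fst X)" for p
    using that assms(3) by (cases p) (auto simp: ivals_def[abs_def])
  then have g: "labelling Y (lab X)"
    using X.labellingD[OF X.labelling_lab] assms(2) by (simp add: labelling_def)
  have "outs Y = outs X" using Y.outs_eq[OF g] by (simp add: outs_def)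
  moreover have "eps_set (lab X) Y = eps_set (lab X) X"
    unfolding eps_set_def assms(2) using assms(3) by auto
  then have "epss Y = epss X" by (simp only: Y.epss_eq[OF g] epss_def[of X])
  ultimately show ?thesis using Y assms(2) by (simp add: same_terms_def)
qed

lemma cl_agree:
  assumes X: "X \<in> dgraphs \<B> n m" and "fst Y = fst X" "\<And>v. v < g_size (fst X) \<Longrightarrow> snd Y v = snd X v"
  shows "Y \<in> dgraphs \<B> n m" "cl Y = cl X"
proof -
  have sX: "sdg X" using X by (simp add: dgraphs_iff)
  have "sdg Y" "same_terms X Y" using same_terms_agree[OF sX assms(2,3)] by blast+
  then show Y: "Y \<in> dgraphs \<B> n m" using X assms(2) by (simp add: dgraphs_iff)
  show "cl Y = cl X" using cl_cong[OF X Y \<open>same_terms X Y\<close>] by simp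
qed

definition par_verts :: "sgraph \<Rightarrow> nat set" where
  "par_verts X = {v. v < g_size (fst X) \<and> S_dim (ccell (snd X v)) = 1}"

lemma finite_par_verts [simp]: "finite (par_verts X)"
  by (simp add: par_verts_def)

lemma pars_eq: "pars X = image_mset (\<lambda>v. cpt (snd X v) 0) (mset_set (par_verts X))"
  by (simp add: pars_def par_verts_def)

lemma set_pars: "set_mset (pars X) = (\<lambda>v. cpt (snd X v) 0) ` par_verts X"
  by (simp add: pars_eq)

lemma size_pars: "size (pars X) = card (par_verts X)"
  by (simp add: pars_eq)

lemma par_verts_inst [simp]: "par_verts (inst \<theta> X) = par_verts X"
  by (auto simp: par_verts_def inst_def inst_pt_def)

lemma pars_inst: "pars (inst \<theta> X) = image_mset \<theta> (pars X)"
  unfolding pars_eq par_verts_inst multiset.map_comp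
  by (rule image_mset_cong) (auto simp: par_verts_def inst_def inst_pt_def)

lemma cl_inst_cong:
  assumes X: "X \<in> dgraphs \<B> n m" and "\<theta> \<in> Theta" "\<And>s. s \<in># pars X \<Longrightarrow> \<theta> s = \<theta>' s"
  shows "cl (inst \<theta>' X) = cl (inst \<theta> X)"
proof (rule cl_agree(2)[OF inst_Theta(1)[OF assms(2) X]])
  fix v assume "v < g_size (fst (inst \<theta> X))"
  then have "S_dim (ccell (snd X v)) = 1 \<Longrightarrow> \<theta> (cpt (snd X v) 0) = \<theta>' (cpt (snd X v) 0)"
    using assms(3) by (simp add: set_pars par_verts_def inst_def)
  then show "snd (inst \<theta>' X) v = snd (inst \<theta> X) v" by (simp add: inst_def inst_pt_def)
qed (simp add: inst_def)

lemma inst_inst: "inst \<theta> (inst \<theta>' X) = inst (\<theta> \<circ> \<theta>') X"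
  by (auto simp: inst_def inst_pt_def)

definition red :: "nat \<Rightarrow> nat \<Rightarrow> sgraph \<Rightarrow> bool" where
  "red n m X \<longleftrightarrow> X \<in> dgraphs \<B> n m \<and> set_mset (pars X) \<subseteq> {0<..<1} \<and> reduced (epss X)"

lemma set_mset_sum: "finite V \<Longrightarrow> set_mset (\<Sum>v\<in>V. f v) = (\<Union>v\<in>V. set_mset (f v))"
  by (induction V rule: finite_induct) auto

lemma red_red_graph: "red n m X \<longleftrightarrow> red_graph n m X (vtxs X)"
proof (cases "X \<in> dgraphs \<B> n m")
  case True
  then have sX: "sdg X" "g_in (fst X) = n" by (simp_all add: dgraphs_iff)
  note L = graph_lin[OF sX(1)]
  have "nondeg (vtxs X) \<longleftrightarrow> set_mset (pars X) \<subseteq> {0<..<1}"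
    unfolding nondeg_def L(2)[symmetric] set_mset_sum[OF lin_finite[OF L(1)]] by blast
  then show ?thesis using True L(1) sX(2) by (simp add: red_def red_graph_def)
qed (simp add: red_def red_graph_def)

lemma reduce_red:
  assumes "X \<in> dgraphs \<B> n m"
  obtains Y where "red n m Y" "peq X Y" "pars Y \<subseteq># filter_mset (\<lambda>s. s \<noteq> 0 \<and> s \<noteq> 1) (pars X)"
  using reduce[OF assms] red_red_graph by metis

text \<open>Composing \<open>lab X\<close> with \<open>map_tm \<theta>\<close> labels the graph
  \<open>inst \<theta> X\<close>, and labellings are injective there too. So two edges never differ
  by parameters alone, even when \<open>\<theta>\<close> is far from injective.\<close>

lemma map_tm_label_inj:
  assumes X: "X \<in> dgraphs \<B> n m" and t: "\<theta> \<in> Theta"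
    and "q \<in> targets (fst X)" "q' \<in> targets (fst X)" "map_tm \<theta> (lab X q) = map_tm \<theta> (lab X q')"
  shows "q = q'"
proof -
  have th: "\<And>s. s \<in> {0..1} \<Longrightarrow> \<theta> s \<in> {0..1}" using t by (simp add: Theta_def)
  have "sdg (inst \<theta> X)" using inst_Theta(1)[OF t X] by (simp add: dgraphs_iff)
  then interpret Y: sdgraph "inst \<theta> X" "fst X" "snd (inst \<theta> X)" by unfold_locales (simp_all add: inst_def)
  show ?thesis using Y.labelling_inj[OF inst(4)[OF X th]] assms(3-5) by blast
qed

lemma epss_label: "t \<in> epss X \<Longrightarrow> X \<in> dgraphs \<B> n m \<Longrightarrow> \<exists>q\<in>targets (fst X). t = lab X q"
proof -
  assume t: "t \<in> epss X" and X: "X \<in> dgraphs \<B> n m"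
  have "sdg X" using X by (simp add: dgraphs_iff)
  then interpret sdgraph X "fst X" "snd X" by (rule sdgraphI)
  show ?thesis using t eps_target by (auto simp: epss_def eps_set_def)
qed

lemma label_sub:
  assumes X: "X \<in> dgraphs \<B> n m" and "q \<in> targets (fst X)" "t \<in> sub (lab X q)"
  shows "\<exists>q'\<in>targets (fst X). t = lab X q'"
proof -
  have "sdg X" using X by (simp add: dgraphs_iff)
  then interpret sdgraph X "fst X" "snd X" by (rule sdgraphI)
  have "lab X q \<in> \<Union> (sub ` (set (outs X) \<union> epss X))"
    using labels[OF labelling_lab] assms(2) by blast
  then have "t \<in> \<Union> (sub ` (set (outs X) \<union> epss X))" using assms(3) sub_trans by blast
  then show ?thesis using labels[OF labelling_lab] by blast
qed

text \<open>A removable vertex of \<open>inst \<theta> X\<close> is traced back to \<open>X\<close>.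
  Only \<Delta> is delicate: its two outputs might stem from different vertices whose inputs become
  equal under \<open>\<theta>\<close>, which \<open>map_tm_label_inj\<close> excludes.\<close>

lemma reduced_inst:
  assumes X: "X \<in> dgraphs \<B> n m" and t: "\<theta> \<in> Theta" and r: "reduced (epss X)"
  shows "reduced (epss (inst \<theta> X))"
  unfolding reduced_def inst_Theta(3)[OF t X]
proof (intro allI notI)
  fix v assume v: "set (vouts v) \<subseteq> map_tm \<theta> ` epss X"
  show False
  proof (cases v)
    case (VM s a b)
    then obtain u where u: "u \<in> epss X" "map_tm \<theta> u = Mt s a b" using v by auto
    then obtain s' a' b' where "u = Mt s' a' b'" by (cases u) auto
    then have "set (vouts (VM s' a' b')) \<subseteq> epss X" using u by simp
    then show False using r by (simp only: reduced_def)
  next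
    case (VH s a)
    then obtain u where u: "u \<in> epss X" "map_tm \<theta> u = Ht s a" using v by auto
    then obtain s' a' where "u = Ht s' a'" by (cases u) auto
    then have "set (vouts (VH s' a')) \<subseteq> epss X" using u by simp
    then show False using r by (simp only: reduced_def)
  next
    case (VD a)
    then obtain u w where u: "u \<in> epss X" "map_tm \<theta> u = Lt a" and w: "w \<in> epss X" "map_tm \<theta> w = Rt a"
      using v by (auto simp: image_iff)
    obtain a1 where a1: "u = Lt a1" "map_tm \<theta> a1 = a" using u by (cases u) auto
    obtain a2 where a2: "w = Rt a2" "map_tm \<theta> a2 = a" using w by (cases w) auto
    obtain q1 where q1: "q1 \<in> targets (fst X)" "u = lab X q1" using epss_label[OF u(1) X] by blast
    obtain q2 where q2: "q2 \<in> targets (fst X)" "w = lab X q2" using epss_label[OF w(1) X] by blast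
    have "a1 \<in> sub (lab X q1)" using q1(2) a1(1) by (metis insertCI sub.simps(2) sub_refl)
    then obtain p1 where p1: "p1 \<in> targets (fst X)" "a1 = lab X p1" using label_sub[OF X q1(1)] by blast
    have "a2 \<in> sub (lab X q2)" using q2(2) a2(1) by (metis insertCI sub.simps(3) sub_refl)
    then obtain p2 where p2: "p2 \<in> targets (fst X)" "a2 = lab X p2" using label_sub[OF X q2(1)] by blast
    have "p1 = p2" using map_tm_label_inj[OF X t p1(1) p2(1)] a1(2) a2(2) p1(2) p2(2) by simp
    then have "set (vouts (VD a1)) \<subseteq> epss X" using u w a1 a2 p1 p2 by simp
    then show False using r by (simp only: reduced_def)
  qed
qed

lemma red_inst:
  assumes "red n m X" "\<theta> \<in> Theta" "\<And>s. s \<in># pars X \<Longrightarrow> \<theta> s \<in> {0<..<1}"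
  shows "red n m (inst \<theta> X)"
proof -
  have X: "X \<in> dgraphs \<B> n m" "reduced (epss X)" using assms(1) by (simp_all add: red_def)
  show ?thesis
    unfolding red_def pars_inst
    using inst_Theta(1)[OF assms(2) X(1)] reduced_inst[OF X(1) assms(2) X(2)] assms(3) by auto
qed

text \<open>Read contrapositively, parameter changes reflect reducedness;
  \<open>reduced_inst\<close> is the harder direction.\<close>

lemma map_vt: "set (vouts v) \<subseteq> E \<Longrightarrow> \<exists>w. set (vouts w) \<subseteq> map_tm \<theta> ` E"
proof (cases v)
  case (VD t)
  assume "set (vouts v) \<subseteq> E"
  then have "set (vouts (VD (map_tm \<theta> t))) \<subseteq> map_tm \<theta> ` E" using VD by (auto intro: rev_image_eqI)
  then show ?thesis by blast
next
  case (VM s a b)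
  assume "set (vouts v) \<subseteq> E"
  then have "set (vouts (VM (\<theta> s) (map_tm \<theta> a) (map_tm \<theta> b))) \<subseteq> map_tm \<theta> ` E" using VM by (auto intro: rev_image_eqI)
  then show ?thesis by blast
next
  case (VH s a)
  assume "set (vouts v) \<subseteq> E"
  then have "set (vouts (VH (\<theta> s) (map_tm \<theta> a))) \<subseteq> map_tm \<theta> ` E" using VH by (auto intro: rev_image_eqI)
  then show ?thesis by blast
qed

subsection \<open>Shapes\<close>

text \<open>Forgets where inner parameters lie, with 1/2 as a common inner value, while the ends
  stay fixed as \<open>Theta\<close> requires.\<close>

definition half :: "real \<Rightarrow> real" where
  "half s = (if s = 0 \<or> s = 1 then s else 1/2)"

lemma half_Theta: "half \<in> Theta"
  by (simp add: Theta_def half_def)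

text \<open>An injection of the naturals into the open unit interval, so that variables are
  themselves legitimate inner parameters.\<close>

definition name :: "nat \<Rightarrow> real" where
  "name i = 1 / (real i + 2)"

lemma name_inj: "name i = name j \<longleftrightarrow> i = j"
  by (auto simp: name_def field_simps)

lemma inj_name: "inj name"
  by (simp add: inj_def name_inj)

lemma name_bounds: "0 < name i" "name i < 1"
  by (simp_all add: name_def)

lemma name_ne [simp]: "name i \<noteq> 0" "name i \<noteq> 1"
  using name_bounds[of i] by auto

text \<open>The parameters \<open>name i\<close> serve as variables, for which \<open>theta k s\<close> substitutes the coordinates
  of \<open>s\<close>.\<close>

definition theta :: "nat \<Rightarrow> (nat \<Rightarrow> real) \<Rightarrow> real \<Rightarrow> real" where
  "theta k s x = (if x = 0 \<or> x = 1 then x else if x \<in> name ` {..<k} then s (inv name x) else 1/2)"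

lemma theta_name: "i < k \<Longrightarrow> theta k s (name i) = s i"
  using inj_name by (simp add: theta_def inv_f_f)

lemma theta_Theta: "(\<And>i. i < k \<Longrightarrow> s i \<in> {0..1}) \<Longrightarrow> theta k s \<in> Theta"
  using inj_name by (auto simp: Theta_def theta_def inv_f_f)

lemma theta_cube: "s \<in> topspace (cube k) \<Longrightarrow> theta k s \<in> Theta"
  by (rule theta_Theta) (rule cube_coord)

lemma theta_inner: "\<lbrakk>\<And>i. i < k \<Longrightarrow> s i \<in> {0<..<1}; x \<in> {0<..<1}\<rbrakk> \<Longrightarrow> theta k s x \<in> {0<..<1}"
  using inj_name by (auto simp: theta_def inv_f_f)

definition cand :: "nat \<Rightarrow> nat \<Rightarrow> sgraph \<Rightarrow> bool" where
  "cand n m X \<longleftrightarrow> red n m X \<and> pars X = mset (map name [0..<size (pars X)])"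

abbreviation cdim :: "sgraph \<Rightarrow> nat" where
  "cdim X \<equiv> size (pars X)"

definition shape :: "sgraph \<Rightarrow> real tm list" where
  "shape X = map (map_tm half) (outs X)"

text \<open>One representative for each shape. Choosing it also fixes which vertex carries which
  coordinate of the cube.\<close>

definition cells :: "nat \<Rightarrow> nat \<Rightarrow> sgraph set" where
  "cells n m = (\<lambda>w. SOME X. cand n m X \<and> shape X = w) ` shape ` {X. cand n m X}"

definition Phi :: "sgraph \<Rightarrow> (nat \<Rightarrow> real) \<Rightarrow> S_cell cell_point dgraph set set set" where
  "Phi X s = cl (inst (theta (cdim X) s) X)"

lemma cells_cand: "X \<in> cells n m \<Longrightarrow> cand n m X"
proof -
  assume "X \<in> cells n m"
  then obtain Y where "cand n m Y" "X = (SOME Z. cand n m Z \<and> shape Z = shape Y)" by (auto simp: cells_def)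
  then show ?thesis using someI[of "\<lambda>Z. cand n m Z \<and> shape Z = shape Y" Y] by simp
qed

lemma ex_cell:
  assumes "cand n m Y"
  shows "\<exists>X\<in>cells n m. shape X = shape Y"
proof -
  have "shape (SOME Z. cand n m Z \<and> shape Z = shape Y) = shape Y"
    using someI[of "\<lambda>Z. cand n m Z \<and> shape Z = shape Y" Y] assms by simp
  then show ?thesis unfolding cells_def using assms by blast
qed

lemma cells_shape: "\<lbrakk>X \<in> cells n m; Y \<in> cells n m; shape X = shape Y\<rbrakk> \<Longrightarrow> X = Y"
proof -
  assume X: "X \<in> cells n m" and Y: "Y \<in> cells n m" and s: "shape X = shape Y"
  have "X = (SOME Z. cand n m Z \<and> shape Z = shape X)" if X: "X \<in> cells n m" for X
  proof -
    obtain W where W: "cand n m W" "X = (SOME Z. cand n m Z \<and> shape Z = shape W)"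
      using X unfolding cells_def by blast
    then have "shape X = shape W" using someI[of "\<lambda>Z. cand n m Z \<and> shape Z = shape W" W] by simp
    then show ?thesis using W by simp
  qed
  from this[OF X] this[OF Y] s show ?thesis by metis
qed

lemma cand_pars:
  assumes "cand n m X"
  shows "inj_on (\<lambda>v. cpt (snd X v) 0) (par_verts X)" "(\<lambda>v. cpt (snd X v) 0) ` par_verts X = name ` {..<cdim X}"
proof -
  have p: "pars X = mset (map name [0..<cdim X])" using assms by (simp only: cand_def)
  show im: "(\<lambda>v. cpt (snd X v) 0) ` par_verts X = name ` {..<cdim X}"
    unfolding set_pars[symmetric] by (subst p) (auto simp: atLeast0LessThan)
  have "card ((\<lambda>v. cpt (snd X v) 0) ` par_verts X) = card (par_verts X)"
    unfolding im using card_image[OF inj_on_subset[OF inj_name subset_UNIV], of "{..<cdim X}"] by (simp add: size_pars)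
  then show "inj_on (\<lambda>v. cpt (snd X v) 0) (par_verts X)" by (rule eq_card_imp_inj_on[OF finite_par_verts])
qed

lemma outs_inst_half: "X \<in> dgraphs \<B> n m \<Longrightarrow> outs (inst half X) = shape X"
  using inst_Theta(2)[OF half_Theta] by (simp add: shape_def)

lemma red_half: "red n m X \<Longrightarrow> red n m (inst half X)"
  by (rule red_inst[OF _ half_Theta]) (auto simp: red_def half_def)

text \<open>The renaming is done vertex by vertex. It need not be of the form
  \<open>inst \<theta>\<close>, because several vertices of \<open>X\<close> may share a
  parameter.\<close>

lemma ex_name:
  assumes X: "X \<in> dgraphs \<B> n m"
  obtains Y where "Y \<in> dgraphs \<B> n m" "fst Y = fst X" "pars Y = mset (map name [0..<card (par_verts X)])"
    "\<And>v. v < g_size (fst X) \<Longrightarrow> snd Y v = (if v \<in> par_verts X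
       then (cout (snd X v), ccell (snd X v), cpt (snd Y v), cin (snd X v)) else snd X v)"
    "par_verts Y = par_verts X"
proof -
  let ?P = "par_verts X"
  obtain e where e: "bij_betw e ?P {..<card ?P}"
    using ex_bij_betw_finite_nat[OF finite_par_verts] by (metis atLeast0LessThan)
  define Y where "Y = (fst X, \<lambda>v. if v \<in> ?P then (cout (snd X v), ccell (snd X v), pt1 (name (e v)), cin (snd X v)) else snd X v)"
  have sX: "sdg X" using X by (simp add: dgraphs_iff)
  interpret X: sdgraph X "fst X" "snd X" using sX by (rule sdgraphI)
  have "snd Y v \<in> cell_points S_cells (v_in (fst X) v) (v_out (fst X) v)" if v: "v < g_size (fst X)" for v
  proof -
    have "pt1 (name (e v)) \<in> topspace (cube 1)" using pt1_in_cube name_bounds[of "e v"] by simp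
    then show ?thesis using X.dec[OF v] by (auto simp: Y_def in_cell_points par_verts_def)
  qed
  then have "sdg Y" using X.bij X.acyclic by (simp add: Y_def sdg_iff)
  then have d: "Y \<in> dgraphs \<B> n m" using X by (simp add: dgraphs_iff Y_def)
  have pv: "par_verts Y = ?P" by (auto simp: par_verts_def Y_def)
  have "pars Y = image_mset (\<lambda>v. name (e v)) (mset_set ?P)"
    unfolding pars_eq pv by (rule image_mset_cong) (simp add: Y_def)
  also have "\<dots> = image_mset name (image_mset e (mset_set ?P))" by (simp add: multiset.map_comp comp_def)
  also have "image_mset e (mset_set ?P) = mset_set {..<card ?P}"
    using e by (simp add: image_mset_mset_set bij_betw_def)
  also have "image_mset name (mset_set {..<card ?P}) = mset (map name [0..<card ?P])"
    by (simp add: atLeast0LessThan)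
  finally show ?thesis using that[of Y] d pv by (simp add: Y_def)
qed

text \<open>\<open>X\<close> and the renamed \<open>Y\<close> agree after \<open>inst half\<close>.
  Reducedness passes from \<open>X\<close> to this common instance and from there back to
  \<open>Y\<close>.\<close>

lemma ex_cand:
  assumes X: "red n m X"
  shows "\<exists>Y. cand n m Y \<and> shape Y = shape X"
proof -
  have d: "X \<in> dgraphs \<B> n m" using X by (simp add: red_def)
  obtain Y where Y: "Y \<in> dgraphs \<B> n m" "fst Y = fst X" "pars Y = mset (map name [0..<card (par_verts X)])"
    "\<And>v. v < g_size (fst X) \<Longrightarrow> snd Y v = (if v \<in> par_verts X
       then (cout (snd X v), ccell (snd X v), cpt (snd Y v), cin (snd X v)) else snd X v)"
    "par_verts Y = par_verts X"
    using ex_name[OF d] by blast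
  have sz: "size (pars Y) = card (par_verts X)" by (simp add: Y(3))
  have "snd (inst half Y) v = snd (inst half X) v" if v: "v < g_size (fst X)" for v
  proof (cases "v \<in> par_verts X")
    case True
    have "cpt (snd Y v) 0 \<in># pars Y" "cpt (snd X v) 0 \<in># pars X" using True Y(5) by (simp_all add: set_pars)
    then have "half (cpt (snd Y v) 0) = 1/2" "half (cpt (snd X v) 0) = 1/2"
      using X by (auto simp: Y(3) half_def red_def)
    then have "half (cpt (snd Y v) 0) = half (cpt (snd X v) 0)" by simp
    moreover have "cout (snd Y v) = cout (snd X v)" "ccell (snd Y v) = ccell (snd X v)" "cin (snd Y v) = cin (snd X v)"
      using Y(4)[OF v] True by (metis fst_conv snd_conv)+
    ultimately show ?thesis using True by (simp add: inst_def inst_pt_def par_verts_def)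
  qed (use Y(4)[OF v] in \<open>simp add: inst_def\<close>)
  then have st: "same_terms (inst half X) (inst half Y)"
    using same_terms_agree[of "inst half X" "inst half Y"] inst_Theta(1)[OF half_Theta d] Y(2)
    by (simp add: dgraphs_iff inst_def)
  have sh: "shape Y = shape X"
    using st outs_inst_half[OF d] outs_inst_half[OF Y(1)] by (simp add: same_terms_def)
  have "reduced (epss (inst half Y))"
    using st red_half[OF X] by (simp add: same_terms_def red_def)
  then have "reduced (epss Y)"
    unfolding reduced_def inst_Theta(3)[OF half_Theta Y(1)] using map_vt by blast
  then have "red n m Y" using Y(1) name_bounds by (auto simp: red_def Y(3))
  then have "cand n m Y" unfolding cand_def sz using Y(3) by simp
  then show ?thesis using sh by blast
qed

text \<open>With parameters forgotten, both reduced graphs have the same outputs and are therefore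
  isomorphic. \<open>\<rho> i\<close> is the parameter in \<open>X\<close> at the vertex
  corresponding to the one where \<open>C\<close> has the variable \<open>name i\<close>; the same
  vertex bijection and relabelings then work for every \<open>\<theta>\<close>.\<close>

lemma shape_transfer:
  assumes X: "red n m X" and C: "cand n m C" and sh: "shape X = shape C"
  shows "size (pars X) = cdim C" and
    "\<exists>\<rho>. (\<forall>i<cdim C. \<rho> i \<in># pars X) \<and>
      (\<forall>\<theta>\<in>Theta. cl (inst \<theta> X) = cl (inst (theta (cdim C) (\<lambda>i. \<theta> (\<rho> i))) C))"
proof -
  have rC: "red n m C" using C by (simp add: cand_def)
  have dX: "X \<in> dgraphs \<B> n m" and dC: "C \<in> dgraphs \<B> n m" using X rC by (simp_all add: red_def)
  note hX = red_half[OF X] and hC = red_half[OF rC]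
  have st: "same_terms (inst half X) (inst half C)"
    using red_same_terms[of n m "inst half X" _ "inst half C"] hX hC sh
    unfolding red_red_graph by (simp add: outs_inst_half[OF dX] outs_inst_half[OF dC])
  have dhX: "inst half X \<in> dgraphs \<B> n m" and dhC: "inst half C \<in> dgraphs \<B> n m"
    using hX hC by (simp_all add: red_def)
  have "dgraph_iso \<B> (inst half X) (inst half C)"
    using iso_if_same_terms[OF _ _ st] dhX dhC by (simp add: dgraphs_iff)
  then obtain \<pi> \<sigma> \<tau> where io: "g_in (fst C) = g_in (fst X)" "g_out (fst C) = g_out (fst X)"
    and \<pi>: "bij_betw \<pi> {..<g_size (fst X)} {..<g_size (fst C)}"
    and v: "\<And>v. v < g_size (fst X) \<Longrightarrow> v_in (fst C) (\<pi> v) = v_in (fst X) v \<and> v_out (fst C) (\<pi> v) = v_out (fst X) v \<and>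
       \<sigma> v permutes {..<v_in (fst X) v} \<and> \<tau> v permutes {..<v_out (fst X) v} \<and>
       snd (inst half C) (\<pi> v) = lact \<B> (\<tau> v) (ract \<B> (snd (inst half X) v) (inv (\<sigma> v)))"
    and w: "\<And>p. p \<in> sources (fst X) \<Longrightarrow> wire (fst C) (map_half_edge \<pi> \<tau> p) = map_half_edge \<pi> \<sigma> (wire (fst X) p)"
    unfolding dgraph_iso_def case_prod_beta by (simp add: inst_def) blast
  have dec: "cout (snd C (\<pi> v)) = \<tau> v \<circ> cout (snd X v)" "ccell (snd C (\<pi> v)) = ccell (snd X v)"
    "cin (snd C (\<pi> v)) = cin (snd X v) \<circ> inv (\<sigma> v)"
    "S_dim (ccell (snd X v)) \<noteq> 1 \<Longrightarrow> cpt (snd C (\<pi> v)) = cpt (snd X v)" if "v < g_size (fst X)" for v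
    using v[OF that] by (auto simp: inst_def inst_pt_def)
  have \<pi>lt: "\<pi> v < g_size (fst C)" if "v < g_size (fst X)" for v using bij_betw_mem[OF \<pi>, of v] that by simp
  have \<pi>pv: "bij_betw \<pi> (par_verts X) (par_verts C)"
  proof (rule bij_betw_imageI)
    show "inj_on \<pi> (par_verts X)"
      by (rule inj_on_subset[OF bij_betw_imp_inj_on[OF \<pi>]]) (auto simp: par_verts_def)
    show "\<pi> ` par_verts X = par_verts C"
    proof (intro set_eqI iffI)
      fix u assume u: "u \<in> par_verts C"
      then obtain v where "v < g_size (fst X)" "u = \<pi> v" using bij_betw_ex[OF \<pi>, of u] by (auto simp: par_verts_def)
      then show "u \<in> \<pi> ` par_verts X" using u dec(2) by (auto simp: par_verts_def)
    qed (use dec(2) \<pi>lt in \<open>auto simp: par_verts_def\<close>)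
  qed
  show "size (pars X) = cdim C" unfolding size_pars using bij_betw_same_card[OF \<pi>pv] .
  define k where "k = cdim C"
  define f where "f u = cpt (snd C u) 0" for u
  have f: "bij_betw f (par_verts C) (name ` {..<k})"
    using cand_pars[OF C] by (simp add: bij_betw_def f_def[abs_def] k_def)
  define \<rho> where "\<rho> i = cpt (snd X (inv_into (par_verts X) (f \<circ> \<pi>) (name i))) 0" for i
  have b: "bij_betw (f \<circ> \<pi>) (par_verts X) (name ` {..<k})" using bij_betw_trans[OF \<pi>pv f] .
  have \<rho>1: "\<rho> i \<in># pars X" if "i < k" for i
  proof -
    have "inv_into (par_verts X) (f \<circ> \<pi>) (name i) \<in> par_verts X"
      using b that by (intro inv_into_into) (auto simp: bij_betw_def)
    then show ?thesis by (simp add: set_pars \<rho>_def)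
  qed
  have \<rho>2: "\<exists>i<k. f (\<pi> u) = name i \<and> \<rho> i = cpt (snd X u) 0" if u: "u \<in> par_verts X" for u
  proof -
    obtain i where i: "i < k" "f (\<pi> u) = name i" using bij_betw_mem[OF b u] by auto
    then have "inv_into (par_verts X) (f \<circ> \<pi>) (name i) = u"
      using inv_into_f_f[OF bij_betw_imp_inj_on[OF b] u] by simp
    then show ?thesis using i by (auto simp: \<rho>_def)
  qed
  have "cl (inst \<theta> X) = cl (inst (theta k (\<lambda>i. \<theta> (\<rho> i))) C)" if t: "\<theta> \<in> Theta" for \<theta>
  proof -
    have "\<theta> (\<rho> i) \<in> {0..1}" if "i < k" for i
      using \<rho>1[OF that] X t by (fastforce simp: red_def Theta_def)
    then have t': "theta k (\<lambda>i. \<theta> (\<rho> i)) \<in> Theta" by (rule theta_Theta)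
    let ?t = "theta k (\<lambda>i. \<theta> (\<rho> i))"
    have d: "snd (inst ?t C) (\<pi> u) = lact \<B> (\<tau> u) (ract \<B> (snd (inst \<theta> X) u) (inv (\<sigma> u)))"
      if u: "u < g_size (fst X)" for u
    proof (cases "S_dim (ccell (snd X u)) = 1")
      case True
      then have "u \<in> par_verts X" using u by (simp add: par_verts_def)
      then obtain i where "i < k" "f (\<pi> u) = name i" "\<rho> i = cpt (snd X u) 0" using \<rho>2 by blast
      then have "?t (cpt (snd C (\<pi> u)) 0) = \<theta> (cpt (snd X u) 0)" by (simp add: f_def theta_name)
      then show ?thesis using dec[OF u] True by (simp add: inst_def inst_pt_def)
    next
      case False
      then show ?thesis using dec[OF u] by (simp add: inst_def inst_pt_def)
    qed
    have "dgraph_iso \<B> (inst \<theta> X) (inst ?t C)"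
      unfolding dgraph_iso_def case_prod_beta
      using io \<pi> v w d by (intro conjI exI[of _ \<pi>] exI[of _ \<sigma>] exI[of _ \<tau>]) (auto simp: inst_def simp del: lact_B ract_B)
    then have "same_terms (inst \<theta> X) (inst ?t C)"
      using iso_imp_same_terms inst_Theta(1)[OF t dX] by (simp add: dgraphs_iff)
    then show ?thesis using cl_cong[OF inst_Theta(1)[OF t dX] inst_Theta(1)[OF t' dC]] by blast
  qed
  then show "\<exists>\<rho>. (\<forall>i<cdim C. \<rho> i \<in># pars X) \<and>
      (\<forall>\<theta>\<in>Theta. cl (inst \<theta> X) = cl (inst (theta (cdim C) (\<lambda>i. \<theta> (\<rho> i))) C))"
    using \<rho>1 unfolding k_def by blast
qed

text \<open>Reduction commutes with all parameter changes, and reduced graphs of equal shape differ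
  by a substitution. So the whole family of instances of \<open>X\<close> runs through one cell with
  coordinates \<open>\<theta> (\<rho> i)\<close>, also where \<open>\<theta>\<close> makes a
  coordinate 0 or 1 and the point lies on the boundary.\<close>

lemma factor_cell:
  assumes X: "X \<in> dgraphs \<B> n m"
  obtains C \<rho> where "C \<in> cells n m" "cdim C \<le> size (filter_mset (\<lambda>s. s \<noteq> 0 \<and> s \<noteq> 1) (pars X))"
    "\<And>i. i < cdim C \<Longrightarrow> \<rho> i \<in># pars X \<and> \<rho> i \<in> {0<..<1}"
    "\<And>\<theta>. \<theta> \<in> Theta \<Longrightarrow> cl (inst \<theta> X) = Phi C (\<lambda>i\<in>{..<cdim C}. \<theta> (\<rho> i))"
proof -
  obtain Y where Y: "red n m Y" "peq X Y" "pars Y \<subseteq># filter_mset (\<lambda>s. s \<noteq> 0 \<and> s \<noteq> 1) (pars X)"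
    using reduce_red[OF X] by blast
  obtain Z where Z: "cand n m Z" "shape Z = shape Y" using ex_cand[OF Y(1)] by blast
  obtain C where C: "C \<in> cells n m" "shape C = shape Z" using ex_cell[OF Z(1)] by blast
  have sh: "shape Y = shape C" using Z C by simp
  note tr = shape_transfer[OF Y(1) cells_cand[OF C(1)] sh]
  obtain \<rho> where \<rho>: "\<forall>i<cdim C. \<rho> i \<in># pars Y"
      "\<forall>\<theta>\<in>Theta. cl (inst \<theta> Y) = cl (inst (theta (cdim C) (\<lambda>i. \<theta> (\<rho> i))) C)" using tr(2) by blast
  have eq: "theta k (\<lambda>i\<in>{..<k}. f i) = theta k f" for k f
    using inj_name by (auto simp: theta_def fun_eq_iff inv_f_f)
  show ?thesis
  proof (rule that[OF C(1), of \<rho>])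
    show "cdim C \<le> size (filter_mset (\<lambda>s. s \<noteq> 0 \<and> s \<noteq> 1) (pars X))"
      using size_mset_mono[OF Y(3)] tr(1) by simp
    show "\<rho> i \<in># pars X \<and> \<rho> i \<in> {0<..<1}" if "i < cdim C" for i
      using \<rho>(1) that Y(1) set_mset_mono[OF Y(3)] by (auto simp: red_def)
    show "cl (inst \<theta> X) = Phi C (\<lambda>i\<in>{..<cdim C}. \<theta> (\<rho> i))" if "\<theta> \<in> Theta" for \<theta>
      using Y(2) \<rho>(2) that unfolding Phi_def eq peq_def by simp
  qed
qed

section \<open>Topology of the prop S\<close>

definition decs :: "graph \<Rightarrow> (nat \<Rightarrow> S_cell cell_point) topology" where
  "decs G = product_topology (\<lambda>v. cw_top (bsp \<B> (v_in G v) (v_out G v))) {..<g_size G}"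

lemma topspace_decs: "topspace (decs G) = (\<Pi>\<^sub>E v\<in>{..<g_size G}. cell_points S_cells (v_in G v) (v_out G v))"
  by (simp add: decs_def topspace_bsp)

definition typed :: "nat \<Rightarrow> nat \<Rightarrow> graph \<Rightarrow> bool" where
  "typed n m G \<longleftrightarrow> valid_graph G \<and> g_in G = n \<and> g_out G = m"

lemma decs_dgraph: "\<lbrakk>typed n m G; d \<in> topspace (decs G)\<rbrakk> \<Longrightarrow> (G, d) \<in> dgraphs \<B> n m"
  by (auto simp: dgraphs_def typed_def topspace_decs topspace_bsp dest!: PiE_mem)

lemma dgraph_typed: "X \<in> dgraphs \<B> n m \<Longrightarrow> typed n m (fst X)"
  by (cases X) (auto simp: dgraphs_def typed_def)

text \<open>A composite of quotient maps is a quotient map, so the criterion mentions neither the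
  free prop nor the intermediate one.\<close>

lemma openin_S:
  "openin (cw_top (phom S_prop n m)) U \<longleftrightarrow> U \<subseteq> pset S_prop n m \<and>
     (\<forall>G. typed n m G \<longrightarrow> openin (kification (decs G)) {d \<in> topspace (decs G). cl (G, d) \<in> U})"
proof -
  have F: "openin (cw_top (phom \<F> n m)) V \<longleftrightarrow> V \<subseteq> pset \<F> n m \<and>
     (\<forall>G. typed n m G \<longrightarrow> openin (kification (decs G)) {d \<in> topspace (decs G). dgraph_class \<B> (G, d) \<in> V})" for V
    unfolding pset_free unfolding free_on_cells_def free_prop_def
    by (simp add: openin_final_topology decs_def typed_def)
  have Q: "openin (cw_top (phom (prop_quot P R) n m)) V \<longleftrightarrow> V \<subseteq> quot_class P R ` pset P n m \<and>
     openin (cw_top (phom P n m)) {x \<in> pset P n m. quot_class P R x \<in> V}"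
    for P :: "'z prop_data" and R V
    by (simp add: prop_quot_def openin_final_topology)
  have eq: "{d \<in> topspace (decs G). dgraph_class \<B> (G, d) \<in> {x \<in> pset \<F> n m. quot_class \<F> attach_rel x \<in>
      {x \<in> pset S_attached n m. quot_class S_attached S_relations x \<in> U}}} = {d \<in> topspace (decs G). cl (G, d) \<in> U}"
    if "typed n m G" for G
    using decs_dgraph[OF that] class_in_free acl_in unfolding cl_def acl_def by blast
  have A: "openin (cw_top (phom S_attached n m)) {x \<in> pset S_attached n m. quot_class S_attached S_relations x \<in> U} \<longleftrightarrow>
     (\<forall>G. typed n m G \<longrightarrow> openin (kification (decs G)) {d \<in> topspace (decs G). cl (G, d) \<in> U})"
  proof -
    have s: "{x \<in> pset S_attached n m. quot_class S_attached S_relations x \<in> U} \<subseteq> quot_class \<F> attach_rel ` pset \<F> n m"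
      unfolding pset_attached pset_free acl_def by (auto simp: image_image)
    show ?thesis
      unfolding S_attached_eq Q F using s eq unfolding S_attached_eq by auto
  qed
  have "quot_class S_attached S_relations ` pset S_attached n m = pset S_prop n m"
    unfolding pset_S pset_attached cl_def by (simp add: image_image)
  then show ?thesis
    unfolding S_prop_def Q by (simp only: A)
qed

text \<open>A map from a k-space into a k-ification is continuous iff it is continuous into the
  original space, here a product, so continuity is checked vertex by vertex. Restricting the
  decoration to the vertices makes it a point of that product.\<close>

lemma continuous_cl:
  assumes T: "k_space T" and G: "typed n m G"
    and f: "\<And>v. v < g_size G \<Longrightarrow> continuous_map T (cw_top (bsp \<B> (v_in G v) (v_out G v))) (\<lambda>t. f t v)"
  shows "continuous_map T (cw_top (phom S_prop n m)) (\<lambda>t. cl (G, f t))"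
proof -
  let ?r = "\<lambda>t. restrict (f t) {..<g_size G}"
  have r: "continuous_map T (kification (decs G)) ?r"
    unfolding continuous_map_into_kification[OF T] decs_def continuous_map_componentwise
    using f by (auto intro: continuous_map_eq)
  then have mem: "?r t \<in> topspace (decs G)" if "t \<in> topspace T" for t
    using that by (auto simp: continuous_map_def Pi_iff)
  have eq: "cl (G, f t) = cl (G, ?r t)" if "t \<in> topspace T" for t
    by (rule cl_agree(2)[OF decs_dgraph[OF G mem[OF that]]]) simp_all
  show ?thesis
    unfolding continuous_map_def
  proof (intro conjI funcsetI allI impI)
    show "cl (G, f t) \<in> pset S_prop n m" if "t \<in> topspace T" for t
      unfolding eq[OF that] by (rule cl_in[OF decs_dgraph[OF G mem[OF that]]])
    fix U assume U: "openin (cw_top (phom S_prop n m)) U"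
    have eq2: "{t \<in> topspace T. cl (G, f t) \<in> U} = {t \<in> topspace T. ?r t \<in> {d \<in> topspace (decs G). cl (G, d) \<in> U}}"
      using eq mem by auto
    have "openin (kification (decs G)) {d \<in> topspace (decs G). cl (G, d) \<in> U}"
      using U G by (simp add: openin_S)
    then show "openin T {t \<in> topspace T. cl (G, f t) \<in> U}"
      unfolding eq2 by (rule openin_continuous_map_preimage[OF r])
  qed
qed

lemma openin_bsp: "openin (cw_top (bsp \<B> n m)) U \<longleftrightarrow> U \<subseteq> cell_points S_cells n m \<and>
    (\<forall>\<tau> c \<sigma>. S_in c = n \<and> S_out c = m \<and> \<tau> permutes {..<m} \<and> \<sigma> permutes {..<n} \<longrightarrow>
      openin (cube (S_dim c)) {x \<in> topspace (cube (S_dim c)). (\<tau>, c, x, \<sigma>) \<in> U})"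
  by (auto simp: cell_bimodule_def openin_final_topology S_cells_def)

lemma continuous_bsp_incl:
  assumes "\<tau> permutes {..<S_out c}" "\<sigma> permutes {..<S_in c}"
  shows "continuous_map (cube (S_dim c)) (cw_top (bsp \<B> (S_in c) (S_out c))) (\<lambda>x. (\<tau>, c, x, \<sigma>))"
  using assms by (auto simp: continuous_map_def topspace_bsp in_cell_points openin_bsp)

lemma continuous_from_bsp:
  assumes "\<And>\<tau> c \<sigma>. \<lbrakk>S_in c = n; S_out c = m; \<tau> permutes {..<m}; \<sigma> permutes {..<n}\<rbrakk> \<Longrightarrow>
     continuous_map (cube (S_dim c)) Z (\<lambda>x. f (\<tau>, c, x, \<sigma>))"
  shows "continuous_map (cw_top (bsp \<B> n m)) Z f"
  unfolding continuous_map_def topspace_bsp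
proof (intro conjI funcsetI allI impI)
  fix p assume p: "p \<in> cell_points S_cells n m"
  then show "f p \<in> topspace Z"
    using assms[of "ccell p" "cout p" "cin p"] by (auto simp: in_cell_points continuous_map_def Pi_iff)
next
  fix U assume U: "openin Z U"
  show "openin (cw_top (bsp \<B> n m)) {x \<in> cell_points S_cells n m. f x \<in> U}"
    unfolding openin_bsp
  proof (intro conjI allI impI)
    fix \<tau> c \<sigma> assume a: "S_in c = n \<and> S_out c = m \<and> \<tau> permutes {..<m} \<and> \<sigma> permutes {..<n}"
    have "{x \<in> topspace (cube (S_dim c)). (\<tau>, c, x, \<sigma>) \<in> {x \<in> cell_points S_cells n m. f x \<in> U}} =
       {x \<in> topspace (cube (S_dim c)). f (\<tau>, c, x, \<sigma>) \<in> U}"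
      using a by (auto simp: in_cell_points)
    then show "openin (cube (S_dim c)) {x \<in> topspace (cube (S_dim c)). (\<tau>, c, x, \<sigma>) \<in> {x \<in> cell_points S_cells n m. f x \<in> U}}"
      using openin_continuous_map_preimage[OF assms[of c \<tau> \<sigma>] U] a by simp
  qed auto
qed

lemma continuous_inst_pt:
  assumes p: "p \<in> cell_points S_cells n m"
    and t: "\<And>t. t \<in> topspace T \<Longrightarrow> \<theta> t \<in> Theta"
    and c: "S_dim (ccell p) = 1 \<Longrightarrow> continuous_map T euclideanreal (\<lambda>t. \<theta> t (cpt p 0))"
  shows "continuous_map T (cw_top (bsp \<B> n m)) (\<lambda>t. inst_pt (\<theta> t) p)"
proof -
  note P = p[unfolded in_cell_points]
  let ?x = "\<lambda>t. if S_dim (ccell p) = 1 then pt1 (\<theta> t (cpt p 0)) else cpt p"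
  have "continuous_map T (cube (S_dim (ccell p))) ?x"
  proof (cases "S_dim (ccell p) = 1")
    case True
    have "cpt p 0 \<in> {0..1}" using cube_coord[of "cpt p" "S_dim (ccell p)" 0] P True by simp
    then have "\<theta> t (cpt p 0) \<in> {0..1}" if "t \<in> topspace T" for t using t[OF that] by (simp add: Theta_def)
    then have "continuous_map T (cube 1) (\<lambda>t. pt1 (\<theta> t (cpt p 0)))"
      using c[OF True] by (intro continuous_map_into_cube) (auto simp: pt1_def One_nat_def)
    then show ?thesis using True by simp
  next
    case False
    then show ?thesis using P by simp
  qed
  from continuous_map_compose[OF this continuous_bsp_incl[of "cout p" "ccell p" "cin p"]] P
  show ?thesis by (simp add: comp_def inst_pt_def)
qed

lemma continuous_cl_inst:
  assumes T: "k_space T" and X: "X \<in> dgraphs \<B> n m"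
    and t: "\<And>t. t \<in> topspace T \<Longrightarrow> \<theta> t \<in> Theta"
    and c: "\<And>s. s \<in># pars X \<Longrightarrow> continuous_map T euclideanreal (\<lambda>t. \<theta> t s)"
  shows "continuous_map T (cw_top (phom S_prop n m)) (\<lambda>t. cl (inst (\<theta> t) X))"
  unfolding inst_def
proof (rule continuous_cl[OF T dgraph_typed[OF X]])
  fix v assume v: "v < g_size (fst X)"
  have "sdg X" using X by (simp add: dgraphs_iff)
  then interpret sdgraph X "fst X" "snd X" by (rule sdgraphI)
  show "continuous_map T (cw_top (bsp \<B> (v_in (fst X) v) (v_out (fst X) v))) (\<lambda>t. inst_pt (\<theta> t) (snd X v))"
  proof (rule continuous_inst_pt[OF dec[OF v] t])
    assume "S_dim (ccell (snd X v)) = 1"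
    then show "continuous_map T euclideanreal (\<lambda>t. \<theta> t (cpt (snd X v) 0))"
      using v by (intro c) (simp add: set_pars par_verts_def)
  qed
qed

lemma k_space_cube: "k_space (cube k)"
  by (rule compact_imp_k_space) (simp_all add: compact_space_cube Hausdorff_space_cube)

lemma continuous_theta:
  "\<lbrakk>k \<le> l; i < k\<rbrakk> \<Longrightarrow> continuous_map (cube l) euclideanreal (\<lambda>s. theta k s (name i))"
  by (simp add: theta_name continuous_map_cube_proj)

lemma continuous_Phi:
  assumes "C \<in> cells n m"
  shows "continuous_map (cube (cdim C)) (cw_top (phom S_prop n m)) (Phi C)"
proof -
  have C: "cand n m C" by (rule cells_cand[OF assms])
  then have d: "C \<in> dgraphs \<B> n m" by (simp add: cand_def red_def)
  show ?thesis
    unfolding Phi_def[abs_def]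
  proof (rule continuous_cl_inst[OF k_space_cube d])
    fix x assume "x \<in># pars C"
    then obtain i where "i < cdim C" "x = name i"
      unfolding set_pars cand_pars(2)[OF C] by auto
    then show "continuous_map (cube (cdim C)) euclideanreal (\<lambda>s. theta (cdim C) s x)"
      by (simp add: continuous_theta)
  qed (rule theta_cube)
qed

definition label :: "S_cell cell_point \<Rightarrow> (nat \<Rightarrow> nat) \<times> S_cell \<times> (nat \<Rightarrow> nat)" where
  "label p = (cout p, ccell p, cin p)"

lemma openin_label: "openin (cw_top (bsp \<B> n m)) {p \<in> cell_points S_cells n m. label p = l}"
proof -
  have "{x \<in> topspace (cube (S_dim c)). (\<tau>, c, x, \<sigma>) \<in> {p \<in> cell_points S_cells n m. label p = l}} =
     (if (\<tau>, c, \<sigma>) = l then topspace (cube (S_dim c)) else {})"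
    if "S_in c = n \<and> S_out c = m \<and> \<tau> permutes {..<m} \<and> \<sigma> permutes {..<n}" for \<tau> c \<sigma>
    using that by (auto simp: label_def in_cell_points)
  then show ?thesis unfolding openin_bsp by (simp add: Collect_restrict)
qed

lemma continuous_cpt:
  "continuous_map (cw_top (bsp \<B> n m)) euclideanreal (\<lambda>p. if S_dim (ccell p) = 1 then cpt p 0 else 0)"
  by (rule continuous_from_bsp) (simp add: continuous_map_cube_proj)

lemma factor_cell_ex:
  assumes X: "X \<in> dgraphs \<B> n m"
  shows "\<exists>C \<rho>. C \<in> cells n m \<and> cdim C \<le> size (filter_mset (\<lambda>s. s \<noteq> 0 \<and> s \<noteq> 1) (pars X)) \<and>
    (\<forall>i<cdim C. \<rho> i \<in># pars X \<and> \<rho> i \<in> {0<..<1}) \<and>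
    (\<forall>\<theta>\<in>Theta. cl (inst \<theta> X) = Phi C (\<lambda>i\<in>{..<cdim C}. \<theta> (\<rho> i)))"
proof (rule factor_cell[OF X], intro exI conjI)
  fix C \<rho>
  assume "\<And>i. i < cdim C \<Longrightarrow> \<rho> i \<in># pars X \<and> \<rho> i \<in> {0<..<1}"
    "\<And>\<theta>. \<theta> \<in> Theta \<Longrightarrow> cl (inst \<theta> X) = Phi C (\<lambda>i\<in>{..<cdim C}. \<theta> (\<rho> i))"
  then show "\<forall>i<cdim C. \<rho> i \<in># pars X \<and> \<rho> i \<in> {0<..<1}"
    "\<forall>\<theta>\<in>Theta. cl (inst \<theta> X) = Phi C (\<lambda>i\<in>{..<cdim C}. \<theta> (\<rho> i))" by simp_all
qed assumption+

text \<open>The weak topology of the cells is no finer than the quotient topology. Near a decoration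
  \<open>d0\<close> the discrete data are constant; on the open set \<open>N\<close> where they
  agree with those of \<open>d0\<close>, all graphs are instances of one graph \<open>Y\<close>, and
  \<open>factor_cell\<close> writes their classes as \<open>Phi C (g d)\<close> with
  \<open>g\<close> continuous. Openness in the plain product suffices, the k-ification being
  finer.\<close>

lemma openin_from_cells:
  assumes U: "U \<subseteq> pset S_prop n m"
    and c: "\<And>C. C \<in> cells n m \<Longrightarrow> openin (cube (cdim C)) {s \<in> topspace (cube (cdim C)). Phi C s \<in> U}"
  shows "openin (cw_top (phom S_prop n m)) U"
  unfolding openin_S
proof (intro conjI U allI impI openin_kification_finer)
  fix G assume G: "typed n m G"
  show "openin (decs G) {d \<in> topspace (decs G). cl (G, d) \<in> U}"
  proof (subst openin_subopen, intro ballI)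
    fix d0 assume "d0 \<in> {d \<in> topspace (decs G). cl (G, d) \<in> U}"
    then have d0: "d0 \<in> topspace (decs G)" "cl (G, d0) \<in> U" by auto
    let ?X = "(G, d0)" and ?P = "par_verts (G, d0)"
    let ?K = "card ?P"
    note X = decs_dgraph[OF G d0(1)]
    obtain Y where Y: "Y \<in> dgraphs \<B> n m" "fst Y = fst ?X" "pars Y = mset (map name [0..<?K])"
      "\<And>v. v < g_size (fst ?X) \<Longrightarrow> snd Y v = (if v \<in> ?P
         then (cout (snd ?X v), ccell (snd ?X v), cpt (snd Y v), cin (snd ?X v)) else snd ?X v)"
      "par_verts Y = ?P"
      using ex_name[OF X] by blast
    have Yd: "snd Y v = (if v \<in> ?P then (cout (d0 v), ccell (d0 v), cpt (snd Y v), cin (d0 v)) else d0 v)"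
      if v: "v < g_size G" for v
      using Y(4)[of v, unfolded fst_conv snd_conv, OF v] .
    define f where "f v = cpt (snd Y v) 0" for v
    have fim: "f ` ?P = name ` {..<?K}"
      using set_pars[of Y] Y(3,5) by (simp add: f_def[abs_def] atLeast0LessThan)
    have "card (f ` ?P) = ?K"
      unfolding fim using card_image[OF inj_on_subset[OF inj_name subset_UNIV], of "{..<?K}"] by simp
    then have finj: "inj_on f ?P" by (rule eq_card_imp_inj_on[OF finite_par_verts])
    \<comment> \<open>The vertex at which \<open>Y\<close> carries the variable
      \<open>name i\<close>. Below, \<open>th d\<close> substitutes for that variable the parameter
      that \<open>d\<close> has at this vertex.\<close>
    define vx where "vx i = inv_into ?P f (name i)" for i
    have vx: "vx i \<in> ?P" "f (vx i) = name i" if "i < ?K" for i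
      using that fim unfolding vx_def by (auto intro: inv_into_into f_inv_into_f)
    have vxf: "vx i = v" if "v \<in> ?P" "f v = name i" for v i
      using that finj unfolding vx_def by (metis inv_into_f_f)
    define th where "th d = theta ?K (\<lambda>i. cpt (d (vx i)) 0)" for d :: "nat \<Rightarrow> S_cell cell_point"
    define N where "N = {d \<in> topspace (decs G). \<forall>v\<in>{..<g_size G}. label (d v) = label (d0 v)}"
    have ND: "d v \<in> cell_points S_cells (v_in G v) (v_out G v)" "label (d v) = label (d0 v)"
      if "d \<in> N" "v < g_size G" for d v
      using that by (auto simp: N_def topspace_decs dest: PiE_mem)
    have Plt: "v < g_size G" "S_dim (ccell (d0 v)) = 1" if "v \<in> ?P" for v
      using that by (auto simp: par_verts_def)
    have cp: "cpt (d v) 0 \<in> {0..1}" if "d \<in> N" "v \<in> ?P" for d v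
      using ND[OF that(1) Plt(1)[OF that(2)]] Plt(2)[OF that(2)] cube_coord[of "cpt (d v)" 1 0]
      by (simp add: in_cell_points label_def)
    have thT: "th d \<in> Theta" if "d \<in> N" for d
      unfolding th_def by (rule theta_Theta) (rule cp[OF that vx(1)])
    have clN: "cl (G, d) = cl (inst (th d) Y)" if d: "d \<in> N" for d
    proof (rule cl_agree(2)[OF inst_Theta(1)[OF thT[OF d] Y(1)]])
      fix v assume "v < g_size (fst (inst (th d) Y))"
      then have v: "v < g_size G" using Y(2) by (simp add: inst_def)
      note D = ND[OF d v]
      show "snd (G, d) v = snd (inst (th d) Y) v"
      proof (cases "v \<in> ?P")
        case True
        then have "f v \<in> name ` {..<?K}" unfolding fim[symmetric] by (rule imageI)
        then obtain i where i: "i < ?K" "f v = name i" by auto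
        then have "th d (cpt (snd Y v) 0) = cpt (d v) 0"
          unfolding th_def using theta_name[OF i(1)] vxf[OF True i(2)] by (simp add: f_def)
        moreover have "S_dim (ccell (d v)) = 1" using D(2) Plt(2)[OF True] by (simp add: label_def)
        moreover have "cpt (d v) = pt1 (cpt (d v) 0)"
          by (rule cube_point_eqI[where k = 1])
            (use D(1) calculation(2) pt1_in_cube cp[OF d True] in \<open>simp_all add: in_cell_points\<close>)
        ultimately show ?thesis
          using Yd[OF v] True D(2) by (simp add: inst_def inst_pt_def label_def prod_eq_iff)
      next
        case False
        then have "S_dim (ccell (d0 v)) \<noteq> 1" using v by (simp add: par_verts_def)
        then have z: "S_dim (ccell (d0 v)) = 0" using S_dim_le[of "ccell (d0 v)"] by linarith
        have "d0 \<in> N" using d0(1) by (simp add: N_def)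
        have "cpt (d v) = cpt (d0 v)"
          by (rule cube_point_eqI[where k = 0])
            (use D z ND(1)[OF \<open>d0 \<in> N\<close> v] in \<open>simp_all add: in_cell_points label_def\<close>)
        then show ?thesis
          using Yd[OF v] False D(2) z by (simp add: inst_def inst_pt_def label_def prod_eq_iff)
      qed
    qed (simp add: inst_def Y(2))
    obtain C \<rho> where C0: "C \<in> cells n m" "cdim C \<le> size (filter_mset (\<lambda>s. s \<noteq> 0 \<and> s \<noteq> 1) (pars Y))"
      "\<And>i. i < cdim C \<Longrightarrow> \<rho> i \<in># pars Y \<and> \<rho> i \<in> {0<..<1}"
      "\<And>\<theta>. \<theta> \<in> Theta \<Longrightarrow> cl (inst \<theta> Y) = Phi C (\<lambda>i\<in>{..<cdim C}. \<theta> (\<rho> i))"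
      using factor_cell_ex[OF Y(1)] by blast
    note C = C0(1,3,4)
    define g where "g d = (\<lambda>i\<in>{..<cdim C}. th d (\<rho> i))" for d
    have oN: "openin (decs G) N"
    proof -
      have lab_open: "openin (decs G) {d \<in> topspace (decs G). d v \<in> {p \<in> cell_points S_cells (v_in G v) (v_out G v). label p = label (d0 v)}}"
        if "v < g_size G" for v
        by (rule openin_continuous_map_preimage[OF _ openin_label])
          (unfold decs_def, rule continuous_map_product_projection, use that in simp)
      then have "openin (decs G) {d \<in> topspace (decs G). label (d v) = label (d0 v)}" if "v < g_size G" for v
      proof -
        have "{d \<in> topspace (decs G). d v \<in> {p \<in> cell_points S_cells (v_in G v) (v_out G v). label p = label (d0 v)}} =
          {d \<in> topspace (decs G). label (d v) = label (d0 v)}"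
          using that by (auto simp: topspace_decs dest: PiE_mem)
        then show ?thesis using lab_open[OF that] by simp
      qed
      moreover have "N = topspace (decs G) \<inter> (\<Inter>v\<in>{..<g_size G}. {d \<in> topspace (decs G). label (d v) = label (d0 v)})"
        by (auto simp: N_def)
      \<comment> \<open>A graph without vertices is treated apart, since the intersection is then
        over an empty family.\<close>
      ultimately show ?thesis
        by (cases "g_size G = 0") (auto intro!: openin_Int openin_Inter)
    qed
    have cg: "continuous_map (subtopology (decs G) N) (cube (cdim C)) g"
    proof (rule continuous_map_into_cube)
      fix k assume k: "k < cdim C"
      then obtain i where i: "i < ?K" "\<rho> k = name i" using C(2)[OF k] by (auto simp: Y(3))
      have v: "vx i \<in> ?P" using vx(1)[OF i(1)] .
      have "continuous_map (decs G) euclideanreal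
         ((\<lambda>p. if S_dim (ccell p) = 1 then cpt p 0 else 0) \<circ> (\<lambda>d. d (vx i)))"
        by (rule continuous_map_compose[OF _ continuous_cpt])
          (unfold decs_def, rule continuous_map_product_projection, use Plt(1)[OF v] in simp)
      then have "continuous_map (subtopology (decs G) N) euclideanreal
         ((\<lambda>p. if S_dim (ccell p) = 1 then cpt p 0 else 0) \<circ> (\<lambda>d. d (vx i)))"
        by (rule continuous_map_from_subtopology)
      then show "continuous_map (subtopology (decs G) N) euclideanreal (\<lambda>d. g d k)"
      proof (rule continuous_map_eq)
        fix d assume "d \<in> topspace (subtopology (decs G) N)"
        then have "d \<in> N" by simp
        then have "S_dim (ccell (d (vx i))) = 1"
          using ND(2)[OF _ Plt(1)[OF v]] Plt(2)[OF v] by (simp add: label_def)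
        then show "((\<lambda>p. if S_dim (ccell p) = 1 then cpt p 0 else 0) \<circ> (\<lambda>d. d (vx i))) d = g d k"
          using k i by (simp add: g_def th_def theta_name)
      qed
    next
      fix d k assume "d \<in> topspace (subtopology (decs G) N)" "k < cdim C"
      then show "g d k \<in> {0..1}"
        using thT[of d] C(2)[of k] by (auto simp: g_def Theta_def less_imp_le)
    qed (simp add: g_def)
    let ?N' = "{d \<in> topspace (subtopology (decs G) N). g d \<in> {s \<in> topspace (cube (cdim C)). Phi C s \<in> U}}"
    have "openin (subtopology (decs G) N) ?N'"
      by (rule openin_continuous_map_preimage[OF cg c[OF C(1)]])
    then have "openin (decs G) ?N'" using oN by (rule openin_trans_full)
    moreover have eq: "cl (G, d) = Phi C (g d)" if "d \<in> N" for d
      unfolding clN[OF that] C(3)[OF thT[OF that]] g_def ..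
    have "d0 \<in> N" using d0(1) by (simp add: N_def)
    then have "d0 \<in> ?N'"
      using d0 eq cg by (auto simp: continuous_map_def Pi_iff)
    moreover have "?N' \<subseteq> {d \<in> topspace (decs G). cl (G, d) \<in> U}" using eq by auto
    ultimately show "\<exists>T. openin (decs G) T \<and> d0 \<in> T \<and> T \<subseteq> {d \<in> topspace (decs G). cl (G, d) \<in> U}" by blast
  qed
qed

subsection \<open>The cell structure\<close>

lemma cells_dgraph: "C \<in> cells n m \<Longrightarrow> C \<in> dgraphs \<B> n m"
  using cells_cand by (simp add: cand_def red_def)

lemma Phi_in:
  assumes "C \<in> cells n m" "s \<in> topspace (cube (cdim C))"
  shows "Phi C s \<in> pset S_prop n m"
  unfolding Phi_def by (rule cl_in[OF inst_Theta(1)[OF theta_cube[OF assms(2)] cells_dgraph[OF assms(1)]]])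

lemma open_cube_coord: "\<lbrakk>s \<in> open_cube k; i < k\<rbrakk> \<Longrightarrow> s i \<in> {0<..<1}"
  unfolding open_cube_def by (drule PiE_mem[of _ _ _ i]) auto

lemma open_cube_theta:
  assumes C: "C \<in> cells n m" and s: "s \<in> open_cube (cdim C)"
  shows "red n m (inst (theta (cdim C) s) C)" "ev (inst (theta (cdim C) s) C) = (n, map (map_tm (theta (cdim C) s)) (outs C))"
    "\<And>x. x \<in> {0<..<1} \<Longrightarrow> theta (cdim C) s x \<in> {0<..<1}"
proof -
  have rC: "red n m C" using cells_cand[OF C] by (simp add: cand_def)
  have T: "theta (cdim C) s \<in> Theta" using theta_cube open_cube_subset s by blast
  show i: "theta (cdim C) s x \<in> {0<..<1}" if "x \<in> {0<..<1}" for x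
    by (rule theta_inner[OF _ that]) (rule open_cube_coord[OF s])
  show r: "red n m (inst (theta (cdim C) s) C)"
    by (rule red_inst[OF rC T i]) (use rC in \<open>auto simp: red_def\<close>)
  show "ev (inst (theta (cdim C) s) C) = (n, map (map_tm (theta (cdim C) s)) (outs C))"
    using red_ev(1) r inst_Theta(2)[OF T cells_dgraph[OF C]] by (simp add: red_red_graph)
qed

lemma map_tm_eqD: "map_tm f t = map_tm g t \<Longrightarrow> x \<in> set_tm t \<Longrightarrow> f x = g x"
  by (induction t) auto

lemma set_tm_sub: "u \<in> sub t \<Longrightarrow> set_tm u \<subseteq> set_tm t"
  by (induction t) auto

text \<open>In a reduced graph every vertex lies upstream of an output (\<open>red_alive\<close>),
  so its parameter occurs in that output's term.\<close>

lemma red_pars_outs: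
  assumes "red n m X" "x \<in># pars X"
  shows "\<exists>t\<in>set (outs X). x \<in> set_tm t"
proof -
  have R: "red_graph n m X (vtxs X)" using assms(1) by (simp add: red_red_graph)
  have sX: "sdg X" using assms(1) by (simp add: red_def dgraphs_iff)
  have "x \<in># (\<Sum>v\<in>vtxs X. vpar v)" using assms(2) graph_lin(2)[OF sX] by simp
  then obtain v where v: "v \<in> vtxs X" "x \<in># vpar v"
    unfolding set_mset_sum[OF red_finite[OF R]] by blast
  obtain t u where t: "t \<in> set (vouts v)" "u \<in> set (outs X)" "t \<in> sub u" using red_alive[OF R v(1)] by blast
  have "x \<in> set_tm t" using v(2) t(1) by (cases v) auto
  then show ?thesis using set_tm_sub[OF t(3)] t(2) by blast
qed

text \<open>Over an open cube the instance is reduced, so soundness makes its output terms equal.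
  Their images under \<open>half\<close> give the shape and hence the cell; since every variable
  occurs in an output of the cell, the coordinates are recovered as well.\<close>

lemma Phi_inj:
  assumes C: "C \<in> cells n m" and D: "D \<in> cells n m" and s: "s \<in> open_cube (cdim C)" and t: "t \<in> open_cube (cdim D)"
    and eq: "Phi C s = Phi D t"
  shows "C = D \<and> s = t"
proof -
  note cs = open_cube_theta[OF C s] and dt = open_cube_theta[OF D t]
  have d: "inst (theta (cdim C) s) C \<in> dgraphs \<B> n m" "inst (theta (cdim D) t) D \<in> dgraphs \<B> n m"
    using cs(1) dt(1) by (simp_all add: red_def)
  have "ev (inst (theta (cdim C) s) C) = ev (inst (theta (cdim D) t) D)"
    using cl_sound[OF d] eq by (simp add: Phi_def)
  then have o: "map (map_tm (theta (cdim C) s)) (outs C) = map (map_tm (theta (cdim D) t)) (outs D)"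
    unfolding cs(2) dt(2) by simp
  have sh: "map (map_tm half) (map (map_tm (theta (cdim E) u)) (outs E)) = shape E"
    if E: "E \<in> cells n m" and u: "u \<in> open_cube (cdim E)" for E u
  proof -
    have rE: "red n m E" using cells_cand[OF E] by (simp add: cand_def)
    have "map_tm half (map_tm (theta (cdim E) u) v) = map_tm half v" if "v \<in> set (outs E)" for v
    proof -
      have "set_tm v \<subseteq> {0<..<1}" using red_ev(2) rE that by (simp add: red_red_graph)
      then have "half (theta (cdim E) u x) = half x" if "x \<in> set_tm v" for x
        using open_cube_theta(3)[OF E u, of x] that by (auto simp: half_def)
      then show ?thesis by (simp add: tm.map_comp comp_def cong: tm.map_cong)
    qed
    then show ?thesis by (simp add: shape_def)
  qed
  have CD: "C = D" using cells_shape[OF C D] sh[OF C s] sh[OF D t] o by metis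
  have "s = t"
  proof (rule extensionalityI)
    show "s \<in> extensional {..<cdim C}" "t \<in> extensional {..<cdim C}"
      using s t CD by (auto simp: open_cube_def PiE_def)
    fix i assume "i \<in> {..<cdim C}"
    then have i: "i < cdim C" by simp
    have rC: "red n m C" using cells_cand[OF C] by (simp add: cand_def)
    have "name i \<in># pars C" using i unfolding set_pars cand_pars(2)[OF cells_cand[OF C]] by simp
    then obtain u where u: "u \<in> set (outs C)" "name i \<in> set_tm u" using red_pars_outs[OF rC] by blast
    have "map_tm (theta (cdim C) s) u = map_tm (theta (cdim C) t) u" using o u(1) CD by simp
    from map_tm_eqD[OF this u(2)] show "s i = t i" using i by (simp add: theta_name)
  qed
  then show ?thesis using CD by simp
qed

text \<open>Set the variable with number \<open>k\<close> to \<open>e\<close> and keep the others: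
  the resulting graph \<open>X\<close> has fewer inner parameters, so \<open>factor_cell\<close>
  yields a cell of smaller dimension together with its coordinate map \<open>g\<close>.\<close>

lemma Phi_facet:
  assumes C: "C \<in> cells n m" and k: "k < cdim C" and e: "e \<in> {0, 1}"
  shows "\<exists>D\<in>cells n m. \<exists>g. cdim D < cdim C \<and> continuous_map (cube (cdim C)) (cube (cdim D)) g \<and>
     (\<forall>s\<in>topspace (cube (cdim C)). s k = e \<longrightarrow> Phi C s = Phi D (g s))"
proof -
  let ?n = "cdim C"
  note cC = cells_cand[OF C] and dC = cells_dgraph[OF C]
  define \<theta>0 where "\<theta>0 = theta ?n (\<lambda>i. if i = k then e else name i)"
  have T0: "\<theta>0 \<in> Theta" unfolding \<theta>0_def by (rule theta_Theta) (use e name_bounds in \<open>auto simp: less_imp_le\<close>)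
  define X where "X = inst \<theta>0 C"
  have dX: "X \<in> dgraphs \<B> n m" unfolding X_def by (rule inst_Theta(1)[OF T0 dC])
  have "pars C = mset (map name [0..<?n])" using cC by (simp only: cand_def)
  then have "pars X = image_mset \<theta>0 (mset (map name [0..<?n]))"
    unfolding X_def pars_inst by (rule arg_cong)
  also have "\<dots> = mset (map (\<theta>0 \<circ> name) [0..<?n])"
    by (metis map_map mset_map)
  also have "map (\<theta>0 \<circ> name) [0..<?n] = map (\<lambda>i. if i = k then e else name i) [0..<?n]"
    by (rule map_cong) (auto simp: \<theta>0_def theta_name)
  finally have pX: "pars X = mset (map (\<lambda>i. if i = k then e else name i) [0..<?n])" .
  obtain D \<rho> where D: "D \<in> cells n m" "cdim D \<le> size (filter_mset (\<lambda>s. s \<noteq> 0 \<and> s \<noteq> 1) (pars X))"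
    "\<And>i. i < cdim D \<Longrightarrow> \<rho> i \<in># pars X \<and> \<rho> i \<in> {0<..<1}"
    "\<And>\<theta>. \<theta> \<in> Theta \<Longrightarrow> cl (inst \<theta> X) = Phi D (\<lambda>i\<in>{..<cdim D}. \<theta> (\<rho> i))"
    using factor_cell_ex[OF dX] by blast
  have "e \<in># pars X" using k unfolding pX by (auto intro!: image_eqI[of _ _ k])
  then have "filter_mset (\<lambda>s. s \<noteq> 0 \<and> s \<noteq> 1) (pars X) \<subset># pars X"
    using e by (auto simp: subset_mset.less_le filter_mset_eq_conv)
  then have "size (filter_mset (\<lambda>s. s \<noteq> 0 \<and> s \<noteq> 1) (pars X)) < size (pars X)" by (rule mset_subset_size)
  then have lt: "cdim D < ?n" using D(2) by (simp add: pX)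
  define g where "g s = (\<lambda>i\<in>{..<cdim D}. theta ?n s (\<rho> i))" for s
  have \<rho>: "\<exists>j<?n. \<rho> i = name j" if i: "i < cdim D" for i
  proof -
    have "\<rho> i \<noteq> e" using D(3)[OF i] e by auto
    then show ?thesis using D(3)[OF i] by (auto simp: pX split: if_splits)
  qed
  have "continuous_map (cube ?n) (cube (cdim D)) g"
  proof (rule continuous_map_into_cube)
    fix i assume i: "i < cdim D"
    then obtain j where "j < ?n" "\<rho> i = name j" using \<rho> by blast
    then show "continuous_map (cube ?n) euclideanreal (\<lambda>s. g s i)"
      using i by (simp add: g_def continuous_theta)
  next
    fix s i assume s: "s \<in> topspace (cube ?n)" and i: "i < cdim D"
    show "g s i \<in> {0..1}"
      using theta_cube[OF s] D(3)[OF i] i by (auto simp: g_def Theta_def less_imp_le)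
  qed (simp add: g_def)
  moreover have "Phi C s = Phi D (g s)" if s: "s \<in> topspace (cube ?n)" "s k = e" for s
  proof -
    have T: "theta ?n s \<in> Theta" by (rule theta_cube[OF s(1)])
    have TT: "theta ?n s \<circ> \<theta>0 \<in> Theta" using T T0 by (auto simp: Theta_def)
    \<comment> \<open>On the facet, substituting \<open>s\<close> after \<open>\<theta>0\<close> is
      the same as substituting \<open>s\<close>, because \<open>s k = e\<close> and \<open>e\<close>
      is fixed.\<close>
    have "cl (inst (theta ?n s) C) = cl (inst (theta ?n s \<circ> \<theta>0) C)"
    proof (rule cl_inst_cong[OF dC TT])
      fix x assume "x \<in># pars C"
      then obtain i where i: "i < ?n" "x = name i" unfolding set_pars cand_pars(2)[OF cC] by auto
      show "(theta ?n s \<circ> \<theta>0) x = theta ?n s x"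
      proof (cases "i = k")
        case True
        have "theta ?n s e = e" using e T by (auto simp: Theta_def)
        then show ?thesis using i True s(2) by (simp add: \<theta>0_def theta_name)
      qed (use i in \<open>simp add: \<theta>0_def theta_name\<close>)
    qed
    then have "Phi C s = cl (inst (theta ?n s) X)" by (simp add: Phi_def X_def inst_inst)
    then show ?thesis unfolding D(4)[OF T] g_def .
  qed
  ultimately show ?thesis using D(1) lt by blast
qed

lemma Phi_cover:
  assumes X: "X \<in> dgraphs \<B> n m"
  obtains C s where "C \<in> cells n m" "s \<in> open_cube (cdim C)" "cl X = Phi C s"
    "cdim C \<le> size (filter_mset (\<lambda>s. s \<noteq> 0 \<and> s \<noteq> 1) (pars X))"
proof -
  obtain C \<rho> where C: "C \<in> cells n m" "cdim C \<le> size (filter_mset (\<lambda>s. s \<noteq> 0 \<and> s \<noteq> 1) (pars X))"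
    "\<And>i. i < cdim C \<Longrightarrow> \<rho> i \<in># pars X \<and> \<rho> i \<in> {0<..<1}"
    "\<And>\<theta>. \<theta> \<in> Theta \<Longrightarrow> cl (inst \<theta> X) = Phi C (\<lambda>i\<in>{..<cdim C}. \<theta> (\<rho> i))"
    using factor_cell_ex[OF X] by blast
  show ?thesis
  proof (rule that[OF C(1) _ _ C(2)])
    show "(\<lambda>i\<in>{..<cdim C}. \<rho> i) \<in> open_cube (cdim C)" using C(3) by (auto simp: open_cube_def)
    show "cl X = Phi C (\<lambda>i\<in>{..<cdim C}. \<rho> i)"
      using C(4)[OF id_Theta] cl_inst_id[OF X] by simp
  qed
qed

lemma cube_complex_S:
  "cube_complex (pset S_prop n m) (cells n m) cdim Phi (cw_top (phom S_prop n m))"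
proof
  fix U
  show "openin (cw_top (phom S_prop n m)) U \<longleftrightarrow> U \<subseteq> pset S_prop n m \<and>
     (\<forall>C\<in>cells n m. openin (cube (cdim C)) {x \<in> topspace (cube (cdim C)). Phi C x \<in> U})" (is "?l \<longleftrightarrow> ?r")
  proof
    assume U: ?l
    then have "U \<subseteq> pset S_prop n m" by (rule openin_subset)
    moreover have "openin (cube (cdim C)) {x \<in> topspace (cube (cdim C)). Phi C x \<in> U}" if "C \<in> cells n m" for C
      by (rule openin_continuous_map_preimage[OF continuous_Phi[OF that] U])
    ultimately show ?r by blast
  qed (rule openin_from_cells; blast)
next
  show "pset S_prop n m = (\<Union>C\<in>cells n m. Phi C ` open_cube (cdim C))"
  proof (intro set_eqI iffI)
    fix z assume "z \<in> pset S_prop n m"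
    then obtain X where X: "X \<in> dgraphs \<B> n m" "z = cl X" unfolding pset_S by blast
    from Phi_cover[OF X(1)] obtain C s where "C \<in> cells n m" "s \<in> open_cube (cdim C)" "cl X = Phi C s" .
    then show "z \<in> (\<Union>C\<in>cells n m. Phi C ` open_cube (cdim C))" using X(2) by blast
  next
    fix z assume "z \<in> (\<Union>C\<in>cells n m. Phi C ` open_cube (cdim C))"
    then obtain C s where C: "C \<in> cells n m" "s \<in> open_cube (cdim C)" "z = Phi C s" by blast
    show "z \<in> pset S_prop n m"
      unfolding C(3) by (rule Phi_in[OF C(1)]) (use C(2) open_cube_subset in blast)
  qed
next
  show "inj_on (Phi C) (open_cube (cdim C))" if "C \<in> cells n m" for C
    by (rule inj_onI) (use Phi_inj[OF that that] in simp)
next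
  show "C = D" if "C \<in> cells n m" "D \<in> cells n m" "u \<in> open_cube (cdim C)" "v \<in> open_cube (cdim D)" "Phi C u = Phi D v"
    for C D u v
    using Phi_inj[OF that] by simp
qed (fact Phi_in Phi_facet)+

text \<open>At each vertex the least admissible value of \<open>\<kappa>\<close> is the number of
  inner coordinates of its decoration, and these add up to the number of inner parameters.\<close>

lemma skel_S: "skel (phom S_prop n m) k =
    {cl X |X. X \<in> dgraphs \<B> n m \<and> size (filter_mset (\<lambda>s. s \<noteq> 0 \<and> s \<noteq> 1) (pars X)) \<le> k}"
proof -
  define nd :: "S_cell cell_point \<Rightarrow> nat" where "nd p = card {i. i < S_dim (ccell p) \<and> cpt p i \<notin> {0, 1}}" for p
  have nd: "nd p = (if S_dim (ccell p) = 1 \<and> cpt p 0 \<noteq> 0 \<and> cpt p 0 \<noteq> 1 then 1 else 0)" for p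
  proof (cases "S_dim (ccell p) = 1")
    case True
    then have "{i. i < S_dim (ccell p) \<and> cpt p i \<notin> {0, 1}} = (if cpt p 0 \<noteq> 0 \<and> cpt p 0 \<noteq> 1 then {0} else {})"
      by (auto simp: One_nat_def)
    then show ?thesis using True by (simp add: nd_def)
  next
    case False
    then have "S_dim (ccell p) = 0" using S_dim_le[of "ccell p"] by linarith
    then show ?thesis by (simp add: nd_def)
  qed
  have sum: "(\<Sum>v<g_size (fst X). nd (snd X v)) = size (filter_mset (\<lambda>s. s \<noteq> 0 \<and> s \<noteq> 1) (pars X))" for X
  proof -
    have "size (filter_mset (\<lambda>s. s \<noteq> 0 \<and> s \<noteq> 1) (pars X)) =
       card {v \<in> par_verts X. cpt (snd X v) 0 \<noteq> 0 \<and> cpt (snd X v) 0 \<noteq> 1}"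
      by (simp add: pars_eq filter_mset_image_mset)
    also have "\<dots> = (\<Sum>v<g_size (fst X). if v \<in> par_verts X \<and> cpt (snd X v) 0 \<noteq> 0 \<and> cpt (snd X v) 0 \<noteq> 1 then 1 else 0)"
    proof -
      have "{v \<in> par_verts X. cpt (snd X v) 0 \<noteq> 0 \<and> cpt (snd X v) 0 \<noteq> 1} =
        {v \<in> {..<g_size (fst X)}. v \<in> par_verts X \<and> cpt (snd X v) 0 \<noteq> 0 \<and> cpt (snd X v) 0 \<noteq> 1}"
        by (auto simp: par_verts_def)
      then show ?thesis by (simp only: card_eq_sum sum.inter_filter[OF finite_lessThan])
    qed
    also have "\<dots> = (\<Sum>v<g_size (fst X). nd (snd X v))"
      by (rule sum.cong) (auto simp: nd par_verts_def)
    finally show ?thesis ..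
  qed
  have bsk: "skel (bsp \<B> a b) \<kappa> = {p \<in> cell_points S_cells a b. nd p \<le> \<kappa>}" for a b \<kappa>
    by (auto simp: cell_bimodule_def nd_def S_cells_def)
  have "skel (phom \<F> n m) k = dgraph_class \<B> ` {X \<in> dgraphs \<B> n m. (\<Sum>v<g_size (fst X). nd (snd X v)) \<le> k}"
  proof -
    have "(\<exists>\<kappa>. (\<forall>v<g_size G. d v \<in> skel (bsp \<B> (v_in G v) (v_out G v)) (\<kappa> v)) \<and> (\<Sum>v<g_size G. \<kappa> v) \<le> k) \<longleftrightarrow>
        (\<Sum>v<g_size G. nd (d v)) \<le> k" if "(G, d) \<in> dgraphs \<B> n m" for G d
    proof
      assume "\<exists>\<kappa>. (\<forall>v<g_size G. d v \<in> skel (bsp \<B> (v_in G v) (v_out G v)) (\<kappa> v)) \<and> (\<Sum>v<g_size G. \<kappa> v) \<le> k"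
      then obtain \<kappa> where \<kappa>: "\<forall>v<g_size G. nd (d v) \<le> \<kappa> v" "(\<Sum>v<g_size G. \<kappa> v) \<le> k" by (auto simp: bsk)
      have "(\<Sum>v<g_size G. nd (d v)) \<le> (\<Sum>v<g_size G. \<kappa> v)" by (rule sum_mono) (use \<kappa>(1) in simp)
      then show "(\<Sum>v<g_size G. nd (d v)) \<le> k" using \<kappa>(2) by simp
    next
      assume "(\<Sum>v<g_size G. nd (d v)) \<le> k"
      then show "\<exists>\<kappa>. (\<forall>v<g_size G. d v \<in> skel (bsp \<B> (v_in G v) (v_out G v)) (\<kappa> v)) \<and> (\<Sum>v<g_size G. \<kappa> v) \<le> k"
        using that by (intro exI[of _ "\<lambda>v. nd (d v)"]) (simp add: bsk dgraphs_def topspace_bsp)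
    qed
    then have "{(G, d) \<in> dgraphs \<B> n m.
        \<exists>\<kappa>. (\<forall>v<g_size G. d v \<in> skel (bsp \<B> (v_in G v) (v_out G v)) (\<kappa> v)) \<and> (\<Sum>v<g_size G. \<kappa> v) \<le> k} =
      {X \<in> dgraphs \<B> n m. (\<Sum>v<g_size (fst X). nd (snd X v)) \<le> k}"
      by (intro set_eqI) (simp split: prod.split cong: conj_cong)
    then show ?thesis unfolding free_on_cells_def free_prop_def by simp
  qed
  then have "skel (phom S_prop n m) k = cl ` {X \<in> dgraphs \<B> n m. (\<Sum>v<g_size (fst X). nd (snd X v)) \<le> k}"
    unfolding S_prop_def S_attached_eq by (simp add: prop_quot_def image_image cl_def acl_def S_attached_eq)
  then show ?thesis unfolding sum by blast
qed

text \<open>Reducing a graph does not increase its number of inner parameters, so the filtration by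
  graphs is the filtration by dimension of cells.\<close>

lemma skel_S_cells:
  "skel (phom S_prop n m) k = (\<Union>C\<in>{C \<in> cells n m. cdim C \<le> k}. Phi C ` open_cube (cdim C))"
proof (intro set_eqI iffI)
  fix z assume "z \<in> skel (phom S_prop n m) k"
  then obtain X where X: "X \<in> dgraphs \<B> n m" "size (filter_mset (\<lambda>s. s \<noteq> 0 \<and> s \<noteq> 1) (pars X)) \<le> k" "z = cl X"
    unfolding skel_S by blast
  obtain C s where "C \<in> cells n m" "s \<in> open_cube (cdim C)" "cl X = Phi C s"
    "cdim C \<le> size (filter_mset (\<lambda>s. s \<noteq> 0 \<and> s \<noteq> 1) (pars X))" using Phi_cover[OF X(1)] by blast
  then show "z \<in> (\<Union>C\<in>{C \<in> cells n m. cdim C \<le> k}. Phi C ` open_cube (cdim C))"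
    unfolding X(3) using order_trans[OF _ X(2)] by blast
next
  fix z assume "z \<in> (\<Union>C\<in>{C \<in> cells n m. cdim C \<le> k}. Phi C ` open_cube (cdim C))"
  then obtain C s where C: "C \<in> cells n m" "cdim C \<le> k" "s \<in> open_cube (cdim C)" "z = Phi C s" by auto
  have "size (filter_mset (\<lambda>s. s \<noteq> 0 \<and> s \<noteq> 1) (pars (inst (theta (cdim C) s) C))) \<le> cdim C"
    by (rule order_trans[OF size_filter_mset_lesseq]) (simp add: pars_inst)
  moreover have "inst (theta (cdim C) s) C \<in> dgraphs \<B> n m"
    using open_cube_theta(1)[OF C(1,3)] by (simp add: red_def)
  ultimately show "z \<in> skel (phom S_prop n m) k"
    unfolding skel_S C(4) Phi_def using C(2) order_trans by blast
qed

lemma CW_S: "CW_complex (phom S_prop n m)"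
proof -
  have "\<lparr>cw_top = cw_top (phom S_prop n m),
      skel = (\<lambda>k. \<Union>C\<in>{C \<in> cells n m. cdim C \<le> k}. Phi C ` open_cube (cdim C))\<rparr> = phom S_prop n m"
    by (simp add: skel_S_cells[symmetric])
  then show ?thesis using cube_complex.CW[OF cube_complex_S, of n m] by (simp only:)
qed

section \<open>The prop axioms\<close>

lemma bind_bind: "bind \<rho> (bind \<rho>' t) = bind (\<lambda>i. bind \<rho> (\<rho>' i)) t"
  by (induction t) auto

lemma bind_In: "bind In t = t"
  by (induction t) auto

text \<open>The representing graph, its arity included, is arbitrary; soundness makes the terms
  independent of it.\<close>

definition tms :: "S_cell cell_point dgraph set set set \<Rightarrow> real tm list" where
  "tms x = snd (ev (SOME X. \<exists>n m. X \<in> dgraphs \<B> n m \<and> cl X = x))"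

lemma tms_cl: "X \<in> dgraphs \<B> n m \<Longrightarrow> tms (cl X) = map norm (outs X)"
proof -
  assume X: "X \<in> dgraphs \<B> n m"
  define Y where "Y = (SOME Y. \<exists>n m. Y \<in> dgraphs \<B> n m \<and> cl Y = cl X)"
  have "\<exists>n m. Y \<in> dgraphs \<B> n m \<and> cl Y = cl X"
    unfolding Y_def by (rule someI) (use X in blast)
  then have "ev Y = ev X" using cl_sound X by blast
  then show ?thesis unfolding tms_def Y_def[symmetric] by (simp add: ev_def)
qed

lemma pset_E:
  assumes "x \<in> pset S_prop n m"
  obtains X where "X \<in> dgraphs \<B> n m" "x = cl X"
  using assms unfolding pset_S by blast

lemma length_tms: "x \<in> pset S_prop n m \<Longrightarrow> length (tms x) = m"
  by (erule pset_E) (simp add: tms_cl, simp add: dgraphs_iff)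

lemma In_tms:
  assumes x: "x \<in> pset S_prop n m" and j: "j < m" and i: "In i \<in> sub (tms x ! j)"
  shows "i < n"
proof -
  obtain X where X: "X \<in> dgraphs \<B> n m" "x = cl X" by (rule pset_E[OF x])
  then have l: "length (outs X) = m" by (simp add: dgraphs_iff)
  have "tms x ! j = norm (outs X ! j)" using X j l by (simp add: tms_cl)
  then have "In i \<in> sub (outs X ! j)" using i In_norm by simp
  moreover have "outs X ! j \<in> set (outs X) \<union> epss X" using j l by simp
  ultimately show ?thesis using In_outs[OF X(1)] by blast
qed

text \<open>Completeness turns an equation in the prop into equations of terms. All axioms of the
  prop and of its operad are proved through this.\<close>

lemma tms_eqI:
  assumes x: "x \<in> pset S_prop n m" and y: "y \<in> pset S_prop n m"
    and e: "\<And>j. j < m \<Longrightarrow> tms x ! j = tms y ! j"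
  shows "x = y"
proof -
  obtain X where X: "X \<in> dgraphs \<B> n m" "x = cl X" by (rule pset_E[OF x])
  obtain Y where Y: "Y \<in> dgraphs \<B> n m" "y = cl Y" by (rule pset_E[OF y])
  have "tms x = tms y" by (rule nth_equalityI) (use length_tms x y e in simp_all)
  then have "ev X = ev Y" using X Y by (simp add: tms_cl ev_def dgraphs_iff)
  then show ?thesis using cl_eq_iff X Y by blast
qed

lemma tms_hor:
  assumes x: "x \<in> pset S_prop n m" and y: "y \<in> pset S_prop n' m'" and j: "j < m + m'"
  shows "tms (phor S_prop x y) ! j =
    (if j < m then tms x ! j else bind (\<lambda>i. In (n + i)) (tms y ! (j - m)))"
proof -
  obtain X where X: "X \<in> dgraphs \<B> n m" "x = cl X" by (rule pset_E[OF x])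
  obtain Y where Y: "Y \<in> dgraphs \<B> n' m'" "y = cl Y" by (rule pset_E[OF y])
  have l: "length (outs X) = m" "length (outs Y) = m'" using X Y by (simp_all add: dgraphs_iff)
  note h = dgraph_hor[OF X(1) Y(1)]
  have "tms (phor S_prop x y) = map norm (outs X) @ map (bind (\<lambda>i. In (n + i))) (map norm (outs Y))"
    using X(2) Y(2) cl_hor[OF X(1) Y(1)] tms_cl[OF h(1)] h(2) by (simp add: norm_bind)
  then show ?thesis using X Y j l by (simp add: tms_cl nth_append)
qed

lemma tms_ver:
  assumes x: "x \<in> pset S_prop n m" and y: "y \<in> pset S_prop m l" and j: "j < l"
  shows "tms (pver S_prop y x) ! j = bind (\<lambda>i. tms x ! i) (tms y ! j)"
proof -
  obtain X where X: "X \<in> dgraphs \<B> n m" "x = cl X" by (rule pset_E[OF x])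
  obtain Y where Y: "Y \<in> dgraphs \<B> m l" "y = cl Y" by (rule pset_E[OF y])
  have l: "length (outs X) = m" "length (outs Y) = l" using X Y by (simp_all add: dgraphs_iff)
  note h = dgraph_ver[OF X(1) Y(1)]
  have "tms (pver S_prop y x) ! j = bind (\<lambda>i. norm (outs X ! i)) (norm (outs Y ! j))"
    using X(2) Y(2) cl_ver[OF X(1) Y(1)] tms_cl[OF h(1)] h(2) l j by (simp add: norm_bind)
  also have "\<dots> = bind (\<lambda>i. tms x ! i) (norm (outs Y ! j))"
  proof (rule bind_cong)
    fix i assume "In i \<in> sub (norm (outs Y ! j))"
    then have "i < m" using In_outs[OF Y(1), of "outs Y ! j" i] In_norm j l by simp
    then show "norm (outs X ! i) = tms x ! i" using X l by (simp add: tms_cl)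
  qed
  also have "norm (outs Y ! j) = tms y ! j" using Y j l by (simp add: tms_cl)
  finally show ?thesis .
qed

lemma perm_in: "\<sigma> permutes {..<n} \<Longrightarrow> pperm S_prop n \<sigma> \<in> pset S_prop n n"
  unfolding cl_perm by (rule cl_in[OF dgraph_perm(1)])

text \<open>Strand \<open>i\<close> moves to \<open>\<sigma> i\<close>, so output \<open>j\<close>
  has come from input \<open>inv \<sigma> j\<close>.\<close>

lemma tms_perm:
  assumes \<sigma>: "\<sigma> permutes {..<n}" and j: "j < n"
  shows "tms (pperm S_prop n \<sigma>) ! j = In (inv \<sigma> j)"
  unfolding cl_perm tms_cl[OF dgraph_perm(1)[OF \<sigma>]] dgraph_perm(2)[OF \<sigma>] using j by simp

lemma id_in: "pid S_prop n \<in> pset S_prop n n"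
  by (rule perm_in[OF permutes_id])

lemma tms_id: "j < n \<Longrightarrow> tms (pid S_prop n) ! j = In j"
  by (simp add: tms_perm[OF permutes_id])

lemma tms_perm_ver:
  assumes \<sigma>: "\<sigma> permutes {..<m}" and x: "x \<in> pset S_prop n m" and j: "j < m"
  shows "tms (pver S_prop (pperm S_prop m \<sigma>) x) ! j = tms x ! inv \<sigma> j"
  by (simp add: tms_ver[OF x perm_in[OF \<sigma>] j] tms_perm[OF \<sigma> j])

lemma inv_lt: "\<lbrakk>\<sigma> permutes {..<n}; j < n\<rbrakk> \<Longrightarrow> inv \<sigma> j < (n::nat)"
  using permutes_in_image[OF permutes_inv] by fastforce

lemma ver_assoc:
  assumes f: "f \<in> pset S_prop n m" and g: "g \<in> pset S_prop m l" and h: "h \<in> pset S_prop l k"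
  shows "pver S_prop h (pver S_prop g f) = pver S_prop (pver S_prop h g) f"
proof (rule tms_eqI)
  fix j assume j: "j < k"
  have "bind (\<lambda>i. tms (pver S_prop g f) ! i) (tms h ! j) = bind (\<lambda>i. bind (\<lambda>i. tms f ! i) (tms g ! i)) (tms h ! j)"
    by (rule bind_cong) (rule tms_ver[OF f g In_tms[OF h j]])
  then show "tms (pver S_prop h (pver S_prop g f)) ! j = tms (pver S_prop (pver S_prop h g) f) ! j"
    by (simp add: tms_ver[OF f \<S>.ver_in[OF g h] j] tms_ver[OF g h j] tms_ver[OF \<S>.ver_in[OF f g] h j] bind_bind)
qed (rule \<S>.ver_in[OF \<S>.ver_in[OF f g] h] \<S>.ver_in[OF f \<S>.ver_in[OF g h]])+

lemma ver_id:
  assumes f: "f \<in> pset S_prop n m"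
  shows "pver S_prop (pid S_prop m) f = f" "pver S_prop f (pid S_prop n) = f"
proof -
  show "pver S_prop (pid S_prop m) f = f"
    by (rule tms_eqI[OF \<S>.ver_in[OF f id_in] f]) (simp add: tms_ver[OF f id_in] tms_id)
  show "pver S_prop f (pid S_prop n) = f"
  proof (rule tms_eqI[OF \<S>.ver_in[OF id_in f] f])
    fix j assume j: "j < m"
    have "bind (\<lambda>i. tms (pid S_prop n) ! i) (tms f ! j) = bind In (tms f ! j)"
      by (rule bind_cong) (rule tms_id[OF In_tms[OF f j]])
    then show "tms (pver S_prop f (pid S_prop n)) ! j = tms f ! j"
      by (simp add: tms_ver[OF id_in f j] bind_In)
  qed
qed

lemma hor_assoc:
  assumes f: "f \<in> pset S_prop n m" and g: "g \<in> pset S_prop n' m'" and h: "h \<in> pset S_prop n'' m''"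
  shows "phor S_prop (phor S_prop f g) h = phor S_prop f (phor S_prop g h)"
proof (rule tms_eqI)
  show "phor S_prop (phor S_prop f g) h \<in> pset S_prop (n + n' + n'') (m + m' + m'')"
    by (intro \<S>.hor_in f g h)
  show "phor S_prop f (phor S_prop g h) \<in> pset S_prop (n + n' + n'') (m + m' + m'')"
    unfolding add.assoc by (intro \<S>.hor_in f g h)
  fix j assume j: "j < m + m' + m''"
  show "tms (phor S_prop (phor S_prop f g) h) ! j = tms (phor S_prop f (phor S_prop g h)) ! j"
    using j tms_hor[OF \<S>.hor_in[OF f g] h, of j] tms_hor[OF f \<S>.hor_in[OF g h], of j]
      tms_hor[OF f g, of j] tms_hor[OF g h, of "j - m"]
    by (auto simp: bind_bind add.assoc diff_diff_eq split: if_splits)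
qed

lemma hor_id:
  assumes f: "f \<in> pset S_prop n m"
  shows "phor S_prop (pid S_prop 0) f = f" "phor S_prop f (pid S_prop 0) = f"
proof -
  show "phor S_prop (pid S_prop 0) f = f"
    by (rule tms_eqI[OF _ f]) (use \<S>.hor_in[OF id_in[of 0] f] tms_hor[OF id_in[of 0] f] in \<open>simp_all add: bind_In\<close>)
  show "phor S_prop f (pid S_prop 0) = f"
    by (rule tms_eqI[OF _ f]) (use \<S>.hor_in[OF f id_in[of 0]] tms_hor[OF f id_in[of 0]] in simp_all)
qed

lemma interchange:
  assumes f: "f \<in> pset S_prop n m" and g: "g \<in> pset S_prop m l"
    and f': "f' \<in> pset S_prop n' m'" and g': "g' \<in> pset S_prop m' l'"
  shows "pver S_prop (phor S_prop g g') (phor S_prop f f') = phor S_prop (pver S_prop g f) (pver S_prop g' f')"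
proof (rule tms_eqI)
  note ff = \<S>.hor_in[OF f f'] and gg = \<S>.hor_in[OF g g']
  show "pver S_prop (phor S_prop g g') (phor S_prop f f') \<in> pset S_prop (n + n') (l + l')"
    "phor S_prop (pver S_prop g f) (pver S_prop g' f') \<in> pset S_prop (n + n') (l + l')"
    by (intro \<S>.ver_in[OF ff gg] \<S>.hor_in[OF \<S>.ver_in[OF f g] \<S>.ver_in[OF f' g']])+
  fix j assume j: "j < l + l'"
  note e = tms_ver[OF ff gg j] tms_hor[OF g g' j] tms_hor[OF \<S>.ver_in[OF f g] \<S>.ver_in[OF f' g'] j]
  show "tms (pver S_prop (phor S_prop g g') (phor S_prop f f')) ! j =
    tms (phor S_prop (pver S_prop g f) (pver S_prop g' f')) ! j"
  proof (cases "j < l")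
    case True
    have "bind (\<lambda>i. tms (phor S_prop f f') ! i) (tms g ! j) = bind (\<lambda>i. tms f ! i) (tms g ! j)"
    proof (rule bind_cong)
      fix i assume "In i \<in> sub (tms g ! j)"
      then have "i < m" by (rule In_tms[OF g True])
      then show "tms (phor S_prop f f') ! i = tms f ! i" by (simp add: tms_hor[OF f f'])
    qed
    then show ?thesis using True by (simp add: e tms_ver[OF f g])
  next
    case False
    then have j': "j - l < l'" using j by simp
    have "bind (\<lambda>i. tms (phor S_prop f f') ! (m + i)) (tms g' ! (j - l)) =
       bind (\<lambda>i. bind (\<lambda>i. In (n + i)) (tms f' ! i)) (tms g' ! (j - l))"
    proof (rule bind_cong)
      fix i assume "In i \<in> sub (tms g' ! (j - l))"
      then have "i < m'" by (rule In_tms[OF g' j'])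
      then show "tms (phor S_prop f f') ! (m + i) = bind (\<lambda>i. In (n + i)) (tms f' ! i)"
        by (simp add: tms_hor[OF f f'])
    qed
    then show ?thesis using False by (simp add: e tms_ver[OF f' g' j'] bind_bind)
  qed
qed

lemma perm_ver:
  assumes \<sigma>: "\<sigma> permutes {..<n}" and \<tau>: "\<tau> permutes {..<n}"
  shows "pver S_prop (pperm S_prop n \<sigma>) (pperm S_prop n \<tau>) = pperm S_prop n (\<sigma> \<circ> \<tau>)"
proof (rule tms_eqI)
  note p = permutes_compose[OF \<tau> \<sigma>]
  show "pver S_prop (pperm S_prop n \<sigma>) (pperm S_prop n \<tau>) \<in> pset S_prop n n" "pperm S_prop n (\<sigma> \<circ> \<tau>) \<in> pset S_prop n n"
    by (rule \<S>.ver_in[OF perm_in[OF \<tau>] perm_in[OF \<sigma>]] perm_in[OF p])+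
  fix j assume j: "j < n"
  show "tms (pver S_prop (pperm S_prop n \<sigma>) (pperm S_prop n \<tau>)) ! j = tms (pperm S_prop n (\<sigma> \<circ> \<tau>)) ! j"
    using tms_perm_ver[OF \<sigma> perm_in[OF \<tau>] j] tms_perm[OF \<tau> inv_lt[OF \<sigma> j]] tms_perm[OF p j]
      o_inv_distrib[OF permutes_bij[OF \<sigma>] permutes_bij[OF \<tau>]] by simp
qed

lemma permutesI_inverse:
  assumes "\<And>x. f' (f x) = x" "\<And>x. f (f' x) = x" "\<And>x. x \<notin> S \<Longrightarrow> f x = x"
  shows "f permutes S"
  unfolding permutes_def
proof (intro conjI allI impI)
  show "\<exists>!x. f x = y" for y
    by (rule ex1I[of _ "f' y"]) (use assms(1,2) in auto)
qed (rule assms(3))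

lemma perm_sum_permutes:
  assumes \<sigma>: "\<sigma> permutes {..<n}" and \<tau>: "\<tau> permutes {..<m}"
  shows "perm_sum n \<sigma> \<tau> permutes {..<n + m}" "inv (perm_sum n \<sigma> \<tau>) = perm_sum n (inv \<sigma>) (inv \<tau>)"
proof -
  have c: "perm_sum n \<sigma> \<tau> (perm_sum n \<sigma>' \<tau>' i) = i"
    if "\<sigma>' permutes {..<n}" "\<And>i. \<sigma> (\<sigma>' i) = i" "\<And>i. \<tau> (\<tau>' i) = i" for \<sigma> \<sigma>' \<tau> \<tau>' :: "nat \<Rightarrow> nat" and i
    using permutes_in_image[OF that(1), of i] that(2,3) by (simp add: perm_sum_def)
  have 1: "perm_sum n (inv \<sigma>) (inv \<tau>) (perm_sum n \<sigma> \<tau> i) = i" for i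
    by (rule c[OF \<sigma>]) (simp_all add: permutes_inverses[OF \<sigma>] permutes_inverses[OF \<tau>])
  have 2: "perm_sum n \<sigma> \<tau> (perm_sum n (inv \<sigma>) (inv \<tau>) i) = i" for i
    by (rule c[OF permutes_inv[OF \<sigma>]]) (simp_all add: permutes_inverses[OF \<sigma>] permutes_inverses[OF \<tau>])
  show "inv (perm_sum n \<sigma> \<tau>) = perm_sum n (inv \<sigma>) (inv \<tau>)" by (rule inv_equality[OF 1 2])
  have "perm_sum n \<sigma> \<tau> i = i" if "i \<notin> {..<n + m}" for i
    using that permutes_not_in[OF \<tau>, of "i - n"] by (simp add: perm_sum_def)
  then show "perm_sum n \<sigma> \<tau> permutes {..<n + m}" by (rule permutesI_inverse[OF 1 2])
qed

lemma perm_hor: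
  assumes \<sigma>: "\<sigma> permutes {..<n}" and \<tau>: "\<tau> permutes {..<m}"
  shows "phor S_prop (pperm S_prop n \<sigma>) (pperm S_prop m \<tau>) = pperm S_prop (n + m) (perm_sum n \<sigma> \<tau>)"
proof (rule tms_eqI)
  note p = perm_sum_permutes[OF \<sigma> \<tau>]
  show "phor S_prop (pperm S_prop n \<sigma>) (pperm S_prop m \<tau>) \<in> pset S_prop (n + m) (n + m)"
    "pperm S_prop (n + m) (perm_sum n \<sigma> \<tau>) \<in> pset S_prop (n + m) (n + m)"
    by (intro \<S>.hor_in perm_in \<sigma> \<tau> p)+
  fix j assume j: "j < n + m"
  show "tms (phor S_prop (pperm S_prop n \<sigma>) (pperm S_prop m \<tau>)) ! j = tms (pperm S_prop (n + m) (perm_sum n \<sigma> \<tau>)) ! j"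
    using tms_hor[OF perm_in[OF \<sigma>] perm_in[OF \<tau>] j] tms_perm[OF p(1) j] tms_perm[OF \<sigma>, of j] tms_perm[OF \<tau>, of "j - n"] j
    by (simp add: p(2) perm_sum_def)
qed

lemma block_swap_permutes:
  "block_swap n m permutes {..<n + m}" "inv (block_swap n m) = block_swap m n"
proof -
  have c: "block_swap n m (block_swap m n i) = i" for n m i unfolding block_swap_def by auto
  show "inv (block_swap n m) = block_swap m n" by (rule inv_equality) (rule c)+
  show "block_swap n m permutes {..<n + m}" by (rule permutesI_inverse[of "block_swap m n"]) (rule c, rule c, simp add: block_swap_def)
qed

lemma hor_swap:
  assumes f: "f \<in> pset S_prop n m" and g: "g \<in> pset S_prop n' m'"
  shows "pver S_prop (pperm S_prop (m + m') (block_swap m m')) (phor S_prop f g) =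
    pver S_prop (phor S_prop g f) (pperm S_prop (n + n') (block_swap n n'))"
proof (rule tms_eqI)
  have gf: "phor S_prop g f \<in> pset S_prop (n + n') (m + m')"
    using \<S>.hor_in[OF g f] by (simp only: add.commute)
  note fg = \<S>.hor_in[OF f g] and bn = block_swap_permutes[of n n'] and bm = block_swap_permutes[of m m']
  show "pver S_prop (pperm S_prop (m + m') (block_swap m m')) (phor S_prop f g) \<in> pset S_prop (n + n') (m + m')"
    "pver S_prop (phor S_prop g f) (pperm S_prop (n + n') (block_swap n n')) \<in> pset S_prop (n + n') (m + m')"
    by (intro \<S>.ver_in[OF fg perm_in[OF bm(1)]] \<S>.ver_in[OF perm_in[OF bn(1)] gf])+
  fix j assume j: "j < m + m'"
  then have j': "j < m' + m" by simp
  have L: "tms (pver S_prop (pperm S_prop (m + m') (block_swap m m')) (phor S_prop f g)) ! j =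
      tms (phor S_prop f g) ! block_swap m' m j"
    using tms_perm_ver[OF bm(1) fg j] by (simp add: bm(2))
  have R: "tms (pver S_prop (phor S_prop g f) (pperm S_prop (n + n') (block_swap n n'))) ! j =
      bind (\<lambda>i. tms (pperm S_prop (n + n') (block_swap n n')) ! i) (tms (phor S_prop g f) ! j)"
    by (rule tms_ver[OF perm_in[OF bn(1)] gf j])
  note T = tms_perm[OF bn(1), unfolded bn(2)]
  show "tms (pver S_prop (pperm S_prop (m + m') (block_swap m m')) (phor S_prop f g)) ! j =
     tms (pver S_prop (phor S_prop g f) (pperm S_prop (n + n') (block_swap n n'))) ! j"
  proof (cases "j < m'")
    case True
    have "bind (\<lambda>i. tms (pperm S_prop (n + n') (block_swap n n')) ! i) (tms g ! j) = bind (\<lambda>i. In (n + i)) (tms g ! j)"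
    proof (rule bind_cong)
      fix i assume "In i \<in> sub (tms g ! j)"
      then have "i < n'" by (rule In_tms[OF g True])
      then show "tms (pperm S_prop (n + n') (block_swap n n')) ! i = In (n + i)"
        by (simp add: T) (simp add: block_swap_def)
    qed
    then show ?thesis
      unfolding L R using True tms_hor[OF g f j'] tms_hor[OF f g, of "j + m"] by (simp add: block_swap_def)
  next
    case False
    then have jm: "j - m' < m" using j by simp
    have "bind (\<lambda>i. tms (pperm S_prop (n + n') (block_swap n n')) ! (n' + i)) (tms f ! (j - m')) = bind In (tms f ! (j - m'))"
    proof (rule bind_cong)
      fix i assume "In i \<in> sub (tms f ! (j - m'))"
      then have "i < n" by (rule In_tms[OF f jm])
      then show "tms (pperm S_prop (n + n') (block_swap n n')) ! (n' + i) = In i"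
        by (simp add: T) (simp add: block_swap_def)
    qed
    then show ?thesis
      unfolding L R using False j jm tms_hor[OF g f j'] tms_hor[OF f g, of "j - m'"]
      by (simp add: block_swap_def bind_bind bind_In)
  qed
qed

section \<open>The compositions are cellular\<close>

lemma pars_append:
  assumes "g_size G = g_size (fst X) + g_size (fst Y)"
  shows "pars (G, append_fun (g_size (fst X)) (snd X) (snd Y)) = pars X + pars Y"
proof -
  let ?Z = "(G, append_fun (g_size (fst X)) (snd X) (snd Y))" and ?k = "g_size (fst X)"
  have V: "par_verts ?Z = par_verts X \<union> (+) ?k ` par_verts Y"
  proof (intro set_eqI iffI)
    fix v assume v: "v \<in> par_verts ?Z"
    show "v \<in> par_verts X \<union> (+) ?k ` par_verts Y"
    proof (cases "v < ?k")
      case True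
      then show ?thesis using v by (simp add: par_verts_def append_fun_def)
    next
      case False
      then have "v - ?k \<in> par_verts Y" "v = ?k + (v - ?k)" using v assms by (auto simp: par_verts_def append_fun_def)
      then show ?thesis by blast
    qed
  qed (auto simp: par_verts_def append_fun_def assms)
  have "mset_set (par_verts ?Z) = mset_set (par_verts X) + image_mset ((+) ?k) (mset_set (par_verts Y))"
    unfolding V by (subst mset_set_Union) (auto simp: par_verts_def image_mset_mset_set)
  moreover have "image_mset (\<lambda>v. cpt (snd ?Z v) 0) (mset_set (par_verts X)) = pars X"
    unfolding pars_eq by (rule image_mset_cong) (simp add: par_verts_def append_fun_def)
  moreover have "image_mset (\<lambda>v. cpt (snd ?Z v) 0) (image_mset ((+) ?k) (mset_set (par_verts Y))) = pars Y"
    unfolding pars_eq multiset.map_comp by (rule image_mset_cong) (simp add: append_fun_def)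
  ultimately show ?thesis by (simp only: pars_eq[of ?Z] image_mset_union)
qed

lemma pars_hor: "pars (dgraph_hor X Y) = pars X + pars Y"
  unfolding dgraph_hor_def by (rule pars_append) (simp add: graph_hor_def)

lemma pars_ver: "pars (dgraph_ver Y X) = pars X + pars Y"
  unfolding dgraph_ver_def by (rule pars_append) (simp add: graph_ver_def Let_def)

lemma skel_hor:
  assumes "x \<in> skel (phom S_prop n m) k" "y \<in> skel (phom S_prop n' m') l"
  shows "phor S_prop x y \<in> skel (phom S_prop (n + n') (m + m')) (k + l)"
proof -
  obtain X Y where X: "X \<in> dgraphs \<B> n m" "x = cl X" "size (filter_mset (\<lambda>s. s \<noteq> 0 \<and> s \<noteq> 1) (pars X)) \<le> k"
    and Y: "Y \<in> dgraphs \<B> n' m'" "y = cl Y" "size (filter_mset (\<lambda>s. s \<noteq> 0 \<and> s \<noteq> 1) (pars Y)) \<le> l"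
    using assms unfolding skel_S by blast
  have "size (filter_mset (\<lambda>s. s \<noteq> 0 \<and> s \<noteq> 1) (pars (dgraph_hor X Y))) \<le> k + l"
    using X(3) Y(3) by (simp add: pars_hor)
  then show ?thesis unfolding skel_S X(2) Y(2) cl_hor[OF X(1) Y(1)] using dgraph_hor(1)[OF X(1) Y(1)] by blast
qed

lemma skel_ver:
  assumes "x \<in> skel (phom S_prop n m) k" "y \<in> skel (phom S_prop m p) l"
  shows "pver S_prop y x \<in> skel (phom S_prop n p) (k + l)"
proof -
  obtain X Y where X: "X \<in> dgraphs \<B> n m" "x = cl X" "size (filter_mset (\<lambda>s. s \<noteq> 0 \<and> s \<noteq> 1) (pars X)) \<le> k"
    and Y: "Y \<in> dgraphs \<B> m p" "y = cl Y" "size (filter_mset (\<lambda>s. s \<noteq> 0 \<and> s \<noteq> 1) (pars Y)) \<le> l"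
    using assms unfolding skel_S by blast
  have "size (filter_mset (\<lambda>s. s \<noteq> 0 \<and> s \<noteq> 1) (pars (dgraph_ver Y X))) \<le> k + l"
    using X(3) Y(3) by (simp add: pars_ver)
  then show ?thesis unfolding skel_S X(2) Y(2) cl_ver[OF X(1) Y(1)] using dgraph_ver(1)[OF X(1) Y(1)] by blast
qed

lemma skel_perm: "\<sigma> permutes {..<n} \<Longrightarrow> pperm S_prop n \<sigma> \<in> skel (phom S_prop n n) 0"
proof -
  assume \<sigma>: "\<sigma> permutes {..<n}"
  have "pars (perm_graph n \<sigma>) = {#}" by (simp add: pars_eq par_verts_def perm_graph_def)
  then have "size (filter_mset (\<lambda>s. s \<noteq> 0 \<and> s \<noteq> 1) (pars (perm_graph n \<sigma>))) \<le> 0" by simp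
  then show ?thesis unfolding skel_S cl_perm using dgraph_perm(1)[OF \<sigma>] by blast
qed

text \<open>In both kinds of composite the vertices of one graph are followed by those of the other,
  and the wiring does not depend on the parameters. So one statement about a fixed graph
  \<open>G\<close> with varying decorations covers both.\<close>

lemma continuous_cl_pair:
  assumes Z: "(G, append_fun (g_size (fst C)) (snd C) (snd D)) \<in> dgraphs \<B> a b"
    and v_in: "v_in G = append_fun (g_size (fst C)) (v_in (fst C)) (v_in (fst D))"
    and v_out: "v_out G = append_fun (g_size (fst C)) (v_out (fst C)) (v_out (fst D))"
    and sz: "g_size G = g_size (fst C) + g_size (fst D)"
    and C: "C \<in> cells n m" and D: "D \<in> cells n' m'"
  shows "continuous_map (prod_topology (cube (cdim C)) (cube (cdim D))) (cw_top (phom S_prop a b))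
    (\<lambda>p. cl (G, append_fun (g_size (fst C)) (snd (inst (theta (cdim C) (fst p)) C)) (snd (inst (theta (cdim D) (snd p)) D))))"
proof (rule continuous_cl)
  let ?T = "prod_topology (cube (cdim C)) (cube (cdim D))"
  show "k_space ?T"
    by (rule compact_imp_k_space)
      (simp_all add: compact_space_prod_topology compact_space_cube Hausdorff_space_prod_topology Hausdorff_space_cube)
  show "typed a b G" using dgraph_typed[OF Z] by simp
  have one: "continuous_map ?T (cw_top (bsp \<B> (v_in (fst E) v) (v_out (fst E) v)))
       (\<lambda>p. snd (inst (theta (cdim E) (pr p)) E) v)"
    if E: "E \<in> cells n m" and v: "v < g_size (fst E)" and pr: "continuous_map ?T (cube (cdim E)) pr" for E n m v pr
  proof -
    have cE: "cand n m E" by (rule cells_cand[OF E])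
    have "sdg E" using cells_dgraph[OF E] by (simp add: dgraphs_iff)
    then interpret sdgraph E "fst E" "snd E" by (rule sdgraphI)
    have "continuous_map ?T (cw_top (bsp \<B> (v_in (fst E) v) (v_out (fst E) v))) (\<lambda>p. inst_pt (theta (cdim E) (pr p)) (snd E v))"
    proof (rule continuous_inst_pt[OF dec[OF v]])
      fix p assume "p \<in> topspace ?T"
      then show "theta (cdim E) (pr p) \<in> Theta"
        using pr by (intro theta_cube) (auto simp: continuous_map_def Pi_iff)
    next
      assume "S_dim (ccell (snd E v)) = 1"
      then have "cpt (snd E v) 0 \<in># pars E" using v by (simp add: set_pars par_verts_def)
      then obtain i where i: "i < cdim E" "cpt (snd E v) 0 = name i"
        unfolding set_pars cand_pars(2)[OF cE] by auto
      have "continuous_map ?T euclideanreal ((\<lambda>s. theta (cdim E) s (name i)) \<circ> pr)"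
        by (rule continuous_map_compose[OF pr continuous_theta]) (use i in auto)
      then show "continuous_map ?T euclideanreal (\<lambda>p. theta (cdim E) (pr p) (cpt (snd E v) 0))"
        by (simp add: i comp_def)
    qed
    then show ?thesis by (simp add: inst_def)
  qed
  fix v assume v: "v < g_size G"
  show "continuous_map ?T (cw_top (bsp \<B> (v_in G v) (v_out G v)))
     (\<lambda>p. append_fun (g_size (fst C)) (snd (inst (theta (cdim C) (fst p)) C)) (snd (inst (theta (cdim D) (snd p)) D)) v)"
  proof (cases "v < g_size (fst C)")
    case True
    then show ?thesis using one[OF C True continuous_map_fst] by (simp add: v_in v_out append_fun_def)
  next
    case False
    then have "v - g_size (fst C) < g_size (fst D)" using v sz by simp
    from one[OF D this continuous_map_snd] False show ?thesis by (simp add: v_in v_out append_fun_def)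
  qed
qed

lemma continuous_hor:
  "continuous_map (kification (prod_topology (cw_top (phom S_prop n m)) (cw_top (phom S_prop n' m'))))
     (cw_top (phom S_prop (n + n') (m + m'))) (\<lambda>(f, g). phor S_prop f g)"
proof (rule continuous_map_from_kified_product[OF cube_complex_S cube_complex_S])
  fix C D assume C: "C \<in> cells n m" and D: "D \<in> cells n' m'"
  let ?T = "prod_topology (cube (cdim C)) (cube (cdim D))"
  note dC = cells_dgraph[OF C] and dD = cells_dgraph[OF D]
  have "continuous_map ?T (cw_top (phom S_prop (n + n') (m + m')))
    (\<lambda>p. cl (graph_hor (fst C) (fst D), append_fun (g_size (fst C))
      (snd (inst (theta (cdim C) (fst p)) C)) (snd (inst (theta (cdim D) (snd p)) D))))"
    by (rule continuous_cl_pair[OF dgraph_hor(1)[OF dC dD, unfolded dgraph_hor_def] _ _ _ C D]) (simp_all add: graph_hor_def)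
  then show "continuous_map ?T (cw_top (phom S_prop (n + n') (m + m')))
     (\<lambda>(x, y). (\<lambda>(f, g). phor S_prop f g) (Phi C x, Phi D y))"
  proof (rule continuous_map_eq)
    fix p assume "p \<in> topspace ?T"
    then obtain x y where p: "p = (x, y)" "x \<in> topspace (cube (cdim C))" "y \<in> topspace (cube (cdim D))" by auto
    have "inst (theta (cdim C) x) C \<in> dgraphs \<B> n m" "inst (theta (cdim D) y) D \<in> dgraphs \<B> n' m'"
      using inst_Theta(1)[OF theta_cube] p dC dD by blast+
    from cl_hor[OF this] show "cl (graph_hor (fst C) (fst D), append_fun (g_size (fst C))
      (snd (inst (theta (cdim C) (fst p)) C)) (snd (inst (theta (cdim D) (snd p)) D))) =
      (\<lambda>(x, y). (\<lambda>(f, g). phor S_prop f g) (Phi C x, Phi D y)) p"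
      by (simp add: p Phi_def dgraph_hor_def) (simp add: inst_def)
  qed
qed

lemma continuous_ver:
  "continuous_map (kification (prod_topology (cw_top (phom S_prop m l)) (cw_top (phom S_prop n m))))
     (cw_top (phom S_prop n l)) (\<lambda>(g, f). pver S_prop g f)"
proof (rule continuous_map_from_kified_product[OF cube_complex_S cube_complex_S])
  fix D C assume D: "D \<in> cells m l" and C: "C \<in> cells n m"
  let ?T = "prod_topology (cube (cdim D)) (cube (cdim C))" and ?T' = "prod_topology (cube (cdim C)) (cube (cdim D))"
  note dC = cells_dgraph[OF C] and dD = cells_dgraph[OF D]
  have "continuous_map ?T' (cw_top (phom S_prop n l))
    (\<lambda>p. cl (graph_ver (fst D) (fst C), append_fun (g_size (fst C))
      (snd (inst (theta (cdim C) (fst p)) C)) (snd (inst (theta (cdim D) (snd p)) D))))"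
    by (rule continuous_cl_pair[OF dgraph_ver(1)[OF dC dD, unfolded dgraph_ver_def] _ _ _ C D])
      (simp_all add: graph_ver_def Let_def)
  \<comment> \<open>In the composite graph the lower factor comes first, while the pair lists the
    upper one first.\<close>
  moreover have "continuous_map ?T ?T' (\<lambda>p. (snd p, fst p))"
    by (intro continuous_map_pairedI continuous_map_fst continuous_map_snd)
  ultimately have "continuous_map ?T (cw_top (phom S_prop n l)) ((\<lambda>p. cl (graph_ver (fst D) (fst C), append_fun (g_size (fst C))
      (snd (inst (theta (cdim C) (fst p)) C)) (snd (inst (theta (cdim D) (snd p)) D)))) \<circ> (\<lambda>p. (snd p, fst p)))"
    using continuous_map_compose by blast
  then show "continuous_map ?T (cw_top (phom S_prop n l)) (\<lambda>(x, y). (\<lambda>(g, f). pver S_prop g f) (Phi D x, Phi C y))"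
  proof (rule continuous_map_eq)
    fix p assume "p \<in> topspace ?T"
    then obtain x y where p: "p = (y, x)" "x \<in> topspace (cube (cdim C))" "y \<in> topspace (cube (cdim D))" by auto
    have "inst (theta (cdim C) x) C \<in> dgraphs \<B> n m" "inst (theta (cdim D) y) D \<in> dgraphs \<B> m l"
      using inst_Theta(1)[OF theta_cube] p dC dD by blast+
    from cl_ver[OF this] show "((\<lambda>p. cl (graph_ver (fst D) (fst C), append_fun (g_size (fst C))
      (snd (inst (theta (cdim C) (fst p)) C)) (snd (inst (theta (cdim D) (snd p)) D)))) \<circ> (\<lambda>p. (snd p, fst p))) p =
      (\<lambda>(x, y). (\<lambda>(g, f). pver S_prop g f) (Phi D x, Phi C y)) p"
      by (simp add: p Phi_def dgraph_ver_def) (simp add: inst_def)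
  qed
qed

lemma cellular_hor:
  "cellular_map (cw_prod (phom S_prop n m) (phom S_prop n' m')) (phom S_prop (n + n') (m + m')) (\<lambda>(f, g). phor S_prop f g)"
proof -
  have "phor S_prop f g \<in> skel (phom S_prop (n + n') (m + m')) k"
    if "i \<le> k" "f \<in> skel (phom S_prop n m) i" "g \<in> skel (phom S_prop n' m') (k - i)" for f g i k
    using skel_hor[OF that(2,3)] that(1) by simp
  then show ?thesis unfolding cellular_map_def cw_prod_def using continuous_hor by auto
qed

lemma cellular_ver:
  "cellular_map (cw_prod (phom S_prop m l) (phom S_prop n m)) (phom S_prop n l) (\<lambda>(g, f). pver S_prop g f)"
proof -
  have "pver S_prop g f \<in> skel (phom S_prop n l) k"
    if "i \<le> k" "g \<in> skel (phom S_prop m l) i" "f \<in> skel (phom S_prop n m) (k - i)" for f g i k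
    using skel_ver[OF that(3,2)] that(1) by simp
  then show ?thesis unfolding cellular_map_def cw_prod_def using continuous_ver by auto
qed

lemma cw_prop_S: "cw_prop S_prop"
  unfolding cw_prop_def
proof (intro conjI allI ballI impI; (elim conjE)?)
  show "disjnt (pset S_prop n m) (pset S_prop n' m')" if "(n, m) \<noteq> (n', m')" for n m n' m'
    unfolding disjnt_iff using \<S>.arity that by blast
qed (fact CW_S cellular_ver cellular_hor skel_perm ver_assoc ver_id hor_assoc hor_id interchange perm_ver perm_hor hor_swap)+

section \<open>The operad of S\<close>

abbreviation oc where
  "oc m k i x y \<equiv> pver S_prop (phor S_prop (phor S_prop (pid S_prop i) y) (pid S_prop (m - 1 - i))) x"

context
  fixes m k i :: nat and x y
  assumes i: "i < m" and x: "x \<in> pset S_prop 1 m" and y: "y \<in> pset S_prop 1 k"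
begin

lemma oc_mid: "phor S_prop (phor S_prop (pid S_prop i) y) (pid S_prop (m - 1 - i)) \<in> pset S_prop m (m + k - 1)"
proof -
  have "i + 1 + (m - 1 - i) = m" "i + k + (m - 1 - i) = m + k - 1" using i by linarith+
  then show ?thesis using \<S>.hor_in[OF \<S>.hor_in[OF id_in[of i] y] id_in[of "m - 1 - i"]] by metis
qed

lemma oc_in: "oc m k i x y \<in> pset S_prop 1 (m + k - 1)"
  by (rule \<S>.ver_in[OF x oc_mid])

lemma tms_oc_block:
  assumes t: "t < k"
  shows "tms (oc m k i x y) ! (i + t) = bind (\<lambda>_. tms x ! i) (tms y ! t)"
proof -
  have j: "i + t < m + k - 1" using i t by linarith
  have "tms (phor S_prop (phor S_prop (pid S_prop i) y) (pid S_prop (m - 1 - i))) ! (i + t) = bind (\<lambda>a. In (i + a)) (tms y ! t)"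
    using tms_hor[OF \<S>.hor_in[OF id_in[of i] y] id_in[of "m - 1 - i"], of "i + t"] tms_hor[OF id_in[of i] y, of "i + t"] t i
    by simp
  then have "tms (oc m k i x y) ! (i + t) = bind (\<lambda>a. tms x ! (i + a)) (tms y ! t)"
    unfolding tms_ver[OF x oc_mid j] by (simp only: bind_bind bind.simps)
  also have "\<dots> = bind (\<lambda>_. tms x ! i) (tms y ! t)"
  proof (rule bind_cong)
    fix a assume "In a \<in> sub (tms y ! t)"
    then have "a < 1" by (rule In_tms[OF y t])
    then show "tms x ! (i + a) = tms x ! i" by simp
  qed
  finally show ?thesis .
qed

lemma tms_oc_other:
  assumes b: "b < m" "b \<noteq> i"
  shows "tms (oc m k i x y) ! (if b < i then b else b + k - 1) = tms x ! b"
proof -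
  let ?j = "if b < i then b else b + k - 1"
  have j: "?j < m + k - 1" using i b by (auto split: if_splits)
  note a = tms_hor[OF \<S>.hor_in[OF id_in[of i] y] id_in[of "m - 1 - i"], of ?j]
  have "tms (phor S_prop (phor S_prop (pid S_prop i) y) (pid S_prop (m - 1 - i))) ! ?j = In b"
  proof (cases "b < i")
    case True
    then show ?thesis using a i tms_hor[OF id_in[of i] y, of b] by (simp add: tms_id)
  next
    case False
    then have e: "\<not> b + k - 1 < i + k" "b + k - 1 - (i + k) < m - 1 - i" "i + 1 + (b + k - 1 - (i + k)) = b"
      "b + k - 1 < i + k + (m - 1 - i)"
      using b i by linarith+
    show ?thesis using a False e by (simp add: tms_id)
  qed
  then show ?thesis by (simp only: tms_ver[OF x oc_mid j] bind.simps)
qed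

end

text \<open>A position lies in the inserted block or comes from another output \<open>b\<close> of
  the outer operation. For \<open>k = 0\<close> the truncated \<open>b + k - 1\<close> is still
  exact, because that branch has \<open>i < b\<close>.\<close>

lemma index_cases:
  fixes i j k m :: nat
  assumes "j < m + k - 1" "i < m"
  obtains t where "t < k" "j = i + t" | b where "b < m" "b \<noteq> i" "j = (if b < i then b else b + k - 1)"
proof (cases "i \<le> j \<and> j < i + k")
  case True
  then have "j - i < k" "j = i + (j - i)" by auto
  then show ?thesis by (rule that(1))
next
  case False
  then show ?thesis using that(2)[of "if j < i then j else j + 1 - k"] assms by (auto split: if_splits)
qed

lemma oc_eqI:
  assumes "i < m" "u \<in> pset S_prop 1 (m + k - 1)" "v \<in> pset S_prop 1 (m + k - 1)"
    and "\<And>t. t < k \<Longrightarrow> tms u ! (i + t) = tms v ! (i + t)"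
    and "\<And>b. \<lbrakk>b < m; b \<noteq> i\<rbrakk> \<Longrightarrow> tms u ! (if b < i then b else b + k - 1) = tms v ! (if b < i then b else b + k - 1)"
  shows "u = v"
proof (rule tms_eqI[OF assms(2,3)])
  fix j assume "j < m + k - 1"
  then show "tms u ! j = tms v ! j"
    by (rule index_cases[OF _ assms(1)]) (use assms(4,5) in simp_all)
qed

lemma oc_unit:
  assumes x: "x \<in> pset S_prop 1 m"
  shows "oc 1 m 0 (pid S_prop 1) x = x" "i < m \<Longrightarrow> oc m 1 i x (pid S_prop 1) = x"
proof -
  have bz: "bind (\<lambda>_. In 0) (tms x ! t) = tms x ! t" if "t < m" for t
  proof -
    have "bind (\<lambda>_. In 0) (tms x ! t) = bind In (tms x ! t)"
      by (rule bind_cong) (use In_tms[OF x that] in simp)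
    then show ?thesis by (simp add: bind_In)
  qed
  have l: "(0::nat) < 1" by simp
  show "oc 1 m 0 (pid S_prop 1) x = x"
  proof (rule tms_eqI[OF _ x])
    show "oc 1 m 0 (pid S_prop 1) x \<in> pset S_prop 1 m" using oc_in[OF l id_in x] by simp
    show "tms (oc 1 m 0 (pid S_prop 1) x) ! j = tms x ! j" if "j < m" for j
      using tms_oc_block[OF l id_in x that] bz[OF that] by (simp add: tms_id)
  qed
  assume i: "i < m"
  show "oc m 1 i x (pid S_prop 1) = x"
  proof (rule oc_eqI[OF i oc_in[OF i x id_in]])
    show "x \<in> pset S_prop 1 (m + 1 - 1)" using x by simp
    show "tms (oc m 1 i x (pid S_prop 1)) ! (i + t) = tms x ! (i + t)" if "t < 1" for t
      using tms_oc_block[OF i x id_in that] that by (simp add: tms_id)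
    show "tms (oc m 1 i x (pid S_prop 1)) ! (if b < i then b else b + 1 - 1) = tms x ! (if b < i then b else b + 1 - 1)"
      if "b < m" "b \<noteq> i" for b
      using tms_oc_other[OF i x id_in that] by simp
  qed
qed

lemma oc_assoc:
  assumes i: "i < m" and j: "j < k"
    and x: "x \<in> pset S_prop 1 m" and y: "y \<in> pset S_prop 1 k" and z: "z \<in> pset S_prop 1 l"
  shows "oc (m + k - 1) l (i + j) (oc m k i x y) z = oc m (k + l - 1) i x (oc k l j y z)"
proof -
  have ij: "i + j < m + k - 1" using i j by linarith
  note xy = oc_in[OF i x y] and yz = oc_in[OF j y z]
  note L = oc_in[OF ij xy z] and R = oc_in[OF i x yz]
  have e: "m + k - 1 + l - 1 = m + (k + l - 1) - 1" using i j by linarith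
  show ?thesis
  proof (rule oc_eqI[OF i L[unfolded e] R])
    fix t assume t: "t < k + l - 1"
    note Rt = tms_oc_block[OF i x yz t]
    from t j show "tms (oc (m + k - 1) l (i + j) (oc m k i x y) z) ! (i + t) = tms (oc m (k + l - 1) i x (oc k l j y z)) ! (i + t)"
    proof (cases rule: index_cases)
      case (1 u)
      then show ?thesis
        using Rt tms_oc_block[OF ij xy z 1(1)] tms_oc_block[OF i x y j] tms_oc_block[OF j y z 1(1)]
        by (simp add: bind_bind add.assoc)
    next
      case (2 c)
      have p: "i + t = (if i + c < i + j then i + c else i + c + l - 1)" using 2 by auto
      have "tms (oc (m + k - 1) l (i + j) (oc m k i x y) z) ! (i + t) = tms (oc m k i x y) ! (i + c)"
        unfolding p by (rule tms_oc_other[OF ij xy z]) (use 2 i in auto)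
      then show ?thesis
        using Rt tms_oc_block[OF i x y 2(1)] tms_oc_other[OF j y z 2(1,2)] 2(3) by simp
    qed
  next
    fix b assume b: "b < m" "b \<noteq> i"
    let ?p = "if b < i then b else b + (k + l - 1) - 1" and ?b = "if b < i then b else b + k - 1"
    have p: "?p = (if ?b < i + j then ?b else ?b + l - 1)" using b j by auto
    have b': "?b < m + k - 1" "?b \<noteq> i + j" using b i j by auto
    show "tms (oc (m + k - 1) l (i + j) (oc m k i x y) z) ! ?p = tms (oc m (k + l - 1) i x (oc k l j y z)) ! ?p"
      unfolding tms_oc_other[OF i x yz b] unfolding p tms_oc_other[OF ij xy z b'] tms_oc_other[OF i x y b] ..
  qed
qed

lemma oc_comm:
  assumes i': "i' < m" and i: "i < i'"
    and x: "x \<in> pset S_prop 1 m" and y: "y \<in> pset S_prop 1 k" and z: "z \<in> pset S_prop 1 l"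
  shows "oc (m + k - 1) l (i' + k - 1) (oc m k i x y) z = oc (m + l - 1) k i (oc m l i' x z) y"
proof -
  have im: "i < m" and a: "i' + k - 1 < m + k - 1" and c: "i < m + l - 1" using i i' by linarith+
  note xy = oc_in[OF im x y] and xz = oc_in[OF i' x z]
  note L = oc_in[OF a xy z] and R = oc_in[OF c xz y]
  have e: "m + l - 1 + k - 1 = m + k - 1 + l - 1" using i i' by linarith
  show ?thesis
  proof (rule oc_eqI[OF a L R[unfolded e]])
    fix t assume t: "t < l"
    let ?d = "i' + t"
    have p: "i' + k - 1 + t = (if ?d < i then ?d else ?d + k - 1)" and d: "?d < m + l - 1" "?d \<noteq> i"
      and q: "i' + k - 1 = (if i' < i then i' else i' + k - 1)"
      using i i' t by auto
    have 1: "tms (oc m k i x y) ! (i' + k - 1) = tms x ! i'"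
      using tms_oc_other[OF im x y i'] i by (simp add: q[symmetric])
    show "tms (oc (m + k - 1) l (i' + k - 1) (oc m k i x y) z) ! (i' + k - 1 + t) =
       tms (oc (m + l - 1) k i (oc m l i' x z) y) ! (i' + k - 1 + t)"
      unfolding tms_oc_block[OF a xy z t] 1 unfolding p tms_oc_other[OF c xz y d] tms_oc_block[OF i' x z t] ..
  next
    fix b assume b: "b < m + k - 1" "b \<noteq> i' + k - 1"
    let ?p = "if b < i' + k - 1 then b else b + l - 1"
    from b(1) im show "tms (oc (m + k - 1) l (i' + k - 1) (oc m k i x y) z) ! ?p =
       tms (oc (m + l - 1) k i (oc m l i' x z) y) ! ?p"
      unfolding tms_oc_other[OF a xy z b]
    proof (cases rule: index_cases)
      case (1 t)
      have p: "?p = i + t" using 1 i by simp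
      have "tms (oc m l i' x z) ! i = tms x ! i" using tms_oc_other[OF i' x z im] i by simp
      then show "tms (oc m k i x y) ! b = tms (oc (m + l - 1) k i (oc m l i' x z) y) ! ?p"
        unfolding p tms_oc_block[OF c xz y 1(1)] unfolding 1(2) tms_oc_block[OF im x y 1(1)] by simp
    next
      case (2 d)
      let ?d = "if d < i' then d else d + l - 1"
      have d: "d \<noteq> i'" using 2 b i by auto
      have p: "?p = (if ?d < i then ?d else ?d + k - 1)" and d': "?d < m + l - 1" "?d \<noteq> i"
        using 2 d i i' by auto
      show "tms (oc m k i x y) ! b = tms (oc (m + l - 1) k i (oc m l i' x z) y) ! ?p"
        unfolding p tms_oc_other[OF c xz y d'] tms_oc_other[OF i' x z 2(1) d] unfolding 2(3) tms_oc_other[OF im x y 2(1,2)] ..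
    qed
  qed
qed

lemma perm_subst_block: "\<lbrakk>i < m; t < k\<rbrakk> \<Longrightarrow> perm_subst m k i \<sigma> \<tau> (i + t) = \<sigma> i + \<tau> t"
  by (auto simp: perm_subst_def)

lemma perm_subst_other:
  "\<lbrakk>i < m; b < m; b \<noteq> i\<rbrakk> \<Longrightarrow> perm_subst m k i \<sigma> \<tau> (if b < i then b else b + k - 1) =
     (if \<sigma> b < \<sigma> i then \<sigma> b else \<sigma> b + k - 1)"
  by (auto simp: perm_subst_def Let_def)

text \<open>The inverse is again of this form, with the block now sitting at
  \<open>\<sigma> i\<close>.\<close>

lemma perm_subst_inverse:
  assumes \<sigma>: "\<sigma> permutes {..<m}" and \<tau>: "\<tau> permutes {..<k}" and i: "i < m"
  shows "perm_subst m k (\<sigma> i) (inv \<sigma>) (inv \<tau>) (perm_subst m k i \<sigma> \<tau> j) = j"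
proof (cases "j < m + k - 1")
  case True
  have si: "\<sigma> i < m" using permutes_in_image[OF \<sigma>] i by simp
  from True i show ?thesis
  proof (cases rule: index_cases)
    case (1 t)
    have "\<tau> t < k" using permutes_in_image[OF \<tau>] 1(1) by simp
    then show ?thesis
      unfolding 1(2) perm_subst_block[OF i 1(1)] perm_subst_block[OF si \<open>\<tau> t < k\<close>]
      by (simp add: permutes_inverses[OF \<sigma>] permutes_inverses[OF \<tau>])
  next
    case (2 b)
    have sb: "\<sigma> b < m" "\<sigma> b \<noteq> \<sigma> i"
      using permutes_in_image[OF \<sigma>] 2 permutes_inj[OF \<sigma>] by (auto dest: injD)
    show ?thesis
      unfolding 2(3) perm_subst_other[OF i 2(1,2)] perm_subst_other[OF si sb]
      by (simp add: permutes_inverses[OF \<sigma>])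
  qed
qed (simp add: perm_subst_def)

lemma perm_subst_permutes:
  assumes \<sigma>: "\<sigma> permutes {..<m}" and \<tau>: "\<tau> permutes {..<k}" and i: "i < m"
  shows "perm_subst m k i \<sigma> \<tau> permutes {..<m + k - 1}"
proof (rule permutesI_inverse[of "perm_subst m k (\<sigma> i) (inv \<sigma>) (inv \<tau>)"])
  show "perm_subst m k (\<sigma> i) (inv \<sigma>) (inv \<tau>) (perm_subst m k i \<sigma> \<tau> j) = j" for j
    by (rule perm_subst_inverse[OF assms])
  have "\<sigma> i < m" using permutes_in_image[OF \<sigma>] i by simp
  from perm_subst_inverse[OF permutes_inv[OF \<sigma>] permutes_inv[OF \<tau>] this]
  show "perm_subst m k i \<sigma> \<tau> (perm_subst m k (\<sigma> i) (inv \<sigma>) (inv \<tau>) j) = j" for j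
    by (simp add: permutes_inv_inv[OF \<sigma>] permutes_inv_inv[OF \<tau>] permutes_inverses[OF \<sigma>])
qed (simp add: perm_subst_def)

lemma oc_equivariant:
  assumes \<sigma>: "\<sigma> permutes {..<m}" and \<tau>: "\<tau> permutes {..<k}" and i: "i < m"
    and x: "x \<in> pset S_prop 1 m" and y: "y \<in> pset S_prop 1 k"
  shows "oc m k (\<sigma> i) (pver S_prop (pperm S_prop m \<sigma>) x) (pver S_prop (pperm S_prop k \<tau>) y) =
    pver S_prop (pperm S_prop (m + k - 1) (perm_subst m k i \<sigma> \<tau>)) (oc m k i x y)" (is "?l = ?r")
proof -
  let ?\<pi> = "perm_subst m k i \<sigma> \<tau>"
  note \<pi> = perm_subst_permutes[OF \<sigma> \<tau> i]
  have si: "\<sigma> i < m" using permutes_in_image[OF \<sigma>] i by simp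
  note sx = \<S>.ver_in[OF x perm_in[OF \<sigma>]] and ty = \<S>.ver_in[OF y perm_in[OF \<tau>]]
  have sxn: "tms (pver S_prop (pperm S_prop m \<sigma>) x) ! \<sigma> b = tms x ! b" if "b < m" for b
    using tms_perm_ver[OF \<sigma> x, of "\<sigma> b"] permutes_in_image[OF \<sigma>] that by (simp add: permutes_inverses[OF \<sigma>])
  have L: "tms ?l ! ?\<pi> j = tms (oc m k i x y) ! j" if "j < m + k - 1" for j
    using that i
  proof (cases rule: index_cases)
    case (1 t)
    have t: "\<tau> t < k" using permutes_in_image[OF \<tau>] 1(1) by simp
    show ?thesis
      unfolding 1(2) perm_subst_block[OF i 1(1)] tms_oc_block[OF si sx ty t] tms_oc_block[OF i x y 1(1)]
        sxn[OF i] tms_perm_ver[OF \<tau> y t] by (simp add: permutes_inverses[OF \<tau>])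
  next
    case (2 b)
    have sb: "\<sigma> b < m" "\<sigma> b \<noteq> \<sigma> i"
      using permutes_in_image[OF \<sigma>] 2 permutes_inj[OF \<sigma>] by (auto dest: injD)
    show ?thesis
      unfolding 2(3) perm_subst_other[OF i 2(1,2)] tms_oc_other[OF si sx ty sb] tms_oc_other[OF i x y 2(1,2)]
      by (rule sxn[OF 2(1)])
  qed
  show ?thesis
  proof (rule tms_eqI[OF oc_in[OF si sx ty] \<S>.ver_in[OF oc_in[OF i x y] perm_in[OF \<pi>]]])
    fix j assume j: "j < m + k - 1"
    show "tms ?l ! j = tms ?r ! j"
      using L[OF inv_lt[OF \<pi> j]] tms_perm_ver[OF \<pi> oc_in[OF i x y] j] by (simp add: permutes_inverses[OF \<pi>])
  qed
qed

section \<open>Continuity and cellularity of the operad structure\<close>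

lemma k_space_S: "k_space (cw_top (phom S_prop n m))"
  by (rule cube_complex.k_space_T[OF cube_complex_S])

lemma cont_hor:
  assumes T: "k_space T" and f: "continuous_map T (cw_top (phom S_prop n m)) f"
    and g: "continuous_map T (cw_top (phom S_prop n' m')) g"
  shows "continuous_map T (cw_top (phom S_prop (n + n') (m + m'))) (\<lambda>t. phor S_prop (f t) (g t))"
proof -
  have "continuous_map T (kification (prod_topology (cw_top (phom S_prop n m)) (cw_top (phom S_prop n' m')))) (\<lambda>t. (f t, g t))"
    unfolding continuous_map_into_kification[OF T] by (rule continuous_map_pairedI[OF f g])
  from continuous_map_compose[OF this continuous_hor] show ?thesis by (simp add: comp_def)
qed

lemma cont_ver:
  assumes T: "k_space T" and f: "continuous_map T (cw_top (phom S_prop n m)) f"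
    and g: "continuous_map T (cw_top (phom S_prop m l)) g"
  shows "continuous_map T (cw_top (phom S_prop n l)) (\<lambda>t. pver S_prop (g t) (f t))"
proof -
  have "continuous_map T (kification (prod_topology (cw_top (phom S_prop m l)) (cw_top (phom S_prop n m)))) (\<lambda>t. (g t, f t))"
    unfolding continuous_map_into_kification[OF T] by (rule continuous_map_pairedI[OF g f])
  from continuous_map_compose[OF this continuous_ver] show ?thesis by (simp add: comp_def)
qed

lemma cellular_act:
  assumes \<sigma>: "\<sigma> permutes {..<m}"
  shows "cellular_map (phom S_prop 1 m) (phom S_prop 1 m) (pver S_prop (pperm S_prop m \<sigma>))"
  unfolding cellular_map_def
proof (intro conjI allI image_subsetI)
  show "continuous_map (cw_top (phom S_prop 1 m)) (cw_top (phom S_prop 1 m)) (pver S_prop (pperm S_prop m \<sigma>))"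
    using cont_ver[OF k_space_S[of 1 m], where f = "\<lambda>x. x" and g = "\<lambda>_. pperm S_prop m \<sigma>" and n = 1 and m = m and l = m]
      perm_in[OF \<sigma>] by simp
  show "pver S_prop (pperm S_prop m \<sigma>) x \<in> skel (phom S_prop 1 m) n" if "x \<in> skel (phom S_prop 1 m) n" for x n
    using skel_ver[OF that skel_perm[OF \<sigma>]] by simp
qed

lemma cellular_oc:
  assumes i: "i < m"
  shows "cellular_map (cw_prod (phom S_prop 1 m) (phom S_prop 1 k)) (phom S_prop 1 (m + k - 1)) (\<lambda>(x, y). oc m k i x y)"
proof -
  have e: "i + 1 + (m - 1 - i) = m" "i + k + (m - 1 - i) = m + k - 1" using i by linarith+
  let ?T = "kification (prod_topology (cw_top (phom S_prop 1 m)) (cw_top (phom S_prop 1 k)))"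
  have k: "k_space ?T" by simp
  have fst: "continuous_map ?T (cw_top (phom S_prop 1 m)) fst"
    and snd: "continuous_map ?T (cw_top (phom S_prop 1 k)) snd"
    by (intro continuous_map_from_kification continuous_map_fst continuous_map_snd)+
  have const: "continuous_map ?T (cw_top (phom S_prop n n)) (\<lambda>_. pid S_prop n)" for n by (simp add: id_in)
  have "continuous_map ?T (cw_top (phom S_prop 1 (m + k - 1))) (\<lambda>p. oc m k i (fst p) (snd p))"
    using cont_ver[OF k fst cont_hor[OF k cont_hor[OF k const[of i] snd] const[of "m - 1 - i"], unfolded e]] .
  moreover have "oc m k i x y \<in> skel (phom S_prop 1 (m + k - 1)) n"
    if "j \<le> n" "x \<in> skel (phom S_prop 1 m) j" "y \<in> skel (phom S_prop 1 k) (n - j)" for x y j n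
  proof -
    note id = skel_perm[OF permutes_id]
    have "phor S_prop (phor S_prop (pid S_prop i) y) (pid S_prop (m - 1 - i)) \<in> skel (phom S_prop m (m + k - 1)) (n - j)"
      using skel_hor[OF skel_hor[OF id[of i] that(3)] id[of "m - 1 - i"], unfolded e] by simp
    from skel_ver[OF that(2) this] show ?thesis using that(1) by simp
  qed
  ultimately show ?thesis unfolding cellular_map_def cw_prod_def by (auto simp: case_prod_unfold)
qed

lemma cw_operad_S: "cw_operad (operad_of_prop S_prop)"
  unfolding cw_operad_def operad_of_prop_def operad.simps
proof (intro conjI allI ballI impI; (elim conjE)?)
  show "pver S_prop (pperm S_prop m \<sigma>) (pver S_prop (pperm S_prop m \<tau>) x) = pver S_prop (pperm S_prop m (\<sigma> \<circ> \<tau>)) x"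
    if "x \<in> pset S_prop 1 m" "\<sigma> permutes {..<m}" "\<tau> permutes {..<m}" for m x \<sigma> \<tau>
    using ver_assoc[OF that(1) perm_in[OF that(3)] perm_in[OF that(2)]] perm_ver[OF that(2,3)] by simp
qed (fact CW_S skel_perm[OF permutes_id] cellular_act cellular_oc ver_id oc_unit | (rule oc_assoc oc_comm oc_equivariant; assumption))+

lemma CW_complex_unit: "CW_complex cw_unit"
proof -
  have c: "cube 0 = discrete_topology {\<lambda>_. undefined}" "open_cube 0 = {\<lambda>_. undefined}"
    by (simp_all add: cube_def open_cube_def product_topology_empty_discrete)
  show ?thesis
    unfolding CW_complex_def cw_unit_def cw.simps
    by (intro conjI Hausdorff_space_discrete_topology exI[of _ "{(0, \<lambda>_. ())}"])
      (auto simp: c cube_boundary_def open_cell_def)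
qed

lemma cellular_to_unit: "CW_complex X \<Longrightarrow> cellular_map X cw_unit (\<lambda>_. ())"
  by (auto simp: cellular_map_def cw_unit_def)

lemma cw_operad_terminal: "cw_operad terminal_operad"
proof -
  have "cellular_map (cw_prod cw_unit cw_unit) cw_unit (\<lambda>(x, y). ())"
    by (auto simp: cellular_map_def cw_unit_def cw_prod_def case_prod_unfold)
  moreover have "cellular_map cw_unit cw_unit (\<lambda>x. ())" by (rule cellular_to_unit[OF CW_complex_unit])
  ultimately show ?thesis
    by (simp add: cw_operad_def terminal_operad_def CW_complex_unit) (simp add: cw_unit_def)
qed

section \<open>Freeness and contractibility\<close>

text \<open>Take a reduced representative. Its output terms are normal and are ends of a linear
  system, in which no edge occurs twice.\<close>

lemma distinct_tms:
  assumes x: "x \<in> pset S_prop n m"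
  shows "distinct (tms x)"
proof -
  obtain X where X: "X \<in> dgraphs \<B> n m" "x = cl X" by (rule pset_E[OF x])
  obtain Y where Y: "red n m Y" "peq X Y" using reduce_red[OF X(1)] by blast
  have dY: "Y \<in> dgraphs \<B> n m" using Y(1) by (simp add: red_def)
  have "cl X = cl Y"
    using Y(2) id_Theta cl_inst_id[OF X(1)] cl_inst_id[OF dY] unfolding peq_def by auto
  then have "tms x = snd (ev Y)" using X(2) tms_cl[OF dY] by (simp add: ev_def)
  then have t: "tms x = outs Y" using red_ev(1)[OF Y(1)[unfolded red_red_graph]] by simp
  have L: "lin n (mset (outs Y) + mset_set (epss Y)) (vtxs Y)"
    using Y(1) by (simp add: red_red_graph red_graph_def)
  have "count (mset (outs Y)) a \<le> 1" for a
    using lin_count[OF L, of a] by simp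
  then show ?thesis
    unfolding t distinct_count_atmost_1
    by (metis count_greater_zero_iff count_eq_zero_iff le_antisym less_one not_le set_mset_mset)
qed

lemma sigma_free_S: "sigma_free (operad_of_prop S_prop)"
  unfolding sigma_free_def operad_of_prop_def operad.simps
proof (intro allI ballI impI, elim conjE)
  fix m \<sigma> x assume x: "x \<in> pset S_prop 1 m" and \<sigma>: "\<sigma> permutes {..<m}"
    and e: "pver S_prop (pperm S_prop m \<sigma>) x = x"
  have "inv \<sigma> j = j" for j
  proof (cases "j < m")
    case True
    have "tms x ! inv \<sigma> j = tms x ! j" using tms_perm_ver[OF \<sigma> x True] e by simp
    then show ?thesis
      using nth_eq_iff_index_eq[OF distinct_tms[OF x]] length_tms[OF x] inv_lt[OF \<sigma> True] True by simp
  next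
    case False
    then show ?thesis using permutes_not_in[OF permutes_inv[OF \<sigma>]] by simp
  qed
  then have "\<sigma> j = j" for j using permutes_inverses(2)[OF \<sigma>] by metis
  then show "\<sigma> = id" by (simp add: fun_eq_iff)
qed

section \<open>The contracting homotopies\<close>

lemma continuous_gen1:
  assumes c: "S_dim c = 1"
  shows "continuous_map (top_of_set {0..1}) (cw_top (phom S_prop (S_in c) (S_out c))) (\<lambda>s. cl (gen c (pt1 s)))"
proof -
  let ?T = "top_of_set {0..1::real}"
  have "pt1 0 \<in> topspace (cube (S_dim c))" unfolding c pt1_in_cube by simp
  then have d: "gen c (pt1 0) \<in> dgraphs \<B> (S_in c) (S_out c)" by (rule dgraph_gen(1))
  have k: "k_space ?T" by (simp add: compact_imp_k_space compact_space_subtopology Hausdorff_space_subtopology)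
  have eq: "(fst (gen c (pt1 0)), snd (gen c (pt1 s))) = gen c (pt1 s)" for s by (simp add: gen_def corolla_def)
  have "continuous_map ?T (cw_top (phom S_prop (S_in c) (S_out c))) (\<lambda>s. cl (fst (gen c (pt1 0)), snd (gen c (pt1 s))))"
  proof (rule continuous_cl[OF k dgraph_typed[OF d]])
    fix v assume "v < g_size (fst (gen c (pt1 0)))"
    have "continuous_map ?T (cube (S_dim c)) pt1"
      unfolding c by (rule continuous_map_into_cube) (auto simp: pt1_def One_nat_def)
    from continuous_map_compose[OF this continuous_bsp_incl[OF permutes_id permutes_id, of c]]
    show "continuous_map ?T (cw_top (bsp \<B> (v_in (fst (gen c (pt1 0))) v) (v_out (fst (gen c (pt1 0))) v)))
      (\<lambda>s. snd (gen c (pt1 s)) v)"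
      by (simp add: gen_def corolla_def comp_def)
  qed
  then show ?thesis by (simp only: eq)
qed

abbreviation "mu s \<equiv> cl (gM s)"
abbreviation "ht s \<equiv> cl (gH s)"

lemma mu_in: "s \<in> {0..1} \<Longrightarrow> mu s \<in> pset S_prop 2 1" by (rule cl_in[OF gM(1)])
lemma ht_in: "s \<in> {0..1} \<Longrightarrow> ht s \<in> pset S_prop 1 1" by (rule cl_in[OF gH(1)])
lemma Delta_in: "cl gD \<in> pset S_prop 1 2" by (rule cl_in[OF gD(1)])
lemma eps_in: "cl gE \<in> pset S_prop 1 0" by (rule cl_in[OF gE(1)])

lemma tms_gens:
  "s \<in> {0..1} \<Longrightarrow> tms (mu s) = [norm (Mt s (In 0) (In 1))]"
  "s \<in> {0..1} \<Longrightarrow> tms (ht s) = [norm (Ht s (In 0))]"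
  "tms (cl gD) = [Lt (In 0), Rt (In 0)]"
  using tms_cl[OF gM(1)] tms_cl[OF gH(1)] tms_cl[OF gD(1)] gM(2) gH(2) gD(2) by (simp_all del: norm.simps(4,5))

fun mus :: "nat \<Rightarrow> real \<Rightarrow> S_cell cell_point dgraph set set set" where
  "mus 0 s = pid S_prop 0"
| "mus (Suc m) s = phor S_prop (mus m s) (mu s)"

lemma mus_in: "s \<in> {0..1} \<Longrightarrow> mus m s \<in> pset S_prop (2 * m) m"
proof (induction m)
  case 0
  then show ?case using id_in[of 0] by simp
next
  case (Suc m)
  have e: "2 * Suc m = 2 * m + 2" "Suc m = m + 1" by simp_all
  show ?case
    unfolding mus.simps e(1) unfolding e(2) by (rule \<S>.hor_in[OF Suc.IH[OF Suc.prems] mu_in[OF Suc.prems]])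
qed

lemma tms_mus:
  "\<lbrakk>s \<in> {0..1}; j < m\<rbrakk> \<Longrightarrow> tms (mus m s) ! j = norm (Mt s (In (2 * j)) (In (2 * j + 1)))"
proof (induction m)
  case (Suc m)
  have j: "j < m + 1" using Suc.prems by simp
  have l: "bind (\<lambda>i. In (2 * m + i)) (norm (Mt s (In 0) (In 1))) = norm (Mt s (In (2 * m)) (In (2 * m + 1)))"
    by simp
  show ?case
  proof (cases "j < m")
    case True
    then show ?thesis using tms_hor[OF mus_in mu_in j] Suc by simp
  next
    case False
    then have "j = m" using j by simp
    then show ?thesis using tms_hor[OF mus_in mu_in j] Suc.prems l tms_gens(1) by (simp del: norm.simps)
  qed
qed simp

lemma continuous_mus: "continuous_map (top_of_set {0..1}) (cw_top (phom S_prop (2 * m) m)) (mus m)"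
proof (induction m)
  case 0
  have "mus 0 = (\<lambda>s. pid S_prop 0)" by (simp add: fun_eq_iff)
  then show ?case using id_in[of 0] by simp
next
  case (Suc m)
  have k: "k_space (top_of_set {0..1::real})"
    by (simp add: compact_imp_k_space compact_space_subtopology Hausdorff_space_subtopology)
  have "continuous_map (top_of_set {0..1}) (cw_top (phom S_prop 2 1)) mu"
    using continuous_gen1[of Mu] by simp
  note h = cont_hor[OF k Suc this]
  have e: "2 * Suc m = 2 * m + 2" "mus (Suc m) = (\<lambda>s. phor S_prop (mus m s) (mu s))" by (simp_all add: fun_eq_iff)
  have e': "Suc m = m + 1" by simp
  show ?case unfolding e unfolding e' by (rule h)
qed

text \<open>Interleaves two blocks of \<open>m\<close> strands, so that the strands with number
  \<open>j\<close> of both blocks become the neighbours \<open>2 * j\<close> and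
  \<open>2 * j + 1\<close> entering one \<mu>_s.\<close>

definition shuffle :: "nat \<Rightarrow> nat \<Rightarrow> nat" where
  "shuffle m j = (if j < m then 2 * j else if j < 2 * m then 2 * (j - m) + 1 else j)"

definition unshuffle :: "nat \<Rightarrow> nat \<Rightarrow> nat" where
  "unshuffle m j = (if 2 * m \<le> j then j else if even j then j div 2 else m + j div 2)"

lemma shuffle_permutes: "shuffle m permutes {..<2 * m}" "inv (shuffle m) = unshuffle m"
proof -
  have 1: "unshuffle m (shuffle m j) = j" for j by (auto simp: shuffle_def unshuffle_def)
  have 2: "shuffle m (unshuffle m j) = j" for j by (auto simp: shuffle_def unshuffle_def elim!: oddE)
  show "shuffle m permutes {..<2 * m}" by (rule permutesI_inverse[of "unshuffle m"]) (rule 1, rule 2, simp add: shuffle_def)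
  show "inv (shuffle m) = unshuffle m" by (rule inv_equality) (rule 1, rule 2)
qed

definition mix :: "nat \<Rightarrow> real \<Rightarrow> S_cell cell_point dgraph set set set \<Rightarrow> S_cell cell_point dgraph set set set \<Rightarrow> S_cell cell_point dgraph set set set" where
  "mix m s c x = pver S_prop (mus m s) (pver S_prop (pperm S_prop (2 * m) (shuffle m)) (pver S_prop (phor S_prop c x) (cl gD)))"

text \<open>Writing the term as a substitution into the normal form of \<mu>_s lets the ends
  \<open>s = 0\<close> and \<open>s = 1\<close> be evaluated by \<open>norm\<close> alone.\<close>

lemma mix_facts:
  assumes s: "s \<in> {0..1}" and c: "c \<in> pset S_prop 1 m" and x: "x \<in> pset S_prop 1 m"
  shows "mix m s c x \<in> pset S_prop 1 m"
    "j < m \<Longrightarrow> tms (mix m s c x) ! j =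
       bind (\<lambda>i. if i = 0 then bind (\<lambda>_. Lt (In 0)) (tms c ! j) else bind (\<lambda>_. Rt (In 0)) (tms x ! j)) (norm (Mt s (In 0) (In 1)))"
proof -
  have cx: "phor S_prop c x \<in> pset S_prop 2 (2 * m)"
    using \<S>.hor_in[OF c x] by (simp add: mult_2)
  note v = \<S>.ver_in[OF Delta_in cx]
  note w = \<S>.ver_in[OF v perm_in[OF shuffle_permutes(1)]]
  show "mix m s c x \<in> pset S_prop 1 m"
    unfolding mix_def by (rule \<S>.ver_in[OF w mus_in[OF s]])
  assume j: "j < m"
  let ?w = "pver S_prop (pperm S_prop (2 * m) (shuffle m)) (pver S_prop (phor S_prop c x) (cl gD))"
  have w0: "tms ?w ! (2 * j) = bind (\<lambda>_. Lt (In 0)) (tms c ! j)"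
  proof -
    have "tms ?w ! (2 * j) = tms (pver S_prop (phor S_prop c x) (cl gD)) ! j"
      using tms_perm_ver[OF shuffle_permutes(1) v, of "2 * j"] j by (simp add: shuffle_permutes(2) unshuffle_def)
    also have "\<dots> = bind (\<lambda>i. tms (cl gD) ! i) (tms c ! j)"
      using tms_ver[OF Delta_in cx, of j] tms_hor[OF c x, of j] j by simp
    also have "\<dots> = bind (\<lambda>_. Lt (In 0)) (tms c ! j)"
    proof (rule bind_cong)
      fix a assume "In a \<in> sub (tms c ! j)"
      then have "a < 1" by (rule In_tms[OF c j])
      then show "tms (cl gD) ! a = Lt (In 0)" by (simp add: tms_gens)
    qed
    finally show ?thesis .
  qed
  have w1: "tms ?w ! (2 * j + 1) = bind (\<lambda>_. Rt (In 0)) (tms x ! j)"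
  proof -
    have "tms ?w ! (2 * j + 1) = tms (pver S_prop (phor S_prop c x) (cl gD)) ! (m + j)"
      using tms_perm_ver[OF shuffle_permutes(1) v, of "2 * j + 1"] j by (simp add: shuffle_permutes(2) unshuffle_def)
    also have "\<dots> = bind (\<lambda>i. tms (cl gD) ! (1 + i)) (tms x ! j)"
      using tms_ver[OF Delta_in cx, of "m + j"] tms_hor[OF c x, of "m + j"] j by (simp add: bind_bind)
    also have "\<dots> = bind (\<lambda>_. Rt (In 0)) (tms x ! j)"
    proof (rule bind_cong)
      fix a assume "In a \<in> sub (tms x ! j)"
      then have "a < 1" by (rule In_tms[OF x j])
      then show "tms (cl gD) ! (1 + a) = Rt (In 0)" by (simp add: tms_gens One_nat_def)
    qed
    finally show ?thesis .
  qed
  have "norm (Mt s (In (2 * j)) (In (2 * j + 1))) = bind (\<lambda>i. In (2 * j + i)) (norm (Mt s (In 0) (In 1)))" by simp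
  then have "tms (mix m s c x) ! j = bind (\<lambda>i. tms ?w ! (2 * j + i)) (norm (Mt s (In 0) (In 1)))"
    unfolding mix_def tms_ver[OF w mus_in[OF s] j] tms_mus[OF s j] by (simp only: bind_bind bind.simps)
  also have "\<dots> = bind (\<lambda>i. if i = 0 then bind (\<lambda>_. Lt (In 0)) (tms c ! j) else bind (\<lambda>_. Rt (In 0)) (tms x ! j)) (norm (Mt s (In 0) (In 1)))"
    using w0 w1 by simp
  finally show "tms (mix m s c x) ! j =
       bind (\<lambda>i. if i = 0 then bind (\<lambda>_. Lt (In 0)) (tms c ! j) else bind (\<lambda>_. Rt (In 0)) (tms x ! j)) (norm (Mt s (In 0) (In 1)))" .
qed

text \<open>At \<open>s = 0\<close> only the outputs of \<open>c\<close> survive, so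
  \<open>x\<close> may be replaced by \<open>c\<close> and the map is constant. At
  \<open>s = 1\<close> the outputs of \<open>x\<close> survive, fed by the right branch of \<Delta>,
  which is h_1; there the two homotopies meet.\<close>

lemma mix_ends:
  assumes c: "c \<in> pset S_prop 1 m" and x: "x \<in> pset S_prop 1 m"
  shows "mix m 0 c x = mix m 0 c c" "mix m 1 c x = pver S_prop x (ht 1)" "pver S_prop x (ht 0) = x"
proof -
  have 01: "0 \<in> {0..1::real}" "1 \<in> {0..1::real}" by simp_all
  show "mix m 0 c x = mix m 0 c c"
    by (rule tms_eqI[OF mix_facts(1)[OF 01(1) c x] mix_facts(1)[OF 01(1) c c]])
      (simp add: mix_facts(2)[OF 01(1) c x] mix_facts(2)[OF 01(1) c c])
  have v: "tms (pver S_prop x (ht s)) ! j = bind (\<lambda>_. norm (Ht s (In 0))) (tms x ! j)"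
    if "s \<in> {0..1}" "j < m" for s j
    unfolding tms_ver[OF ht_in[OF that(1)] x that(2)]
  proof (rule bind_cong)
    fix a assume "In a \<in> sub (tms x ! j)"
    then have "a < 1" by (rule In_tms[OF x that(2)])
    then show "tms (ht s) ! a = norm (Ht s (In 0))" by (simp add: tms_gens(2)[OF that(1)] del: norm.simps)
  qed
  show "mix m 1 c x = pver S_prop x (ht 1)"
    by (rule tms_eqI[OF mix_facts(1)[OF 01(2) c x] \<S>.ver_in[OF ht_in[OF 01(2)] x]])
      (simp add: mix_facts(2)[OF 01(2) c x] v[OF 01(2)])
  have "ht 0 = pid S_prop 1" by (simp add: cl_relations cl_perm)
  then show "pver S_prop x (ht 0) = x" using ver_id(2)[OF x] by simp
qed

lemma nonempty_S: "pset S_prop 1 m \<noteq> {}"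
proof (induction m)
  case 0
  show ?case using eps_in by blast
next
  case (Suc m)
  then obtain c where "c \<in> pset S_prop 1 m" by blast
  then have "phor S_prop (pid S_prop 1) c \<in> pset S_prop 2 (Suc m)"
    using \<S>.hor_in[OF id_in[of 1]] by (metis one_add_one plus_1_eq_Suc)
  then show ?case using \<S>.ver_in[OF Delta_in] by blast
qed

lemma contractible_S:
  assumes c: "c \<in> pset S_prop 1 m"
  shows "homotopic_with (\<lambda>_. True) (cw_top (phom S_prop 1 m)) (cw_top (phom S_prop 1 m)) (\<lambda>_. mix m 0 c c) id"
proof -
  let ?X = "cw_top (phom S_prop 1 m)" and ?I = "top_of_set {0..1::real}"
  let ?T = "prod_topology ?I ?X"
  \<comment> \<open>The compositions are continuous on k-ified products, so the homotopies need a
    k-space as domain. The interval is locally compact Hausdorff, which makes its product with a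
    k-space one.\<close>
  have k: "k_space ?T"
    by (rule k_space_prod_topology_left[OF _ _ k_space_S])
      (simp_all add: compact_imp_locally_compact_space compact_space_subtopology Hausdorff_space_subtopology)
  have snd: "continuous_map ?T ?X snd" by (rule continuous_map_snd)
  have lift: "continuous_map ?T Z (\<lambda>p. f (fst p))" if "continuous_map ?I Z f" for f and Z :: "'z topology"
    using continuous_map_compose[OF continuous_map_fst that, of ?X] by (simp add: comp_def)
  have cc: "continuous_map ?T (cw_top (phom S_prop 1 m)) (\<lambda>_. c)" using c by simp
  have "continuous_map ?T (cw_top (phom S_prop (1 + 1) (m + m))) (\<lambda>p. phor S_prop c (snd p))"
    by (rule cont_hor[OF k cc snd])
  then have "continuous_map ?T (cw_top (phom S_prop 2 (2 * m))) (\<lambda>p. phor S_prop c (snd p))"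
    by (simp add: mult_2)
  then have "continuous_map ?T ?X (\<lambda>p. mix m (fst p) c (snd p))"
    unfolding mix_def
    by (intro cont_ver[OF k _ lift[OF continuous_mus]] cont_ver[OF k _ continuous_map_const[THEN iffD2]] cont_ver[OF k continuous_map_const[THEN iffD2]])
      (use Delta_in perm_in[OF shuffle_permutes(1)] in auto)
  then have 1: "homotopic_with (\<lambda>_. True) ?X ?X (\<lambda>_. mix m 0 c c) (\<lambda>x. pver S_prop x (ht 1))"
    by (subst homotopic_with) (use mix_ends[OF c] in \<open>auto intro!: exI[of _ "\<lambda>p. mix m (fst p) c (snd p)"]\<close>)
  have "continuous_map ?I (cw_top (phom S_prop 1 1)) ht"
    using continuous_gen1[of Htp] by simp
  from cont_ver[OF k lift[OF this] snd] have "homotopic_with (\<lambda>_. True) ?X ?X id (\<lambda>x. pver S_prop x (ht 1))"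
    by (subst homotopic_with) (use mix_ends[OF c] in \<open>auto intro!: exI[of _ "\<lambda>p. pver S_prop (snd p) (ht (fst p))"]\<close>)
  from homotopic_with_trans[OF 1 homotopic_with_symD[OF this]] show ?thesis .
qed

lemma homotopy_equivalence_S:
  "homotopy_equivalence_map (cw_top (phom S_prop 1 m)) (cw_top cw_unit) (\<lambda>_. ())"
proof -
  obtain c where c: "c \<in> pset S_prop 1 m" using nonempty_S by blast
  have b: "mix m 0 c c \<in> pset S_prop 1 m" by (rule mix_facts(1)[OF _ c c]) simp
  show ?thesis
    unfolding homotopy_equivalence_map_def
  proof (intro conjI exI[of _ "\<lambda>_. mix m 0 c c"])
    show "homotopic_with (\<lambda>_. True) (cw_top (phom S_prop 1 m)) (cw_top (phom S_prop 1 m)) ((\<lambda>_. mix m 0 c c) \<circ> (\<lambda>_. ())) id"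
      using contractible_S[OF c] by (simp add: comp_def)
    have "(\<lambda>_. ()) \<circ> (\<lambda>_. mix m 0 c c) = id" by (simp add: fun_eq_iff)
    then show "homotopic_with (\<lambda>_. True) (cw_top cw_unit) (cw_top cw_unit) ((\<lambda>_. ()) \<circ> (\<lambda>_. mix m 0 c c)) id"
      by (simp del: comp_apply)
  qed (use b in \<open>simp_all add: cw_unit_def\<close>)
qed

theorem theorem3:
  shows "E_infinity_prop S_prop"
  unfolding E_infinity_prop_def E_infinity_operad_def
proof (intro conjI exI)
  show "cw_prop S_prop" by (rule cw_prop_S)
  show "sigma_free_resolution (operad_of_prop S_prop) terminal_operad (\<lambda>_ _. ())"
    unfolding sigma_free_resolution_def
  proof (intro conjI allI cw_operad_S cw_operad_terminal sigma_free_S)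
    show "operad_morphism (operad_of_prop S_prop) terminal_operad (\<lambda>_ _. ())"
      by (simp add: operad_morphism_def terminal_operad_def operad_of_prop_def cellular_to_unit CW_S)
    show "homotopy_equivalence_map (cw_top (osp (operad_of_prop S_prop) m)) (cw_top (osp terminal_operad m)) (\<lambda>_. ())" for m
      using homotopy_equivalence_S by (simp add: operad_of_prop_def terminal_operad_def)
  qed
  \<comment> \<open>Without outputs there are no terms to compare.\<close>
  have "x = cl gE" if "x \<in> pset S_prop 1 0" for x
    by (rule tms_eqI[OF that eps_in]) simp
  then have "pset S_prop 1 0 = {cl gE}" using eps_in by blast
  then show "topspace (cw_top (osp (operad_of_prop S_prop) 0)) = {cl gE}"
    by (simp only: operad_of_prop_def operad.simps)
qed

end
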